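(* Let $\hat I\colon\mathcal M_1(E)\to[0,+\infty]$ be defined by $$\hat I(\mu)=\sup_{\phi\in C(E)}\Big\{-\iint\mu(dx)c(x,dy)\,\big[\exp\{\phi(y)-\phi(x)\}-1\big]\Big\}.$$ As $T\to+\infty$ the family $\{\mathbb P_x\circ\mu_T^{-1}\}_{T>0}$ satisfies, uniformly with respect to $x$ bounded away from $E_0$, a large deviation principle with convex rate function $\hat I$. Namely, $\hat I$ is convex and lower semicontinuous, and for each compact $E_1\subset E\setminus E_0$, each closed $C\subset\mathcal M_1(E)$ and each open $A\subset\mathcal M_1(E)$, $$\limsup_{T\to+\infty}\sup_{x\in E_1}\frac1T\log\mathbb P_x(\mu_T\in C)\le-\inf_{\mu\in C}\hat I(\mu),\qquad \liminf_{T\to+\infty}\inf_{x\in E_1}\frac1T\log\mathbb P_x(\mu_T\in A)\ge-\inf_{\mu\in A}\hat I(\mu).$$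
   Context: Setting. $E$ is a compact Polish space with its Borel $\sigma$-algebra; $C(E)$, $C(E\times E)$ are the spaces of continuous functions. Consider the continuous time Markov chain on $E$ with transition rates $c(x,dy)=r(x)p(x,dy)$, where $r\colon E\to\mathbb R_+=[0,+\infty)$ and $p$ is a transition kernel on $E$ (in state $x$ the chain waits an exponential time of parameter $r(x)$, infinite if $r(x)=0$, then jumps according to $p(x,dy)$). $\mathbb P_x$ is its law with initial state $x$, a probability on the Skorokhod space $D(\mathbb R_+;E)$ with canonical coordinate $X_t$. Standing assumptions: (i) $r$ is continuous; set $E_0:=\{x\in E: r(x)=0\}$. (ii) There is a probability $\lambda$ on $E$, strictly positive on (nonempty) open sets, such that $p(x,dy)=p(x,y)\lambda(dy)$ for some strictly positive density $p\in C(E\times E)$. (iii) $\int\lambda(dx)\,1/r(x)<+\infty$. (iv) With $A_\delta:=\{x\in E: r(x)<\delta\}$, there is a sequence $\delta_n\to0$ ($\delta_n>0$) such that $\sup_n\lambda(A_{2\delta_n})/\lambda(A_{2\delta_n}\setminus A_{\delta_n})<+\infty$. $\mathcal M_1(E)$ is the space of probability measures on $E$ with the weak topology. The empirical measure is $\mu_T(f)=\frac1T\int_0^T f(X_t)\,dt$, $f\in C(E)$, $T>0$. *)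

theory Defs
  imports "HOL-Probability.Probability"
begin

section \<open>Probability measures with the weak topology\<close>

definition prob_measures :: "'a::topological_space measure set" where
  "prob_measures = space (prob_algebra borel)"

text \<open>The coarsest topology on \<^const>\<open>prob_measures\<close> making
  \<open>\<mu> \<mapsto> \<integral>f d\<mu>\<close> continuous for every bounded continuous \<open>f\<close>.\<close>

definition weak_topology :: "'a::topological_space measure topology" where
  "weak_topology = topology_generated_by
     {{\<mu>\<in>prob_measures. (\<integral>x. f x \<partial>\<mu>) \<in> U} |f U.
        continuous_on UNIV (f :: 'a \<Rightarrow> real) \<and> bounded (range f) \<and> open U}"

lemma prob_measures_iff: "\<mu> \<in> prob_measures \<longleftrightarrow> prob_space \<mu> \<and> sets \<mu> = sets borel"
  by (auto simp: prob_measures_def space_prob_algebra)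

lemma topspace_weak_topology [simp]: "topspace weak_topology = prob_measures"
proof -
  have "prob_measures \<in> {{\<mu>\<in>prob_measures. (\<integral>x. f x \<partial>\<mu>) \<in> U} |f U.
      continuous_on UNIV (f :: 'a \<Rightarrow> real) \<and> bounded (range f) \<and> open U}"
    by (auto intro!: exI[of _ "\<lambda>_. 0"] exI[of _ UNIV])
  then show ?thesis
    unfolding weak_topology_def topology_generated_by_topspace by blast
qed

definition mixture :: "real \<Rightarrow> 'a measure \<Rightarrow> 'a measure \<Rightarrow> 'a measure" where
  "mixture t \<mu> \<nu> = measure_of (space \<mu>) (sets \<mu>)
     (\<lambda>A. ennreal t * emeasure \<mu> A + ennreal (1 - t) * emeasure \<nu> A)"

lemma emeasure_mixture:
  assumes "sets \<nu> = sets \<mu>" "A \<in> sets \<mu>"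
  shows "emeasure (mixture t \<mu> \<nu>) A = ennreal t * emeasure \<mu> A + ennreal (1 - t) * emeasure \<nu> A"
  unfolding mixture_def
proof (rule emeasure_measure_of_sigma)
  show "sigma_algebra (space \<mu>) (sets \<mu>)" ..
  show "positive (sets \<mu>) (\<lambda>A. ennreal t * emeasure \<mu> A + ennreal (1 - t) * emeasure \<nu> A)"
    by (simp add: positive_def)
  show "countably_additive (sets \<mu>) (\<lambda>A. ennreal t * emeasure \<mu> A + ennreal (1 - t) * emeasure \<nu> A)"
  proof (rule countably_additiveI)
    fix B :: "nat \<Rightarrow> 'a set"
    assume B: "range B \<subseteq> sets \<mu>" "disjoint_family B"
    have "(\<Sum>i. emeasure \<mu> (B i)) = emeasure \<mu> (\<Union>i. B i)"
         "(\<Sum>i. emeasure \<nu> (B i)) = emeasure \<nu> (\<Union>i. B i)"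
      using B assms by (auto intro!: suminf_emeasure)
    then show "(\<Sum>i. ennreal t * emeasure \<mu> (B i) + ennreal (1 - t) * emeasure \<nu> (B i)) =
        ennreal t * emeasure \<mu> (\<Union>i. B i) + ennreal (1 - t) * emeasure \<nu> (\<Union>i. B i)"
      by (simp add: suminf_add[symmetric])
  qed
qed fact

lemma mixture_in_prob_measures:
  assumes "\<mu> \<in> prob_measures" "\<nu> \<in> prob_measures" "0 \<le> t" "t \<le> 1"
  shows "mixture t \<mu> \<nu> \<in> prob_measures"
proof -
  have s: "sets \<mu> = sets borel" "sets \<nu> = sets borel" "prob_space \<mu>" "prob_space \<nu>"
    using assms by (auto simp: prob_measures_iff)
  have sp: "space \<mu> = UNIV" "space \<nu> = UNIV"
    using s by (auto dest: sets_eq_imp_space_eq)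
  have "emeasure (mixture t \<mu> \<nu>) (space \<mu>) = ennreal t * 1 + ennreal (1 - t) * 1"
    using s sp prob_space.emeasure_space_1[of \<mu>] prob_space.emeasure_space_1[of \<nu>]
    by (subst emeasure_mixture) auto
  also have "\<dots> = 1"
    using assms ennreal_plus[of t "1 - t"] by simp
  finally have "prob_space (mixture t \<mu> \<nu>)"
    by (intro prob_spaceI) (simp add: mixture_def)
  moreover have "sets (mixture t \<mu> \<nu>) = sets borel"
    unfolding mixture_def s(1)[symmetric] by simp
  ultimately show ?thesis
    by (simp add: prob_measures_iff)
qed

definition convex_functional :: "('a::topological_space measure \<Rightarrow> ereal) \<Rightarrow> bool" where
  "convex_functional I \<longleftrightarrow>
     (\<forall>\<mu>\<in>prob_measures. \<forall>\<nu>\<in>prob_measures. \<forall>t\<in>{0..1}.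
        I (mixture t \<mu> \<nu>) \<le> ereal t * I \<mu> + ereal (1 - t) * I \<nu>)"

definition lower_semicontinuous_map :: "'b topology \<Rightarrow> ('b \<Rightarrow> ereal) \<Rightarrow> bool" where
  "lower_semicontinuous_map X f \<longleftrightarrow> (\<forall>a. closedin X {x \<in> topspace X. f x \<le> a})"


section \<open>Skorokhod space and the empirical measure\<close>

text \<open>Paths indexed by \<open>[0,\<infinity>)\<close> are functions on \<^typ>\<open>real\<close> that are \<^const>\<open>extensional\<close>
  on \<open>{0..}\<close>.\<close>

definition cadlag :: "(real \<Rightarrow> 'a::topological_space) \<Rightarrow> bool" where
  "cadlag \<omega> \<longleftrightarrow> \<omega> \<in> extensional {0..} \<and>
     (\<forall>t\<ge>0. (\<omega> \<longlongrightarrow> \<omega> t) (at_right t)) \<and> (\<forall>t>0. \<exists>l. (\<omega> \<longlongrightarrow> l) (at_left t))"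

text \<open>On a Polish state space the Borel sets of the Skorokhod topology are exactly the
  sets generated by the coordinate maps.\<close>

definition skorokhod_space :: "(real \<Rightarrow> 'a::topological_space) measure" where
  "skorokhod_space = restrict_space (PiM {0..} (\<lambda>_. borel)) {\<omega>. cadlag \<omega>}"

text \<open>The image of the uniform distribution on \<open>[0,T]\<close> under the path.\<close>

definition empirical_measure :: "real \<Rightarrow> (real \<Rightarrow> 'a::topological_space) \<Rightarrow> 'a measure" where
  "empirical_measure T \<omega> = distr (uniform_measure lborel {0..T}) borel \<omega>"

lemma cadlag_borel_measurable:
  fixes \<omega> :: "real \<Rightarrow> 'a::metric_space"
  assumes "cadlag \<omega>"
  shows "\<omega> \<in> borel_measurable borel"
proof -
  define g where "g n t = (if t < 0 then undefined else \<omega> ((of_int \<lfloor>real (Suc n) * t\<rfloor> + 1) / real (Suc n)))"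
    for n t
  have m: "(\<lambda>t. \<omega> ((of_int \<lfloor>real (Suc n) * t\<rfloor> + 1) / real (Suc n))) \<in> borel_measurable borel" for n
  proof -
    have "(\<lambda>t. (\<lambda>k::int. \<omega> ((of_int k + 1) / real (Suc n))) \<lfloor>real (Suc n) * t\<rfloor>) \<in> borel_measurable borel"
      by (rule measurable_compose[where N="count_space UNIV"]) simp_all
    then show ?thesis by simp
  qed
  show ?thesis
  proof (rule borel_measurable_LIMSEQ_metric)
    show "g n \<in> borel_measurable borel" for n
      unfolding g_def[abs_def] using m by (intro measurable_If) auto
    fix t :: real
    show "(\<lambda>n. g n t) \<longlonglongrightarrow> \<omega> t"
    proof (cases "t < 0")
      case True
      then have "\<omega> t = undefined" using assms by (auto simp: cadlag_def extensional_def)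
      then show ?thesis using True by (simp add: g_def)
    next
      case False
      let ?s = "\<lambda>n. (of_int \<lfloor>real (Suc n) * t\<rfloor> + 1) / real (Suc n)"
      have s: "t < ?s n" "?s n \<le> t + 1 / real (Suc n)" for n
      proof -
        have "real (Suc n) * t < of_int \<lfloor>real (Suc n) * t\<rfloor> + 1" by linarith
        then show "t < ?s n" by (simp add: pos_less_divide_eq mult.commute)
        have "of_int \<lfloor>real (Suc n) * t\<rfloor> + 1 \<le> real (Suc n) * t + 1" by linarith
        then have "?s n \<le> (real (Suc n) * t + 1) / real (Suc n)"
          by (intro divide_right_mono) auto
        also have "\<dots> = t + 1 / real (Suc n)"
          by (simp add: add_divide_distrib)
        finally show "?s n \<le> t + 1 / real (Suc n)" .
      qed
      have "(\<lambda>n. t + 1 / real (Suc n)) \<longlonglongrightarrow> t + 0"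
        by (intro tendsto_intros LIMSEQ_Suc[OF lim_1_over_n])
      then have "?s \<longlonglongrightarrow> t"
        using s by (intro tendsto_sandwich[of "\<lambda>_. t" ?s sequentially "\<lambda>n. t + 1 / real (Suc n)"])
          (auto intro!: always_eventually less_imp_le)
      then have "filterlim ?s (at_right t) sequentially"
        unfolding filterlim_at using s(1) by (auto intro!: always_eventually less_imp_neq[symmetric])
      moreover have "(\<omega> \<longlongrightarrow> \<omega> t) (at_right t)"
        using assms False by (auto simp: cadlag_def)
      ultimately have "(\<lambda>n. \<omega> (?s n)) \<longlonglongrightarrow> \<omega> t"
        by (rule filterlim_compose[rotated])
      then show ?thesis using False by (simp add: g_def)
    qed
  qed
qed

lemma empirical_measure_in_prob_measures:
  fixes \<omega> :: "real \<Rightarrow> 'a::metric_space"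
  assumes "cadlag \<omega>" "0 < T"
  shows "empirical_measure T \<omega> \<in> prob_measures"
proof -
  have "prob_space (uniform_measure lborel {0..T})"
    using assms by (intro prob_space_uniform_measure) auto
  then show ?thesis
    unfolding empirical_measure_def prob_measures_iff
    using cadlag_borel_measurable[OF assms(1)]
    by (auto intro!: prob_space.prob_space_distr)
qed

lemma integral_empirical_measure:
  fixes \<omega> :: "real \<Rightarrow> 'a::metric_space" and f :: "'a \<Rightarrow> real"
  assumes "cadlag \<omega>" "0 < T" "continuous_on UNIV f"
  shows "(\<integral>x. f x \<partial>empirical_measure T \<omega>) = 1 / T * (LINT t:{0..T}|lborel. f (\<omega> t))"
proof -
  have [measurable]: "\<omega> \<in> borel_measurable borel" "f \<in> borel_measurable borel"
    using cadlag_borel_measurable[OF assms(1)] borel_measurable_continuous_onI[OF assms(3)] by auto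
  have "uniform_measure lborel {0..T} = density lborel (\<lambda>t. ennreal (indicator {0..T} t / T))"
    unfolding uniform_measure_def using assms(2)
    by (intro density_cong) (auto simp: indicator_def divide_ennreal[symmetric] simp flip: ennreal_1)
  then show ?thesis
    using assms(2)
    by (simp add: empirical_measure_def integral_distr integral_density set_lebesgue_integral_def
        divide_inverse mult_ac)
qed


section \<open>The continuous time Markov chain\<close>

text \<open>A realisation of the chain is recorded as the sequence of visited states together with
  the times spent there, an element of \<open>(E \<times> [0,\<infinity>])\<^sup>\<nat>\<close>.\<close>

definition holding_time :: "real \<Rightarrow> ennreal measure" where
  "holding_time a = (if a = 0 then return borel \<infinity>
     else distr (density lborel (exponential_density a)) borel ennreal)"

definition visit :: "('a::topological_space \<Rightarrow> real) \<Rightarrow> 'a \<Rightarrow> ('a \<times> ennreal) measure" where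
  "visit r y = distr (holding_time (r y)) (borel \<Otimes>\<^sub>M borel) (Pair y)"

definition visit_kernel :: "('a::topological_space \<Rightarrow> real) \<Rightarrow> ('a \<Rightarrow> 'a measure) \<Rightarrow> 'a \<Rightarrow>
    nat \<Rightarrow> (nat \<Rightarrow> 'a \<times> ennreal) \<Rightarrow> ('a \<times> ennreal) measure" where
  "visit_kernel r p x n z = (case n of 0 \<Rightarrow> visit r x | Suc m \<Rightarrow> p (fst (z m)) \<bind> visit r)"

text \<open>The law of the sequence given by the theorem of Ionescu Tulcea.\<close>

definition visit_sequence :: "('a::topological_space \<Rightarrow> real) \<Rightarrow> ('a \<Rightarrow> 'a measure) \<Rightarrow> 'a \<Rightarrow>
    (nat \<Rightarrow> 'a \<times> ennreal) measure" where
  "visit_sequence r p x = projective_family.lim UNIV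
     (Ionescu_Tulcea.CI (visit_kernel r p x) (\<lambda>_. borel \<Otimes>\<^sub>M borel)) (\<lambda>_. borel \<Otimes>\<^sub>M borel)"

definition jump_time :: "(nat \<Rightarrow> 'a \<times> ennreal) \<Rightarrow> nat \<Rightarrow> ennreal" where
  "jump_time z n = (\<Sum>k<n. snd (z k))"

text \<open>The explosive sequences, for which the jump times do not tend to infinity, are
  sent to a constant path so that every path is cadlag. They form a null set when \<open>r\<close> is bounded.\<close>

definition jump_path :: "(nat \<Rightarrow> 'a \<times> ennreal) \<Rightarrow> real \<Rightarrow> 'a" where
  "jump_path z = (\<lambda>t\<in>{0..}. if (SUP n. jump_time z n) = \<infinity>
     then fst (z (LEAST n. ennreal t < jump_time z (Suc n))) else fst (z 0))"

definition chain_law :: "('a::topological_space \<Rightarrow> real) \<Rightarrow> ('a \<Rightarrow> 'a measure) \<Rightarrow> 'a \<Rightarrow>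
    (real \<Rightarrow> 'a) measure" where
  "chain_law r p x = distr (visit_sequence r p x) skorokhod_space jump_path"

lemma prob_space_holding_time: "0 \<le> a \<Longrightarrow> prob_space (holding_time a)"
  by (auto simp: holding_time_def intro!: prob_space_return prob_space.prob_space_distr prob_space_exponential_density)

lemma sets_holding_time[measurable_cong]: "sets (holding_time a) = sets borel"
  by (simp add: holding_time_def)

lemma emeasure_holding_time:
  assumes [measurable]: "A \<in> sets borel"
  shows "emeasure (holding_time a) A = (if a = 0 then indicator A \<infinity> else
    (\<integral>\<^sup>+t. ennreal (exponential_density a t) * indicator A (ennreal t) \<partial>lborel))"
proof -
  have *: "indicator (ennreal -` A) t = indicator A (ennreal t)" for t
    by (auto simp: indicator_def)
  have [measurable]: "ennreal -` A \<in> sets borel" using measurable_sets[OF measurable_ennreal assms] by simp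
  show ?thesis
    by (simp add: holding_time_def emeasure_distr, subst emeasure_density) (auto simp: *)
qed

lemma measurable_visit:
  fixes r :: "'a::second_countable_topology \<Rightarrow> real"
  assumes [measurable]: "r \<in> borel_measurable borel" and r: "\<And>x. 0 \<le> r x"
  shows "visit r \<in> borel \<rightarrow>\<^sub>M prob_algebra (borel \<Otimes>\<^sub>M borel)"
proof (rule measurable_prob_algebraI)
  show "prob_space (visit r y)" for y
    unfolding visit_def using r by (intro prob_space.prob_space_distr prob_space_holding_time) simp_all
  have "(\<lambda>y. holding_time (r y)) \<in> borel \<rightarrow>\<^sub>M subprob_algebra borel"
  proof (rule measurable_subprob_algebra)
    fix A :: "ennreal set" assume [measurable]: "A \<in> sets borel"
    show "(\<lambda>y. emeasure (holding_time (r y)) A) \<in> borel_measurable borel"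
    proof -
      have [measurable]: "(\<lambda>x. indicator A (ennreal (snd x)) :: ennreal) \<in> borel_measurable (borel \<Otimes>\<^sub>M lborel :: ('a \<times> real) measure)"
        by (rule measurable_compose[OF _ borel_measurable_indicator[of A borel]]) measurable
      have [measurable]: "(\<lambda>x. ennreal (exponential_density (r (fst x)) (snd x))) \<in> borel_measurable (borel \<Otimes>\<^sub>M lborel :: ('a \<times> real) measure)"
        unfolding exponential_density_def by measurable
      have [measurable]: "(\<lambda>y. \<integral>\<^sup>+t. ennreal (exponential_density (r y) t) * indicator A (ennreal t) \<partial>lborel) \<in> borel_measurable borel"
        by (rule lborel.borel_measurable_nn_integral) (simp add: case_prod_beta', measurable)
      show ?thesis
        unfolding emeasure_holding_time[OF \<open>A \<in> sets borel\<close>] by measurable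
    qed
  qed (auto simp: sets_holding_time intro: prob_space_imp_subprob_space prob_space_holding_time r)
  then show "visit r \<in> borel \<rightarrow>\<^sub>M subprob_algebra (borel \<Otimes>\<^sub>M borel)"
    unfolding visit_def[abs_def] by (intro measurable_distr2[where M=borel]) simp_all
qed

lemma Ionescu_Tulcea_visit_kernel:
  fixes r :: "'a::second_countable_topology \<Rightarrow> real"
  assumes r: "r \<in> borel_measurable borel" "\<And>x. 0 \<le> r x"
   and [measurable]: "p \<in> borel \<rightarrow>\<^sub>M prob_algebra borel"
  shows "Ionescu_Tulcea (visit_kernel r p x) (\<lambda>_. borel \<Otimes>\<^sub>M borel)"
proof -
  note [measurable] = measurable_visit[OF r]
  have *: "visit_kernel r p x i \<in> PiM {0..<i} (\<lambda>_. borel \<Otimes>\<^sub>M borel) \<rightarrow>\<^sub>M prob_algebra (borel \<Otimes>\<^sub>M borel)" for i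
  proof (cases i)
    case 0
    then show ?thesis using measurable_space[OF measurable_visit[OF r], of x]
      by (simp add: visit_kernel_def[abs_def])
  next
    case (Suc m)
    have [measurable]: "(\<lambda>z. z m) \<in> PiM {0..<Suc m} (\<lambda>_. borel \<Otimes>\<^sub>M borel) \<rightarrow>\<^sub>M (borel \<Otimes>\<^sub>M borel :: ('a \<times> ennreal) measure)"
      by (rule measurable_component_singleton) simp
    have "(\<lambda>z. p (fst (z m)) \<bind> visit r) \<in> PiM {0..<Suc m} (\<lambda>_. borel \<Otimes>\<^sub>M borel) \<rightarrow>\<^sub>M prob_algebra (borel \<Otimes>\<^sub>M borel)"
      by measurable
    then show ?thesis by (simp add: Suc visit_kernel_def[abs_def])
  qed
  show ?thesis
    apply (rule Ionescu_Tulcea.intro)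
    subgoal for i using *[of i] by (rule measurable_prob_algebraD)
    subgoal for i z using measurable_space[OF *[of i], of z] by (simp add: space_prob_algebra)
    done
qed

lemma jump_time_mono: "m \<le> n \<Longrightarrow> jump_time z m \<le> jump_time z n"
  unfolding jump_time_def by (intro sum_mono2) auto

lemma cadlag_jump_path: 
  fixes z :: "nat \<Rightarrow> 'a::topological_space \<times> ennreal"
  shows "cadlag (jump_path z)"
proof (cases "(SUP n. jump_time z n) = \<infinity>")
  case False
  then have F: "jump_path z = (\<lambda>t\<in>{0..}. fst (z 0))" unfolding jump_path_def by (simp only: if_False)
  show ?thesis
    unfolding cadlag_def
  proof (intro conjI allI impI)
    show "jump_path z \<in> extensional {0..}" by (simp add: jump_path_def)
    show "(jump_path z \<longlongrightarrow> jump_path z t) (at_right t)" if "t \<ge> 0" for t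
      using that by (intro tendsto_eventually eventually_at_rightI[of t "t+1"]) (auto simp: F)
    show "\<exists>l. (jump_path z \<longlongrightarrow> l) (at_left t)" if "t > 0" for t
      using that by (intro exI[of _ "fst (z 0)"] tendsto_eventually eventually_at_leftI[of 0 t]) (auto simp: F)
  qed
next
  case True
  define N where "N t = (LEAST n. ennreal t < jump_time z (Suc n))" for t
  have path: "jump_path z t = fst (z (N t))" if "t \<ge> 0" for t
    using that True by (simp add: jump_path_def N_def)
  have ex: "\<exists>n. ennreal t < jump_time z (Suc n)" for t
  proof -
    have "ennreal t < (SUP n. jump_time z n)" by (simp add: True)
    then obtain n where "ennreal t < jump_time z n" by (auto simp: less_SUP_iff)
    also have "\<dots> \<le> jump_time z (Suc n)" by (rule jump_time_mono) simp
    finally show ?thesis by blast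
  qed
  have N1: "ennreal t < jump_time z (Suc (N t))" for t
    unfolding N_def using ex by (rule LeastI_ex)
  have N2: "n < N t \<Longrightarrow> jump_time z (Suc n) \<le> ennreal t" for n t
    unfolding N_def using not_less_Least not_less by metis
  have Nmono: "s \<le> t \<Longrightarrow> N s \<le> N t" for s t
    using N1[of t] N2[of "N t" s] ennreal_leI[of s t] by (meson leD le_less_trans not_le order_trans)
  show ?thesis
    unfolding cadlag_def
  proof (intro conjI allI impI)
    show "jump_path z \<in> extensional {0..}" by (simp add: jump_path_def)
  next
    fix t :: real assume t: "t \<ge> 0"
    obtain b where b: "t < b" "ennreal b \<le> jump_time z (Suc (N t))"
    proof (cases "jump_time z (Suc (N t))")
      case (real y)
      then show ?thesis using N1[of t] t that[of y] by (auto simp: ennreal_less_iff)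
    next
      case top
      then show ?thesis using that[of "t+1"] by auto
    qed
    have "N s = N t" if "t < s" "s < b" for s
    proof (rule antisym)
      show "N t \<le> N s" using Nmono that by simp
      have "ennreal s < ennreal b" using that t by (simp add: ennreal_less_iff)
      then have "ennreal s < jump_time z (Suc (N t))" using b by simp
      then show "N s \<le> N t" unfolding N_def[of s] by (rule Least_le)
    qed
    then show "(jump_path z \<longlongrightarrow> jump_path z t) (at_right t)"
      using t b by (intro tendsto_eventually eventually_at_rightI[of t b]) (auto simp: path)
  next
    fix t :: real assume t: "t > 0"
    define M where "M = Max (N ` {0..<t})"
    have fin: "finite (N ` {0..<t})"
      by (rule finite_subset[of _ "{..N t}"]) (auto intro: Nmono)
    have "M \<in> N ` {0..<t}" unfolding M_def using t by (intro Max_in fin) auto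
    then obtain s where s: "0 \<le> s" "s < t" "M = N s" by auto
    have "N u = M" if "s < u" "u < t" for u
      using s that Nmono[of s u] Max_ge[OF fin, of "N u"] by (auto simp: M_def intro!: antisym)
    then show "\<exists>l. (jump_path z \<longlongrightarrow> l) (at_left t)"
      using s by (intro exI[of _ "fst (z M)"] tendsto_eventually eventually_at_leftI[of s t]) (auto simp: path)
  qed
qed

lemma prob_space_chain_law:
  fixes r :: "'a::second_countable_topology \<Rightarrow> real"
  assumes r: "r \<in> borel_measurable borel" "\<And>x. 0 \<le> r x"
   and p: "p \<in> borel \<rightarrow>\<^sub>M prob_algebra borel"
  shows "prob_space (chain_law r p x)"
proof -
  let ?S = "borel \<Otimes>\<^sub>M borel :: ('a \<times> ennreal) measure"
  interpret Ionescu_Tulcea "visit_kernel r p x" "\<lambda>_. ?S"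
    using assms by (rule Ionescu_Tulcea_visit_kernel)
  have vs: "visit_sequence r p x = PF.lim"
    by (simp add: visit_sequence_def)
  have "prob_space (visit_sequence r p x)"
  proof (rule prob_spaceI)
    have 1: "emeasure PF.lim (PF.emb UNIV {} (space (PiM {} (\<lambda>_. ?S)))) = emeasure (CI {}) (space (PiM {} (\<lambda>_. ?S)))"
      by (rule lim) (rule finite.emptyI, rule sets.top)
    have 2: "emeasure (CI {}) (space (PiM {} (\<lambda>_. ?S))) = 1"
      using prob_space.emeasure_space_1[OF PF.prob_space_P[of "{}"]] by (simp add: CI_def)
    have 3: "PF.emb UNIV {} (space (PiM {} (\<lambda>_. ?S))) = space PF.lim"
      by (auto simp: prod_emb_def space_PiM restrict_def)
    show "emeasure (visit_sequence r p x) (space (visit_sequence r p x)) = 1"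
      unfolding vs using 1 2 3 by simp
  qed
  moreover have "jump_path \<in> PiM UNIV (\<lambda>_. ?S) \<rightarrow>\<^sub>M skorokhod_space"
    unfolding skorokhod_space_def
  proof (rule measurable_restrict_space2)
    have [measurable]: "(\<lambda>z. fst (z n)) \<in> PiM UNIV (\<lambda>_. ?S) \<rightarrow>\<^sub>M borel"
      "(\<lambda>z. snd (z n)) \<in> PiM UNIV (\<lambda>_. ?S) \<rightarrow>\<^sub>M borel" for n
      by measurable
    have [measurable]: "(\<lambda>z. jump_time z n) \<in> PiM UNIV (\<lambda>_. ?S) \<rightarrow>\<^sub>M borel" for n
      unfolding jump_time_def by measurable
    show "jump_path \<in> space (PiM UNIV (\<lambda>_. ?S)) \<rightarrow> {\<omega>. cadlag \<omega>}"
      by (auto intro: cadlag_jump_path)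
    have m: "(\<lambda>z. fst (z (LEAST n. ennreal t < jump_time z (Suc n)))) \<in> PiM UNIV (\<lambda>_. ?S) \<rightarrow>\<^sub>M borel" for t
      by (rule measurable_compose_countable[where g="\<lambda>z. LEAST n. ennreal t < jump_time z (Suc n)"]) measurable
    show "jump_path \<in> PiM UNIV (\<lambda>_. ?S) \<rightarrow>\<^sub>M PiM {0..} (\<lambda>_. borel)"
      unfolding jump_path_def[abs_def] by (intro measurable_restrict measurable_If m) measurable
  qed
  then have "jump_path \<in> visit_sequence r p x \<rightarrow>\<^sub>M skorokhod_space"
    by (subst measurable_cong_sets[of _ "PiM UNIV (\<lambda>_. ?S)" _ skorokhod_space]) (simp_all add: vs)
  ultimately show ?thesis
    unfolding chain_law_def by (rule prob_space.prob_space_distr)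
qed


section \<open>The rate function\<close>

definition jump_rates :: "('a \<Rightarrow> real) \<Rightarrow> ('a \<Rightarrow> 'a measure) \<Rightarrow> 'a \<Rightarrow> 'a measure" where
  "jump_rates r p x = scale_measure (ennreal (r x)) (p x)"

definition rate_functional :: "('a::topological_space \<Rightarrow> 'a measure) \<Rightarrow> 'a measure \<Rightarrow> ereal" where
  "rate_functional c \<mu> = (SUP \<phi>\<in>{\<phi> :: 'a \<Rightarrow> real. continuous_on UNIV \<phi>}.
     ereal (- (\<integral>x. (\<integral>y. exp (\<phi> y - \<phi> x) - 1 \<partial>c x) \<partial>\<mu>)))"

lemma rate_functional_nonneg: "0 \<le> rate_functional c \<mu>"
  unfolding rate_functional_def
  by (rule SUP_upper2[of "\<lambda>_. 0"]) (auto simp: zero_ereal_def[symmetric])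

definition log_ereal :: "real \<Rightarrow> ereal" where
  "log_ereal a = (if a \<le> 0 then - \<infinity> else ereal (ln a))"

end

theory Submission
  imports Defs
begin

text \<open>The upper bound comes from the exponential martingales
  \<open>exp (\<phi> X)\<close> compensated by the potential \<open>e\<^sup>-\<^sup>\<phi> L e\<^sup>\<phi>\<close>: Chebyshev's inequality bounds half-spaces, and compactness of
  \<open>M\<^sub>1(E)\<close> reduces closed sets to finitely many of these.
  For the lower bound, mixing \<open>\<mu>\<close> with a little \<open>\<lambda>\<close> gives all cells of a fine finite partition positive weight.
  Discretising the kernel on the cells, the function \<open>\<phi>\<close> that minimises the discretised functional is
  stationary, which says exactly that the kernel tilted by \<open>\<phi>\<close>, with suitably accelerated clocks, has occupation
  measure close to \<open>\<mu>\<close>. The likelihood ratio of the tilted chain costs at most the value of the functional at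
  a bounded truncation of \<open>\<phi>\<close>, hence at most the rate of \<open>\<mu>\<close>, and the weak law of large
  numbers for the tilted chain follows from the Poisson equation of a finite Markov chain. States of small rate
  are never visited by the tilted chain, so their long holding times do no harm.\<close>

section \<open>The chain as a sequence of visits\<close>

text \<open>The measure \<open>\<mu>\<close> may charge the zero set of \<open>r\<close>, where a
  chain can only wait. The lower bound counts the mass of a cell under \<open>\<mu>\<close> in full
  but lets the tilted chain enter the cell only through its part in \<open>D\<close>, the states
  with \<open>r\<close> at least \<open>\<delta>\<close>; \<open>r\<close> varies by at most
  \<open>\<eta>\<close> on a cell, so this displacement is cheap. The discretised kernel lies below
  \<open>q\<close>: after the first jump the factors \<open>Q / q\<close> of the likelihood ratio
  are at most 1 and the other jump factors telescope. What survives is the time integral of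
  \<open>(1 - \<rho>) * r\<close>, whose mean per unit time is the sum of the label rates minus the
  energy of the tilt. The tilted law is represented as the original law of the visits weighted by
  \<open>weight n\<close>, for a deterministic number \<open>n\<close> of jumps that covers time
  \<open>T\<close> on a good event. The truncation level \<open>K\<close> precedes the partition,
  because the minimiser depends on the partition without control; \<open>\<eta>\<close>, the mesh
  and \<open>\<delta>\<close> follow in this order. The starting point enters through the
  probability that the first holding time is at most one, whence the uniformity away from the zero
  set of \<open>r\<close>.\<close>

abbreviation visit_space :: "('a::topological_space \<times> ennreal) measure" where
  "visit_space \<equiv> borel \<Otimes>\<^sub>M borel"

text \<open>Points of a product over \<open>A\<close> are extensional, so a coordinate outside
  \<open>A\<close> is the constant \<open>undefined\<close>. This lets a functional of whole visit
  sequences be integrated against the finite-dimensional measures of the Ionescu Tulcea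
  construction.\<close>

lemma measurable_extend_PiM:
  "(\<lambda>\<omega>. \<omega>) \<in> PiM A (\<lambda>_. visit_space) \<rightarrow>\<^sub>M PiM UNIV (\<lambda>_. visit_space :: ('a::topological_space \<times> ennreal) measure)"
proof (rule measurable_PiM_single')
  fix i :: 'b
  show "(\<lambda>\<omega>. \<omega> i) \<in> PiM A (\<lambda>_. visit_space) \<rightarrow>\<^sub>M (visit_space :: ('a \<times> ennreal) measure)"
  proof (cases "i \<in> A")
    case True then show ?thesis by (rule measurable_component_singleton)
  next
    case False
    then show ?thesis
      by (subst measurable_cong[where g="\<lambda>_. undefined"]) (auto simp: space_PiM PiE_def extensional_def space_pair_measure)
  qed
qed (auto simp: space_pair_measure)

locale jump_chain =
  fixes r :: "'a::second_countable_topology \<Rightarrow> real" and p :: "'a \<Rightarrow> 'a measure"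
  assumes r_measurable[measurable]: "r \<in> borel_measurable borel" and r_nonneg: "0 \<le> r x"
    and p_measurable[measurable]: "p \<in> borel \<rightarrow>\<^sub>M prob_algebra borel"
begin

abbreviation "law \<equiv> visit_sequence r p"

lemma sets_law[measurable_cong]: "sets (law x) = sets (PiM UNIV (\<lambda>_. visit_space))"
proof -
  interpret Ionescu_Tulcea "visit_kernel r p x" "\<lambda>_. visit_space"
    by (rule Ionescu_Tulcea_visit_kernel) (auto intro: r_measurable r_nonneg p_measurable)
  show ?thesis by (simp add: visit_sequence_def)
qed

lemma space_law: "space (law x) = UNIV"
  using sets_eq_imp_space_eq[OF sets_law[of x]] by (auto simp: space_PiM space_pair_measure)

text \<open>The law of the first \<open>n + 1\<close> visits is the bind of the law of the first
  \<open>n\<close> with the \<open>n\<close>-th kernel, and \<open>F\<close> sees only these visits.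
  The later expectations over visit sequences are computed from this one-step
  disintegration.\<close>

lemma nn_integral_law_last:
  assumes F[measurable]: "F \<in> borel_measurable (PiM UNIV (\<lambda>_. visit_space))"
    and dep: "\<And>z z'. (\<And>k. k \<le> n \<Longrightarrow> z k = z' k) \<Longrightarrow> F z = F z'"
  shows "(\<integral>\<^sup>+z. F z \<partial>law x) = (\<integral>\<^sup>+z. (\<integral>\<^sup>+\<zeta>. F (z(n := \<zeta>)) \<partial>visit_kernel r p x n z) \<partial>law x)"
proof -
  let ?K = "visit_kernel r p x"
  interpret Ionescu_Tulcea ?K "\<lambda>_. visit_space"
    by (rule Ionescu_Tulcea_visit_kernel) (auto intro: r_measurable r_nonneg p_measurable)
  define u where "u = (\<lambda>_::nat. undefined :: 'a \<times> ennreal)"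
  have u: "u \<in> space (PiM {0..<0} (\<lambda>_. visit_space))" by (auto simp: u_def space_PiM)
  \<comment> \<open>\<open>CI\<close> cuts the law of a set of coordinates out of a long enough
    initial segment. For \<open>{0..<m}\<close> the segment has length exactly \<open>m\<close>, so
    the restriction is trivial and the composed kernel \<open>C 0 m\<close> itself appears.\<close>
  have CI_C: "CI {0..<m} = C 0 m u" for m
  proof -
    have up: "up_to {0..<m} = m" unfolding up_to_def
    proof (rule Least_equality)
      show "m \<le> y" if "\<forall>i\<ge>y. i \<notin> {0..<m}" for y
        using that[rule_format, of y] by simp
    qed simp
    have "CI {0..<m} = distr (C 0 m u) (PiM {0..<0+m} (\<lambda>_. visit_space)) (\<lambda>f. restrict f {0..<0+m})"
      by (simp add: CI_def up u_def)
    also have "\<dots> = C 0 m u" by (rule distr_C[symmetric, OF order_refl u])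
    finally show ?thesis .
  qed
  have law: "law x = PF.lim" by (simp add: visit_sequence_def)
  have D: "C 0 m u = distr (law x) (PiM {0..<m} (\<lambda>_. visit_space)) (\<lambda>z. restrict z {0..<m})" for m
    unfolding law using distr_lim[of "{0..<m}"] CI_C[of m] by simp
  have mF: "F \<in> borel_measurable (PiM {0..<m} (\<lambda>_. visit_space))" for m
    by (rule measurable_compose[OF measurable_extend_PiM F])
  have mK: "(\<lambda>z. \<integral>\<^sup>+\<zeta>. F (z(n := \<zeta>)) \<partial>?K n z) \<in> borel_measurable (PiM {0..<n} (\<lambda>_. visit_space))"
  proof (rule nn_integral_measurable_subprob_algebra2[OF _ P])
    have "(\<lambda>(z, \<zeta>). z(n := \<zeta>)) \<in> PiM {0..<n} (\<lambda>_. visit_space) \<Otimes>\<^sub>M visit_space \<rightarrow>\<^sub>M PiM {0..<Suc n} (\<lambda>_. visit_space :: ('a \<times> ennreal) measure)"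
      unfolding split_beta' by (rule measurable_fun_upd[where J="{0..<n}"]) auto
    from measurable_compose[OF this mF]
    show "(\<lambda>(z, \<zeta>). F (z(n := \<zeta>))) \<in> borel_measurable (PiM {0..<n} (\<lambda>_. visit_space) \<Otimes>\<^sub>M visit_space)"
      by (simp add: split_beta')
  qed
  have rm: "(\<lambda>z. restrict z {0..<m}) \<in> law x \<rightarrow>\<^sub>M PiM {0..<m} (\<lambda>_. visit_space)" for m
    unfolding measurable_cong_sets[OF sets_law refl] by (rule measurable_restrict_subset) simp
  have "(\<integral>\<^sup>+z. F z \<partial>law x) = (\<integral>\<^sup>+z. F (restrict z {0..<Suc n}) \<partial>law x)"
    by (intro nn_integral_cong dep) auto
  also have "\<dots> = (\<integral>\<^sup>+z. F z \<partial>C 0 (Suc n) u)"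
    unfolding D using mF by (subst nn_integral_distr[OF rm]) simp_all
  also have "\<dots> = (\<integral>\<^sup>+\<omega>. \<integral>\<^sup>+\<omega>'. F \<omega>' \<partial>eP n \<omega> \<partial>C 0 n u)"
  proof -
    have "eP n \<in> C 0 n u \<rightarrow>\<^sub>M subprob_algebra (PiM {0..<Suc n} (\<lambda>_. visit_space))"
      unfolding measurable_cong_sets[OF sets_C[OF u, of n] refl] using measurable_eP[of n] by simp
    then show ?thesis by (simp add: nn_integral_bind[OF mF])
  qed
  also have "\<dots> = (\<integral>\<^sup>+z. (\<integral>\<^sup>+\<zeta>. F (z(n := \<zeta>)) \<partial>?K n z) \<partial>C 0 n u)"
    using space_C[OF u, of n] by (intro nn_integral_cong) (simp add: nn_integral_eP[OF _ mF])
  also have "\<dots> = (\<integral>\<^sup>+z. (\<integral>\<^sup>+\<zeta>. F ((restrict z {0..<n})(n := \<zeta>)) \<partial>?K n (restrict z {0..<n})) \<partial>law x)"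
    unfolding D using mK by (subst nn_integral_distr[OF rm]) simp_all
  also have "\<dots> = (\<integral>\<^sup>+z. (\<integral>\<^sup>+\<zeta>. F (z(n := \<zeta>)) \<partial>?K n z) \<partial>law x)"
  proof (intro nn_integral_cong)
    fix z :: "nat \<Rightarrow> 'a \<times> ennreal"
    have "?K n (restrict z {0..<n}) = ?K n z" by (simp add: visit_kernel_def split: nat.split)
    then show "(\<integral>\<^sup>+\<zeta>. F ((restrict z {0..<n})(n := \<zeta>)) \<partial>?K n (restrict z {0..<n})) = (\<integral>\<^sup>+\<zeta>. F (z(n := \<zeta>)) \<partial>?K n z)"
      by simp (intro nn_integral_cong dep, auto)
  qed
  finally show ?thesis .
qed

lemma prob_space_law: "prob_space (law x)"
proof -
  interpret Ionescu_Tulcea "visit_kernel r p x" "\<lambda>_. visit_space"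
    by (rule Ionescu_Tulcea_visit_kernel) (auto intro: r_measurable r_nonneg p_measurable)
  have "prob_space (distr (law x) (PiM {} (\<lambda>_. visit_space)) (\<lambda>z. restrict z {}))"
    using distr_lim[of "{}"] PF.prob_space_P[of "{}"] by (simp add: visit_sequence_def)
  then show ?thesis
    by (rule prob_space_distrD[rotated])
      (unfold measurable_cong_sets[OF sets_law refl], intro measurable_restrict_subset, simp)
qed

lemma nn_integral_visit:
  assumes "F \<in> borel_measurable visit_space"
  shows "(\<integral>\<^sup>+\<zeta>. F \<zeta> \<partial>visit r y) = (\<integral>\<^sup>+t. F (y, t) \<partial>holding_time (r y))"
  unfolding visit_def using assms by (subst nn_integral_distr) (auto simp: measurable_cong_sets[OF sets_holding_time refl])

lemma nn_integral_next_visit: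
  assumes [measurable]: "F \<in> borel_measurable visit_space"
  shows "(\<integral>\<^sup>+\<zeta>. F \<zeta> \<partial>(p y \<bind> visit r)) = (\<integral>\<^sup>+y'. (\<integral>\<^sup>+t. F (y', t) \<partial>holding_time (r y')) \<partial>p y)"
proof -
  have "sets (p y) = sets borel" using measurable_space[OF p_measurable, of y] by (simp add: space_prob_algebra)
  then have "visit r \<in> p y \<rightarrow>\<^sub>M subprob_algebra visit_space"
    using measurable_visit[OF r_measurable r_nonneg, THEN measurable_prob_algebraD] by (simp cong: measurable_cong_sets)
  then show ?thesis by (simp add: nn_integral_bind[OF assms] nn_integral_visit[OF assms])
qed

lemma nn_integral_law_Suc:
  assumes "F \<in> borel_measurable (PiM UNIV (\<lambda>_. visit_space))"
    and "\<And>z z'. (\<And>k. k \<le> Suc n \<Longrightarrow> z k = z' k) \<Longrightarrow> F z = F z'"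
  shows "(\<integral>\<^sup>+z. F z \<partial>law x) =
    (\<integral>\<^sup>+z. (\<integral>\<^sup>+y. (\<integral>\<^sup>+t. F (z(Suc n := (y, t))) \<partial>holding_time (r y)) \<partial>p (fst (z n))) \<partial>law x)"
proof -
  have "(\<lambda>\<zeta>. F (z(Suc n := \<zeta>))) \<in> borel_measurable visit_space" for z
    using measurable_fun_upd[of UNIV UNIV "Suc n" "\<lambda>_. z" visit_space "\<lambda>_. visit_space" "\<lambda>x. x"]
    by (intro measurable_compose[OF _ assms(1)]) (auto simp: space_PiM space_pair_measure)
  then show ?thesis
    by (subst nn_integral_law_last[OF assms]) (auto simp: visit_kernel_def nn_integral_next_visit)
qed

lemma nn_integral_law_0:
  assumes "F \<in> borel_measurable visit_space"
  shows "(\<integral>\<^sup>+z. F (z 0) \<partial>law x) = (\<integral>\<^sup>+t. F (x, t) \<partial>holding_time (r x))"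
  using assms prob_space.emeasure_space_1[OF prob_space_law, of x]
  by (subst nn_integral_law_last[where n=0]) (auto simp: visit_kernel_def nn_integral_visit)

lemma nn_integral_holding_time:
  assumes a: "0 < a" and [measurable]: "F \<in> borel_measurable borel"
  shows "(\<integral>\<^sup>+t. F t \<partial>holding_time a) = (\<integral>\<^sup>+t. ennreal (exponential_density a t) * F (ennreal t) \<partial>lborel)"
  using a by (simp add: holding_time_def nn_integral_distr nn_integral_density)

lemma nn_integral_holding_time_0:
  "F \<in> borel_measurable borel \<Longrightarrow> (\<integral>\<^sup>+t. F t \<partial>holding_time 0) = F \<infinity>"
  by (simp add: holding_time_def nn_integral_return)

end

lemma nn_integral_exponential_density:
  assumes "0 < b" shows "(\<integral>\<^sup>+t. ennreal (exponential_density b t) \<partial>lborel) = 1"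
proof -
  interpret prob_space "density lborel (exponential_density b)"
    by (rule prob_space_exponential_density[OF assms])
  show ?thesis using emeasure_space_1 by (simp add: emeasure_density)
qed

lemma measurable_snd_visit[measurable]:
  "(\<lambda>z. snd (z n)) \<in> borel_measurable (PiM UNIV (\<lambda>_. visit_space :: ('a::topological_space \<times> ennreal) measure))"
  "(\<lambda>z. fst (z n)) \<in> borel_measurable (PiM UNIV (\<lambda>_. visit_space :: ('a::topological_space \<times> ennreal) measure))"
  by measurable

lemma measurable_jump_time[measurable]:
  "(\<lambda>z. jump_time z n) \<in> borel_measurable (PiM UNIV (\<lambda>_. visit_space :: ('a::topological_space \<times> ennreal) measure))"
  unfolding jump_time_def by measurable

lemma measurable_jump_path:
  "jump_path \<in> PiM UNIV (\<lambda>_. visit_space :: ('a::second_countable_topology \<times> ennreal) measure) \<rightarrow>\<^sub>M skorokhod_space"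
  unfolding skorokhod_space_def
proof (rule measurable_restrict_space2)
  show "jump_path \<in> space (PiM UNIV (\<lambda>_. visit_space)) \<rightarrow> {\<omega>. cadlag \<omega>}"
    by (auto intro: cadlag_jump_path)
  have m: "(\<lambda>z. fst (z (LEAST n. ennreal t < jump_time z (Suc n)))) \<in> PiM UNIV (\<lambda>_. visit_space) \<rightarrow>\<^sub>M borel" for t
    by (rule measurable_compose_countable[where g="\<lambda>z. LEAST n. ennreal t < jump_time z (Suc n)"]) measurable
  show "jump_path \<in> PiM UNIV (\<lambda>_. visit_space) \<rightarrow>\<^sub>M PiM {0..} (\<lambda>_. borel)"
    unfolding jump_path_def[abs_def] by (intro measurable_restrict measurable_If m) measurable
qed

section \<open>Absence of explosion for bounded rates\<close>

text \<open>The function \<open>exp (- t)\<close> with value 0 at infinity. A product of discounts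
  over the holding times is \<open>exp\<close> of minus the jump time, so explosion means that these
  products stay away from 0.\<close>

definition discount :: "ennreal \<Rightarrow> ennreal" where
  "discount t = (if t = \<infinity> then 0 else ennreal (exp (- enn2real t)))"

lemma measurable_discount[measurable]: "discount \<in> borel_measurable borel"
  unfolding discount_def[abs_def] by measurable

lemma prod_discount:
  assumes "sum f A \<noteq> \<infinity>" "finite A"
  shows "(\<Prod>k\<in>A. discount (f k)) = ennreal (exp (- enn2real (sum f A)))"
  using assms(2,1)
proof (induction A rule: finite_induct)
  case (insert x A)
  then have "f x < \<infinity>" "sum f A < \<infinity>" by (auto simp: top.not_eq_extremum)
  then show ?case using insert
    by (simp add: discount_def enn2real_plus ennreal_mult[symmetric] exp_add[symmetric] exp_minus_inverse)
qed simp

context jump_chain begin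

text \<open>The Laplace transform at 1 of an exponential time of rate \<open>a\<close> is
  \<open>a / (1 + a)\<close>, increasing in \<open>a\<close>; the infinite holding time of rate 0
  contributes 0.\<close>

lemma nn_integral_discount:
  assumes "0 \<le> a" "a \<le> R"
  shows "(\<integral>\<^sup>+t. discount t \<partial>holding_time a) \<le> ennreal (R / (1 + R))"
proof (cases "a = 0")
  case True then show ?thesis by (simp add: nn_integral_holding_time_0 discount_def)
next
  case False
  then have a: "a > 0" using assms by simp
  have "(\<integral>\<^sup>+t. discount t \<partial>holding_time a) = (\<integral>\<^sup>+t. ennreal (exponential_density a t) * discount (ennreal t) \<partial>lborel)"
    by (rule nn_integral_holding_time[OF a]) simp
  also have "\<dots> = (\<integral>\<^sup>+t. ennreal (a / (1 + a)) * ennreal (exponential_density (1 + a) t) \<partial>lborel)"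
  proof (intro nn_integral_cong)
    fix t :: real
    have e: "exp (- t * a) * exp (- t) = exp (- t * (1 + a))"
      by (simp add: exp_add[symmetric] algebra_simps)
    have "1 + a \<noteq> 0" using a by simp
    then have "a * exp (- t * a) * exp (- t) = a / (1 + a) * ((1 + a) * exp (- t * (1 + a)))"
      unfolding mult.assoc e by simp
    then show "ennreal (exponential_density a t) * discount (ennreal t) =
        ennreal (a / (1 + a)) * ennreal (exponential_density (1 + a) t)"
      using a by (auto simp: discount_def exponential_density_def ennreal_mult[symmetric])
  qed
  also have "\<dots> = ennreal (a / (1 + a))"
    using a by (simp add: nn_integral_cmult nn_integral_exponential_density)
  also have "\<dots> \<le> ennreal (R / (1 + R))"
    using assms a by (intro ennreal_leI) (simp add: field_simps)
  finally show ?thesis .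
qed

lemma nn_integral_discount_jumps:
  assumes R: "\<And>y. r y \<le> R"
  shows "(\<integral>\<^sup>+z. (\<Prod>k<n. discount (snd (z k))) \<partial>law x) \<le> ennreal (R / (1 + R)) ^ n"
proof (induction n)
  case 0 then show ?case using prob_space.emeasure_space_1[OF prob_space_law, of x] by simp
next
  case (Suc n)
  show ?case
  proof (cases n)
    case 0
    have "(\<integral>\<^sup>+z. (\<lambda>\<zeta>. discount (snd \<zeta>)) (z 0) \<partial>law x) = (\<integral>\<^sup>+t. discount (snd (x, t)) \<partial>holding_time (r x))"
      by (rule nn_integral_law_0) measurable
    then show ?thesis using nn_integral_discount[OF r_nonneg R] by (simp add: 0)
  next
    case (Suc m)
    have pp: "emeasure (p y) (space (p y)) = 1" for y
      using measurable_space[OF p_measurable, of y] by (auto simp: space_prob_algebra prob_space.emeasure_space_1)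
    have "(\<integral>\<^sup>+z. (\<Prod>k<Suc n. discount (snd (z k))) \<partial>law x) =
        (\<integral>\<^sup>+z. (\<integral>\<^sup>+y. (\<integral>\<^sup>+t. (\<Prod>k<n. discount (snd (z k))) * discount t \<partial>holding_time (r y)) \<partial>p (fst (z m))) \<partial>law x)"
      by (subst nn_integral_law_Suc[where n=m]) (auto simp: Suc intro!: nn_integral_cong)
    also have "\<dots> \<le> (\<integral>\<^sup>+z. (\<integral>\<^sup>+y. (\<Prod>k<n. discount (snd (z k))) * ennreal (R / (1 + R)) \<partial>p (fst (z m))) \<partial>law x)"
      using nn_integral_discount[OF r_nonneg R]
      by (intro nn_integral_mono, subst nn_integral_cmult)
        (auto simp: measurable_cong_sets[OF sets_holding_time refl] intro!: mult_left_mono)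
    also have "\<dots> = (\<integral>\<^sup>+z. (\<Prod>k<n. discount (snd (z k))) * ennreal (R / (1 + R)) \<partial>law x)"
      by (simp add: pp)
    also have "\<dots> = (\<integral>\<^sup>+z. (\<Prod>k<n. discount (snd (z k))) \<partial>law x) * ennreal (R / (1 + R))"
      by (rule nn_integral_multc) measurable
    also have "\<dots> \<le> ennreal (R / (1 + R)) ^ Suc n"
      using mult_right_mono[OF Suc.IH, of "ennreal (R / (1 + R))"] by (simp add: mult.commute)
    finally show ?thesis .
  qed
qed

text \<open>The mean of the product of the first \<open>n\<close> discounts decays geometrically, so
  the infimum of the products vanishes almost surely; a finite limit \<open>s\<close> of the jump
  times would bound it below by \<open>exp (- s)\<close>.\<close>

lemma AE_nonexplosive:
  assumes R: "\<And>y. r y \<le> R"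
  shows "AE z in law x. (SUP n. jump_time z n) = \<infinity>"
proof -
  have R0: "0 \<le> R" using r_nonneg R order_trans by blast
  define F where "F z = (INF n. \<Prod>k<n. discount (snd (z k)))" for z :: "nat \<Rightarrow> 'a \<times> ennreal"
  have [measurable]: "F \<in> borel_measurable (law x)" unfolding F_def[abs_def] by measurable
  have "(\<integral>\<^sup>+z. F z \<partial>law x) \<le> ennreal ((R / (1 + R)) ^ n)" for n
  proof -
    have "(\<integral>\<^sup>+z. F z \<partial>law x) \<le> (\<integral>\<^sup>+z. (\<Prod>k<n. discount (snd (z k))) \<partial>law x)"
      unfolding F_def by (intro nn_integral_mono INF_lower) simp
    also note nn_integral_discount_jumps[OF R, of x n]
    finally show ?thesis using R0 by (simp add: ennreal_power)
  qed
  moreover have "(\<lambda>n. ennreal ((R / (1 + R)) ^ n)) \<longlonglongrightarrow> ennreal 0"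
    using R0 by (intro tendsto_ennrealI LIMSEQ_power_zero) auto
  ultimately have "(\<integral>\<^sup>+z. F z \<partial>law x) \<le> 0"
    by (intro LIMSEQ_le_const[of _ "0"]) auto
  then have "AE z in law x. F z = 0" by (subst (asm) le_zero_eq, subst (asm) nn_integral_0_iff_AE) auto
  then show ?thesis
  proof eventually_elim
    case (elim z)
    show ?case
    proof (rule ccontr)
      assume fin: "(SUP n. jump_time z n) \<noteq> \<infinity>"
      let ?s = "SUP n. jump_time z n"
      have le: "jump_time z n \<le> ?s" for n by (rule SUP_upper) simp
      have "ennreal (exp (- enn2real ?s)) \<le> F z"
        unfolding F_def
      proof (rule INF_greatest)
        fix n
        have J: "jump_time z n \<noteq> \<infinity>"
        proof
          assume "jump_time z n = \<infinity>"
          with le[of n] have "\<infinity> \<le> ?s" by (simp only:)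
          with fin show False by (metis infinity_ennreal_def top_unique)
        qed
        have "(\<Prod>k<n. discount (snd (z k))) = ennreal (exp (- enn2real (jump_time z n)))"
          using prod_discount[of "\<lambda>k. snd (z k)" "{..<n}"] J by (simp add: jump_time_def)
        moreover have "enn2real (jump_time z n) \<le> enn2real ?s"
          using le[of n] fin by (intro enn2real_mono) (simp_all only: top.not_eq_extremum[symmetric] infinity_ennreal_def not_False_eq_True)
        ultimately show "ennreal (exp (- enn2real ?s)) \<le> (\<Prod>k<n. discount (snd (z k)))"
          by (simp add: ennreal_leI)
      qed
      then show False using elim by simp
    qed
  qed
qed

end

section \<open>Time integrals along the path as sums over visits\<close>

text \<open>Jump times cut at \<open>T\<close> and made real: the increment over visit
  \<open>k\<close> is the time spent in that visit during \<open>[0,T]\<close>, whether the visit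
  ends before \<open>T\<close>, straddles \<open>T\<close> or comes later, and the increments
  telescope.\<close>

definition clipped_time :: "(nat \<Rightarrow> 'a \<times> ennreal) \<Rightarrow> real \<Rightarrow> nat \<Rightarrow> real" where
  "clipped_time z T n = enn2real (min (jump_time z n) (ennreal T))"

lemma measurable_clipped_time[measurable]:
  "(\<lambda>z. clipped_time z T n) \<in> borel_measurable (PiM UNIV (\<lambda>_. visit_space :: ('a::topological_space \<times> ennreal) measure))"
  unfolding clipped_time_def by measurable

lemma clipped_time_mono: "m \<le> n \<Longrightarrow> clipped_time z T m \<le> clipped_time z T n"
  unfolding clipped_time_def
  by (intro enn2real_mono min.mono jump_time_mono) (auto simp: min_less_iff_disj)

lemma clipped_time_0 [simp]: "clipped_time z T 0 = 0"
  by (simp add: clipped_time_def jump_time_def)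

lemma clipped_time_nonneg [simp]: "0 \<le> clipped_time z T n"
  by (simp add: clipped_time_def)

lemma clipped_time_le: "0 \<le> T \<Longrightarrow> clipped_time z T n \<le> T"
  unfolding clipped_time_def
  by (rule order_trans[OF enn2real_mono[of _ "ennreal T"]]) auto

lemma clipped_time_late: "0 \<le> T \<Longrightarrow> ennreal T \<le> jump_time z n \<Longrightarrow> clipped_time z T n = T"
  by (simp add: clipped_time_def min_absorb2)

lemma less_clipped_time_iff:
  assumes "0 \<le> t" "t < T"
  shows "t < clipped_time z T n \<longleftrightarrow> ennreal t < jump_time z n"
proof -
  have "ennreal (clipped_time z T n) = min (jump_time z n) (ennreal T)"
    unfolding clipped_time_def by (rule ennreal_enn2real) (auto simp: min_less_iff_disj)
  moreover have "t < clipped_time z T n \<longleftrightarrow> ennreal t < ennreal (clipped_time z T n)"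
    using assms by (simp add: ennreal_less_iff)
  moreover have "ennreal t < ennreal T" using assms by (simp add: ennreal_less_iff)
  ultimately show ?thesis by simp
qed

lemma jump_path_eq:
  assumes "(SUP n. jump_time z n) = \<infinity>" "0 \<le> t" "jump_time z k \<le> ennreal t" "ennreal t < jump_time z (Suc k)"
  shows "jump_path z t = fst (z k)"
proof -
  have "(LEAST n. ennreal t < jump_time z (Suc n)) = k"
  proof (rule Least_equality)
    fix n assume "ennreal t < jump_time z (Suc n)"
    then have "\<not> jump_time z (Suc n) \<le> jump_time z k" using assms(3) by (meson leD order_trans)
    then show "k \<le> n" using jump_time_mono[of "Suc n" k z] by linarith
  qed fact
  then show ?thesis using assms by (simp add: jump_path_def)
qed

lemma integral_jump_path:
  fixes f :: "'a::topological_space \<Rightarrow> real"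
  assumes ex: "(SUP n. jump_time z n) = \<infinity>" and T: "0 \<le> T" "ennreal T \<le> jump_time z n"
  shows "(LINT t:{0..T}|lborel. f (jump_path z t)) =
    (\<Sum>k<n. f (fst (z k)) * (clipped_time z T (Suc k) - clipped_time z T k))"
proof -
  let ?s = "clipped_time z T"
  \<comment> \<open>The half-open intervals between clipped times miss the endpoint
    \<open>T\<close>, which is therefore left out; it is a null set.\<close>
  have eq: "indicator {0..T} t *\<^sub>R f (jump_path z t) = (\<Sum>k<n. f (fst (z k)) * indicator {?s k..<?s (Suc k)} t)"
    if "t \<noteq> T" for t
  proof (cases "0 \<le> t \<and> t < T")
    case False
    then have "t < 0 \<or> T < t" using that by auto
    then have "t \<notin> {?s k..<?s (Suc k)}" for k
      using clipped_time_le[OF T(1), of z "Suc k"] clipped_time_nonneg[of z T k]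
      by (auto simp del: clipped_time_nonneg)
    then show ?thesis using \<open>t < 0 \<or> T < t\<close> by auto
  next
    case True
    then have t: "ennreal t < jump_time z n" using T less_le_trans[of "ennreal t" "ennreal T"] by (simp add: ennreal_less_iff)
    define k where "k = (LEAST m. ennreal t < jump_time z (Suc m))"
    have n0: "n \<noteq> 0"
    proof
      assume "n = 0" then show False using t by (simp add: jump_time_def)
    qed
    then have t': "ennreal t < jump_time z (Suc (n - 1))" using t by simp
    have k1: "ennreal t < jump_time z (Suc k)" unfolding k_def by (rule LeastI) (rule t')
    have kn: "k < n" using Least_le[of "\<lambda>m. ennreal t < jump_time z (Suc m)", OF t'] n0 by (simp add: k_def)
    have k2: "jump_time z k \<le> ennreal t"
    proof (cases k)
      case 0 then show ?thesis by (simp add: jump_time_def)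
    next
      case (Suc m)
      then have "\<not> ennreal t < jump_time z (Suc m)"
        using not_less_Least[of m "\<lambda>m. ennreal t < jump_time z (Suc m)"] by (simp add: k_def)
      then show ?thesis using Suc by simp
    qed
    have iff: "t \<in> {?s i..<?s (Suc i)} \<longleftrightarrow> jump_time z i \<le> ennreal t \<and> ennreal t < jump_time z (Suc i)" for i
      using less_clipped_time_iff[of t T z] True by (simp add: not_less[symmetric] del: not_less) 
    have "t \<in> {?s i..<?s (Suc i)} \<longleftrightarrow> i = k" for i
    proof
      assume "t \<in> {?s i..<?s (Suc i)}"
      then have a: "jump_time z i \<le> ennreal t" "ennreal t < jump_time z (Suc i)" using iff by auto
      have "\<not> jump_time z (Suc i) \<le> jump_time z k" using a k2 by (meson leD order_trans)
      moreover have "\<not> jump_time z (Suc k) \<le> jump_time z i" using a k1 by (meson leD order_trans)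
      ultimately show "i = k" using jump_time_mono[of "Suc i" k z] jump_time_mono[of "Suc k" i z] by linarith
    next
      assume "i = k" then show "t \<in> {?s i..<?s (Suc i)}" using k1 k2 iff[of i] by blast
    qed
    then have "(\<Sum>i<n. f (fst (z i)) * indicator {?s i..<?s (Suc i)} t) = (\<Sum>i<n. if i = k then f (fst (z k)) else 0)"
      by (intro sum.cong) (auto simp: indicator_def)
    also have "\<dots> = f (fst (z k))" using kn by simp
    finally show ?thesis using True jump_path_eq[OF ex _ k2 k1] by simp
  qed
  have "(LINT t:{0..T}|lborel. f (jump_path z t)) = (LINT t|lborel. (\<Sum>k<n. f (fst (z k)) * indicator {?s k..<?s (Suc k)} t))"
    unfolding set_lebesgue_integral_def
    by (rule integral_discrete_difference[of "{T}"]; ((rule eq, simp) | simp)?)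
  also have "\<dots> = (\<Sum>k<n. f (fst (z k)) * (?s (Suc k) - ?s k))"
    using clipped_time_mono[of _ "Suc _" z T]
    by (subst Bochner_Integration.integral_sum) (auto intro!: sum.cong)
  finally show ?thesis .
qed

section \<open>Measurability on path space\<close>

lemma space_skorokhod: "space skorokhod_space = {\<omega>. cadlag \<omega>}"
  by (auto simp: skorokhod_space_def space_restrict_space space_PiM cadlag_def PiE_def)

lemma measurable_skorokhod_component:
  assumes "0 \<le> t" shows "(\<lambda>\<omega>. \<omega> t) \<in> borel_measurable skorokhod_space"
  unfolding skorokhod_space_def using assms
  by (intro measurable_restrict_space1 measurable_component_singleton) simp

text \<open>The sigma-algebra of paths is generated by single coordinates, so joint measurability of
  \<open>f (\<omega> t)\<close> in path and time is obtained by sampling at the next grid point to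
  the right of \<open>t\<close>; right continuity gives the limit.\<close>

lemma measurable_path_integral:
  fixes f :: "'a::{metric_space, second_countable_topology} \<Rightarrow> real"
  assumes f: "continuous_on UNIV f"
  shows "(\<lambda>\<omega>. LINT t:{0..T}|lborel. f (\<omega> t)) \<in> borel_measurable skorokhod_space"
proof -
  let ?s = "\<lambda>n t. (of_int \<lfloor>real (Suc n) * t\<rfloor> + 1) / real (Suc n)"
  define g where "g n \<xi> = (if 0 \<le> snd \<xi> \<and> snd \<xi> \<le> T then f (fst \<xi> (?s n (snd \<xi>))) else 0)" for n and \<xi> :: "(real \<Rightarrow> 'a) \<times> real"
  have [measurable]: "f \<in> borel_measurable borel" using f by (rule borel_measurable_continuous_onI)
  have g: "g n \<in> borel_measurable (skorokhod_space \<Otimes>\<^sub>M lborel)" for n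
  proof -
    \<comment> \<open>For a fixed grid index the sample is a single coordinate; the guard keeps its
      time in \<open>{0..}\<close>, where paths carry information.\<close>
    define h where "h k \<omega> = (if 0 \<le> (real_of_int k + 1) / real (Suc n) then f (\<omega> ((of_int k + 1) / real (Suc n))) else 0)" for k :: int and \<omega>
    have [measurable]: "h k \<in> borel_measurable skorokhod_space" for k
      unfolding h_def[abs_def]
      using measurable_compose[OF measurable_skorokhod_component[of "(real_of_int k + 1) / real (Suc n)"], of f borel]
      by (cases "0 \<le> (real_of_int k + 1) / real (Suc n)") (simp_all del: of_nat_Suc)
    have m: "(\<lambda>\<xi>. h \<lfloor>real (Suc n) * snd \<xi>\<rfloor> (fst \<xi>)) \<in> borel_measurable (skorokhod_space \<Otimes>\<^sub>M lborel)"
      by (rule measurable_compose_countable[where g="\<lambda>\<xi>. \<lfloor>real (Suc n) * snd \<xi>\<rfloor>"]) measurable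
    have "g n = (\<lambda>\<xi>. if 0 \<le> snd \<xi> \<and> snd \<xi> \<le> T then h \<lfloor>real (Suc n) * snd \<xi>\<rfloor> (fst \<xi>) else 0)"
      by (auto simp: g_def h_def fun_eq_iff)
    then show ?thesis using m by simp
  qed
  have lim: "(\<lambda>n. g n (\<omega>, t)) \<longlonglongrightarrow> indicator {0..T} t * f (\<omega> t)" if \<omega>: "cadlag \<omega>" for \<omega> t
  proof (cases "0 \<le> t \<and> t \<le> T")
    case True
    have s: "t < ?s n t" "?s n t \<le> t + 1 / real (Suc n)" for n
    proof -
      have "real (Suc n) * t < of_int \<lfloor>real (Suc n) * t\<rfloor> + 1" by linarith
      then show "t < ?s n t" by (simp add: pos_less_divide_eq mult.commute)
      have "of_int \<lfloor>real (Suc n) * t\<rfloor> + 1 \<le> real (Suc n) * t + 1" by linarith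
      then have "?s n t \<le> (real (Suc n) * t + 1) / real (Suc n)"
        by (intro divide_right_mono) auto
      also have "\<dots> = t + 1 / real (Suc n)" by (simp add: add_divide_distrib)
      finally show "?s n t \<le> t + 1 / real (Suc n)" .
    qed
    have "(\<lambda>n. t + 1 / real (Suc n)) \<longlonglongrightarrow> t + 0"
      by (intro tendsto_intros LIMSEQ_Suc[OF lim_1_over_n])
    then have "(\<lambda>n. ?s n t) \<longlonglongrightarrow> t"
      using s by (intro tendsto_sandwich[of "\<lambda>_. t" "\<lambda>n. ?s n t" sequentially "\<lambda>n. t + 1 / real (Suc n)"])
        (auto intro!: always_eventually less_imp_le)
    then have "filterlim (\<lambda>n. ?s n t) (at_right t) sequentially"
      unfolding filterlim_at using s(1) by (auto intro!: always_eventually less_imp_neq[symmetric])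
    moreover have "(\<omega> \<longlongrightarrow> \<omega> t) (at_right t)"
      using \<omega> True by (auto simp: cadlag_def)
    ultimately have "(\<lambda>n. \<omega> (?s n t)) \<longlonglongrightarrow> \<omega> t"
      by (rule filterlim_compose[rotated])
    moreover have "isCont f (\<omega> t)" using f by (simp add: continuous_on_eq_continuous_at)
    ultimately have "(\<lambda>n. f (\<omega> (?s n t))) \<longlonglongrightarrow> f (\<omega> t)" by (rule isCont_tendsto_compose[rotated])
    then show ?thesis using True by (simp add: g_def)
  qed (auto simp: g_def)
  have "(\<lambda>\<xi>. indicator {0..T} (snd \<xi>) * f (fst \<xi> (snd \<xi>))) \<in> borel_measurable (skorokhod_space \<Otimes>\<^sub>M lborel)"
    by (rule borel_measurable_LIMSEQ_metric[OF g])
      (auto simp: space_pair_measure space_skorokhod intro!: lim)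
  then show ?thesis
    unfolding set_lebesgue_integral_def
    by (intro lborel.borel_measurable_lebesgue_integral) (simp add: split_beta')
qed

section \<open>The weak topology over a compact space\<close>

text \<open>Induction over the generation of the open sets. The neighbourhoods are centred at
  \<open>\<mu>\<close> itself and share one radius, which is the form in which openness is used
  below.\<close>

lemma weak_topology_nbhd:
  fixes A :: "'a::topological_space measure set"
  assumes "openin weak_topology A" "\<mu> \<in> A"
  shows "\<exists>F e. finite F \<and> 0 < (e::real) \<and> (\<forall>f\<in>F. continuous_on UNIV f \<and> bounded (range f)) \<and>
    (\<forall>\<nu>\<in>prob_measures. (\<forall>f\<in>F. \<bar>(\<integral>x. f x \<partial>\<nu>) - (\<integral>x. f x \<partial>\<mu>)\<bar> < e) \<longrightarrow> \<nu> \<in> A)"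
    (is "?P \<mu> A")
proof -
  let ?S = "{{\<mu>\<in>prob_measures. (\<integral>x. f x \<partial>\<mu>) \<in> U} |f U.
        continuous_on UNIV (f :: 'a \<Rightarrow> real) \<and> bounded (range f) \<and> open U}"
  have "generate_topology_on ?S A"
    using assms(1) unfolding weak_topology_def by (rule openin_topology_generated_by)
  then have "\<forall>\<mu>\<in>A. ?P \<mu> A"
  proof induction
    case Empty then show ?case by simp
  next
    case (Int A B)
    show ?case
    proof
      fix \<mu> assume "\<mu> \<in> A \<inter> B"
      then have "?P \<mu> A" "?P \<mu> B" using Int.IH by auto
      then obtain F G :: "('a \<Rightarrow> real) set" and e d where
        "finite F" "0 < e" "\<forall>f\<in>F. continuous_on UNIV f \<and> bounded (range f)"
        "\<forall>\<nu>\<in>prob_measures. (\<forall>f\<in>F. \<bar>(\<integral>x. f x \<partial>\<nu>) - (\<integral>x. f x \<partial>\<mu>)\<bar> < e) \<longrightarrow> \<nu> \<in> A"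
        "finite G" "0 < d" "\<forall>f\<in>G. continuous_on UNIV f \<and> bounded (range f)"
        "\<forall>\<nu>\<in>prob_measures. (\<forall>f\<in>G. \<bar>(\<integral>x. f x \<partial>\<nu>) - (\<integral>x. f x \<partial>\<mu>)\<bar> < d) \<longrightarrow> \<nu> \<in> B"
        by blast
      then show "?P \<mu> (A \<inter> B)"
        by (intro exI[of _ "F \<union> G"] exI[of _ "min e d"] conjI) auto
    qed
  next
    case (UN K)
    show ?case
    proof
      fix \<mu> assume "\<mu> \<in> \<Union>K"
      then obtain k where k: "k \<in> K" "\<mu> \<in> k" by auto
      have "?P \<mu> k" using UN.IH[OF k(1)] k(2) by (rule bspec)
      then obtain F :: "('a \<Rightarrow> real) set" and e where
        "finite F" "0 < e" "\<forall>f\<in>F. continuous_on UNIV f \<and> bounded (range f)"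
        "\<forall>\<nu>\<in>prob_measures. (\<forall>f\<in>F. \<bar>(\<integral>x. f x \<partial>\<nu>) - (\<integral>x. f x \<partial>\<mu>)\<bar> < e) \<longrightarrow> \<nu> \<in> k"
        by blast
      with k(1) show "?P \<mu> (\<Union>K)" by (intro exI[of _ F] exI[of _ e] conjI) auto
    qed
  next
    case (Basis B)
    then obtain f :: "'a \<Rightarrow> real" and U where
      B: "B = {\<mu>\<in>prob_measures. (\<integral>x. f x \<partial>\<mu>) \<in> U}" "continuous_on UNIV f" "bounded (range f)" "open U"
      by blast
    show ?case
    proof
      fix \<mu> assume "\<mu> \<in> B"
      then have "(\<integral>x. f x \<partial>\<mu>) \<in> U" by (simp add: B)
      then obtain e where e: "e > 0" "\<And>y. dist y (\<integral>x. f x \<partial>\<mu>) < e \<Longrightarrow> y \<in> U" using B(4) unfolding open_dist by blast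
      then show "?P \<mu> B"
        by (intro exI[of _ "{f}"] exI[of _ e]) (auto simp: B dist_real_def)
    qed
  qed
  with assms(2) show "?P \<mu> A" by (rule bspec[rotated])
qed

text \<open>Finitely many test functions decide membership near \<open>\<mu>\<close>, so convergence
  along each of them brings the sequence into any neighbourhood. Compactness can thus be used along
  subsequences, with no metric on the measures.\<close>

lemma sequentially_closedin_weak_topology:
  fixes C :: "'a::topological_space measure set"
  assumes "closedin weak_topology C" "\<And>n. \<nu> n \<in> C" "\<mu> \<in> prob_measures"
    and conv: "\<And>f :: 'a \<Rightarrow> real. continuous_on UNIV f \<Longrightarrow> bounded (range f) \<Longrightarrow> (\<lambda>n. \<integral>x. f x \<partial>\<nu> n) \<longlonglongrightarrow> (\<integral>x. f x \<partial>\<mu>)"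
  shows "\<mu> \<in> C"
proof (rule ccontr)
  assume "\<mu> \<notin> C"
  have "openin weak_topology (prob_measures - C)" using assms(1) by (simp add: closedin_def)
  moreover have "\<mu> \<in> prob_measures - C" using \<open>\<mu> \<notin> C\<close> assms(3) by simp
  ultimately obtain F :: "('a \<Rightarrow> real) set" and e :: real
    where F: "finite F" "0 < e" "\<forall>f\<in>F. continuous_on UNIV f \<and> bounded (range f)"
    "\<forall>\<nu>\<in>prob_measures. (\<forall>f\<in>F. \<bar>(\<integral>x. f x \<partial>\<nu>) - (\<integral>x. f x \<partial>\<mu>)\<bar> < e) \<longrightarrow> \<nu> \<in> prob_measures - C"
    using weak_topology_nbhd[of "prob_measures - C" \<mu>] by blast
  have "\<forall>\<^sub>F n in sequentially. \<forall>f\<in>F. \<bar>(\<integral>x. f x \<partial>\<nu> n) - (\<integral>x. f x \<partial>\<mu>)\<bar> < e"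
  proof (intro eventually_ball_finite F(1) ballI)
    fix f assume "f \<in> F"
    then have "(\<lambda>n. \<integral>x. f x \<partial>\<nu> n) \<longlonglongrightarrow> (\<integral>x. f x \<partial>\<mu>)" using F(3) by (intro conv) auto
    then show "\<forall>\<^sub>F n in sequentially. \<bar>(\<integral>x. f x \<partial>\<nu> n) - (\<integral>x. f x \<partial>\<mu>)\<bar> < e"
      using F(2) by (simp add: tendsto_iff dist_real_def)
  qed
  then obtain n where "\<forall>f\<in>F. \<bar>(\<integral>x. f x \<partial>\<nu> n) - (\<integral>x. f x \<partial>\<mu>)\<bar> < e" by (auto simp: eventually_sequentially)
  moreover have "\<nu> n \<in> prob_measures" using assms(1,2) closedin_subset by fastforce
  ultimately show False using F(4) assms(2) by auto
qed

lemma bounded_continuous_compact: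
  fixes f :: "'a::topological_space \<Rightarrow> real"
  assumes "compact (UNIV :: 'a set)" "continuous_on UNIV f"
  obtains B where "0 < B" "\<And>x. \<bar>f x\<bar> \<le> B"
proof -
  have "bounded (range f)" using compact_continuous_image[OF assms(2,1)] by (rule compact_imp_bounded)
  then show thesis using that by (auto simp: bounded_pos)
qed

section \<open>Separability of the continuous functions\<close>

text \<open>A maximum of finitely many cones of slope \<open>M\<close> above a floor
  \<open>b\<close>. Rational parameters and apexes in a countable dense set leave countably many
  such functions.\<close>

fun cone :: "real \<Rightarrow> real \<Rightarrow> ('a::metric_space \<times> real) list \<Rightarrow> 'a \<Rightarrow> real" where
  "cone M b [] x = b"
| "cone M b ((k, a) # xs) x = max (a - M * dist x k) (cone M b xs x)"

lemma continuous_on_cone: "continuous_on UNIV (cone M b xs)"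
proof (induction xs)
  case Nil
  have "cone M b [] = (\<lambda>_. b)" by (simp add: fun_eq_iff)
  then show ?case by simp
next
  case (Cons ka xs)
  obtain k a where "ka = (k, a)" by (cases ka)
  then have "cone M b (ka # xs) = (\<lambda>x. max (a - M * dist x k) (cone M b xs x))" by (simp add: fun_eq_iff)
  then show ?case using Cons.IH by (auto intro!: continuous_on_max continuous_intros)
qed

lemma cone_le_iff: "cone M b xs x \<le> c \<longleftrightarrow> b \<le> c \<and> (\<forall>(k, a)\<in>set xs. a - M * dist x k \<le> c)"
  by (induction xs) auto

lemma cone_ge: "(k, a) \<in> set xs \<Longrightarrow> a - M * dist x k \<le> cone M b xs x"
  using cone_le_iff[of M b xs x "cone M b xs x"] by auto

lemma rational_between: "x < y \<Longrightarrow> \<exists>q\<in>\<rat>. x < q \<and> q < (y::real)"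
  using Rats_dense_in_real by blast

text \<open>A continuous \<open>f\<close> is approximated by cones with apexes near its graph over a
  fine net: uniform continuity handles the nearby apexes, and the slope is so steep that distant
  cones fall below the range of \<open>f\<close>.\<close>

lemma countable_dense_continuous:
  assumes comp: "compact (UNIV :: 'a::{metric_space, second_countable_topology} set)"
  shows "\<exists>D :: ('a \<Rightarrow> real) set. countable D \<and> (\<forall>g\<in>D. continuous_on UNIV g) \<and>
    (\<forall>f e. continuous_on UNIV f \<longrightarrow> 0 < e \<longrightarrow> (\<exists>g\<in>D. \<forall>x. \<bar>f x - g x\<bar> < e))"
proof -
  obtain S :: "'a set" where S: "countable S" "\<And>X. open X \<Longrightarrow> X \<noteq> {} \<Longrightarrow> \<exists>d\<in>S. d \<in> X"
    using countable_dense_setE by blast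
  define D where "D = (\<lambda>(M, b, xs). cone M b xs) ` (\<rat> \<times> \<rat> \<times> lists (S \<times> \<rat>))"
  show ?thesis
  proof (intro exI[of _ D] conjI ballI allI impI)
    show "countable D" unfolding D_def
      by (intro countable_image countable_SIGMA countable_lists) (auto simp: countable_rat S)
    show "continuous_on UNIV g" if "g \<in> D" for g
      using that by (auto simp: D_def continuous_on_cone)
    fix f :: "'a \<Rightarrow> real" and e :: real
    assume f: "continuous_on UNIV f" and e: "0 < e"
    obtain B where B: "0 < B" "\<And>x. \<bar>f x\<bar> \<le> B" using bounded_continuous_compact[OF comp f] by blast
    have "uniformly_continuous_on UNIV f" by (rule compact_uniformly_continuous[OF f comp])
    then obtain d where d: "d > 0" "\<And>x y. dist x y < d \<Longrightarrow> dist (f x) (f y) < e/4"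
      unfolding uniformly_continuous_on_def using e by (metis UNIV_I divide_pos_pos zero_less_numeral)
    \<comment> \<open>Over the distance \<open>d\<close> of uniform continuity a cone drops by more
      than \<open>2 * B + e\<close>, which exceeds the oscillation of \<open>f\<close>.\<close>
    obtain M where M: "M \<in> \<rat>" "(2 * B + e) / d < M" using rational_between[of "(2 * B + e) / d" "(2 * B + e) / d + 1"] by auto
    have M0: "M > 0" using M(2) B(1) e d(1) by (smt (verit) divide_pos_pos)
    have Md: "2 * B + e < M * d" using M(2) d(1) by (simp add: pos_divide_less_eq)
    obtain b where b: "b \<in> \<rat>" "b < - B" using rational_between[of "- B - 1" "- B"] by auto
    \<comment> \<open>The net is finer than \<open>d\<close>: within \<open>d'\<close> a cone drops
      by at most \<open>e / 4\<close>, which gives the lower bound.\<close>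
    define d' where "d' = min d (e / (4 * M))"
    have d': "d' > 0" "d' \<le> d" "M * d' \<le> e/4" using d(1) e M0 by (auto simp: d'_def min_def field_simps)
    have cov: "UNIV \<subseteq> (\<Union>k\<in>S. ball k d')"
    proof
      fix x :: 'a
      obtain k where "k \<in> S" "k \<in> ball x d'" using S(2)[of "ball x d'"] d'(1) by auto
      then show "x \<in> (\<Union>k\<in>S. ball k d')" by (auto simp: dist_commute)
    qed
    obtain F where F: "F \<subseteq> S" "finite F" "UNIV \<subseteq> (\<Union>k\<in>F. ball k d')"
      using compactE_image[OF comp _ cov] by (metis open_ball)
    obtain ks where ks: "set ks = F" using finite_list[OF F(2)] by blast
    have "\<forall>k. \<exists>a\<in>\<rat>. f k - e/4 < a \<and> a < f k + e/4" using e by (intro allI rational_between) simp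
    then obtain a where a: "\<And>k. a k \<in> \<rat>" "\<And>k. f k - e/4 < a k" "\<And>k. a k < f k + e/4" by metis
    define xs where "xs = map (\<lambda>k. (k, a k)) ks"
    have "cone M b xs \<in> D"
      unfolding D_def using M(1) b(1) F(1) ks a(1)
      by (intro image_eqI[of _ _ "(M, b, xs)"]) (auto simp: xs_def)
    moreover have "\<bar>f x - cone M b xs x\<bar> < e" for x
    proof -
      have "cone M b xs x \<le> f x + e/2"
        unfolding cone_le_iff
      proof (intro conjI)
        show "b \<le> f x + e/2" using b(2) B(2)[of x] e by simp
        have "a k - M * dist x k \<le> f x + e/2" for k
        proof (cases "dist x k < d")
          case True
          have "0 \<le> M * dist x k" using M0 by simp
          moreover have "f k < f x + e/4" using d(2)[OF True] unfolding dist_real_def by linarith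
          ultimately show ?thesis using a(3)[of k] by linarith
        next
          case False
          then have "M * d \<le> M * dist x k" using M0 by simp
          then show ?thesis using Md a(3)[of k] B(2)[of k] B(2)[of x] e by linarith
        qed
        then show "\<forall>(k, a)\<in>set xs. a - M * dist x k \<le> f x + e/2" by (auto simp: xs_def)
      qed
      moreover have "f x - 3 * e / 4 \<le> cone M b xs x"
      proof -
        obtain k where k: "k \<in> F" "dist k x < d'" using F(3) by (auto simp: subset_iff) 
        have "f x < f k + e/4" using d(2)[of k x] k(2) d'(2) unfolding dist_real_def by linarith
        moreover have "M * dist x k \<le> e/4" using k(2) M0 d'(3) by (smt (verit) dist_commute mult_left_mono)
        moreover have "a k - M * dist x k \<le> cone M b xs x"
          using k ks by (intro cone_ge) (auto simp: xs_def)
        ultimately show ?thesis using a(2)[of k] by linarith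
      qed
      ultimately show ?thesis using e by linarith
    qed
    ultimately show "\<exists>g\<in>D. \<forall>x. \<bar>f x - g x\<bar> < e" by blast
  qed
qed

lemma prob_measure_integrable:
  fixes f :: "'a::topological_space \<Rightarrow> real"
  assumes "\<nu> \<in> prob_measures" "f \<in> borel_measurable borel" "\<And>x. \<bar>f x\<bar> \<le> B"
  shows "integrable \<nu> f"
proof -
  interpret prob_space \<nu> using assms(1) by (simp add: prob_measures_iff)
  have "f \<in> borel_measurable \<nu>" using assms by (simp add: prob_measures_iff cong: measurable_cong_sets)
  then show ?thesis using assms(3) by (intro integrable_const_bound[of _ B]) auto
qed

lemma prob_measure_integral_close:
  fixes f :: "'a::topological_space \<Rightarrow> real"
  assumes \<nu>: "\<nu> \<in> prob_measures" and fg: "integrable \<nu> f" "integrable \<nu> g" "\<And>x. \<bar>f x - g x\<bar> \<le> e"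
  shows "\<bar>(\<integral>x. f x \<partial>\<nu>) - (\<integral>x. g x \<partial>\<nu>)\<bar> \<le> e"
proof -
  interpret prob_space \<nu> using assms(1) by (simp add: prob_measures_iff)
  have "\<bar>(\<integral>x. f x \<partial>\<nu>) - (\<integral>x. g x \<partial>\<nu>)\<bar> = \<bar>\<integral>x. f x - g x \<partial>\<nu>\<bar>" using fg by simp
  also have "\<dots> \<le> (\<integral>x. \<bar>f x - g x\<bar> \<partial>\<nu>)" by (rule integral_abs_bound)
  also have "\<dots> \<le> (\<integral>x. e \<partial>\<nu>)" using fg by (intro integral_mono) auto
  finally show ?thesis by (simp add: prob_space)
qed

text \<open>The weak topology is generated by uncountably many test functions. A countable uniformly
  dense family with rational centres and radii writes an open set as a countable union of sets
  defined through finitely many path integrals, which are measurable.\<close>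

lemma sets_empirical_measure_open:
  fixes A :: "'a::{metric_space, second_countable_topology} measure set"
  assumes comp: "compact (UNIV :: 'a set)" and A: "openin weak_topology A" and T: "0 < T"
  shows "{\<omega> \<in> space skorokhod_space. empirical_measure T \<omega> \<in> A} \<in> sets skorokhod_space"
proof -
  obtain D :: "('a \<Rightarrow> real) set" where D: "countable D" "\<forall>g\<in>D. continuous_on UNIV g"
    "\<forall>f e. continuous_on UNIV f \<longrightarrow> 0 < e \<longrightarrow> (\<exists>g\<in>D. \<forall>x. \<bar>f x - g x\<bar> < e)"
    using countable_dense_continuous[OF comp] by blast
  define N where "N = (\<lambda>(xs :: (('a \<Rightarrow> real) \<times> real) list, e::real). {\<nu>\<in>prob_measures. \<forall>(g, c)\<in>set xs. \<bar>(\<integral>x. g x \<partial>\<nu>) - c\<bar> < e})"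
  define I where "I = {i \<in> lists (D \<times> \<rat>) \<times> \<rat>. N i \<subseteq> A}"
  have "countable (lists (D \<times> (\<rat> :: real set)) \<times> (\<rat> :: real set))"
    by (intro countable_SIGMA countable_lists) (auto simp: countable_rat D)
  then have cI: "countable I"
    unfolding I_def by (rule countable_subset[rotated]) auto
  have AN: "A = (\<Union>i\<in>I. N i)"
  proof (intro set_eqI iffI)
    fix \<nu> assume \<nu>: "\<nu> \<in> A"
    then have \<nu>': "\<nu> \<in> prob_measures" using openin_subset[OF A] by auto
    obtain F :: "('a \<Rightarrow> real) set" and e :: real
      where F: "finite F" "0 < e" "\<forall>f\<in>F. continuous_on UNIV f \<and> bounded (range f)"
      "\<forall>\<nu>'\<in>prob_measures. (\<forall>f\<in>F. \<bar>(\<integral>x. f x \<partial>\<nu>') - (\<integral>x. f x \<partial>\<nu>)\<bar> < e) \<longrightarrow> \<nu>' \<in> A"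
      using weak_topology_nbhd[OF A \<nu>] by blast
    have F3: "continuous_on UNIV f" if "f \<in> F" for f using F(3) that by blast
    \<comment> \<open>Four errors below \<open>e / 4\<close> add up: replacing \<open>f\<close> by
      \<open>g f\<close> under both measures, and the distance of both integrals of
      \<open>g f\<close> from the rational centre \<open>c f\<close>.\<close>
    obtain e' where e': "e' \<in> \<rat>" "0 < e'" "e' < e/4" using rational_between[of 0 "e/4"] F(2) by auto
    have "\<forall>f\<in>F. \<exists>g\<in>D. \<forall>x. \<bar>f x - g x\<bar> < e'" using D(3) F3 e'(2) by blast
    then obtain g where g: "\<And>f. f \<in> F \<Longrightarrow> g f \<in> D" "\<And>f x. f \<in> F \<Longrightarrow> \<bar>f x - g f x\<bar> < e'" by metis
    define c where "c f = (SOME c. c \<in> \<rat> \<and> (\<integral>x. g f x \<partial>\<nu>) < c \<and> c < (\<integral>x. g f x \<partial>\<nu>) + e')" for f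
    have c': "c f \<in> \<rat> \<and> (\<integral>x. g f x \<partial>\<nu>) < c f \<and> c f < (\<integral>x. g f x \<partial>\<nu>) + e'" for f
      unfolding c_def
    proof (rule someI_ex)
      show "\<exists>c. c \<in> \<rat> \<and> (\<integral>x. g f x \<partial>\<nu>) < c \<and> c < (\<integral>x. g f x \<partial>\<nu>) + e'"
        using rational_between[of "\<integral>x. g f x \<partial>\<nu>" "(\<integral>x. g f x \<partial>\<nu>) + e'"] e'(2) by auto
    qed
    have c: "c f \<in> \<rat>" "\<bar>(\<integral>x. g f x \<partial>\<nu>) - c f\<bar> < e'" for f
      using c'[of f] e'(2) by linarith+
    obtain fs where fs: "set fs = F" using finite_list[OF F(1)] by blast
    let ?i = "(map (\<lambda>f. (g f, c f)) fs, e')"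
    have "N ?i \<subseteq> A"
    proof
      fix \<nu>' assume "\<nu>' \<in> N ?i"
      then have n: "\<nu>' \<in> prob_measures" "\<And>f. f \<in> F \<Longrightarrow> \<bar>(\<integral>x. g f x \<partial>\<nu>') - c f\<bar> < e'" using fs by (auto simp: N_def)
      show "\<nu>' \<in> A"
      proof (rule F(4)[rule_format, OF n(1)])
        fix f assume f: "f \<in> F"
        have int: "integrable \<eta> h" if h: "\<eta> \<in> prob_measures" "continuous_on UNIV h" for \<eta> and h :: "'a \<Rightarrow> real"
        proof -
          obtain B where "\<And>x. \<bar>h x\<bar> \<le> B" using bounded_continuous_compact[OF comp h(2)] by blast
          then show ?thesis using h by (intro prob_measure_integrable borel_measurable_continuous_onI) auto
        qed
        have "\<bar>(\<integral>x. f x \<partial>\<eta>) - (\<integral>x. g f x \<partial>\<eta>)\<bar> \<le> e'" if "\<eta> \<in> prob_measures" for \<eta>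
          using that g(2)[OF f] F3[OF f] D(2)[rule_format, OF g(1)[OF f]]
          by (intro prob_measure_integral_close int) (auto intro: less_imp_le)
        from this[OF \<nu>'] this[OF n(1)] n(2)[OF f] c(2)[of f] e'(3)
        show "\<bar>(\<integral>x. f x \<partial>\<nu>') - (\<integral>x. f x \<partial>\<nu>)\<bar> < e" by linarith
      qed
    qed
    moreover have "\<nu> \<in> N ?i" using \<nu>' c by (auto simp: N_def)
    moreover have "?i \<in> lists (D \<times> \<rat>) \<times> \<rat>" using e' c g fs by auto
    ultimately show "\<nu> \<in> (\<Union>i\<in>I. N i)" by (auto simp: I_def simp del: UN_iff intro!: UN_I[of ?i])
  qed (auto simp: I_def)
  have "{\<omega> \<in> space skorokhod_space. empirical_measure T \<omega> \<in> N i} \<in> sets skorokhod_space" if "i \<in> I" for i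
  proof -
    obtain xs e where i: "i = (xs, e)" by (cases i)
    have xs: "continuous_on UNIV g" if "(g, c) \<in> set xs" for g c
      using \<open>i \<in> I\<close> that D(2) by (auto simp: I_def i lists_eq_set)
    have "{\<omega> \<in> space skorokhod_space. empirical_measure T \<omega> \<in> N i} =
      {\<omega> \<in> space skorokhod_space. \<forall>(g, c)\<in>set xs. \<bar>1 / T * (LINT t:{0..T}|lborel. g (\<omega> t)) - c\<bar> < e}"
      using xs by (auto simp: N_def i space_skorokhod empirical_measure_in_prob_measures T integral_empirical_measure) 
    also have "\<dots> \<in> sets skorokhod_space"
    proof -
      have "{\<omega> \<in> space skorokhod_space. \<forall>gc\<in>set xs. \<bar>1 / T * (LINT t:{0..T}|lborel. fst gc (\<omega> t)) - snd gc\<bar> < e} \<in> sets skorokhod_space"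
      proof (rule sets.sets_Collect_finite_All)
        fix gc assume "gc \<in> set xs"
        then have [measurable]: "(\<lambda>\<omega>. LINT t:{0..T}|lborel. fst gc (\<omega> t)) \<in> borel_measurable skorokhod_space"
          using xs[of "fst gc" "snd gc"] by (intro measurable_path_integral) simp
        show "{\<omega> \<in> space skorokhod_space. \<bar>1 / T * (LINT t:{0..T}|lborel. fst gc (\<omega> t)) - snd gc\<bar> < e} \<in> sets skorokhod_space"
          by measurable
      qed simp
      then show ?thesis by (simp add: case_prod_beta')
    qed
    finally show ?thesis .
  qed
  then have "(\<Union>i\<in>I. {\<omega> \<in> space skorokhod_space. empirical_measure T \<omega> \<in> N i}) \<in> sets skorokhod_space"
    using cI by (intro sets.countable_UN') auto
  moreover have "(\<Union>i\<in>I. {\<omega> \<in> space skorokhod_space. empirical_measure T \<omega> \<in> N i}) = {\<omega> \<in> space skorokhod_space. empirical_measure T \<omega> \<in> A}"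
    unfolding AN by auto
  ultimately show ?thesis by simp
qed

text \<open>A coding of the points by reals whose inverse is uniformly continuous: two points with close
  codes lie in the same sets of a countable base up to a large index.\<close>

lemma ternary_series_close:
  fixes a :: "nat \<Rightarrow> real"
  assumes a: "\<And>n. a n \<in> {-1, 0, 1}" and small: "\<bar>\<Sum>n. a n * (1/3)^n\<bar> < (1/3)^N / 2" and "n \<le> N"
  shows "a n = 0"
proof (rule ccontr)
  assume "a n \<noteq> 0"
  \<comment> \<open>The first nonzero term has modulus \<open>(1/3)^m\<close>, while the whole tail
    after it is at most half of that. The ratio 1/3 makes this gap; with ratio 1/2 the tail could
    cancel the term.\<close>
  define m where "m = (LEAST n. a n \<noteq> 0)"
  have m: "a m \<noteq> 0" unfolding m_def by (rule LeastI) fact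
  have mn: "m \<le> n" unfolding m_def by (rule Least_le) fact
  have z: "a i = 0" if "i < m" for i using not_less_Least[of i "\<lambda>n. a n \<noteq> 0"] that by (auto simp: m_def)
  have ab: "\<bar>a i\<bar> \<le> 1" for i using a[of i] by auto
  have g: "summable (\<lambda>i. (1/3::real)^i)" by (rule summable_geometric) simp
  have s: "summable (\<lambda>i. a i * (1/3)^i)"
    by (rule summable_comparison_test'[OF g, of 0]) (use ab in \<open>auto simp: abs_mult intro!: mult_left_le_one_le\<close>)
  have "(\<Sum>i. a i * (1/3)^i) = (\<Sum>i. a (i + Suc m) * (1/3)^(i + Suc m)) + (\<Sum>i<Suc m. a i * (1/3)^i)"
    by (rule suminf_split_initial_segment[OF s])
  also have "(\<Sum>i<Suc m. a i * (1/3)^i) = a m * (1/3)^m" using z by (simp add: sum.neutral)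
  finally have eq: "(\<Sum>i. a i * (1/3)^i) = (\<Sum>i. a (i + Suc m) * (1/3)^(i + Suc m)) + a m * (1/3)^m" .
  have g': "summable (\<lambda>i. (1/3::real)^(i + Suc m))" using summable_ignore_initial_segment[OF g] .
  have bd: "norm (a (i + Suc m) * (1/3)^(i + Suc m)) \<le> (1/3)^(i + Suc m)" for i
    using ab[of "i + Suc m"] by (simp add: abs_mult mult_left_le_one_le)
  have s': "summable (\<lambda>i. norm (a (i + Suc m) * (1/3)^(i + Suc m)))"
    by (rule summable_comparison_test'[OF g', of 0]) (use bd in simp)
  have "\<bar>\<Sum>i. a (i + Suc m) * (1/3)^(i + Suc m)\<bar> \<le> (\<Sum>i. norm (a (i + Suc m) * (1/3)^(i + Suc m)))"
    using summable_norm[OF s'] by simp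
  also have "\<dots> \<le> (\<Sum>i. (1/3::real)^(i + Suc m))"
    by (rule suminf_le[OF bd s' g'])
  also have "\<dots> = (1/3)^Suc m * (\<Sum>i. (1/3::real)^i)"
    by (subst suminf_mult[OF g, symmetric]) (simp add: power_add mult.commute)
  also have "\<dots> = (1/3)^m / 2" by (simp add: suminf_geometric)
  finally have "\<bar>\<Sum>i. a (i + Suc m) * (1/3)^(i + Suc m)\<bar> \<le> (1/3)^m / 2" .
  moreover have "\<bar>a m * (1/3)^m\<bar> = (1/3)^m" using m a[of m] by (auto simp: abs_mult)
  ultimately have "(1/3)^m / 2 \<le> \<bar>\<Sum>i. a i * (1/3)^i\<bar>" unfolding eq by linarith
  moreover have "(1/3::real)^N \<le> (1/3)^m" using mn \<open>n \<le> N\<close> by (intro power_decreasing) auto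
  ultimately show False using small by linarith
qed

text \<open>The code is the series of the indicators of a countable base with weights
  \<open>(1/3)^n\<close>. It is merely measurable, but its inverse is uniformly continuous, which
  allows the compactness of measures on the real line to be transferred to the state space.\<close>

lemma real_coding:
  assumes comp: "compact (UNIV :: 'a::{metric_space, second_countable_topology} set)"
  obtains s :: "'a::{metric_space, second_countable_topology} \<Rightarrow> real" where "s \<in> borel_measurable borel" "\<And>x. 0 \<le> s x" "\<And>x. s x \<le> 2"
    "\<And>e. 0 < e \<Longrightarrow> \<exists>d>0. \<forall>x y. \<bar>s x - s y\<bar> < d \<longrightarrow> dist x y < e"
proof -
  obtain \<B> :: "'a set set" where \<B>: "countable \<B>" "topological_basis \<B>"
    using ex_countable_basis by blast
  have ne: "\<B> \<noteq> {}" using topological_basisE[OF \<B>(2), of UNIV undefined] by auto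
  define U where "U = from_nat_into \<B>"
  have rU: "range U = \<B>" unfolding U_def using ne \<B>(1) by (rule range_from_nat_into)
  define s where "s x = (\<Sum>n. indicator (U n) x * (1/3::real)^n)" for x
  have g: "summable (\<lambda>i. (1/3::real)^i)" by (rule summable_geometric) simp
  have sm: "summable (\<lambda>n. indicator (U n) x * (1/3::real)^n)" for x
    by (rule summable_comparison_test'[OF g, of 0]) (auto simp: indicator_def)
  have oU: "open (U n)" for n using rU \<B>(2) topological_basis_open by blast
  show thesis
  proof (rule that[of s])
    have [measurable]: "U n \<in> sets borel" for n using oU by simp
    show "s \<in> borel_measurable borel" unfolding s_def[abs_def] by measurable
    show "0 \<le> s x" for x unfolding s_def by (rule suminf_nonneg[OF sm]) simp
    have "s x \<le> (\<Sum>n. (1/3::real)^n)" for x unfolding s_def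
      by (rule suminf_le[OF _ sm g]) (simp add: indicator_def)
    then show "s x \<le> 2" for x by (rule order_trans) (simp add: suminf_geometric)
    fix e :: real assume e: "0 < e"
    \<comment> \<open>Base sets of diameter at most \<open>e\<close> cover the space, finitely many
      of them by compactness. Codes so close that the digits up to the largest index
      \<open>N\<close> agree put \<open>x\<close> and \<open>y\<close> into a common one.\<close>
    define I where "I = {i. \<forall>x\<in>U i. \<forall>y\<in>U i. dist x y < e}"
    have cov: "UNIV \<subseteq> (\<Union>i\<in>I. U i)"
    proof
      fix x :: 'a
      obtain B where B: "B \<in> \<B>" "x \<in> B" "B \<subseteq> ball x (e/2)"
        using topological_basisE[OF \<B>(2), of "ball x (e/2)" x] e by auto
      then obtain i where i: "B = U i" using rU by auto
      have "dist y z < e" if "y \<in> B" "z \<in> B" for y z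
        using B(3) that dist_triangle_half_r[of x y e z] by (auto simp: subset_iff)
      then show "x \<in> (\<Union>i\<in>I. U i)" using B i by (auto simp: I_def)
    qed
    obtain F where F: "F \<subseteq> I" "finite F" "UNIV \<subseteq> (\<Union>i\<in>F. U i)"
      using compactE_image[OF comp _ cov] oU by metis
    obtain N where N: "\<And>i. i \<in> F \<Longrightarrow> i \<le> N" using F(2) by (meson finite_nat_set_iff_bounded_le)
    show "\<exists>d>0. \<forall>x y. \<bar>s x - s y\<bar> < d \<longrightarrow> dist x y < e"
    proof (intro exI[of _ "(1/3)^N / 2"] conjI allI impI)
      fix x y assume d: "\<bar>s x - s y\<bar> < (1/3)^N / 2"
      obtain i where i: "i \<in> F" "x \<in> U i" using F(3) by auto
      have "s x - s y = (\<Sum>n. (indicator (U n) x - indicator (U n) y) * (1/3)^n)"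
        unfolding s_def by (subst suminf_diff[OF sm sm]) (simp add: left_diff_distrib)
      then have "indicator (U i) x - indicator (U i) y = (0::real)"
        using d N[OF i(1)] by (intro ternary_series_close[where N=N and a="\<lambda>n. indicator (U n) x - indicator (U n) y"]) (auto simp: indicator_def)
      then have "y \<in> U i" using i(2) by (simp add: indicator_def split: if_splits)
      then show "dist x y < e" using i F(1) by (auto simp: I_def)
    qed simp
  qed
qed

text \<open>Helly selection on the line: the coded measures live on \<open>[0,2]\<close>, hence are
  tight, and a weak limit is decoded. The limit may charge limit points of codes that code nothing,
  so the decoder is first extended to the closure \<open>K\<close> of the range.\<close>

lemma sequentially_compact_prob_measures:
  fixes \<nu> :: "nat \<Rightarrow> 'a::polish_space measure"
  assumes comp: "compact (UNIV :: 'a set)" and \<nu>: "\<And>n. \<nu> n \<in> prob_measures"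
  shows "\<exists>\<mu> (\<sigma> :: nat \<Rightarrow> nat). strict_mono \<sigma> \<and> \<mu> \<in> prob_measures \<and>
    (\<forall>f :: 'a \<Rightarrow> real. continuous_on UNIV f \<longrightarrow> (\<lambda>n. \<integral>x. f x \<partial>\<nu> (\<sigma> n)) \<longlonglongrightarrow> (\<integral>x. f x \<partial>\<mu>))"
proof -
  obtain s :: "'a \<Rightarrow> real" where s[measurable]: "s \<in> borel_measurable borel" and s02: "\<And>x. 0 \<le> s x" "\<And>x. s x \<le> 2"
    and ui: "\<And>e. 0 < e \<Longrightarrow> \<exists>d>0. \<forall>x y. \<bar>s x - s y\<bar> < d \<longrightarrow> dist x y < e"
    using real_coding[OF comp] by metis
  have inj: "inj s"
  proof (rule injI, rule ccontr)
    fix x y assume "s x = s y" "x \<noteq> y"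
    then obtain d where "d > 0" "\<forall>x' y'. \<bar>s x' - s y'\<bar> < d \<longrightarrow> dist x' y' < dist x y" using ui[of "dist x y"] by auto
    then show False using \<open>s x = s y\<close> by (metis abs_zero diff_self less_irrefl)
  qed
  define X where "X = range s"
  have "uniformly_continuous_on X (inv s)"
    unfolding uniformly_continuous_on_def X_def using ui by (auto simp: inv_f_f[OF inj] dist_real_def) blast
  then obtain g where g: "uniformly_continuous_on (closure X) g" "\<And>x. x \<in> X \<Longrightarrow> inv s x = g x"
    by (rule uniformly_continuous_on_extension_on_closure) (rule that; assumption)
  have gs: "g (s x) = x" for x using g(2)[of "s x"] inv_f_f[OF inj] by (simp add: X_def)
  define K where "K = closure X"
  have K: "closed K" "K \<noteq> {}" "s x \<in> K" for x using closure_subset[of X] by (auto simp: K_def X_def)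
  define h where "h k = (if k \<in> K then g k else undefined)" for k
  have gK: "continuous_on K g" using g(1) by (simp add: K_def uniformly_continuous_imp_continuous)
  have h[measurable]: "h \<in> borel_measurable borel"
    unfolding h_def[abs_def] using K gK by (intro borel_measurable_continuous_on_if) auto
  define \<eta> where "\<eta> n = distr (\<nu> n) borel s" for n
  have s\<nu>: "s \<in> borel_measurable (\<nu> n)" for n using s \<nu>[of n] by (simp add: prob_measures_iff cong: measurable_cong_sets)
  have rd: "real_distribution (\<eta> n)" for n
  proof -
    interpret prob_space "\<nu> n" using \<nu>[of n] by (simp add: prob_measures_iff)
    show ?thesis unfolding \<eta>_def by (rule real_distribution_distr[OF s\<nu>])
  qed
  have "tight \<eta>"
    unfolding tight_def
  proof (intro conjI allI impI rd)
    fix \<epsilon> :: real assume "0 < \<epsilon>"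
    show "\<exists>a b. a < b \<and> (\<forall>n. 1 - \<epsilon> < measure (\<eta> n) {a<..b})"
    proof (rule exI[of _ "-1"], rule exI[of _ 2], intro conjI allI)
      fix n
      interpret prob_space "\<nu> n" using \<nu>[of n] by (simp add: prob_measures_iff)
      have "measure (\<eta> n) {-1<..2} = prob (s -` {-1<..2} \<inter> space (\<nu> n))"
        unfolding \<eta>_def by (rule measure_distr[OF s\<nu>]) simp
      also have "s -` {-1<..2} \<inter> space (\<nu> n) = space (\<nu> n)"
      proof -
        have "- 1 < s x" for x using s02(1)[of x] by linarith
        then show ?thesis using s02(2) by auto
      qed
      finally show "1 - \<epsilon> < measure (\<eta> n) {-1<..2}" using \<open>0 < \<epsilon>\<close> by (simp add: prob_space)
    qed simp
  qed
  from tight_imp_convergent_subsubsequence[OF this strict_mono_id] obtain \<sigma> M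
    where \<sigma>: "strict_mono (\<sigma> :: nat \<Rightarrow> nat)" and M: "real_distribution M" and "weak_conv_m (\<eta> \<circ> id \<circ> \<sigma>) M"
    by (auto simp: id_def)
  then have wc: "weak_conv_m (\<lambda>n. \<eta> (\<sigma> n)) M" by (simp add: comp_def)
  interpret M: real_distribution M by fact
  have lim: "(\<lambda>n. \<integral>x. F x \<partial>\<eta> (\<sigma> n)) \<longlonglongrightarrow> (\<integral>x. F x \<partial>M)" if "continuous_on UNIV F" "\<And>x. \<bar>F x\<bar> \<le> B" for F :: "real \<Rightarrow> real" and B
    using that
    by (intro weak_conv_imp_integral_bdd_continuous_conv[OF rd M wc, of F B])
      (auto simp: continuous_on_eq_continuous_at)
  have int\<eta>: "(\<integral>x. F x \<partial>\<eta> n) = (\<integral>x. F (s x) \<partial>\<nu> n)" if "F \<in> borel_measurable borel" for F :: "real \<Rightarrow> real" and n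
    unfolding \<eta>_def by (rule integral_distr[OF s\<nu> that])
  \<comment> \<open>The truncated distance to \<open>K\<close> is a bounded continuous test function
    with integral 0 before the limit, hence also in the limit.\<close>
  have AEK: "AE k in M. k \<in> K"
  proof -
    let ?F = "\<lambda>k. min 1 (infdist k K)"
    have cF: "continuous_on UNIV ?F" by (intro continuous_intros)
    then have [measurable]: "?F \<in> borel_measurable borel" by (rule borel_measurable_continuous_onI)
    have "(\<integral>x. ?F x \<partial>\<eta> n) = 0" for n
      using K by (subst int\<eta>) (auto simp: infdist_zero)
    moreover have "(\<lambda>n. \<integral>x. ?F x \<partial>\<eta> (\<sigma> n)) \<longlonglongrightarrow> (\<integral>x. ?F x \<partial>M)"
      by (rule lim[of _ 1, OF cF]) (auto simp: infdist_nonneg abs_le_iff min_def)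
    ultimately have "(\<integral>x. ?F x \<partial>M) = 0"
      by (simp add: LIMSEQ_const_iff)
    moreover have "integrable M ?F"
      by (rule M.integrable_const_bound[of _ 1]) (auto simp: infdist_nonneg)
    ultimately have "AE k in M. ?F k = 0"
      by (subst (asm) integral_nonneg_eq_0_iff_AE) (auto simp: infdist_nonneg)
    then show ?thesis
      by eventually_elim (use in_closed_iff_infdist_zero[OF K(1,2)] in \<open>auto simp: min_def split: if_splits\<close>)
  qed
  let ?\<mu> = "distr M borel h"
  have hM: "h \<in> borel_measurable M" by simp
  show ?thesis
  proof (intro exI conjI allI impI)
    show "strict_mono \<sigma>" by (rule \<sigma>)
    show "?\<mu> \<in> prob_measures"
      by (simp add: prob_measures_iff M.prob_space_distr)
    fix f :: "'a \<Rightarrow> real" assume f: "continuous_on UNIV f"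
    obtain B where B: "0 < B" "\<And>x. \<bar>f x\<bar> \<le> B" using bounded_continuous_compact[OF comp f] by blast
    \<comment> \<open>Weak convergence on the line asks for a test function on the whole line:
      Tietze extends \<open>f \<circ> g\<close> from \<open>K\<close>, and on codes the extension
      returns \<open>f\<close>.\<close>
    have "continuous_on K (f \<circ> g)" using gK f by (intro continuous_on_compose) (auto intro: continuous_on_subset)
    then obtain F where F: "continuous_on UNIV F" "\<And>x. x \<in> K \<Longrightarrow> F x = (f \<circ> g) x" "\<And>x. x \<in> UNIV \<Longrightarrow> norm (F x) \<le> B"
      by (rule Tietze[of K "f \<circ> g" UNIV B]) (use K B in auto)
    have [measurable]: "F \<in> borel_measurable borel" "f \<in> borel_measurable borel"
      using F(1) f by (auto intro: borel_measurable_continuous_onI)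
    have "(\<integral>x. F x \<partial>\<eta> n) = (\<integral>x. f x \<partial>\<nu> n)" for n
      using F(2) K gs by (simp add: int\<eta>)
    moreover have "(\<integral>x. F x \<partial>M) = (\<integral>x. f x \<partial>?\<mu>)"
    proof -
      have "(\<integral>x. F x \<partial>M) = (\<integral>x. f (h x) \<partial>M)"
      proof (rule integral_cong_AE)
        show "AE x in M. F x = f (h x)" using AEK by eventually_elim (simp add: F(2) h_def)
      qed measurable
      also have "\<dots> = (\<integral>x. f x \<partial>?\<mu>)" by (rule integral_distr[OF hM, symmetric]) simp
      finally show ?thesis .
    qed
    ultimately show "(\<lambda>n. \<integral>x. f x \<partial>\<nu> (\<sigma> n)) \<longlonglongrightarrow> (\<integral>x. f x \<partial>?\<mu>)"
      using lim[of F B] F by simp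
  qed
qed

section \<open>The rate function\<close>

lemma nn_integral_mixture:
  assumes s: "sets \<nu> = sets \<mu>" and f: "f \<in> borel_measurable \<mu>"
  shows "(\<integral>\<^sup>+x. f x \<partial>mixture t \<mu> \<nu>) = ennreal t * (\<integral>\<^sup>+x. f x \<partial>\<mu>) + ennreal (1 - t) * (\<integral>\<^sup>+x. f x \<partial>\<nu>)"
  using f
proof (induction rule: borel_measurable_induct)
  have sm: "sets (mixture t \<mu> \<nu>) = sets \<mu>" by (simp add: mixture_def)
  note [measurable_cong] = sm s
  {
    case (cong f g)
    have "(\<integral>\<^sup>+x. f x \<partial>M) = (\<integral>\<^sup>+x. g x \<partial>M)" if "sets M = sets \<mu>" for M
      using cong(3) sets_eq_imp_space_eq[OF that] by (intro nn_integral_cong) simp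
    then show ?case using cong(4) sm s by simp
  next
    case (set A)
    then show ?case using sm s by (simp add: emeasure_mixture)
  next
    case (mult u c)
    then show ?case by (simp add: nn_integral_cmult distrib_left mult.left_commute)
  next
    case (add u v)
    then show ?case by (simp add: nn_integral_add distrib_left add_ac)
  next
    case (seq U)
    have "(\<integral>\<^sup>+x. (SUP i. U i) x \<partial>M) = (SUP i. \<integral>\<^sup>+x. U i x \<partial>M)" if "sets M = sets \<mu>" for M
    proof -
      have "U i \<in> borel_measurable M" for i using seq(1)[of i] that by (simp cong: measurable_cong_sets)
      then have "(\<integral>\<^sup>+x. (SUP i. U i x) \<partial>M) = (SUP i. \<integral>\<^sup>+x. U i x \<partial>M)"
        by (intro nn_integral_monotone_convergence_SUP) (use seq in auto)
      then show ?thesis by (simp add: Sup_apply image_image)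
    qed
    note this[OF sm] this[OF refl] this[OF s]
    moreover have "incseq (\<lambda>i. ennreal t * (\<integral>\<^sup>+x. U i x \<partial>\<mu>))" "incseq (\<lambda>i. ennreal (1 - t) * (\<integral>\<^sup>+x. U i x \<partial>\<nu>))"
      using seq(3) by (auto simp: incseq_def le_fun_def intro!: mult_left_mono nn_integral_mono)
    ultimately show ?case
      using seq.IH by (simp add: SUP_mult_left_ennreal ennreal_SUP_add)
  }
qed

lemma integral_mixture:
  fixes f :: "'a::topological_space \<Rightarrow> real"
  assumes m: "\<mu> \<in> prob_measures" "\<nu> \<in> prob_measures" "0 \<le> t" "t \<le> 1"
    and f: "f \<in> borel_measurable borel" "\<And>x. \<bar>f x\<bar> \<le> B"
  shows "(\<integral>x. f x \<partial>mixture t \<mu> \<nu>) = t * (\<integral>x. f x \<partial>\<mu>) + (1 - t) * (\<integral>x. f x \<partial>\<nu>)"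
proof -
  \<comment> \<open>The shift by \<open>B\<close> makes the integrand nonnegative, so the formula
    for nonnegative integrals applies; all measures involved have mass 1, so the shift
    cancels.\<close>
  let ?g = "\<lambda>x. f x + B"
  have g: "0 \<le> ?g x" for x using f(2)[of x] by linarith
  have gm: "?g \<in> borel_measurable M" if "M \<in> prob_measures" for M
    using f(1) that by (simp add: prob_measures_iff cong: measurable_cong_sets)
  have mx: "mixture t \<mu> \<nu> \<in> prob_measures" using m by (rule mixture_in_prob_measures)
  have eq: "(\<integral>\<^sup>+x. ennreal (?g x) \<partial>M) = ennreal ((\<integral>x. f x \<partial>M) + B)" and ge: "0 \<le> (\<integral>x. f x \<partial>M) + B"
    if M: "M \<in> prob_measures" for M
  proof -
    interpret prob_space M using M by (simp add: prob_measures_iff)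
    have i: "integrable M f" using prob_measure_integrable[OF M f] .
    have "(\<integral>\<^sup>+x. ennreal (?g x) \<partial>M) = ennreal (\<integral>x. ?g x \<partial>M)"
      using i g by (intro nn_integral_eq_integral) auto
    then show "(\<integral>\<^sup>+x. ennreal (?g x) \<partial>M) = ennreal ((\<integral>x. f x \<partial>M) + B)" using i by (simp add: prob_space)
    have "0 \<le> (\<integral>x. ?g x \<partial>M)" by (rule Bochner_Integration.integral_nonneg) (rule g)
    then show "0 \<le> (\<integral>x. f x \<partial>M) + B" using i by (simp add: prob_space)
  qed
  have "(\<integral>\<^sup>+x. ennreal (?g x) \<partial>mixture t \<mu> \<nu>) =
      ennreal t * (\<integral>\<^sup>+x. ennreal (?g x) \<partial>\<mu>) + ennreal (1 - t) * (\<integral>\<^sup>+x. ennreal (?g x) \<partial>\<nu>)"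
    using m gm[OF m(1)] by (intro nn_integral_mixture) (auto simp: prob_measures_iff)
  then have "ennreal ((\<integral>x. f x \<partial>mixture t \<mu> \<nu>) + B) =
      ennreal (t * ((\<integral>x. f x \<partial>\<mu>) + B) + (1 - t) * ((\<integral>x. f x \<partial>\<nu>) + B))"
  proof -
    have "ennreal t * ennreal a + ennreal (1 - t) * ennreal b = ennreal (t * a + (1 - t) * b)"
      if "0 \<le> a" "0 \<le> b" for a b
      using m that by (simp add: ennreal_mult)
    moreover assume "(\<integral>\<^sup>+x. ennreal (?g x) \<partial>mixture t \<mu> \<nu>) =
      ennreal t * (\<integral>\<^sup>+x. ennreal (?g x) \<partial>\<mu>) + ennreal (1 - t) * (\<integral>\<^sup>+x. ennreal (?g x) \<partial>\<nu>)"
    ultimately show ?thesis using ge[OF m(1)] ge[OF m(2)] by (simp only: eq mx m)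
  qed
  then have "(\<integral>x. f x \<partial>mixture t \<mu> \<nu>) + B = t * ((\<integral>x. f x \<partial>\<mu>) + B) + (1 - t) * ((\<integral>x. f x \<partial>\<nu>) + B)"
    using ge[OF mx] ge[OF m(1)] ge[OF m(2)] m by (subst (asm) ennreal_inj) auto
  then show ?thesis by (simp add: algebra_simps)
qed

section \<open>The jump operator, its potentials and the rate functional\<close>

text \<open>The setting of the theorem. The integrability of \<open>1 / r\<close> enters as
  \<open>r_AE_pos\<close>: the zero set of \<open>r\<close> is null for \<open>lam\<close>.\<close>

locale density_chain = jump_chain r p for r :: "'a::polish_space \<Rightarrow> real" and p +
  fixes lam :: "'a measure" and q :: "'a \<Rightarrow> 'a \<Rightarrow> real"
  assumes compact_space: "compact (UNIV :: 'a set)"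
    and r_continuous: "continuous_on UNIV r"
    and prob_lam: "prob_space lam" and sets_lam[measurable_cong, simp]: "sets lam = sets borel"
    and lam_open: "\<And>U. open U \<Longrightarrow> U \<noteq> {} \<Longrightarrow> 0 < emeasure lam U"
    and q_continuous: "continuous_on UNIV (\<lambda>(x, y). q x y)"
    and q_pos: "\<And>x y. 0 < q x y"
    and p_density: "\<And>x. p x = density lam (\<lambda>y. ennreal (q x y))"
    and r_AE_pos: "AE x in lam. 0 < r x"
begin

sublocale lam: prob_space lam by (rule prob_lam)

lemma space_lam [simp]: "space lam = UNIV"
  using sets_eq_imp_space_eq[OF sets_lam] by simp

lemma measure_lam_UNIV [simp]: "measure lam UNIV = 1"
  using lam.prob_space by simp

lemma measurable_q[measurable]: "(\<lambda>x. q (f x) (g x)) \<in> borel_measurable M"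
  if [measurable]: "f \<in> borel_measurable M" "g \<in> borel_measurable M"
proof -
  have "(\<lambda>(x, y). q x y) \<in> borel_measurable (borel \<Otimes>\<^sub>M borel)"
    using borel_measurable_continuous_onI[OF q_continuous] by (simp add: borel_prod)
  then have "(\<lambda>x. (\<lambda>(x, y). q x y) (f x, g x)) \<in> borel_measurable M"
    by (rule measurable_compose[rotated]) measurable
  then show ?thesis by simp
qed

definition R where "R = (SOME B. 0 < B \<and> (\<forall>x. r x \<le> B))"
definition qmax where "qmax = (SOME B. 0 < B \<and> (\<forall>x y. q x y \<le> B))"
definition qmin where "qmin = (SOME b. 0 < b \<and> (\<forall>x y. b \<le> q x y))"

lemma R: "0 < R" "r x \<le> R"
proof -
  obtain B where "0 < B" "\<And>x. \<bar>r x\<bar> \<le> B" using bounded_continuous_compact[OF compact_space r_continuous] by blast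
  then have "\<exists>B. 0 < B \<and> (\<forall>x. r x \<le> B)" by (intro exI[of _ B]) (auto simp: abs_le_iff)
  from someI_ex[OF this] show "0 < R" "r x \<le> R" by (auto simp: R_def)
qed

lemma compact_square: "compact (UNIV :: ('a \<times> 'a) set)"
  using compact_Times[OF compact_space compact_space] by simp

lemma qmax: "0 < qmax" "q x y \<le> qmax"
proof -
  obtain B where "0 < B" "\<And>x. \<bar>case_prod q x\<bar> \<le> B" using bounded_continuous_compact[OF compact_square q_continuous] by blast
  then have "\<exists>B. 0 < B \<and> (\<forall>x y. q x y \<le> B)" by (intro exI[of _ B]) (auto simp: abs_le_iff split: prod.splits)
  from someI_ex[OF this] show "0 < qmax" "q x y \<le> qmax" by (auto simp: qmax_def)
qed

lemma qmin: "0 < qmin" "qmin \<le> q x y"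
proof -
  have "\<exists>z\<in>UNIV. \<forall>w\<in>UNIV. case_prod q z \<le> case_prod q w"
    by (rule continuous_attains_inf[OF compact_square _ q_continuous]) simp
  then obtain z where z: "\<And>w. case_prod q z \<le> case_prod q w" by blast
  have "\<exists>b. 0 < b \<and> (\<forall>x y. b \<le> q x y)"
    using z[of "(_, _)"] q_pos by (intro exI[of _ "case_prod q z"]) (auto split: prod.splits)
  from someI_ex[OF this] show "0 < qmin" "qmin \<le> q x y" by (auto simp: qmin_def)
qed

lemma q_uniform:
  assumes "0 < e" shows "\<exists>d>0. \<forall>x y x' y'. dist x x' < d \<longrightarrow> dist y y' < d \<longrightarrow> \<bar>q x y - q x' y'\<bar> < e"
proof -
  have "uniformly_continuous_on UNIV (case_prod q)"
    by (rule compact_uniformly_continuous[OF q_continuous compact_square])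
  then obtain d where d: "d > 0" "\<And>z w. dist w z < d \<Longrightarrow> dist (case_prod q w) (case_prod q z) < e"
    unfolding uniformly_continuous_on_def using assms by (metis UNIV_I)
  show ?thesis
  proof (intro exI[of _ "d/2"] conjI allI impI)
    fix x y x' y' :: 'a assume "dist x x' < d/2" "dist y y' < d/2"
    then have "dist (x, y) (x', y') < d"
      using sqrt_sum_squares_le_sum_abs[of "dist x x'" "dist y y'"] by (simp add: dist_Pair_Pair)
    from d(2)[OF this] show "\<bar>q x y - q x' y'\<bar> < e" by (simp add: dist_real_def)
  qed (use d in simp)
qed

definition jump_mean :: "('a \<Rightarrow> real) \<Rightarrow> 'a \<Rightarrow> real" where
  "jump_mean u x = (\<integral>y. q x y * u y \<partial>lam)"

lemma integrable_q_mult: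
  assumes [measurable]: "u \<in> borel_measurable borel" and "\<And>y. \<bar>u y\<bar> \<le> B"
  shows "integrable lam (\<lambda>y. q x y * u y)"
proof (rule lam.integrable_const_bound[of _ "qmax * B"])
  have "\<bar>q x y\<bar> * \<bar>u y\<bar> \<le> qmax * B" for y
    using qmax assms(2)[of y] q_pos[of x y] by (intro mult_mono) auto
  then show "AE y in lam. norm (q x y * u y) \<le> qmax * B" by (simp add: abs_mult)
qed measurable

lemma p_mean: "(\<integral>y. u y \<partial>p x) = jump_mean u x"
  if [measurable]: "u \<in> borel_measurable borel" for u :: "'a \<Rightarrow> real"
  unfolding p_density jump_mean_def using q_pos[of x]
  by (subst integral_density) (auto intro: less_imp_le simp: mult.commute)

lemma prob_space_p: "prob_space (p x)"
  using measurable_space[OF p_measurable, of x] by (simp add: space_prob_algebra)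

lemma nn_p_mean:
  assumes u[measurable]: "u \<in> borel_measurable borel" and "\<And>y. 0 \<le> u y" "\<And>y. u y \<le> B"
  shows "(\<integral>\<^sup>+y. ennreal (u y) \<partial>p x) = ennreal (jump_mean u x)"
proof -
  interpret prob_space "p x" by (rule prob_space_p)
  have "integrable (p x) u"
    by (rule integrable_const_bound[of _ B]) (use assms in \<open>auto simp: p_density\<close>)
  then show ?thesis using assms by (subst nn_integral_eq_integral) (auto simp: p_mean)
qed

lemma jump_mean_1: "jump_mean (\<lambda>_. 1) x = 1"
  using p_mean[of "\<lambda>_. 1" x] prob_space.prob_space[OF prob_space_p, of x] by simp

lemma jump_mean_mono:
  assumes "u \<in> borel_measurable borel" "\<And>y. \<bar>u y\<bar> \<le> B" "v \<in> borel_measurable borel" "\<And>y. \<bar>v y\<bar> \<le> B'" "\<And>y. u y \<le> v y"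
  shows "jump_mean u x \<le> jump_mean v x"
  unfolding jump_mean_def using assms q_pos[of x]
  by (intro integral_mono integrable_q_mult[OF assms(1,2)] integrable_q_mult[OF assms(3,4)] mult_left_mono)
    (auto intro: less_imp_le)

lemma jump_mean_const: "jump_mean (\<lambda>_. c) x = c"
  using jump_mean_1[of x] by (simp add: jump_mean_def)

text \<open>The strong Feller property: all dependence on \<open>x\<close> sits in \<open>q\<close>,
  which is uniformly continuous, so \<open>u\<close> may be any bounded measurable function. The
  label functions of the lower bound are of this kind.\<close>

lemma continuous_jump_mean:
  assumes [measurable]: "u \<in> borel_measurable borel" and B: "\<And>y. \<bar>u y\<bar> \<le> B"
  shows "continuous_on UNIV (jump_mean u)"
  unfolding continuous_on_iff
proof (intro ballI allI impI)
  fix x and e :: real assume e: "0 < e"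
  have B0: "0 \<le> B" using B[of undefined] by linarith
  obtain d where d: "d > 0" "\<And>x y x' y'. dist x x' < d \<Longrightarrow> dist y y' < d \<Longrightarrow> \<bar>q x y - q x' y'\<bar> < e / (B + 1)"
    using q_uniform[of "e / (B + 1)"] e B0 by auto
  have "dist (jump_mean u x') (jump_mean u x) < e" if x': "dist x' x < d" for x'
  proof -
    have i: "integrable lam (\<lambda>y. q z y * u y)" for z by (rule integrable_q_mult) (use assms in auto)
    have "\<bar>jump_mean u x' - jump_mean u x\<bar> = \<bar>\<integral>y. (q x' y - q x y) * u y \<partial>lam\<bar>"
      unfolding jump_mean_def using i by (simp add: left_diff_distrib)
    also have "\<dots> \<le> (\<integral>y. \<bar>(q x' y - q x y) * u y\<bar> \<partial>lam)" by (rule integral_abs_bound)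
    also have "\<dots> \<le> (\<integral>y. e / (B + 1) * B \<partial>lam)"
    proof (rule integral_mono)
      show "integrable lam (\<lambda>y. \<bar>(q x' y - q x y) * u y\<bar>)"
        using Bochner_Integration.integrable_diff[OF i[of x'] i[of x]] by (intro integrable_abs) (simp add: left_diff_distrib)
      show "\<bar>(q x' y - q x y) * u y\<bar> \<le> e / (B + 1) * B" for y
        using d(2)[OF x', of y y] d(1) B[of y] by (simp only: abs_mult) (intro mult_mono, auto intro: order_trans[OF abs_ge_zero])
    qed simp
    also have "\<dots> < e" using e B0 by (simp add: lam.prob_space field_simps)
    finally show ?thesis by (simp add: dist_real_def)
  qed
  with d(1) show "\<exists>d>0. \<forall>x'\<in>UNIV. dist x' x < d \<longrightarrow> dist (jump_mean u x') (jump_mean u x) < e" by blast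
qed

text \<open>The potential \<open>e\<^sup>-\<^sup>\<phi> L e\<^sup>\<phi>\<close> of the exponential martingale, where \<open>L\<close> is the generator.\<close>

definition potential :: "('a \<Rightarrow> real) \<Rightarrow> 'a \<Rightarrow> real" where
  "potential \<phi> x = r x * (jump_mean (\<lambda>y. exp (\<phi> y)) x / exp (\<phi> x) - 1)"

lemma exp_bounded:
  assumes "continuous_on UNIV (\<phi> :: 'a \<Rightarrow> real)"
  shows "(\<lambda>y. exp (\<phi> y)) \<in> borel_measurable borel" "\<exists>B. \<forall>y. \<bar>exp (\<phi> y)\<bar> \<le> B"
proof -
  have c: "continuous_on UNIV (\<lambda>y. exp (\<phi> y))" using assms by (intro continuous_intros)
  show "(\<lambda>y. exp (\<phi> y)) \<in> borel_measurable borel" using c by (rule borel_measurable_continuous_onI)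
  obtain B where "\<And>x. \<bar>exp (\<phi> x)\<bar> \<le> B" using bounded_continuous_compact[OF compact_space c] by blast
  then show "\<exists>B. \<forall>y. \<bar>exp (\<phi> y)\<bar> \<le> B" by blast
qed

lemma continuous_potential:
  assumes "continuous_on UNIV \<phi>" shows "continuous_on UNIV (potential \<phi>)"
proof -
  obtain B where B: "\<And>y. \<bar>exp (\<phi> y)\<bar> \<le> B" using exp_bounded(2)[OF assms] by blast
  show ?thesis unfolding potential_def[abs_def]
    by (intro continuous_intros r_continuous continuous_jump_mean[OF exp_bounded(1)[OF assms] B] assms exp_not_eq_zero ballI)
qed

lemma rates_integral:
  assumes \<phi>: "continuous_on UNIV \<phi>"
  shows "(\<integral>y. exp (\<phi> y - \<phi> x) - 1 \<partial>jump_rates r p x) = potential \<phi> x"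
proof -
  note [measurable] = exp_bounded(1)[OF \<phi>] borel_measurable_continuous_onI[OF \<phi>]
  obtain B where B: "\<And>y. \<bar>exp (\<phi> y)\<bar> \<le> B" using exp_bounded(2)[OF \<phi>] by blast
  interpret P: prob_space "p x" by (rule prob_space_p)
  have sp: "sets (p x) = sets borel" by (simp add: p_density)
  have "scale_measure (ennreal (r x)) (p x) = density (p x) (\<lambda>_. ennreal (r x))"
    by (rule measure_eqI) (auto simp: emeasure_density_const)
  then have "(\<integral>y. exp (\<phi> y - \<phi> x) - 1 \<partial>jump_rates r p x) = r x * (\<integral>y. exp (\<phi> y - \<phi> x) - 1 \<partial>p x)"
    unfolding jump_rates_def using r_nonneg[of x]
    by (simp, subst integral_density) (auto simp: sp cong: measurable_cong_sets)
  also have "(\<integral>y. exp (\<phi> y - \<phi> x) - 1 \<partial>p x) = jump_mean (\<lambda>y. exp (\<phi> y)) x / exp (\<phi> x) - 1"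
  proof -
    have "integrable (p x) (\<lambda>y. exp (\<phi> y))"
      by (rule P.integrable_const_bound[of _ B]) (use B in \<open>auto simp: sp cong: measurable_cong_sets\<close>)
    then show ?thesis by (simp add: exp_diff p_mean P.prob_space)
  qed
  finally show ?thesis by (simp add: potential_def)
qed

abbreviation "rate \<equiv> rate_functional (jump_rates r p)"

text \<open>Each potential is bounded and continuous, so the rate is a supremum of weakly continuous
  functionals that are affine under mixtures; convexity and lower semicontinuity are read off from
  this form.\<close>

lemma rate_eq: "rate \<mu> = (SUP \<phi>\<in>{\<phi>. continuous_on UNIV \<phi>}. ereal (- (\<integral>x. potential \<phi> x \<partial>\<mu>)))"
  unfolding rate_functional_def by (intro SUP_cong refl) (simp add: rates_integral)

lemma rate_ge: "continuous_on UNIV \<phi> \<Longrightarrow> ereal (- (\<integral>x. potential \<phi> x \<partial>\<mu>)) \<le> rate \<mu>"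
  unfolding rate_eq by (rule SUP_upper) simp

lemma potential_bounded:
  assumes "continuous_on UNIV \<phi>"
  obtains B where "\<And>x. \<bar>potential \<phi> x\<bar> \<le> B"
  using bounded_continuous_compact[OF compact_space continuous_potential[OF assms]] by metis

lemma convex_rate: "convex_functional rate"
  unfolding convex_functional_def
proof (intro ballI)
  fix \<mu> \<nu> :: "'a measure" and t :: real assume m: "\<mu> \<in> prob_measures" "\<nu> \<in> prob_measures" and t: "t \<in> {0..1}"
  show "rate (mixture t \<mu> \<nu>) \<le> ereal t * rate \<mu> + ereal (1 - t) * rate \<nu>"
    unfolding rate_eq[of "mixture t \<mu> \<nu>"]
  proof (rule SUP_least)
    fix \<phi> :: "'a \<Rightarrow> real" assume "\<phi> \<in> {\<phi>. continuous_on UNIV \<phi>}"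
    then have \<phi>: "continuous_on UNIV \<phi>" by simp
    obtain B where B: "\<And>x. \<bar>potential \<phi> x\<bar> \<le> B" using potential_bounded[OF \<phi>] by blast
    have "ereal (- (\<integral>x. potential \<phi> x \<partial>mixture t \<mu> \<nu>)) =
        ereal t * ereal (- (\<integral>x. potential \<phi> x \<partial>\<mu>)) + ereal (1 - t) * ereal (- (\<integral>x. potential \<phi> x \<partial>\<nu>))"
      using integral_mixture[OF m _ _ borel_measurable_continuous_onI[OF continuous_potential[OF \<phi>]] B, of t] t
      by (simp add: algebra_simps)
    also have "\<dots> \<le> ereal t * rate \<mu> + ereal (1 - t) * rate \<nu>"
      using t by (intro add_mono ereal_mult_left_mono rate_ge \<phi>) auto
    finally show "ereal (- (\<integral>x. potential \<phi> x \<partial>mixture t \<mu> \<nu>)) \<le> ereal t * rate \<mu> + ereal (1 - t) * rate \<nu>" .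
  qed
qed

lemma lower_semicontinuous_rate: "lower_semicontinuous_map weak_topology rate"
  unfolding lower_semicontinuous_map_def closedin_def
proof (intro allI conjI)
  fix a
  let ?U = "{v :: real. a < ereal (- v)}"
  let ?N = "\<lambda>\<phi>. {\<mu> \<in> prob_measures. (\<integral>x. potential \<phi> x \<partial>\<mu>) \<in> ?U}"
  have "open ?U"
  proof -
    have "?U = (\<lambda>v. ereal (- v)) -` {a<..}" by auto
    moreover have "open ((\<lambda>v. ereal (- v)) -` {a<..})" by (intro open_vimage continuous_intros open_greaterThan)
    ultimately show ?thesis by simp
  qed
  then have N: "openin weak_topology (?N \<phi>)" if \<phi>: "continuous_on UNIV \<phi>" for \<phi>
  proof -
    obtain B where "\<And>x. \<bar>potential \<phi> x\<bar> \<le> B" using potential_bounded[OF \<phi>] by blast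
    then have "bounded (range (potential \<phi>))" by (intro boundedI[of _ B]) auto
    then show ?thesis
      unfolding weak_topology_def using continuous_potential[OF \<phi>] \<open>open ?U\<close>
      by (intro topology_generated_by_Basis CollectI, rule_tac x = "potential \<phi>" in exI, rule_tac x = ?U in exI) simp
  qed
  have "openin weak_topology (\<Union>(?N ` {\<phi>. continuous_on UNIV \<phi>}))"
    by (rule openin_Union) (use N in auto)
  moreover have "\<Union>(?N ` {\<phi>. continuous_on UNIV \<phi>}) = topspace weak_topology - {\<mu> \<in> topspace weak_topology. rate \<mu> \<le> a}"
    by (auto simp: rate_eq SUP_le_iff not_le)
  ultimately show "openin weak_topology (topspace weak_topology - {\<mu> \<in> topspace weak_topology. rate \<mu> \<le> a})" by simp
qed auto

end

section \<open>The upper bound\<close>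

text \<open>The memoryless property: shifting time by \<open>s\<close> multiplies the density by
  \<open>exp (- b * s)\<close>.\<close>

lemma nn_integral_exponential_tail:
  assumes b: "0 < b" and s: "0 \<le> s"
  shows "(\<integral>\<^sup>+t. ennreal (exponential_density b t) * indicator {s<..} t \<partial>lborel) = ennreal (exp (- b * s))"
proof -
  have "(\<integral>\<^sup>+t. ennreal (exponential_density b t) * indicator {s<..} t \<partial>lborel) =
      (\<integral>\<^sup>+t. ennreal (exponential_density b (s + 1 * t)) * indicator {s<..} (s + 1 * t) \<partial>lborel)"
    by (subst nn_integral_real_affine[of _ 1 s]) auto
  also have "\<dots> = (\<integral>\<^sup>+t. ennreal (exp (- b * s)) * ennreal (exponential_density b t) \<partial>lborel)"
  proof (rule nn_integral_cong_AE)
    \<comment> \<open>At \<open>t = 0\<close> the density is positive but the shifted indicator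
      vanishes.\<close>
    have "AE t in lborel. t \<noteq> (0::real)" by (rule AE_lborel_singleton)
    then show "AE t in lborel. ennreal (exponential_density b (s + 1 * t)) * indicator {s<..} (s + 1 * t) =
        ennreal (exp (- b * s)) * ennreal (exponential_density b t)"
    proof eventually_elim
      case (elim t)
      show ?case
      proof (cases "t > 0")
        case True
        have "b * exp (- (s + t) * b) = exp (- b * s) * (b * exp (- t * b))"
          by (simp add: algebra_simps exp_add[symmetric] exp_diff)
        then show ?thesis using True s b by (simp add: exponential_density_def ennreal_mult[symmetric])
      qed (use elim s in \<open>auto simp: exponential_density_def indicator_def\<close>)
    qed
  qed
  also have "\<dots> = ennreal (exp (- b * s))"
    using b by (simp add: nn_integral_cmult nn_integral_exponential_density)
  finally show ?thesis .
qed

lemma nn_integral_exponential_split: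
  assumes b: "0 < b" and s: "0 \<le> s"
  shows "(\<integral>\<^sup>+t. ennreal (exponential_density b t) * indicator {..s} t \<partial>lborel) + ennreal (exp (- b * s)) = 1"
proof -
  have "(\<integral>\<^sup>+t. ennreal (exponential_density b t) * indicator {..s} t \<partial>lborel) + ennreal (exp (- b * s)) =
      (\<integral>\<^sup>+t. ennreal (exponential_density b t) * indicator {..s} t + ennreal (exponential_density b t) * indicator {s<..} t \<partial>lborel)"
    by (subst nn_integral_add) (auto simp: nn_integral_exponential_tail[OF assms])
  also have "\<dots> = (\<integral>\<^sup>+t. ennreal (exponential_density b t) \<partial>lborel)"
    by (intro nn_integral_cong) (auto simp: indicator_def)
  finally show ?thesis by (simp add: nn_integral_exponential_density[OF b])
qed

context jump_chain begin

text \<open>The relation between \<open>v\<close> and \<open>u\<close> says that \<open>u\<close> is harmonic up to the potential \<open>v\<close>: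
  one waits at rate \<open>a\<close> for a jump that has value \<open>P\<close>.\<close>

lemma nn_integral_killed_holding_time:
  assumes a: "0 \<le> a" and s: "0 \<le> s" and P: "0 < P" and u: "0 < u" "0 \<le> \<alpha>" "\<alpha> \<le> u" and v: "(a + v) * u = a * P"
  shows "(\<integral>\<^sup>+t. ennreal (exp (- v * enn2real (min t (ennreal s))) * (if t \<le> ennreal s then P else \<alpha>)) \<partial>holding_time a) \<le> ennreal u"
    (is "(\<integral>\<^sup>+t. ?f t \<partial>_) \<le> _")
proof (cases "a = 0")
  \<comment> \<open>With \<open>a = 0\<close> the relation forces \<open>v = 0\<close>: the clock
    never rings and the integral is the final value \<open>\<alpha>\<close>.\<close>
  case True
  then have "v = 0" using v u by simp
  then show ?thesis using True u by (simp add: nn_integral_holding_time_0 top_unique ennreal_leI)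
next
  case False
  then have a: "a > 0" using a by simp
  \<comment> \<open>The rate of the tilted clock: by the relation between \<open>v\<close> and
    \<open>u\<close>, the factor \<open>exp (- v * t) * P\<close> turns the density of rate
    \<open>a\<close> into \<open>u\<close> times the density of rate \<open>b\<close>. The relation
    also makes \<open>b\<close> positive, although \<open>v\<close> may be negative.\<close>
  define b where "b = a + v"
  have "b = a * P / u" using v u by (simp add: b_def field_simps)
  then have b: "b > 0" using a P u by simp
  let ?g = "\<lambda>t. ennreal u * (ennreal (exponential_density b t) * indicator {..s} t) +
      ennreal (exp (- v * s) * u) * (ennreal (exponential_density a t) * indicator {s<..} t)"
  have "(\<integral>\<^sup>+t. ?f t \<partial>holding_time a) = (\<integral>\<^sup>+t. ennreal (exponential_density a t) * ?f (ennreal t) \<partial>lborel)"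
    by (rule nn_integral_holding_time[OF a]) measurable
  also have "\<dots> \<le> (\<integral>\<^sup>+t. ?g t \<partial>lborel)"
  proof (intro nn_integral_mono)
    fix t :: real
    consider "t < 0" | "0 \<le> t" "t \<le> s" | "0 \<le> t" "s < t" by linarith
    then show "ennreal (exponential_density a t) * ?f (ennreal t) \<le> ?g t"
    proof cases
      case 1 then show ?thesis by (simp add: exponential_density_def)
    next
      case 2
      have "a * exp (- t * a) * (exp (- v * t) * P) = (a * P) * (exp (- t * a) * exp (- v * t))" by simp
      also have "\<dots> = b * u * exp (- t * b)" using v by (simp add: b_def exp_add[symmetric] algebra_simps)
      finally have "a * exp (- t * a) * (exp (- v * t) * P) = u * (b * exp (- t * b))" by simp
      then show ?thesis using 2 a P u b
        by (simp add: exponential_density_def ennreal_mult[symmetric] min_def ennreal_le_iff)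
    next
      case 3
      have "a * exp (- t * a) * (exp (- v * s) * \<alpha>) \<le> a * exp (- t * a) * (exp (- v * s) * u)"
        using a u by (intro mult_left_mono) auto
      then show ?thesis using 3 a u s
        by (simp add: exponential_density_def ennreal_mult[symmetric] min_def ennreal_le_iff ennreal_leI mult_ac)
    qed
  qed
  also have "\<dots> = ennreal u * (\<integral>\<^sup>+t. ennreal (exponential_density b t) * indicator {..s} t \<partial>lborel) +
      ennreal (exp (- v * s) * u) * ennreal (exp (- a * s))"
    by (simp add: nn_integral_add nn_integral_cmult nn_integral_exponential_tail[OF a s])
  also have "ennreal (exp (- v * s) * u) * ennreal (exp (- a * s)) = ennreal u * ennreal (exp (- b * s))"
    using u by (simp add: ennreal_mult[symmetric] b_def exp_add[symmetric] algebra_simps)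
  also have "ennreal u * (\<integral>\<^sup>+t. ennreal (exponential_density b t) * indicator {..s} t \<partial>lborel) + ennreal u * ennreal (exp (- b * s)) =
      ennreal u * ((\<integral>\<^sup>+t. ennreal (exponential_density b t) * indicator {..s} t \<partial>lborel) + ennreal (exp (- b * s)))"
    by (simp add: distrib_left)
  also have "\<dots> = ennreal u" by (simp only: nn_integral_exponential_split[OF b s] mult_1_right)
  finally show ?thesis .
qed

end

lemma jump_time_cong: "(\<And>k. k < n \<Longrightarrow> z k = z' k) \<Longrightarrow> jump_time z n = jump_time z' n"
  by (simp add: jump_time_def)

lemma clipped_time_cong: "(\<And>k. k < n \<Longrightarrow> z k = z' k) \<Longrightarrow> clipped_time z T n = clipped_time z' T n"
  unfolding clipped_time_def using jump_time_cong[of n z z'] by simp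

lemma jump_time_Suc_upd: "jump_time (z(m := \<zeta>)) (Suc m) = jump_time z m + snd \<zeta>"
  by (simp add: jump_time_def)

lemma clipped_time_Suc_upd:
  assumes T: "0 \<le> T" and J: "jump_time z m \<le> ennreal T"
  defines "s \<equiv> T - clipped_time z T m"
  shows "0 \<le> s" "clipped_time (z(m := (y, t))) T (Suc m) - clipped_time z T m = enn2real (min t (ennreal s))"
    "jump_time (z(m := (y, t))) (Suc m) \<le> ennreal T \<longleftrightarrow> t \<le> ennreal s"
proof -
  obtain j where j: "jump_time z m = ennreal j" "0 \<le> j" "j \<le> T"
    using J T by (cases "jump_time z m") (auto simp: top_unique)
  then have cj: "clipped_time z T m = j" by (simp add: clipped_time_def min_def)
  show s: "0 \<le> s" using j cj by (simp add: s_def)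
  show "clipped_time (z(m := (y, t))) T (Suc m) - clipped_time z T m = enn2real (min t (ennreal s))"
    using j s T by (cases t) (auto simp: cj s_def clipped_time_def jump_time_Suc_upd ennreal_plus[symmetric] min_def top_unique simp del: ennreal_plus)
  show "jump_time (z(m := (y, t))) (Suc m) \<le> ennreal T \<longleftrightarrow> t \<le> ennreal s"
    using j s T by (cases t) (auto simp: cj s_def jump_time_Suc_upd ennreal_plus[symmetric] top_unique simp del: ennreal_plus)
qed

definition path_sum :: "('a \<Rightarrow> real) \<Rightarrow> real \<Rightarrow> (nat \<Rightarrow> 'a \<times> ennreal) \<Rightarrow> nat \<Rightarrow> real" where
  "path_sum V T z n = (\<Sum>k<n. V (fst (z k)) * (clipped_time z T (Suc k) - clipped_time z T k))"

lemma path_sum_cong: "(\<And>k. k < n \<Longrightarrow> z k = z' k) \<Longrightarrow> path_sum V T z n = path_sum V T z' n"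
  unfolding path_sum_def by (intro sum.cong) (auto intro!: arg_cong2[of _ _ _ _ "(-)"] clipped_time_cong)

lemma path_sum_Suc_upd:
  "path_sum V T (z(m := \<zeta>)) (Suc m) =
    path_sum V T z m + V (fst \<zeta>) * (clipped_time (z(m := \<zeta>)) T (Suc m) - clipped_time z T m)"
proof -
  have "path_sum V T (z(m := \<zeta>)) m = path_sum V T z m" by (rule path_sum_cong) simp
  moreover have "clipped_time (z(m := \<zeta>)) T m = clipped_time z T m" by (rule clipped_time_cong) simp
  ultimately show ?thesis by (simp add: path_sum_def)
qed

context density_chain begin

lemma potential_eq: "(r x + potential \<phi> x) * exp (\<phi> x) = r x * jump_mean (\<lambda>y. exp (\<phi> y)) x"
  by (simp add: potential_def field_simps)

text \<open>A supermartingale in the number of jumps. A visit that ends by \<open>T\<close>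
  contributes the mean of \<open>exp \<phi>\<close> over the next state; once \<open>T\<close> is
  passed the clipped times freeze the exponent, and \<open>\<alpha>\<close> stands in as a lower
  bound of \<open>exp \<phi>\<close>. Averaging first the next holding time, by
  \<open>nn_integral_killed_holding_time\<close>, and then the next state returns at most the
  previous value.\<close>

lemma nn_integral_exponential_martingale:
  assumes \<phi>: "continuous_on UNIV \<phi>" and \<alpha>: "0 < \<alpha>" "\<And>y. \<alpha> \<le> exp (\<phi> y)" and T: "0 \<le> T"
  shows "(\<integral>\<^sup>+z. ennreal (exp (- path_sum (potential \<phi>) T z (Suc n)) *
      (if jump_time z (Suc n) \<le> ennreal T then jump_mean (\<lambda>y. exp (\<phi> y)) (fst (z n)) else \<alpha>)) \<partial>law x) \<le> ennreal (exp (\<phi> x))"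
proof -
  let ?V = "potential \<phi>" and ?u = "\<lambda>y. exp (\<phi> y)" and ?P = "jump_mean (\<lambda>y. exp (\<phi> y))"
  note [measurable] = exp_bounded(1)[OF \<phi>] borel_measurable_continuous_onI[OF continuous_potential[OF \<phi>]]
  obtain B where B: "\<And>y. \<bar>?u y\<bar> \<le> B" using exp_bounded(2)[OF \<phi>] by blast
  have [measurable]: "?P \<in> borel_measurable borel"
    using continuous_jump_mean[OF _ B] by (intro borel_measurable_continuous_onI) auto
  have P: "0 < ?P y" for y
    using jump_mean_mono[of "\<lambda>_. \<alpha>" \<alpha> ?u B y] B \<alpha> by (simp add: jump_mean_const)
  have [measurable]: "(\<lambda>z. path_sum ?V T z n) \<in> borel_measurable (PiM UNIV (\<lambda>_. visit_space))" for n
    unfolding path_sum_def by measurable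
  define M where "M n z = ennreal (exp (- path_sum ?V T z (Suc n)) *
      (if jump_time z (Suc n) \<le> ennreal T then ?P (fst (z n)) else \<alpha>))" for n and z :: "nat \<Rightarrow> 'a \<times> ennreal"
  have Mm: "M n \<in> borel_measurable (PiM UNIV (\<lambda>_. visit_space))" for n
    unfolding M_def by measurable
  have dep: "M n z = M n z'" if "\<And>k. k \<le> n \<Longrightarrow> z k = z' k" for n z z'
    using that path_sum_cong[of "Suc n" z z' ?V T] jump_time_cong[of "Suc n" z z'] by (simp add: M_def)
  have hold: "(\<integral>\<^sup>+t. M m (z(m := (y, t))) \<partial>holding_time (r y)) \<le> ennreal (exp (- path_sum ?V T z m)) * ennreal (?u y)"
    if J: "jump_time z m \<le> ennreal T" for m z y
  proof -
    note c = clipped_time_Suc_upd[OF T J]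
    let ?s = "T - clipped_time z T m"
    have "(\<integral>\<^sup>+t. M m (z(m := (y, t))) \<partial>holding_time (r y)) =
      (\<integral>\<^sup>+t. ennreal (exp (- path_sum ?V T z m)) * ennreal (exp (- ?V y * enn2real (min t (ennreal ?s))) * (if t \<le> ennreal ?s then ?P y else \<alpha>)) \<partial>holding_time (r y))"
      by (intro nn_integral_cong)
        (auto simp: M_def path_sum_Suc_upd c ennreal_mult'[symmetric] exp_add[symmetric] mult.assoc[symmetric] exp_diff exp_minus field_simps)
    also have "\<dots> = ennreal (exp (- path_sum ?V T z m)) * (\<integral>\<^sup>+t. ennreal (exp (- ?V y * enn2real (min t (ennreal ?s))) * (if t \<le> ennreal ?s then ?P y else \<alpha>)) \<partial>holding_time (r y))"
      by (rule nn_integral_cmult) (simp add: measurable_cong_sets[OF sets_holding_time refl])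
    also have "\<dots> \<le> ennreal (exp (- path_sum ?V T z m)) * ennreal (?u y)"
      using c(1) P \<alpha> r_nonneg potential_eq[of y \<phi>]
      by (intro mult_left_mono nn_integral_killed_holding_time) auto
    finally show ?thesis .
  qed
  have "(\<integral>\<^sup>+z. M n z \<partial>law x) \<le> ennreal (?u x)" for n
  proof (induction n)
    case 0
    define F where "F \<zeta> = M 0 ((\<lambda>_. undefined)(0 := \<zeta>))" for \<zeta>
    have F: "F \<in> borel_measurable visit_space"
      unfolding F_def
      using measurable_fun_upd[of UNIV UNIV 0 "\<lambda>_ _. undefined" visit_space "\<lambda>_. visit_space" "\<lambda>x. x"]
      by (intro measurable_compose[OF _ Mm]) (auto simp: space_PiM space_pair_measure)
    have "(\<integral>\<^sup>+z. M 0 z \<partial>law x) = (\<integral>\<^sup>+z. F (z 0) \<partial>law x)"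
      unfolding F_def by (intro nn_integral_cong dep) auto
    also have "\<dots> = (\<integral>\<^sup>+t. F (x, t) \<partial>holding_time (r x))" by (rule nn_integral_law_0[OF F])
    also have "\<dots> \<le> ennreal (?u x)"
      using hold[of "\<lambda>_. undefined" 0 x] by (simp add: F_def jump_time_def path_sum_def)
    finally show ?case .
  next
    case (Suc n)
    have "(\<integral>\<^sup>+z. M (Suc n) z \<partial>law x) =
        (\<integral>\<^sup>+z. (\<integral>\<^sup>+y. (\<integral>\<^sup>+t. M (Suc n) (z(Suc n := (y, t))) \<partial>holding_time (r y)) \<partial>p (fst (z n))) \<partial>law x)"
      by (rule nn_integral_law_Suc[OF Mm dep]) auto
    also have "\<dots> \<le> (\<integral>\<^sup>+z. M n z \<partial>law x)"
    proof (intro nn_integral_mono)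
      fix z
      have pp: "emeasure (p y) (space (p y)) = 1" for y using prob_space_p by (rule prob_space.emeasure_space_1)
      have hp: "emeasure (holding_time (r y)) (space (holding_time (r y))) = 1" for y
        using prob_space_holding_time[OF r_nonneg] by (rule prob_space.emeasure_space_1)
      show "(\<integral>\<^sup>+y. (\<integral>\<^sup>+t. M (Suc n) (z(Suc n := (y, t))) \<partial>holding_time (r y)) \<partial>p (fst (z n))) \<le> M n z"
      proof (cases "jump_time z (Suc n) \<le> ennreal T")
        case True
        have "(\<integral>\<^sup>+y. (\<integral>\<^sup>+t. M (Suc n) (z(Suc n := (y, t))) \<partial>holding_time (r y)) \<partial>p (fst (z n))) \<le>
          (\<integral>\<^sup>+y. ennreal (exp (- path_sum ?V T z (Suc n))) * ennreal (?u y) \<partial>p (fst (z n)))"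
          by (intro nn_integral_mono hold[OF True])
        also have "\<dots> = ennreal (exp (- path_sum ?V T z (Suc n))) * ennreal (?P (fst (z n)))"
          using B by (subst nn_integral_cmult) (auto simp: p_density nn_p_mean[unfolded p_density, of ?u B] abs_le_iff)
        also have "\<dots> = M n z" using True by (simp add: M_def ennreal_mult' )
        finally show ?thesis .
      next
        case False
        then have J: "ennreal T \<le> jump_time z (Suc n)" by simp
        have "M (Suc n) (z(Suc n := (y, t))) = M n z" for y t
        proof -
          have J2: "jump_time z (Suc n) \<le> jump_time (z(Suc n := (y, t))) (Suc (Suc n))" by (simp add: jump_time_Suc_upd)
          then have "\<not> jump_time (z(Suc n := (y, t))) (Suc (Suc n)) \<le> ennreal T" using False by (meson order_trans)
          moreover have "clipped_time (z(Suc n := (y, t))) T (Suc (Suc n)) = T" "clipped_time z T (Suc n) = T"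
            using J J2 by (auto intro!: clipped_time_late[OF T] intro: order_trans)
          ultimately show ?thesis using False by (simp add: M_def path_sum_Suc_upd)
        qed
        then show ?thesis by (simp add: pp hp)
      qed
    qed
    also note Suc.IH
    finally show ?case .
  qed
  then show ?thesis by (simp add: M_def)
qed

text \<open>Markov's inequality for the exponential supermartingale. The constant
  \<open>exp (2 * B)\<close> collects the initial value \<open>exp (\<phi> x)\<close> and the final
  factor \<open>exp (- B)\<close>; it depends on \<open>\<phi>\<close> alone, which later gives
  uniformity in \<open>x\<close>.\<close>

lemma emeasure_path_integral_le:
  assumes \<phi>: "continuous_on UNIV \<phi>"
  shows "\<exists>K>0. \<forall>x T l. 0 < T \<longrightarrow>
    emeasure (law x) {z \<in> space (law x). (LINT t:{0..T}|lborel. potential \<phi> (jump_path z t)) \<le> - l * T} \<le> ennreal (K * exp (- l * T))"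
proof -
  obtain B where B: "0 < B" "\<And>y. \<bar>\<phi> y\<bar> \<le> B" using bounded_continuous_compact[OF compact_space \<phi>] by blast
  have \<alpha>: "exp (- B) \<le> exp (\<phi> y)" "exp (\<phi> y) \<le> exp B" for y using B(2)[of y] by (auto simp: abs_le_iff)
  let ?V = "potential \<phi>"
  note [measurable] = borel_measurable_continuous_onI[OF continuous_potential[OF \<phi>]]
  have [measurable]: "(\<lambda>z. path_sum ?V T z n) \<in> borel_measurable (PiM UNIV (\<lambda>_. visit_space))" for n T
    unfolding path_sum_def by measurable
  have main: "emeasure (law x) {z \<in> space (law x). (LINT t:{0..T}|lborel. ?V (jump_path z t)) \<le> - l * T} \<le> ennreal (exp (2 * B) * exp (- l * T))"
    if T: "0 < T" for x T l
  proof -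
    define S where "S n = {z \<in> space (law x). ennreal T < jump_time z (Suc n) \<and> (SUP n. jump_time z n) = \<infinity> \<and>
      path_sum ?V T z (Suc n) \<le> - l * T}" for n
    have Sm: "S n \<in> sets (law x)" for n unfolding S_def by measurable
    have eq: "path_sum ?V T z n = (LINT t:{0..T}|lborel. ?V (jump_path z t))"
      if "(SUP n. jump_time z n) = \<infinity>" "ennreal T \<le> jump_time z n" for z n
      using integral_jump_path[OF that(1) _ that(2)] T by (simp add: path_sum_def)
    have "emeasure (law x) (S n) \<le> ennreal (exp (2 * B) * exp (- l * T))" for n
    proof -
      let ?c = "ennreal (exp (- B + l * T))"
      have "?c * emeasure (law x) (S n) = (\<integral>\<^sup>+z. ?c * indicator (S n) z \<partial>law x)"
        using Sm by (simp add: nn_integral_cmult)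
      also have "\<dots> \<le> (\<integral>\<^sup>+z. ennreal (exp (- path_sum ?V T z (Suc n)) *
        (if jump_time z (Suc n) \<le> ennreal T then jump_mean (\<lambda>y. exp (\<phi> y)) (fst (z n)) else exp (- B))) \<partial>law x)"
      proof (intro nn_integral_mono)
        fix z
        show "?c * indicator (S n) z \<le> ennreal (exp (- path_sum ?V T z (Suc n)) *
          (if jump_time z (Suc n) \<le> ennreal T then jump_mean (\<lambda>y. exp (\<phi> y)) (fst (z n)) else exp (- B)))"
        proof (cases "z \<in> S n")
          case True
          then have "- B + l * T \<le> - path_sum ?V T z (Suc n) + - B" by (simp add: S_def)
          then show ?thesis using True by (auto simp: S_def exp_add[symmetric] intro!: ennreal_leI)
        qed simp
      qed
      also have "\<dots> \<le> ennreal (exp (\<phi> x))"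
        using T \<alpha> by (intro nn_integral_exponential_martingale[OF \<phi>]) auto
      also have "\<dots> \<le> ennreal (exp B)" using \<alpha> by (intro ennreal_leI)
      finally have "ennreal (exp (B - l * T)) * (?c * emeasure (law x) (S n)) \<le> ennreal (exp (B - l * T)) * ennreal (exp B)"
        by (rule mult_left_mono) simp
      then show ?thesis
        by (simp add: mult.assoc[symmetric] ennreal_mult[symmetric] exp_add[symmetric])
    qed
    \<comment> \<open>The number of jumps before \<open>T\<close> is random: the bound for a fixed
      number passes to the increasing union, which exhausts the event almost surely because there is
      no explosion.\<close>
    moreover have "incseq S"
    proof (rule incseq_SucI, rule subsetI)
      fix n z assume z: "z \<in> S n"
      have "ennreal T < jump_time z (Suc (Suc n))"
        using z jump_time_mono[of "Suc n" "Suc (Suc n)" z] by (auto simp: S_def)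
      with z show "z \<in> S (Suc n)" using eq[of z "Suc n"] eq[of z "Suc (Suc n)"] by (auto simp: S_def)
    qed
    ultimately have "emeasure (law x) (\<Union>n. S n) \<le> ennreal (exp (2 * B) * exp (- l * T))"
      using Sm by (subst SUP_emeasure_incseq[symmetric]) (auto intro!: SUP_least)
    moreover have "emeasure (law x) {z \<in> space (law x). (LINT t:{0..T}|lborel. ?V (jump_path z t)) \<le> - l * T} \<le> emeasure (law x) (\<Union>n. S n)"
    proof (rule emeasure_mono_AE)
      show "AE z in law x. z \<in> {z \<in> space (law x). (LINT t:{0..T}|lborel. ?V (jump_path z t)) \<le> - l * T} \<longrightarrow> z \<in> (\<Union>n. S n)"
        using AE_nonexplosive[OF R(2), of x]
      proof eventually_elim
        case (elim z)
        have "ennreal T < (SUP n. jump_time z n)" unfolding elim by simp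
        then obtain n where "ennreal T < jump_time z n" by (auto simp: less_SUP_iff)
        then have n: "ennreal T < jump_time z (Suc n)" using jump_time_mono[of n "Suc n" z] by simp
        then show ?case using elim eq[OF elim, of "Suc n"] by (auto simp: S_def intro!: exI[of _ n])
      qed
      show "(\<Union>n. S n) \<in> sets (law x)" using Sm by auto
    qed
    ultimately show ?thesis by (rule order_trans[rotated])
  qed
  show ?thesis using main by (intro exI[of _ "exp (2 * B)"] conjI allI impI) auto
qed

lemma sets_chain_law: "sets (chain_law r p x) = sets skorokhod_space"
  by (simp add: chain_law_def)

lemma measurable_jump_path_law: "jump_path \<in> law x \<rightarrow>\<^sub>M skorokhod_space"
  unfolding measurable_cong_sets[OF sets_law refl] by (rule measurable_jump_path)

lemma emeasure_chain_law:
  "A \<in> sets skorokhod_space \<Longrightarrow> emeasure (chain_law r p x) A = emeasure (law x) {z \<in> space (law x). jump_path z \<in> A}"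
  unfolding chain_law_def
  by (subst emeasure_distr[OF measurable_jump_path_law]) (simp_all add: vimage_def Int_def conj_commute)

lemma prob_space_chain: "prob_space (chain_law r p x)"
  by (rule prob_space_chain_law[OF r_measurable r_nonneg p_measurable])

lemma measure_chain_law_le:
  assumes \<phi>: "continuous_on UNIV \<phi>"
  shows "\<exists>K>0. \<forall>x T l. 0 < T \<longrightarrow>
    measure (chain_law r p x) {\<omega> \<in> space (chain_law r p x). l \<le> - (\<integral>y. potential \<phi> y \<partial>empirical_measure T \<omega>)} \<le> K * exp (- l * T)"
proof -
  obtain K where K: "0 < K" "\<forall>x T l. 0 < T \<longrightarrow>
    emeasure (law x) {z \<in> space (law x). (LINT t:{0..T}|lborel. potential \<phi> (jump_path z t)) \<le> - l * T} \<le> ennreal (K * exp (- l * T))"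
    using emeasure_path_integral_le[OF \<phi>] by blast
  have "measure (chain_law r p x) {\<omega> \<in> space (chain_law r p x). l \<le> - (\<integral>y. potential \<phi> y \<partial>empirical_measure T \<omega>)} \<le> K * exp (- l * T)"
    if T: "0 < T" for x T l
  proof -
    interpret P: prob_space "chain_law r p x" by (rule prob_space_chain)
    let ?A = "{\<omega> \<in> space skorokhod_space. (LINT t:{0..T}|lborel. potential \<phi> (\<omega> t)) \<le> - l * T}"
    have A: "?A \<in> sets skorokhod_space"
      using measurable_path_integral[OF continuous_potential[OF \<phi>]] by measurable
    have sp: "space (chain_law r p x) = space skorokhod_space" by (rule sets_eq_imp_space_eq[OF sets_chain_law])
    have "{\<omega> \<in> space (chain_law r p x). l \<le> - (\<integral>y. potential \<phi> y \<partial>empirical_measure T \<omega>)} = ?A"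
      using T by (auto simp: sp space_skorokhod integral_empirical_measure[OF _ T continuous_potential[OF \<phi>]] field_simps)
    moreover have "emeasure (chain_law r p x) ?A \<le> ennreal (K * exp (- l * T))"
      using K(2)[rule_format, OF T, of x l] measurable_space[OF measurable_jump_path_law] 
      by (subst emeasure_chain_law[OF A]) (auto simp: space_skorokhod cadlag_jump_path)
    ultimately show ?thesis using K(1) by (simp add: P.emeasure_eq_measure)
  qed
  with K(1) show ?thesis by blast
qed

end

lemma ereal_mult_log_le:
  assumes "0 < T" "m \<le> K * exp (- l * T)" "0 < K"
  shows "ereal (1 / T) * log_ereal m \<le> ereal (ln K / T - l)"
proof (cases "m \<le> 0")
  case True then show ?thesis using assms by (simp add: log_ereal_def)
next
  case False
  then have "ln m \<le> ln (K * exp (- l * T))" using assms by (subst ln_le_cancel_iff) auto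
  also have "\<dots> = ln K - l * T" using assms by (simp add: ln_mult)
  finally have "1 / T * ln m \<le> 1 / T * (ln K - l * T)" using assms by (intro mult_left_mono) auto
  also have "\<dots> = ln K / T - l" using assms by (simp add: field_simps)
  finally show ?thesis using False by (simp add: log_ereal_def)
qed

section \<open>From half-spaces to closed sets\<close>

context density_chain begin

text \<open>The potential depends on \<open>\<phi>\<close> only through the quotient of the jump
  mean of \<open>exp \<phi>\<close> by \<open>exp \<phi>\<close>, which a uniform perturbation by
  \<open>e\<close> changes by a factor between \<open>exp (- 2 * e)\<close> and
  \<open>exp (2 * e)\<close>. Hence a countable dense family of potentials can replace all of
  them.\<close>

lemma potential_close:
  assumes \<phi>: "continuous_on UNIV \<phi>" and \<eta>: "0 < \<eta>"
  shows "\<exists>e>0. \<forall>\<psi>. continuous_on UNIV \<psi> \<longrightarrow> (\<forall>x. \<bar>\<phi> x - \<psi> x\<bar> < e) \<longrightarrow> (\<forall>x. \<bar>potential \<phi> x - potential \<psi> x\<bar> \<le> \<eta>)"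
proof -
  obtain B where B: "0 < B" "\<And>x. \<bar>\<phi> x\<bar> \<le> B" using bounded_continuous_compact[OF compact_space \<phi>] by blast
  \<comment> \<open>The quotient is at most \<open>exp (2 * B)\<close> and \<open>r\<close> at most
    \<open>R\<close>, so a relative error \<open>k\<close> changes the potential by at most
    \<open>\<eta>\<close>; \<open>e\<close> is the perturbation whose factor
    \<open>exp (2 * e)\<close> equals \<open>1 + k\<close>.\<close>
  define k where "k = \<eta> / (R * exp (2 * B))"
  have k: "k > 0" using \<eta> R(1) by (simp add: k_def)
  define e where "e = ln (1 + k) / 2"
  have e: "e > 0" "exp (2 * e) = 1 + k" using k by (auto simp: e_def)
  show ?thesis
  proof (intro exI[of _ e] conjI allI impI)
    fix \<psi> x assume \<psi>: "continuous_on UNIV \<psi>" and close: "\<forall>x. \<bar>\<phi> x - \<psi> x\<bar> < e"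
    let ?a = "\<lambda>\<phi>. jump_mean (\<lambda>y. exp (\<phi> y)) x / exp (\<phi> x)"
    obtain B' where B': "\<And>y. \<bar>exp (\<psi> y)\<bar> \<le> B'" using exp_bounded(2)[OF \<psi>] by blast
    obtain B2 where B2: "\<And>y. \<bar>exp (\<phi> y)\<bar> \<le> B2" using exp_bounded(2)[OF \<phi>] by blast
    have le: "?a \<psi>2 \<le> exp (2 * e) * ?a \<psi>1"
      if c: "continuous_on UNIV \<psi>1" "continuous_on UNIV \<psi>2" "\<And>y. \<bar>\<psi>1 y - \<psi>2 y\<bar> < e" for \<psi>1 \<psi>2 :: "'a \<Rightarrow> real"
    proof -
      obtain B1 where B1: "\<And>y. \<bar>exp (\<psi>1 y)\<bar> \<le> B1" using exp_bounded(2)[OF c(1)] by blast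
      obtain B2 where B2: "\<And>y. \<bar>exp (\<psi>2 y)\<bar> \<le> B2" using exp_bounded(2)[OF c(2)] by blast
      have "jump_mean (\<lambda>y. exp (\<psi>2 y)) x \<le> jump_mean (\<lambda>y. exp e * exp (\<psi>1 y)) x"
      proof (rule jump_mean_mono[OF exp_bounded(1)[OF c(2)] B2, of _ "exp e * B1"])
        show "(\<lambda>y. exp e * exp (\<psi>1 y)) \<in> borel_measurable borel" using exp_bounded(1)[OF c(1)] by simp
        show "\<bar>exp e * exp (\<psi>1 y)\<bar> \<le> exp e * B1" for y using B1[of y] by (simp add: abs_mult)
        have "\<psi>2 y \<le> e + \<psi>1 y" for y using c(3)[of y] by linarith
        then show "exp (\<psi>2 y) \<le> exp e * exp (\<psi>1 y)" for y by (simp add: exp_add[symmetric])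
      qed
      also have "\<dots> = exp e * jump_mean (\<lambda>y. exp (\<psi>1 y)) x"
        unfolding jump_mean_def by (simp add: mult.left_commute)
      finally have 1: "jump_mean (\<lambda>y. exp (\<psi>2 y)) x \<le> exp e * jump_mean (\<lambda>y. exp (\<psi>1 y)) x" .
      have "\<psi>1 x \<le> e + \<psi>2 x" using c(3)[of x] by linarith
      then have "exp (\<psi>1 x) \<le> exp e * exp (\<psi>2 x)" by (simp add: exp_add[symmetric])
      then have 2: "1 / exp (\<psi>2 x) \<le> exp e / exp (\<psi>1 x)" by (simp add: field_simps)
      have 0: "0 \<le> jump_mean (\<lambda>y. exp (\<psi>1 y)) x"
        unfolding jump_mean_def using q_pos by (intro Bochner_Integration.integral_nonneg) (auto intro: less_imp_le)
      have "?a \<psi>2 \<le> (exp e * jump_mean (\<lambda>y. exp (\<psi>1 y)) x) * (exp e / exp (\<psi>1 x))"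
        using mult_mono[OF 1 2] 0 by simp
      also have "\<dots> = exp (2 * e) * ?a \<psi>1" by (simp add: exp_double power2_eq_square)
      finally show ?thesis .
    qed
    have a0: "0 \<le> ?a \<phi>" unfolding jump_mean_def using q_pos
      by (intro divide_nonneg_nonneg Bochner_Integration.integral_nonneg) (auto intro: less_imp_le)
    have aB: "?a \<phi> \<le> exp (2 * B)"
    proof -
      have "jump_mean (\<lambda>y. exp (\<phi> y)) x \<le> jump_mean (\<lambda>_. exp B) x"
        using B by (intro jump_mean_mono[OF exp_bounded(1)[OF \<phi>] B2, of _ "exp B"]) (auto simp: abs_le_iff)
      then have 1: "jump_mean (\<lambda>y. exp (\<phi> y)) x \<le> exp B" by (simp add: jump_mean_const)
      have "- B \<le> \<phi> x" using B(2)[of x] by (auto simp: abs_le_iff)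
      then have "exp (- B) \<le> exp (\<phi> x)" by simp
      then have "1 / exp (\<phi> x) \<le> exp B" by (simp add: exp_minus field_simps)
      from mult_mono[OF 1 this] show ?thesis by (simp add: exp_double power2_eq_square)
    qed
    have c1: "?a \<psi> \<le> (1 + k) * ?a \<phi>" using le[OF \<phi> \<psi>] close e(2) by simp
    have c2: "?a \<phi> \<le> (1 + k) * ?a \<psi>" using le[OF \<psi> \<phi>] close e(2) by (simp add: abs_minus_commute)
    have "\<bar>a - b\<bar> \<le> k * a" if "b \<le> (1 + k) * a" "a \<le> (1 + k) * b" for a b :: real
    proof (cases "b \<le> a")
      case True
      then have "k * b \<le> k * a" using k by (intro mult_left_mono) auto
      then show ?thesis using True that by (simp add: algebra_simps)
    qed (use that in \<open>simp add: algebra_simps\<close>)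
    from this[OF c1 c2] have "\<bar>?a \<phi> - ?a \<psi>\<bar> \<le> k * ?a \<phi>" .
    also have "\<dots> \<le> k * exp (2 * B)" using k by (intro mult_left_mono aB) auto
    finally have "R * \<bar>?a \<phi> - ?a \<psi>\<bar> \<le> \<eta>" using R(1) by (simp add: k_def field_simps)
    moreover have "\<bar>potential \<phi> x - potential \<psi> x\<bar> = r x * \<bar>?a \<phi> - ?a \<psi>\<bar>"
      unfolding potential_def right_diff_distrib[symmetric] abs_mult using r_nonneg[of x] by simp
    moreover have "r x * \<bar>?a \<phi> - ?a \<psi>\<bar> \<le> R * \<bar>?a \<phi> - ?a \<psi>\<bar>" using R(2) by (intro mult_right_mono) auto
    ultimately show "\<bar>potential \<phi> x - potential \<psi> x\<bar> \<le> \<eta>" by linarith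
  qed (rule e)
qed

lemma integrable_potential: "\<mu> \<in> prob_measures \<Longrightarrow> continuous_on UNIV \<phi> \<Longrightarrow> integrable \<mu> (potential \<phi>)"
proof -
  assume \<mu>: "\<mu> \<in> prob_measures" and \<phi>: "continuous_on UNIV \<phi>"
  obtain B where B: "\<And>x. \<bar>potential \<phi> x\<bar> \<le> B" using potential_bounded[OF \<phi>] by blast
  show "integrable \<mu> (potential \<phi>)"
    by (rule prob_measure_integrable[OF \<mu> borel_measurable_continuous_onI[OF continuous_potential[OF \<phi>]] B])
qed

text \<open>If finitely many members of a dense sequence never sufficed, measures in
  \<open>C\<close> that defeat the first \<open>N\<close> of them would accumulate at a measure in
  \<open>C\<close> that defeats them all and so has rate at most \<open>l\<close>.\<close>

lemma finite_cover_rate: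
  assumes C: "closedin weak_topology C" and l: "\<And>\<mu>. \<mu> \<in> C \<Longrightarrow> ereal l < rate \<mu>"
  shows "\<exists>\<Phi>. finite \<Phi> \<and> (\<forall>\<phi>\<in>\<Phi>. continuous_on UNIV \<phi>) \<and> (\<forall>\<mu>\<in>C. \<exists>\<phi>\<in>\<Phi>. l < - (\<integral>x. potential \<phi> x \<partial>\<mu>))"
proof -
  obtain D :: "('a \<Rightarrow> real) set" where D: "countable D" "\<forall>g\<in>D. continuous_on UNIV g"
    "\<forall>f e. continuous_on UNIV f \<longrightarrow> 0 < e \<longrightarrow> (\<exists>g\<in>D. \<forall>x. \<bar>f x - g x\<bar> < e)"
    using countable_dense_continuous[OF compact_space] by blast
  have ne: "D \<noteq> {}" using D(3)[rule_format, of "\<lambda>_. 0" 1] by auto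
  define d where "d = from_nat_into D"
  have rd: "range d = D" unfolding d_def using ne D(1) by (rule range_from_nat_into)
  then have dc: "continuous_on UNIV (d n)" for n using D(2) by blast
  have "\<exists>N. \<forall>\<mu>\<in>C. \<exists>j\<le>N. l < - (\<integral>x. potential (d j) x \<partial>\<mu>)"
  proof (rule ccontr)
    assume "\<nexists>N. \<forall>\<mu>\<in>C. \<exists>j\<le>N. l < - (\<integral>x. potential (d j) x \<partial>\<mu>)"
    then have "\<forall>N. \<exists>\<mu>. \<mu> \<in> C \<and> (\<forall>j\<le>N. - (\<integral>x. potential (d j) x \<partial>\<mu>) \<le> l)" by (meson not_le)
    then obtain \<nu> where \<nu>: "\<And>N. \<nu> N \<in> C" "\<And>N j. j \<le> N \<Longrightarrow> - (\<integral>x. potential (d j) x \<partial>\<nu> N) \<le> l" by metis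
    have CP: "C \<subseteq> prob_measures" using closedin_subset[OF C] by simp
    have \<nu>P: "\<nu> n \<in> prob_measures" for n using \<nu>(1)[of n] CP by (rule subsetD[rotated])
    obtain \<mu> and \<sigma> :: "nat \<Rightarrow> nat"
      where lim': "strict_mono \<sigma> \<and> \<mu> \<in> prob_measures \<and>
        (\<forall>f :: 'a \<Rightarrow> real. continuous_on UNIV f \<longrightarrow> (\<lambda>n. \<integral>x. f x \<partial>\<nu> (\<sigma> n)) \<longlonglongrightarrow> (\<integral>x. f x \<partial>\<mu>))"
      using sequentially_compact_prob_measures[OF compact_space \<nu>P, of "\<lambda>n. n"] by (elim exE) (rule that)
    note \<sigma> = lim'[THEN conjunct1] and \<mu> = lim'[THEN conjunct2, THEN conjunct1] and lim = lim'[THEN conjunct2, THEN conjunct2]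
    have "\<mu> \<in> C"
      by (rule sequentially_closedin_weak_topology[OF C, of "\<lambda>n. \<nu> (\<sigma> n)"]) (use \<nu>(1) \<mu> lim in simp_all)
    have dl: "- (\<integral>x. potential (d j) x \<partial>\<mu>) \<le> l" for j
    proof (rule LIMSEQ_le_const2)
      show "(\<lambda>n. - (\<integral>x. potential (d j) x \<partial>\<nu> (\<sigma> n))) \<longlonglongrightarrow> - (\<integral>x. potential (d j) x \<partial>\<mu>)"
        by (intro tendsto_minus lim[rule_format] continuous_potential dc)
      show "\<exists>N. \<forall>n\<ge>N. - (\<integral>x. potential (d j) x \<partial>\<nu> (\<sigma> n)) \<le> l"
        using \<nu>(2) order_trans[OF _ seq_suble[OF \<sigma>]] by (intro exI[of _ j]) simp
    qed
    have "rate \<mu> \<le> ereal l"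
      unfolding rate_eq
    proof (rule SUP_least)
      fix \<phi> :: "'a \<Rightarrow> real" assume "\<phi> \<in> {\<phi>. continuous_on UNIV \<phi>}"
      then have \<phi>: "continuous_on UNIV \<phi>" by simp
      have "- (\<integral>x. potential \<phi> x \<partial>\<mu>) \<le> l + \<eta>" if "\<eta> > 0" for \<eta>
      proof -
        obtain e where e: "e > 0" "\<forall>\<psi>. continuous_on UNIV \<psi> \<longrightarrow> (\<forall>x. \<bar>\<phi> x - \<psi> x\<bar> < e) \<longrightarrow> (\<forall>x. \<bar>potential \<phi> x - potential \<psi> x\<bar> \<le> \<eta>)"
          using potential_close[OF \<phi> \<open>\<eta> > 0\<close>] by blast
        obtain \<psi> where "\<psi> \<in> D" "\<forall>x. \<bar>\<phi> x - \<psi> x\<bar> < e" using D(3) \<phi> e(1) by blast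
        then obtain j where j: "\<forall>x. \<bar>\<phi> x - d j x\<bar> < e" using rd by auto
        then have "\<bar>(\<integral>x. potential \<phi> x \<partial>\<mu>) - (\<integral>x. potential (d j) x \<partial>\<mu>)\<bar> \<le> \<eta>"
          using e(2) dc by (intro prob_measure_integral_close[OF \<mu>] integrable_potential \<mu> \<phi>) auto
        then show ?thesis using dl[of j] by linarith
      qed
      then have "- (\<integral>x. potential \<phi> x \<partial>\<mu>) \<le> l" by (rule field_le_epsilon)
      then show "ereal (- (\<integral>x. potential \<phi> x \<partial>\<mu>)) \<le> ereal l" by simp
    qed
    then show False using l[OF \<open>\<mu> \<in> C\<close>] by simp
  qed
  then obtain N where "\<forall>\<mu>\<in>C. \<exists>j\<le>N. l < - (\<integral>x. potential (d j) x \<partial>\<mu>)" by blast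
  then show ?thesis using dc by (intro exI[of _ "d ` {..N}"]) auto
qed

lemma sets_potential_event:
  assumes "continuous_on UNIV \<phi>" and T: "0 < T"
  shows "{\<omega> \<in> space (chain_law r p x). l \<le> - (\<integral>y. potential \<phi> y \<partial>empirical_measure T \<omega>)} \<in> sets (chain_law r p x)"
proof -
  have sp: "space (chain_law r p x) = space skorokhod_space" by (rule sets_eq_imp_space_eq[OF sets_chain_law])
  have [measurable]: "(\<lambda>\<omega>. LINT t:{0..T}|lborel. potential \<phi> (\<omega> t)) \<in> borel_measurable skorokhod_space"
    by (rule measurable_path_integral[OF continuous_potential[OF assms(1)]])
  have "{\<omega> \<in> space (chain_law r p x). l \<le> - (\<integral>y. potential \<phi> y \<partial>empirical_measure T \<omega>)} =
    {\<omega> \<in> space skorokhod_space. l \<le> - (1 / T * (LINT t:{0..T}|lborel. potential \<phi> (\<omega> t)))}"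
    by (auto simp: sp space_skorokhod integral_empirical_measure[OF _ T continuous_potential[OF assms(1)]])
  also have "\<dots> \<in> sets skorokhod_space" by measurable
  finally show ?thesis by (simp add: sets_chain_law)
qed

lemma measure_closed_le:
  assumes C: "closedin weak_topology C" and l: "\<And>\<mu>. \<mu> \<in> C \<Longrightarrow> ereal l < rate \<mu>"
  shows "\<exists>K>0. \<forall>x T. 0 < T \<longrightarrow>
    measure (chain_law r p x) {\<omega> \<in> space (chain_law r p x). empirical_measure T \<omega> \<in> C} \<le> K * exp (- l * T)"
proof -
  obtain \<Phi> where \<Phi>: "finite \<Phi>" "\<forall>\<phi>\<in>\<Phi>. continuous_on UNIV \<phi>" "\<forall>\<mu>\<in>C. \<exists>\<phi>\<in>\<Phi>. l < - (\<integral>x. potential \<phi> x \<partial>\<mu>)"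
    using finite_cover_rate[OF C l] by blast
  let ?E = "\<lambda>\<phi> x T. {\<omega> \<in> space (chain_law r p x). l \<le> - (\<integral>y. potential \<phi> y \<partial>empirical_measure T \<omega>)}"
  have "\<forall>\<phi>\<in>\<Phi>. \<exists>K>0. \<forall>x T l. 0 < T \<longrightarrow> measure (chain_law r p x)
      {\<omega> \<in> space (chain_law r p x). l \<le> - (\<integral>y. potential \<phi> y \<partial>empirical_measure T \<omega>)} \<le> K * exp (- l * T)"
    by (intro ballI measure_chain_law_le \<Phi>(2)[rule_format])
  from bchoice[OF this] obtain K where K': "\<forall>\<phi>\<in>\<Phi>. 0 < K \<phi> \<and> (\<forall>x T l. 0 < T \<longrightarrow> measure (chain_law r p x)
      {\<omega> \<in> space (chain_law r p x). l \<le> - (\<integral>y. potential \<phi> y \<partial>empirical_measure T \<omega>)} \<le> K \<phi> * exp (- l * T))"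
    by (elim exE) (rule that)
  have K: "0 < K \<phi>" "0 < T \<Longrightarrow> measure (chain_law r p x) (?E \<phi> x T) \<le> K \<phi> * exp (- l * T)" if "\<phi> \<in> \<Phi>" for \<phi> x T
    using K'[rule_format, OF that] by simp_all
  have K0: "0 \<le> sum K \<Phi>" using K(1) by (intro sum_nonneg) (auto intro: less_imp_le)
  show ?thesis
  \<comment> \<open>The added 1 keeps the constant positive when the finite family is empty, as can
    happen for empty \<open>C\<close>.\<close>
  proof (intro exI[of _ "sum K \<Phi> + 1"] conjI allI impI)
    show "0 < sum K \<Phi> + 1" using K0 by simp
    fix x and T :: real assume T: "0 < T"
    interpret P: prob_space "chain_law r p x" by (rule prob_space_chain)
    have s: "?E \<phi> x T \<in> sets (chain_law r p x)" if "\<phi> \<in> \<Phi>" for \<phi> using that \<Phi>(2) T by (intro sets_potential_event) auto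
    have "P.prob {\<omega> \<in> space (chain_law r p x). empirical_measure T \<omega> \<in> C} \<le> P.prob (\<Union>\<phi>\<in>\<Phi>. ?E \<phi> x T)"
    proof (rule P.finite_measure_mono)
      show "{\<omega> \<in> space (chain_law r p x). empirical_measure T \<omega> \<in> C} \<subseteq> (\<Union>\<phi>\<in>\<Phi>. ?E \<phi> x T)"
        using \<Phi>(3) by (fastforce intro: less_imp_le)
      show "(\<Union>\<phi>\<in>\<Phi>. ?E \<phi> x T) \<in> sets (chain_law r p x)" using s \<Phi>(1) by (intro sets.finite_UN)
    qed
    also have "\<dots> \<le> (\<Sum>\<phi>\<in>\<Phi>. P.prob (?E \<phi> x T))"
      using s \<Phi>(1) by (intro P.finite_measure_subadditive_finite) auto
    also have "\<dots> \<le> (\<Sum>\<phi>\<in>\<Phi>. K \<phi> * exp (- l * T))" using K T by (intro sum_mono) auto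
    also have "\<dots> = sum K \<Phi> * exp (- l * T)" by (simp add: sum_distrib_right)
    also have "\<dots> \<le> (sum K \<Phi> + 1) * exp (- l * T)" by (intro mult_right_mono) auto
    finally show "P.prob {\<omega> \<in> space (chain_law r p x). empirical_measure T \<omega> \<in> C} \<le> (sum K \<Phi> + 1) * exp (- l * T)" .
  qed
qed

theorem large_deviations_upper:
  assumes C: "closedin weak_topology C"
  shows "Limsup at_top (\<lambda>T::real. SUP x\<in>E1. ereal (1 / T) *
      log_ereal (measure (chain_law r p x) {\<omega> \<in> space (chain_law r p x). empirical_measure T \<omega> \<in> C}))
    \<le> - (INF \<mu>\<in>C. rate \<mu>)" (is "Limsup at_top ?f \<le> - ?I")
proof -
  have *: "Limsup at_top ?f \<le> ereal (- l)" if "ereal l < ?I" for l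
  proof -
    have "ereal l < rate \<mu>" if "\<mu> \<in> C" for \<mu> using \<open>ereal l < ?I\<close> that by (rule less_INF_D)
    from measure_closed_le[OF C this] obtain K where K: "K > 0" "\<forall>x T. 0 < T \<longrightarrow>
      measure (chain_law r p x) {\<omega> \<in> space (chain_law r p x). empirical_measure T \<omega> \<in> C} \<le> K * exp (- l * T)" by blast
    have "((\<lambda>T. ln K / T - l) \<longlongrightarrow> 0 - l) at_top"
      by (intro tendsto_diff tendsto_const real_tendsto_divide_at_top[OF tendsto_const] filterlim_ident)
    then have lim: "((\<lambda>T. ereal (ln K / T - l)) \<longlongrightarrow> ereal (- l)) at_top" by simp
    have "Limsup at_top ?f \<le> Limsup at_top (\<lambda>T. ereal (ln K / T - l))"
    proof (rule Limsup_mono)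
      show "\<forall>\<^sub>F T in at_top. ?f T \<le> ereal (ln K / T - l)"
        using eventually_gt_at_top[of 0]
        by eventually_elim (use K in \<open>auto intro!: SUP_least ereal_mult_log_le\<close>)
    qed
    also have "\<dots> = ereal (- l)" by (rule lim_imp_Limsup[OF _ lim]) simp
    finally show ?thesis .
  qed
  show ?thesis
  proof (rule ccontr)
    assume "\<not> ?thesis"
    then have "- ?I < Limsup at_top ?f" by simp
    then obtain m where m: "- ?I < ereal m" "ereal m < Limsup at_top ?f" using ereal_dense2 by blast
    have "ereal (- m) < ?I" using m(1) by (cases ?I) auto
    from *[OF this] m(2) show False by simp
  qed
qed

end

section \<open>Finite Markov chains\<close>

text \<open>The chain of labels under the tilt. A common lower bound \<open>\<gamma>\<close> on all
  entries is Doeblin's condition, available because every label is reached from every other in one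
  jump.\<close>

locale finite_markov =
  fixes L :: "'l set" and P :: "'l \<Rightarrow> 'l \<Rightarrow> real" and \<pi> :: "'l \<Rightarrow> real" and \<gamma> :: real
  assumes finite_L[simp]: "finite L" and L_nonempty: "L \<noteq> {}"
    and \<gamma>: "0 < \<gamma>" and P_ge: "\<And>i j. i \<in> L \<Longrightarrow> j \<in> L \<Longrightarrow> \<gamma> \<le> P i j"
    and P_sum: "\<And>i. i \<in> L \<Longrightarrow> (\<Sum>j\<in>L. P i j) = 1"
    and \<pi>_nonneg: "\<And>i. i \<in> L \<Longrightarrow> 0 \<le> \<pi> i" and \<pi>_sum: "(\<Sum>i\<in>L. \<pi> i) = 1"
    and invariant: "\<And>j. j \<in> L \<Longrightarrow> (\<Sum>i\<in>L. \<pi> i * P i j) = \<pi> j"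
begin

definition step :: "('l \<Rightarrow> real) \<Rightarrow> 'l \<Rightarrow> real" where
  "step u i = (\<Sum>j\<in>L. P i j * u j)"

lemma \<gamma>_le: "\<gamma> \<le> 1"
proof -
  obtain i where i: "i \<in> L" using L_nonempty by blast
  have "P i i \<le> (\<Sum>j\<in>L. P i j)"
    using i P_ge \<gamma> by (intro member_le_sum) (auto intro: order_trans[of 0 \<gamma>])
  then show ?thesis using P_ge[OF i i] P_sum[OF i] by linarith
qed

lemma P_nonneg: "i \<in> L \<Longrightarrow> j \<in> L \<Longrightarrow> 0 \<le> P i j"
  using P_ge[of i j] \<gamma> by linarith

text \<open>Each row gives weight at least \<open>\<gamma>\<close> to the label where
  \<open>u\<close> is minimal, so one step removes at least the fraction \<open>\<gamma>\<close> of
  the oscillation.\<close>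

lemma step_contracts:
  assumes u: "\<And>i. i \<in> L \<Longrightarrow> a \<le> u i \<and> u i \<le> a + s"
  shows "\<exists>a'. \<forall>i\<in>L. a' \<le> step u i \<and> step u i \<le> a' + (1 - \<gamma>) * s"
proof -
  obtain j0 where j0: "j0 \<in> L" "\<And>i. i \<in> L \<Longrightarrow> u j0 \<le> u i"
    using arg_min_if_finite[OF finite_L L_nonempty, of u] by (metis not_le)
  have "u j0 \<le> step u i \<and> step u i \<le> u j0 + (1 - \<gamma>) * s" if i: "i \<in> L" for i
  proof
    have "step u i - u j0 = (\<Sum>j\<in>L. P i j * (u j - u j0))"
      using P_sum[OF i] by (simp add: step_def right_diff_distrib sum_subtractf sum_distrib_right[symmetric])
    also have "\<dots> \<ge> 0" using P_nonneg[OF i] j0 by (intro sum_nonneg) auto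
    finally show "u j0 \<le> step u i" by simp
    have s: "u j \<le> u j0 + s" if "j \<in> L" for j using u[OF that] u[OF j0(1)] by linarith
    have "\<gamma> * s \<le> P i j0 * s" using P_ge[OF i j0(1)] s[OF j0(1)] by (intro mult_right_mono) auto
    also have "\<dots> = P i j0 * (u j0 + s - u j0)" by simp
    also have "\<dots> \<le> (\<Sum>j\<in>L. P i j * (u j0 + s - u j))"
    proof (rule member_le_sum[where f="\<lambda>j. P i j * (u j0 + s - u j)"])
      show "0 \<le> P i j * (u j0 + s - u j)" if "j \<in> L - {j0}" for j
        using P_nonneg[OF i, of j] s[of j] that by simp
    qed (use j0(1) in auto)
    also have "\<dots> = u j0 + s - step u i"
      using P_sum[OF i] by (simp add: step_def right_diff_distrib distrib_left sum_subtractf sum.distrib sum_distrib_right[symmetric])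
    finally show "step u i \<le> u j0 + (1 - \<gamma>) * s" by (simp add: algebra_simps)
  qed
  then show ?thesis by blast
qed

lemma step_mean: "(\<Sum>i\<in>L. \<pi> i * step u i) = (\<Sum>i\<in>L. \<pi> i * u i)"
proof -
  have "(\<Sum>i\<in>L. \<pi> i * step u i) = (\<Sum>j\<in>L. (\<Sum>i\<in>L. \<pi> i * P i j) * u j)"
    unfolding step_def sum_distrib_left sum_distrib_right by (subst sum.swap) (simp add: mult.assoc)
  then show ?thesis using invariant by simp
qed

text \<open>Partial sums of the Neumann series solve the Poisson equation up to the geometrically small
  oscillation of the iterates.\<close>

lemma approximate_Poisson:
  assumes \<epsilon>: "0 < \<epsilon>"
  shows "\<exists>h. \<forall>i\<in>L. \<bar>h i - step h i - (g i - (\<Sum>j\<in>L. \<pi> j * g j))\<bar> \<le> \<epsilon>"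
proof -
  define u where "u m = (step ^^ m) g" for m
  obtain B where B: "\<And>i. i \<in> L \<Longrightarrow> \<bar>g i\<bar> \<le> B" "0 \<le> B"
    using finite_imp_bounded[of "g ` L"] by (auto simp: bounded_pos intro: less_imp_le)
  have range: "\<exists>a. \<forall>i\<in>L. a \<le> u m i \<and> u m i \<le> a + (1 - \<gamma>)^m * (2 * B)" for m
  proof (induction m)
    case 0
    have "\<forall>i\<in>L. - B \<le> u 0 i \<and> u 0 i \<le> - B + (1 - \<gamma>)^0 * (2 * B)" using B(1) by (fastforce simp: u_def abs_le_iff)
    then show ?case by blast
  next
    case (Suc m)
    then obtain a where "\<forall>i\<in>L. a \<le> u m i \<and> u m i \<le> a + (1 - \<gamma>)^m * (2 * B)" by blast
    from step_contracts[of a "u m", OF this[rule_format]] show ?case by (simp add: u_def mult.assoc)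
  qed
  have mean: "(\<Sum>i\<in>L. \<pi> i * u m i) = (\<Sum>i\<in>L. \<pi> i * g i)" for m
    by (induction m) (auto simp: u_def step_mean)
  \<comment> \<open>The invariant mean is the same for all iterates and lies within their range, so
    each iterate is within its oscillation of the mean.\<close>
  have close: "\<bar>u m i - (\<Sum>j\<in>L. \<pi> j * g j)\<bar> \<le> (1 - \<gamma>)^m * (2 * B)" if i: "i \<in> L" for m i
  proof -
    obtain a where a: "\<And>i. i \<in> L \<Longrightarrow> a \<le> u m i" "\<And>i. i \<in> L \<Longrightarrow> u m i \<le> a + (1 - \<gamma>)^m * (2 * B)" using range[of m] by blast
    have "(\<Sum>j\<in>L. \<pi> j * a) \<le> (\<Sum>j\<in>L. \<pi> j * u m j)" using a \<pi>_nonneg by (intro sum_mono mult_left_mono) auto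
    moreover have "(\<Sum>j\<in>L. \<pi> j * u m j) \<le> (\<Sum>j\<in>L. \<pi> j * (a + (1 - \<gamma>)^m * (2 * B)))" using a \<pi>_nonneg by (intro sum_mono mult_left_mono) auto
    ultimately show ?thesis using a[OF i] unfolding mean sum_distrib_right[symmetric] \<pi>_sum mult_1_left by linarith
  qed
  have "(\<lambda>m. (1 - \<gamma>)^m * (2 * B)) \<longlonglongrightarrow> 0 * (2 * B)"
    using \<gamma> \<gamma>_le by (intro tendsto_mult_right LIMSEQ_power_zero) auto
  then have "\<forall>\<^sub>F m in sequentially. (1 - \<gamma>)^m * (2 * B) < \<epsilon>" using \<epsilon> by (intro order_tendstoD(2)) auto
  then obtain N where N: "(1 - \<gamma>)^N * (2 * B) < \<epsilon>" by (auto simp: eventually_sequentially)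
  define h where "h i = (\<Sum>m<N. u m i)" for i
  have "step h i = (\<Sum>m<N. u (Suc m) i)" for i
    unfolding step_def h_def sum_distrib_left by (subst sum.swap) (simp add: u_def step_def)
  then have "h i - step h i = u 0 i - u N i" for i
    using sum_lessThan_telescope'[of "\<lambda>m. u m i" N] by (simp add: h_def sum_subtractf)
  then have "\<bar>h i - step h i - (g i - (\<Sum>j\<in>L. \<pi> j * g j))\<bar> \<le> \<epsilon>" if "i \<in> L" for i
    using close[OF that, of N] N by (simp add: u_def abs_minus_commute)
  then show ?thesis by blast
qed

end

text \<open>Stationarity of the minimiser says that the weights \<open>w i j e\<^sup>\<phi>\<^sup>j\<^sup>-\<^sup>\<phi>\<^sup>i\<close> form a circulation.\<close>

lemma exponential_tilt_balanced:
  fixes w :: "'l \<Rightarrow> 'l \<Rightarrow> real"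
  assumes L: "finite L" "L \<noteq> {}" and w: "\<And>i j. i \<in> L \<Longrightarrow> j \<in> L \<Longrightarrow> 0 < w i j"
  defines "F \<equiv> \<lambda>\<phi>. \<Sum>i\<in>L. \<Sum>j\<in>L. w i j * exp (\<phi> j - \<phi> i)"
  obtains \<phi> where "\<And>\<psi>. F \<phi> \<le> F \<psi>"
    "\<And>l. l \<in> L \<Longrightarrow> (\<Sum>i\<in>L. w i l * exp (\<phi> l - \<phi> i)) = (\<Sum>j\<in>L. w l j * exp (\<phi> j - \<phi> l))"
proof -
  obtain i0 where i0: "i0 \<in> L" using L by blast
  define m where "m = Min ((\<lambda>(i, j). w i j) ` (L \<times> L))"
  have m_le: "m \<le> w i j" if "i \<in> L" "j \<in> L" for i j
    unfolding m_def using L that by (intro Min_le) auto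
  have m0: "0 < m" unfolding m_def using L w by (subst Min_gr_iff) auto
  \<comment> \<open>Chosen so that \<open>m * exp b\<close> is the value of \<open>F\<close> at 0:
    if \<open>\<psi>\<close> at some label differs from its value at \<open>i0\<close> by more than
    \<open>b\<close>, one of the two terms linking that label with \<open>i0\<close> is already at
    least the value at 0.\<close>
  define b where "b = ln (F (\<lambda>_. 0) / m)"
  have nn: "0 \<le> w i j * exp (\<phi> j - \<phi> i)" if "i \<in> L" "j \<in> L" for \<phi> i j
    using w[OF that] by simp
  have F_ge: "w i j * exp (\<phi> j - \<phi> i) \<le> F \<phi>" if "i \<in> L" "j \<in> L" for \<phi> i j
  proof -
    have "w i j * exp (\<phi> j - \<phi> i) \<le> (\<Sum>j\<in>L. w i j * exp (\<phi> j - \<phi> i))"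
      using L that by (intro member_le_sum[where f="\<lambda>j. w i j * exp (\<phi> j - \<phi> i)"]) (auto intro: nn)
    also have "\<dots> \<le> F \<phi>" unfolding F_def
      using L that by (intro member_le_sum[where f="\<lambda>i. \<Sum>j\<in>L. w i j * exp (\<phi> j - \<phi> i)"]) (auto intro!: sum_nonneg nn)
    finally show ?thesis .
  qed
  have F0: "0 < F (\<lambda>_. 0)" "m \<le> F (\<lambda>_. 0)"
    using F_ge[OF i0 i0, of "\<lambda>_. 0"] w[OF i0 i0] m_le[OF i0 i0] by auto
  have b0: "0 \<le> b" unfolding b_def using F0 m0 by (intro ln_ge_zero) (simp add: le_divide_eq)
  have eb: "m * exp b = F (\<lambda>_. 0)" using F0 m0 by (simp add: b_def)
  \<comment> \<open>\<open>F\<close> is unchanged by adding a constant, so the value at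
    \<open>i0\<close> is fixed to 0; values outside \<open>L\<close> are fixed as well, which makes
    the box compact in the full function space.\<close>
  define S where "S i = (if i \<in> L - {i0} then {-b..b} else {0::real})" for i
  have "compactin (product_topology (\<lambda>_. euclidean) UNIV) (PiE UNIV S)"
    by (subst compactin_PiE) (auto simp: S_def)
  then have comp: "compact (PiE UNIV S)" by (simp add: euclidean_product_topology)
  have cont: "continuous_on (PiE UNIV S) F"
    unfolding F_def by (intro continuous_intros continuous_on_subset[OF continuous_on_product_coordinates subset_UNIV])
  have z: "(\<lambda>_. 0) \<in> PiE UNIV S" using b0 by (auto simp: S_def)
  then obtain \<phi> where \<phi>: "\<phi> \<in> PiE UNIV S" "\<And>\<psi>. \<psi> \<in> PiE UNIV S \<Longrightarrow> F \<phi> \<le> F \<psi>"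
    using continuous_attains_inf[OF comp _ cont] by blast
  have min: "F \<phi> \<le> F \<psi>" for \<psi>
  proof -
    define \<psi>' where "\<psi>' i = (if i \<in> L then \<psi> i - \<psi> i0 else 0)" for i
    have eq: "F \<psi>' = F \<psi>" unfolding F_def by (intro sum.cong refl) (simp add: \<psi>'_def)
    show ?thesis
    proof (cases "\<psi>' \<in> PiE UNIV S")
      case True then show ?thesis using \<phi>(2) eq by metis
    next
      case False
      then obtain i where "\<psi>' i \<notin> S i" by auto
      then have i: "i \<in> L" "\<psi>' i < -b \<or> b < \<psi>' i" by (auto simp: S_def \<psi>'_def split: if_splits)
      have "F (\<lambda>_. 0) \<le> F \<psi>"
        using i(2)
      proof
        assume "b < \<psi>' i"
        then have "m * exp b \<le> w i0 i * exp (\<psi> i - \<psi> i0)"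
          using i m_le[OF i0 i(1)] m0 by (intro mult_mono) (auto simp: \<psi>'_def)
        then show ?thesis using F_ge[OF i0 i(1), of \<psi>] eb by linarith
      next
        assume "\<psi>' i < -b"
        then have "m * exp b \<le> w i i0 * exp (\<psi> i0 - \<psi> i)"
          using i m_le[OF i(1) i0] m0 by (intro mult_mono) (auto simp: \<psi>'_def)
        then show ?thesis using F_ge[OF i(1) i0, of \<psi>] eb by linarith
      qed
      then show ?thesis using \<phi>(2)[OF z] by linarith
    qed
  qed
  have "(\<Sum>i\<in>L. w i l * exp (\<phi> l - \<phi> i)) = (\<Sum>j\<in>L. w l j * exp (\<phi> j - \<phi> l))" if l: "l \<in> L" for l
  proof -
    let ?e = "\<lambda>j. if j = l then 1 else 0 :: real"
    let ?\<phi> = "\<lambda>t j. \<phi> j + ?e j * t"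
    let ?D = "\<Sum>i\<in>L. \<Sum>j\<in>L. w i j * exp (\<phi> j - \<phi> i) * (?e j - ?e i)"
    \<comment> \<open>The single coordinate \<open>l\<close> is moved: terms into \<open>l\<close>
      grow, terms out of \<open>l\<close> shrink, and at the minimum the two totals agree.\<close>
    have "((\<lambda>t. F (?\<phi> t)) has_real_derivative ?D) (at 0)"
      unfolding F_def by (auto intro!: derivative_eq_intros sum.cong)
    then have "?D = 0"
      by (rule DERIV_local_min[of _ _ _ 1]) (auto simp: min)
    then have "(\<Sum>i\<in>L. \<Sum>j\<in>L. w i j * exp (\<phi> j - \<phi> i) * ?e j) = (\<Sum>i\<in>L. \<Sum>j\<in>L. w i j * exp (\<phi> j - \<phi> i) * ?e i)"
      by (simp add: right_diff_distrib sum_subtractf)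
    moreover have "(\<Sum>i\<in>L. \<Sum>j\<in>L. w i j * exp (\<phi> j - \<phi> i) * ?e j) = (\<Sum>i\<in>L. w i l * exp (\<phi> l - \<phi> i))"
      using L l by (intro sum.cong refl) (simp add: if_distrib[of "\<lambda>x. _ * x"] cong: if_cong)
    moreover have "(\<Sum>i\<in>L. \<Sum>j\<in>L. w i j * exp (\<phi> j - \<phi> i) * ?e i) = (\<Sum>j\<in>L. w l j * exp (\<phi> j - \<phi> l))"
      using L l by (subst sum.swap, intro sum.cong refl) (simp add: if_distrib[of "\<lambda>x. _ * x"] cong: if_cong)
    ultimately show ?thesis by simp
  qed
  with min show thesis by (rule that)
qed

section \<open>Tilted chains\<close>

lemma exponential_moments:
  assumes "0 < a"
  shows "has_bochner_integral lborel (\<lambda>t. exponential_density a t) 1"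
    "has_bochner_integral lborel (\<lambda>t. exponential_density a t * t) (1 / a)"
    "(\<integral>\<^sup>+t. ennreal (exponential_density a t * t\<^sup>2) \<partial>lborel) = ennreal (2 / a\<^sup>2)"
proof -
  have nn: "0 \<le> exponential_density a t * t ^ k" for t k
    using assms by (cases "t < 0") (auto simp: exponential_density_def)
  have m: "(\<integral>\<^sup>+t. ennreal (exponential_density a t * t ^ k) \<partial>lborel) = ennreal (fact k / a ^ k)" for k
    using nn_integral_erlang_ith_moment[OF assms, of 0 k] by simp
  have "has_bochner_integral lborel (\<lambda>t. exponential_density a t * t ^ k) (fact k / a ^ k)" for k
    using assms nn by (intro has_bochner_integral_nn_integral m) auto
  from this[of 0] this[of 1] m[of 2] show "has_bochner_integral lborel (\<lambda>t. exponential_density a t) 1"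
    "has_bochner_integral lborel (\<lambda>t. exponential_density a t * t) (1 / a)"
    "(\<integral>\<^sup>+t. ennreal (exponential_density a t * t\<^sup>2) \<partial>lborel) = ennreal (2 / a\<^sup>2)"
    by (simp_all add: fact_2)
qed

lemma (in jump_chain) measurable_holding_integral:
  assumes "H \<in> borel_measurable visit_space"
  shows "(\<lambda>y. \<integral>\<^sup>+t. H (y, t) \<partial>holding_time (r y)) \<in> borel_measurable borel"
proof -
  have "(\<lambda>y. \<integral>\<^sup>+\<zeta>. H \<zeta> \<partial>visit r y) \<in> borel_measurable borel"
    by (rule measurable_compose[OF measurable_prob_algebraD[OF measurable_visit[OF r_measurable r_nonneg]]
      nn_integral_measurable_subprob_algebra[OF assms]])
  then show ?thesis by (simp add: nn_integral_visit[OF assms])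
qed

section \<open>Kernel of the tilted chain and its finite skeleton\<close>

text \<open>The data of a tilt, detached from the way they are chosen. Labels are points of the
  space assigned by \<open>\<iota>\<close>, \<open>Q\<close> is a discretised kernel below
  \<open>q\<close>, and \<open>balanced\<close> says that the flows from \<open>i\<close> to
  \<open>l\<close> form a circulation. \<open>l0\<close> is a fictitious label for the starting
  point.\<close>

locale tilted_chain = density_chain r p lam q for r :: "'a::polish_space \<Rightarrow> real" and p lam q +
  fixes L :: "'a set" and \<iota> :: "'a \<Rightarrow> 'a" and D :: "'a set" and \<delta> :: real
    and Q :: "'a \<Rightarrow> 'a \<Rightarrow> real" and \<phi> \<beta> :: "'a \<Rightarrow> real" and l0 :: 'a
  assumes finite_labels[simp]: "finite L" and l0: "l0 \<in> L"
    and \<iota>_measurable[measurable]: "\<iota> \<in> borel \<rightarrow>\<^sub>M count_space L"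
    and D_sets[measurable]: "D \<in> sets borel" and \<delta>: "0 < \<delta>" and r_ge: "\<And>y. y \<in> D \<Longrightarrow> \<delta> \<le> r y"
    and Q_pos: "\<And>i j. i \<in> L \<Longrightarrow> j \<in> L \<Longrightarrow> 0 < Q i j" and Q_le: "\<And>x y. Q (\<iota> x) (\<iota> y) \<le> q x y"
    and cell_pos: "\<And>j. j \<in> L \<Longrightarrow> 0 < measure lam {y \<in> D. \<iota> y = j}"
    and \<beta>_pos: "\<And>i. i \<in> L \<Longrightarrow> 0 < \<beta> i"
    and balanced: "\<And>l. l \<in> L \<Longrightarrow> (\<Sum>i\<in>L. \<beta> i * Q i l * measure lam {y \<in> D. \<iota> y = l} * exp (\<phi> l - \<phi> i)) =
      (\<Sum>j\<in>L. \<beta> l * Q l j * measure lam {y \<in> D. \<iota> y = j} * exp (\<phi> j - \<phi> l))"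
begin

abbreviation "cell j \<equiv> {y \<in> D. \<iota> y = j}"
abbreviation "mass j \<equiv> measure lam (cell j)"

lemma \<iota>_in: "\<iota> x \<in> L"
  using measurable_space[OF \<iota>_measurable, of x] by simp

lemma measurable_label[measurable (raw)]: "(\<lambda>x. h (\<iota> (f x))) \<in> borel_measurable M" if [measurable]: "f \<in> borel_measurable M"
proof -
  have "(\<lambda>x. \<iota> (f x)) \<in> M \<rightarrow>\<^sub>M count_space L" by measurable
  then show ?thesis by (rule measurable_compose) simp
qed

lemma cell_sets[measurable]: "cell j \<in> sets borel"
proof -
  have "(\<lambda>y. if \<iota> y = j then 1 else 0 :: real) \<in> borel_measurable borel"
    by (rule measurable_label[where h="\<lambda>l. if l = j then 1 else 0" and f="\<lambda>x. x"]) simp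
  from measurable_sets[OF this, of "{1}"] have "{y. \<iota> y = j} \<in> sets borel" by (simp add: vimage_def)
  then have "{y. \<iota> y = j} \<inter> D \<in> sets borel" by simp
  then show ?thesis by (simp add: Int_def conj_commute)
qed

text \<open>The total tilted weight out of label \<open>i\<close>. It plays two roles: it normalises
  the transition probabilities, and it is the factor by which the clocks in the cell are
  accelerated.\<close>

definition \<rho> where "\<rho> i = (\<Sum>j\<in>L. Q i j * mass j * exp (\<phi> j - \<phi> i))"
definition trans_prob where "trans_prob i j = Q i j * mass j * exp (\<phi> j - \<phi> i) / \<rho> i"
definition Z where "Z = (\<Sum>i\<in>L. \<beta> i * \<rho> i)"
definition stat where "stat i = \<beta> i * \<rho> i / Z"

lemma \<rho>_pos: "i \<in> L \<Longrightarrow> 0 < \<rho> i"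
  unfolding \<rho>_def using Q_pos cell_pos l0 by (intro sum_pos) auto

lemma Z_pos: "0 < Z"
  unfolding Z_def using \<beta>_pos \<rho>_pos l0 by (intro sum_pos) auto

text \<open>\<open>stat\<close> is invariant because \<open>stat i * trans_prob i j\<close> is, up
  to \<open>Z\<close>, the flow from \<open>i\<close> to \<open>j\<close>: \<open>balanced\<close>
  equates inflow and outflow, and the outflow of \<open>j\<close> is
  \<open>\<beta> j * \<rho> j\<close>.\<close>

sublocale labels: finite_markov L trans_prob stat "Min ((\<lambda>(i, j). trans_prob i j) ` (L \<times> L))"
proof
  have tp: "0 < trans_prob i j" if "i \<in> L" "j \<in> L" for i j
    unfolding trans_prob_def using that Q_pos cell_pos \<rho>_pos by simp
  show "0 < Min ((\<lambda>(i, j). trans_prob i j) ` (L \<times> L))" using l0 tp by (subst Min_gr_iff) auto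
  show "Min ((\<lambda>(i, j). trans_prob i j) ` (L \<times> L)) \<le> trans_prob i j" if "i \<in> L" "j \<in> L" for i j
    using that by (intro Min_le) auto
  show "(\<Sum>j\<in>L. trans_prob i j) = 1" if "i \<in> L" for i
    using \<rho>_pos[OF that] by (simp add: trans_prob_def sum_divide_distrib[symmetric] \<rho>_def)
  show "0 \<le> stat i" if "i \<in> L" for i
    using \<rho>_pos[OF that] \<beta>_pos[OF that] Z_pos by (simp add: stat_def)
  show "(\<Sum>i\<in>L. stat i) = 1"
    using Z_pos by (simp add: stat_def sum_divide_distrib[symmetric] Z_def)
  show "(\<Sum>i\<in>L. stat i * trans_prob i j) = stat j" if j: "j \<in> L" for j
  proof -
    have "(\<Sum>i\<in>L. stat i * trans_prob i j) = (\<Sum>i\<in>L. \<beta> i * Q i j * mass j * exp (\<phi> j - \<phi> i) / Z)"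
      using \<rho>_pos[THEN less_imp_neq] by (intro sum.cong refl) (fastforce simp: stat_def trans_prob_def)
    also have "\<dots> = stat j"
      using balanced[OF j] by (simp add: sum_divide_distrib[symmetric] stat_def \<rho>_def sum_distrib_left mult.assoc)
    finally show ?thesis .
  qed
qed (use l0 in auto)

definition tilt where "tilt i y = (if y \<in> D then Q i (\<iota> y) * exp (\<phi> (\<iota> y) - \<phi> i) / \<rho> i else 0)"

lemma measurable_tilt[measurable]: "tilt i \<in> borel_measurable borel"
proof -
  have [measurable]: "(\<lambda>y. Q i (\<iota> y) * exp (\<phi> (\<iota> y) - \<phi> i) / \<rho> i) \<in> borel_measurable borel"
    by (rule measurable_label[where h="\<lambda>j. Q i j * exp (\<phi> j - \<phi> i) / \<rho> i" and f="\<lambda>x. x"]) simp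
  show ?thesis unfolding tilt_def[abs_def] by measurable
qed

lemma tilt_nonneg: "i \<in> L \<Longrightarrow> 0 \<le> tilt i y"
  using Q_pos[OF _ \<iota>_in, of i y] \<rho>_pos[of i] by (auto simp: tilt_def)

lemma tilt_integral:
  assumes [measurable]: "u \<in> borel_measurable borel" and B: "\<And>y. y \<in> D \<Longrightarrow> \<bar>u y\<bar> \<le> B"
  shows "(\<integral>y. tilt i y * u y \<partial>lam) = (\<Sum>j\<in>L. Q i j * exp (\<phi> j - \<phi> i) / \<rho> i * (\<integral>y. indicator (cell j) y * u y \<partial>lam))"
    "integrable lam (\<lambda>y. indicator (cell j) y * u y)"
proof -
  show i: "integrable lam (\<lambda>y. indicator (cell j) y * u y)" for j
  proof (rule lam.integrable_const_bound[of _ "\<bar>B\<bar>"])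
    show "AE y in lam. norm (indicator (cell j) y * u y) \<le> \<bar>B\<bar>"
      using B by (intro AE_I2) (auto simp: indicator_def intro: order_trans[OF _ abs_ge_self])
  qed measurable
  have "tilt i y * u y = (\<Sum>j\<in>L. Q i j * exp (\<phi> j - \<phi> i) / \<rho> i * (indicator (cell j) y * u y))" for y
  proof (cases "y \<in> D")
    case True
    have "(\<Sum>j\<in>L. Q i j * exp (\<phi> j - \<phi> i) / \<rho> i * (indicator (cell j) y * u y)) =
      (\<Sum>j\<in>L. if j = \<iota> y then Q i j * exp (\<phi> j - \<phi> i) / \<rho> i * u y else 0)"
      using True by (intro sum.cong) (auto simp: indicator_def)
    also have "\<dots> = tilt i y * u y" using True \<iota>_in[of y] by (simp add: tilt_def)
    finally show ?thesis by simp
  qed (simp add: tilt_def)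
  then show "(\<integral>y. tilt i y * u y \<partial>lam) = (\<Sum>j\<in>L. Q i j * exp (\<phi> j - \<phi> i) / \<rho> i * (\<integral>y. indicator (cell j) y * u y \<partial>lam))"
    using i by (simp add: Bochner_Integration.integral_sum)
qed

lemma tilt_mean_1: "i \<in> L \<Longrightarrow> (\<integral>y. tilt i y \<partial>lam) = 1"
  using tilt_integral(1)[of "\<lambda>_. 1" 1 i] \<rho>_pos[of i]
  by (simp add: sum_divide_distrib[symmetric] \<rho>_def mult_ac)

lemma tilt_bounded: obtains B where "\<And>y. \<bar>tilt i y\<bar> \<le> B"
proof -
  have "\<bar>tilt i y\<bar> \<le> (\<Sum>j\<in>L. \<bar>Q i j * exp (\<phi> j - \<phi> i) / \<rho> i\<bar>)" for y
    using member_le_sum[of "\<iota> y" L "\<lambda>j. \<bar>Q i j * exp (\<phi> j - \<phi> i) / \<rho> i\<bar>"] \<iota>_in[of y]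
    by (auto simp: tilt_def intro!: sum_nonneg)
  then show thesis by (rule that)
qed

lemma nn_tilt_mean_1: "i \<in> L \<Longrightarrow> (\<integral>\<^sup>+y. ennreal (tilt i y) \<partial>lam) = 1"
proof -
  assume i: "i \<in> L"
  obtain B where B: "\<And>y. \<bar>tilt i y\<bar> \<le> B" using tilt_bounded[of i] by blast
  have "integrable lam (tilt i)" by (rule lam.integrable_const_bound[of _ B]) (use B in auto)
  then show ?thesis using tilt_mean_1[OF i] tilt_nonneg[OF i] by (subst nn_integral_eq_integral) auto
qed

text \<open>The law of the next visit of the tilted chain from a state with label \<open>i\<close>: the exponential
  clock of a state \<open>y\<close> is accelerated by \<open>\<rho> (\<iota> y)\<close>.\<close>

definition kernel_density where
  "kernel_density i \<xi> = tilt i (fst \<xi>) * exponential_density (r (fst \<xi>) * \<rho> (\<iota> (fst \<xi>))) (snd \<xi>)"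
definition kernel :: "'a \<Rightarrow> ('a \<times> real) measure" where
  "kernel i = density (lam \<Otimes>\<^sub>M lborel) (\<lambda>\<xi>. ennreal (kernel_density i \<xi>))"

lemma measurable_kernel_density[measurable]: "kernel_density i \<in> borel_measurable (borel \<Otimes>\<^sub>M borel)"
proof -
  have [measurable]: "(\<lambda>\<xi>. \<rho> (\<iota> (fst \<xi>))) \<in> borel_measurable (borel \<Otimes>\<^sub>M borel :: ('a \<times> real) measure)"
    by (rule measurable_label) simp
  show ?thesis unfolding kernel_density_def[abs_def] exponential_density_def by measurable
qed

lemma sets_kernel[measurable_cong]: "sets (kernel i) = sets (borel \<Otimes>\<^sub>M borel)"
  unfolding kernel_def sets_density by (rule sets_pair_measure_cong) simp_all

lemma space_kernel [simp]: "space (kernel i) = UNIV"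
  by (simp add: kernel_def space_pair_measure)

lemma rate_pos: "y \<in> D \<Longrightarrow> 0 < r y * \<rho> (\<iota> y)"
  using r_ge[of y] \<delta> \<rho>_pos[OF \<iota>_in, of y] by simp

lemma kernel_density_nonneg: "i \<in> L \<Longrightarrow> 0 \<le> kernel_density i \<xi>"
  unfolding kernel_density_def
  by (intro mult_nonneg_nonneg tilt_nonneg erlang_density_nonneg r_nonneg less_imp_le[OF \<rho>_pos[OF \<iota>_in]])

lemma nn_integral_kernel:
  assumes [measurable]: "F \<in> borel_measurable (borel \<Otimes>\<^sub>M borel)"
  shows "(\<integral>\<^sup>+\<xi>. F \<xi> \<partial>kernel i) = (\<integral>\<^sup>+y. (\<integral>\<^sup>+t. ennreal (kernel_density i (y, t)) * F (y, t) \<partial>lborel) \<partial>lam)"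
proof -
  have "(\<integral>\<^sup>+\<xi>. F \<xi> \<partial>kernel i) = (\<integral>\<^sup>+\<xi>. ennreal (kernel_density i \<xi>) * F \<xi> \<partial>(lam \<Otimes>\<^sub>M lborel))"
    unfolding kernel_def by (rule nn_integral_density) measurable
  also have "\<dots> = (\<integral>\<^sup>+y. (\<integral>\<^sup>+t. ennreal (kernel_density i (y, t)) * F (y, t) \<partial>lborel) \<partial>lam)"
    by (rule lborel.nn_integral_fst[symmetric]) measurable
  finally show ?thesis .
qed

lemma prob_space_kernel: assumes i: "i \<in> L" shows "prob_space (kernel i)"
proof
  have "emeasure (kernel i) (space (kernel i)) = (\<integral>\<^sup>+\<xi>. 1 \<partial>kernel i)" by simp
  also have "\<dots> = (\<integral>\<^sup>+y. (\<integral>\<^sup>+t. ennreal (kernel_density i (y, t)) * 1 \<partial>lborel) \<partial>lam)"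
    by (rule nn_integral_kernel) simp
  also have "\<dots> = (\<integral>\<^sup>+y. ennreal (tilt i y) \<partial>lam)"
  proof (intro nn_integral_cong)
    fix y
    show "(\<integral>\<^sup>+t. ennreal (kernel_density i (y, t)) * 1 \<partial>lborel) = ennreal (tilt i y)"
    proof (cases "y \<in> D")
      case True
      then show ?thesis
        using tilt_nonneg[OF i, of y] rate_pos[OF True]
        by (simp add: kernel_density_def ennreal_mult' nn_integral_cmult nn_integral_exponential_density)
    qed (simp add: kernel_density_def tilt_def)
  qed
  also have "\<dots> = 1" by (rule nn_tilt_mean_1[OF i])
  finally show "emeasure (kernel i) (space (kernel i)) = 1" .
qed

lemma AE_kernel_nonneg: "AE \<xi> in kernel i. 0 \<le> snd \<xi>"
  unfolding kernel_def
  by (subst AE_density) (auto simp: kernel_density_def exponential_density_def)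

text \<open>On \<open>D\<close> every clock of the tilted chain rings at rate at least
  \<open>\<delta> * m\<close>, which bounds the second moment of the holding time by
  \<open>2 / (\<delta> * m)^2\<close>. The weak law rests on this.\<close>

lemma kernel_square_integrable:
  assumes i: "i \<in> L"
  shows "integrable (kernel i) (\<lambda>\<xi>. (snd \<xi>)\<^sup>2)"
proof (rule integrableI_nonneg)
  define m where "m = Min (\<rho> ` L)"
  have m: "0 < m" unfolding m_def using \<rho>_pos l0 by (subst Min_gr_iff) auto
  have mle: "m \<le> \<rho> j" if "j \<in> L" for j unfolding m_def using that by (intro Min_le) auto
  have "(\<integral>\<^sup>+\<xi>. ennreal ((snd \<xi>)\<^sup>2) \<partial>kernel i) = (\<integral>\<^sup>+y. (\<integral>\<^sup>+t. ennreal (kernel_density i (y, t)) * ennreal (t\<^sup>2) \<partial>lborel) \<partial>lam)"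
    by (subst nn_integral_kernel) auto
  also have "\<dots> \<le> (\<integral>\<^sup>+y. ennreal (tilt i y) * ennreal (2 / (\<delta> * m)\<^sup>2) \<partial>lam)"
  proof (intro nn_integral_mono)
    fix y
    show "(\<integral>\<^sup>+t. ennreal (kernel_density i (y, t)) * ennreal (t\<^sup>2) \<partial>lborel) \<le> ennreal (tilt i y) * ennreal (2 / (\<delta> * m)\<^sup>2)"
    proof (cases "y \<in> D")
      case True
      let ?a = "r y * \<rho> (\<iota> y)"
      have "(\<integral>\<^sup>+t. ennreal (kernel_density i (y, t)) * ennreal (t\<^sup>2) \<partial>lborel) =
          (\<integral>\<^sup>+t. ennreal (tilt i y) * ennreal (exponential_density ?a t * t\<^sup>2) \<partial>lborel)"
        using tilt_nonneg[OF i, of y]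
        by (intro nn_integral_cong) (simp add: kernel_density_def ennreal_mult'[symmetric] ennreal_mult''[symmetric] mult.assoc)
      also have "\<dots> = ennreal (tilt i y) * ennreal (2 / ?a\<^sup>2)"
        using exponential_moments(3)[OF rate_pos[OF True]] by (subst nn_integral_cmult) auto
      also have "\<dots> \<le> ennreal (tilt i y) * ennreal (2 / (\<delta> * m)\<^sup>2)"
      proof -
        have "\<delta> * m \<le> ?a" using r_ge[OF True] mle[OF \<iota>_in] m \<delta> by (intro mult_mono) auto
        then have "(\<delta> * m)\<^sup>2 \<le> ?a\<^sup>2" using m \<delta> by (intro power_mono) auto
        then have "2 / ?a\<^sup>2 \<le> 2 / (\<delta> * m)\<^sup>2" using m \<delta> by (intro frac_le) auto
        then show ?thesis by (intro mult_left_mono ennreal_leI) auto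
      qed
      finally show ?thesis .
    qed (simp add: kernel_density_def tilt_def)
  qed
  also have "\<dots> = ennreal (2 / (\<delta> * m)\<^sup>2)"
    by (subst nn_integral_multc) (auto simp: nn_tilt_mean_1[OF i])
  also have "\<dots> < \<infinity>" by simp
  finally show "(\<integral>\<^sup>+\<xi>. ennreal ((snd \<xi>)\<^sup>2) \<partial>kernel i) < \<infinity>" .
qed auto

text \<open>These integrands are the increments of the weak law: the time integral of
  \<open>\<psi>\<close> over a visit plus a corrector that depends on the label.\<close>

lemma kernel_affine_integrable:
  fixes h :: "'a \<Rightarrow> real"
  assumes i: "i \<in> L" and [measurable]: "\<psi> \<in> borel_measurable borel" and B: "\<And>y. \<bar>\<psi> y\<bar> \<le> B"
  defines "f \<equiv> \<lambda>\<xi>. snd \<xi> * \<psi> (fst \<xi>) + h (\<iota> (fst \<xi>))"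
  shows "integrable (kernel i) f" "integrable (kernel i) (\<lambda>\<xi>. (f \<xi> - c)\<^sup>2)"
proof -
  interpret K: prob_space "kernel i" by (rule prob_space_kernel[OF i])
  have [measurable]: "(\<lambda>\<xi>. h (\<iota> (fst \<xi>))) \<in> borel_measurable (borel \<Otimes>\<^sub>M borel :: ('a \<times> real) measure)"
    by (rule measurable_label) simp
  have [measurable]: "f \<in> borel_measurable (kernel i)" unfolding f_def by measurable
  define H where "H = (\<Sum>j\<in>L. \<bar>h j\<bar>)"
  have H: "\<bar>h (\<iota> y)\<bar> \<le> H" for y
    unfolding H_def using \<iota>_in by (intro member_le_sum[where f="\<lambda>j. \<bar>h j\<bar>"]) auto
  have sq: "(f \<xi> - c)\<^sup>2 \<le> 2 * (B\<^sup>2 * (snd \<xi>)\<^sup>2 + (H + \<bar>c\<bar>)\<^sup>2)" for \<xi> c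
  proof -
    let ?a = "snd \<xi> * \<psi> (fst \<xi>)" and ?b = "h (\<iota> (fst \<xi>)) - c"
    have "(f \<xi> - c)\<^sup>2 = (?a + ?b)\<^sup>2" by (simp add: f_def algebra_simps)
    also have "\<dots> \<le> 2 * (?a\<^sup>2 + ?b\<^sup>2)" using sum_squares_bound[of ?a ?b] by (simp add: power2_sum)
    also have "?a\<^sup>2 \<le> B\<^sup>2 * (snd \<xi>)\<^sup>2"
      using B[of "fst \<xi>"] abs_ge_zero[of "\<psi> (fst \<xi>)"] power_mono[of "\<bar>\<psi> (fst \<xi>)\<bar>" B 2]
      by (simp add: power_mult_distrib mult.commute[of "B\<^sup>2"] mult_left_mono)
    also have "?b\<^sup>2 \<le> (H + \<bar>c\<bar>)\<^sup>2"
      using H[of "fst \<xi>"] power_mono[of "\<bar>?b\<bar>" "H + \<bar>c\<bar>" 2] by simp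
    finally show ?thesis by simp
  qed
  show s: "integrable (kernel i) (\<lambda>\<xi>. (f \<xi> - c)\<^sup>2)" for c
  proof (rule Bochner_Integration.integrable_bound)
    show "integrable (kernel i) (\<lambda>\<xi>. 2 * (B\<^sup>2 * (snd \<xi>)\<^sup>2 + (H + \<bar>c\<bar>)\<^sup>2))"
      using kernel_square_integrable[OF i] by simp
    show "AE \<xi> in kernel i. norm ((f \<xi> - c)\<^sup>2) \<le> norm (2 * (B\<^sup>2 * (snd \<xi>)\<^sup>2 + (H + \<bar>c\<bar>)\<^sup>2))"
      using sq[of _ c] by (intro AE_I2) (auto intro: order_trans[OF _ abs_ge_self])
  qed measurable
  show "integrable (kernel i) f"
  proof (rule Bochner_Integration.integrable_bound)
    show "integrable (kernel i) (\<lambda>\<xi>. 1 + (f \<xi> - 0)\<^sup>2)" using s[of 0] by simp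
    have "\<bar>x\<bar> \<le> 1 + x\<^sup>2" for x :: real
      using sum_squares_bound[of 1 "\<bar>x\<bar>"] by (auto simp: power2_eq_square)
    then show "AE \<xi> in kernel i. norm (f \<xi>) \<le> norm (1 + (f \<xi> - 0)\<^sup>2)"
      by (intro AE_I2) (auto intro: order_trans[OF _ abs_ge_self])
  qed measurable
qed

text \<open>The expected time integral of \<open>\<psi>\<close> over a visit to cell
  \<open>j\<close>: the state is distributed as \<open>lam\<close> conditioned on the cell and is
  held for a mean time \<open>1 / (r y * \<rho> j)\<close>.\<close>

definition cell_mean where
  "cell_mean \<psi> j = (\<integral>y. indicator (cell j) y * (\<psi> y / r y) \<partial>lam) / (mass j * \<rho> j)"

text \<open>Given the next label \<open>j\<close>, the next state is distributed as
  \<open>lam\<close> conditioned on cell \<open>j\<close>, whatever \<open>i\<close> is. Hence means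
  under the kernel reduce to means under the finite chain of labels.\<close>

lemma kernel_mean:
  assumes i: "i \<in> L" and [measurable]: "\<psi> \<in> borel_measurable borel" and B: "\<And>y. \<bar>\<psi> y\<bar> \<le> B"
  shows "(\<integral>\<xi>. snd \<xi> * \<psi> (fst \<xi>) + h (\<iota> (fst \<xi>)) \<partial>kernel i) = (\<Sum>j\<in>L. trans_prob i j * (cell_mean \<psi> j + h j))"
proof -
  let ?f = "\<lambda>\<xi>. snd \<xi> * \<psi> (fst \<xi>) + h (\<iota> (fst \<xi>))"
  have [measurable]: "(\<lambda>\<xi>. h (\<iota> (fst \<xi>))) \<in> borel_measurable (borel \<Otimes>\<^sub>M borel :: ('a \<times> real) measure)"
    "(\<lambda>y. h (\<iota> y)) \<in> borel_measurable borel" "(\<lambda>y. \<rho> (\<iota> y)) \<in> borel_measurable borel"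
    by (rule measurable_label; simp)+
  interpret pair_sigma_finite lam lborel ..
  have nn: "AE \<xi> in lam \<Otimes>\<^sub>M lborel. 0 \<le> kernel_density i \<xi>" using kernel_density_nonneg[OF i] by simp
  have int: "integrable (lam \<Otimes>\<^sub>M lborel) (\<lambda>\<xi>. kernel_density i \<xi> * ?f \<xi>)"
    using kernel_affine_integrable(1)[OF i assms(2) B, where h=h] nn unfolding kernel_def
    by (subst (asm) integrable_density) auto
  have "(\<integral>\<xi>. ?f \<xi> \<partial>kernel i) = (\<integral>\<xi>. kernel_density i \<xi> * ?f \<xi> \<partial>(lam \<Otimes>\<^sub>M lborel))"
    unfolding kernel_def using nn by (subst integral_density) auto
  also have "\<dots> = (\<integral>y. (\<integral>t. kernel_density i (y, t) * ?f (y, t) \<partial>lborel) \<partial>lam)"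
    by (rule integral_fst'[OF int, symmetric])
  also have "\<dots> = (\<integral>y. tilt i y * (\<psi> y / (r y * \<rho> (\<iota> y)) + h (\<iota> y)) \<partial>lam)"
  proof (intro Bochner_Integration.integral_cong refl)
    fix y
    show "(\<integral>t. kernel_density i (y, t) * ?f (y, t) \<partial>lborel) = tilt i y * (\<psi> y / (r y * \<rho> (\<iota> y)) + h (\<iota> y))"
    proof (cases "y \<in> D")
      case True
      let ?a = "r y * \<rho> (\<iota> y)"
      note m = exponential_moments[OF rate_pos[OF True]]
      have "(\<integral>t. kernel_density i (y, t) * ?f (y, t) \<partial>lborel) =
        (\<integral>t. tilt i y * (\<psi> y * (exponential_density ?a t * t) + h (\<iota> y) * exponential_density ?a t) \<partial>lborel)"
        by (intro Bochner_Integration.integral_cong refl) (simp add: kernel_density_def algebra_simps)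
      also have "\<dots> = tilt i y * (\<psi> y * (1 / ?a) + h (\<iota> y) * 1)"
        using m(1,2) by (simp add: has_bochner_integral_iff)
      finally show ?thesis by simp
    qed (simp add: kernel_density_def tilt_def)
  qed
  also have "\<dots> = (\<Sum>j\<in>L. Q i j * exp (\<phi> j - \<phi> i) / \<rho> i * (\<integral>y. indicator (cell j) y * (\<psi> y / (r y * \<rho> (\<iota> y)) + h (\<iota> y)) \<partial>lam))"
  proof (rule tilt_integral(1))
    define m where "m = Min (\<rho> ` L)"
    have m: "0 < m" unfolding m_def using \<rho>_pos l0 by (subst Min_gr_iff) auto
    fix y assume y: "y \<in> D"
    have "\<delta> * m \<le> r y * \<rho> (\<iota> y)" using r_ge[OF y] \<iota>_in[of y] m \<delta> by (intro mult_mono) (auto simp: m_def)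
    then have "\<bar>\<psi> y / (r y * \<rho> (\<iota> y))\<bar> \<le> B / (\<delta> * m)"
      using m \<delta> B[of y] by (simp only: abs_divide) (intro frac_le, auto)
    moreover have "\<bar>h (\<iota> y)\<bar> \<le> (\<Sum>j\<in>L. \<bar>h j\<bar>)"
      using \<iota>_in by (intro member_le_sum[where f="\<lambda>j. \<bar>h j\<bar>"]) auto
    ultimately show "\<bar>\<psi> y / (r y * \<rho> (\<iota> y)) + h (\<iota> y)\<bar> \<le> B / (\<delta> * Min (\<rho> ` L)) + (\<Sum>j\<in>L. \<bar>h j\<bar>)"
      unfolding m_def by linarith
  qed measurable
  also have "\<dots> = (\<Sum>j\<in>L. trans_prob i j * (cell_mean \<psi> j + h j))"
  proof (intro sum.cong refl)
    fix j assume j: "j \<in> L"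
    have bd: "\<bar>\<psi> y / r y\<bar> \<le> B / \<delta>" if "y \<in> D" for y
      using r_ge[OF that] \<delta> B[of y] by (simp only: abs_divide) (intro frac_le, auto)
    have "(\<integral>y. indicator (cell j) y * (\<psi> y / (r y * \<rho> (\<iota> y)) + h (\<iota> y)) \<partial>lam) =
        (\<integral>y. (indicator (cell j) y * (\<psi> y / r y)) / \<rho> j + indicator (cell j) y * h j \<partial>lam)"
      by (intro Bochner_Integration.integral_cong refl) (auto simp: indicator_def)
    also have "\<dots> = (\<integral>y. indicator (cell j) y * (\<psi> y / r y) \<partial>lam) / \<rho> j + mass j * h j"
    proof -
      have mu: "(\<lambda>y. \<psi> y / r y) \<in> borel_measurable borel" by measurable
      have I1: "integrable lam (\<lambda>y. indicator (cell j) y * (\<psi> y / r y))" by (rule tilt_integral(2)[OF mu bd])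
      have I2: "integrable lam (\<lambda>y. indicator (cell j) y * h j)" by (rule tilt_integral(2)[where B="\<bar>h j\<bar>"]) auto
      have "(\<integral>y. indicator (cell j) y * h j \<partial>lam) = mass j * h j" by simp
      then show ?thesis
        by (subst Bochner_Integration.integral_add[OF integrable_divide[OF I1] I2]) (simp only: integral_divide_zero)
    qed
    also have "\<dots> = mass j * (cell_mean \<psi> j + h j)"
      using cell_pos[OF j] \<rho>_pos[OF j] by (simp add: cell_mean_def field_simps)
    finally show "Q i j * exp (\<phi> j - \<phi> i) / \<rho> i * (\<integral>y. indicator (cell j) y * (\<psi> y / (r y * \<rho> (\<iota> y)) + h (\<iota> y)) \<partial>lam) =
        trans_prob i j * (cell_mean \<psi> j + h j)"
      by (simp add: trans_prob_def)
  qed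
  finally show ?thesis .
qed

section \<open>The change of measure\<close>

text \<open>Visit 0 gets the label \<open>l0\<close> instead of that of its state, so the tilt acts
  in the same way from every starting point. The mismatch affects one jump only.\<close>

definition lab :: "(nat \<Rightarrow> 'a \<times> ennreal) \<Rightarrow> nat \<Rightarrow> 'a" where
  "lab z k = (if k = 0 then l0 else \<iota> (fst (z k)))"

lemma lab_in: "lab z k \<in> L"
  by (simp add: lab_def l0 \<iota>_in)

lemma measurable_lab[measurable]: "(\<lambda>z. lab z k) \<in> PiM UNIV (\<lambda>_. visit_space) \<rightarrow>\<^sub>M count_space L"
proof (cases "k = 0")
  case True then show ?thesis by (simp add: lab_def l0)
next
  case False
  have "(\<lambda>z. \<iota> (fst (z k))) \<in> PiM UNIV (\<lambda>_. visit_space) \<rightarrow>\<^sub>M count_space L" by measurable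
  then show ?thesis using False by (simp add: lab_def)
qed

text \<open>The density of the next visit under the tilt relative to the original chain: the exponential factor
  and \<open>\<rho>\<close> compare the holding time densities of rates \<open>\<rho> r\<close> and \<open>r\<close>.\<close>

definition ratio :: "'a \<Rightarrow> 'a \<Rightarrow> 'a \<times> ennreal \<Rightarrow> ennreal" where
  "ratio x i \<zeta> = (if snd \<zeta> = \<infinity> then 0 else ennreal (tilt i (fst \<zeta>) / q x (fst \<zeta>) * \<rho> (\<iota> (fst \<zeta>)) *
     exp ((1 - \<rho> (\<iota> (fst \<zeta>))) * r (fst \<zeta>) * enn2real (snd \<zeta>))))"

lemma measurable_ratio: "(\<lambda>\<xi>. ratio (fst \<xi>) i (snd \<xi>)) \<in> borel_measurable (borel \<Otimes>\<^sub>M visit_space)"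
proof -
  have [measurable]: "(\<lambda>\<xi>. \<rho> (\<iota> (fst (snd \<xi>)))) \<in> borel_measurable (borel \<Otimes>\<^sub>M visit_space :: ('a \<times> 'a \<times> ennreal) measure)"
    by (rule measurable_label) simp
  show ?thesis unfolding ratio_def[abs_def] by measurable
qed

lemma measurable_ratio_seq[measurable]:
  "(\<lambda>z. ratio (fst (z k)) (lab z k) (z (Suc k))) \<in> borel_measurable (PiM UNIV (\<lambda>_. visit_space))"
proof (rule measurable_compose_countable'[OF _ measurable_lab])
  fix i
  have "(\<lambda>z. (fst (z k), z (Suc k))) \<in> PiM UNIV (\<lambda>_. visit_space :: ('a \<times> ennreal) measure) \<rightarrow>\<^sub>M borel \<Otimes>\<^sub>M visit_space" by measurable
  from measurable_compose[OF this measurable_ratio]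
  show "(\<lambda>z. ratio (fst (z k)) i (z (Suc k))) \<in> borel_measurable (PiM UNIV (\<lambda>_. visit_space))" by simp
qed (simp add: countable_finite)

text \<open>One step of the change of measure: integrating \<open>ratio\<close> against the original
  next visit yields the tilted kernel. Infinite holding times have ratio 0, so the tilted holding
  times are real.\<close>

lemma nn_integral_ratio:
  assumes F[measurable]: "F \<in> borel_measurable visit_space" and i: "i \<in> L"
  shows "(\<integral>\<^sup>+y. (\<integral>\<^sup>+t. ratio x i (y, t) * F (y, t) \<partial>holding_time (r y)) \<partial>p x) = (\<integral>\<^sup>+\<xi>. F (fst \<xi>, ennreal (snd \<xi>)) \<partial>kernel i)"
proof -
  have rm[measurable]: "ratio x i \<in> borel_measurable visit_space"
  proof -
    have "(\<lambda>\<zeta>. (x, \<zeta>)) \<in> visit_space \<rightarrow>\<^sub>M borel \<Otimes>\<^sub>M (visit_space :: ('a \<times> ennreal) measure)" by measurable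
    from measurable_compose[OF this measurable_ratio] show ?thesis by simp
  qed
  have [measurable]: "(\<lambda>y. \<integral>\<^sup>+t. ratio x i (y, t) * F (y, t) \<partial>holding_time (r y)) \<in> borel_measurable borel"
    by (rule measurable_holding_integral[of "\<lambda>\<zeta>. ratio x i \<zeta> * F \<zeta>"]) measurable
  have "(\<integral>\<^sup>+y. (\<integral>\<^sup>+t. ratio x i (y, t) * F (y, t) \<partial>holding_time (r y)) \<partial>p x) =
    (\<integral>\<^sup>+y. ennreal (q x y) * (\<integral>\<^sup>+t. ratio x i (y, t) * F (y, t) \<partial>holding_time (r y)) \<partial>lam)"
    unfolding p_density by (rule nn_integral_density) measurable
  also have "\<dots> = (\<integral>\<^sup>+y. (\<integral>\<^sup>+t. ennreal (kernel_density i (y, t)) * F (y, ennreal t) \<partial>lborel) \<partial>lam)"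
  proof (intro nn_integral_cong)
    fix y
    show "ennreal (q x y) * (\<integral>\<^sup>+t. ratio x i (y, t) * F (y, t) \<partial>holding_time (r y)) =
        (\<integral>\<^sup>+t. ennreal (kernel_density i (y, t)) * F (y, ennreal t) \<partial>lborel)"
    proof (cases "y \<in> D")
      case True
      have ry: "0 < r y" using r_ge[OF True] \<delta> by simp
      have "ennreal (q x y) * (\<integral>\<^sup>+t. ratio x i (y, t) * F (y, t) \<partial>holding_time (r y)) =
        ennreal (q x y) * (\<integral>\<^sup>+t. ennreal (exponential_density (r y) t) * (ratio x i (y, ennreal t) * F (y, ennreal t)) \<partial>lborel)"
        by (subst nn_integral_holding_time[OF ry]) measurable
      also have "\<dots> = (\<integral>\<^sup>+t. ennreal (q x y) * (ennreal (exponential_density (r y) t) * (ratio x i (y, ennreal t) * F (y, ennreal t))) \<partial>lborel)"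
        by (rule nn_integral_cmult[symmetric]) measurable
      also have "\<dots> = (\<integral>\<^sup>+t. ennreal (kernel_density i (y, t)) * F (y, ennreal t) \<partial>lborel)"
      proof (intro nn_integral_cong)
        fix t :: real
        let ?\<rho> = "\<rho> (\<iota> y)"
        show "ennreal (q x y) * (ennreal (exponential_density (r y) t) * (ratio x i (y, ennreal t) * F (y, ennreal t))) =
          ennreal (kernel_density i (y, t)) * F (y, ennreal t)"
        proof (cases "t < 0")
          case False
          have "q x y * (r y * exp (- t * r y) * (tilt i y / q x y * ?\<rho> * exp ((1 - ?\<rho>) * r y * t))) =
            tilt i y * (r y * ?\<rho>) * (exp (- t * r y) * exp ((1 - ?\<rho>) * r y * t))"
            using q_pos[of x y] by (simp add: field_simps)
          also have "exp (- t * r y) * exp ((1 - ?\<rho>) * r y * t) = exp (- t * (r y * ?\<rho>))"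
            by (simp add: exp_add[symmetric] algebra_simps)
          finally have *: "q x y * (exponential_density (r y) t * (tilt i y / q x y * ?\<rho> * exp ((1 - ?\<rho>) * r y * t))) = kernel_density i (y, t)"
            using False by (simp add: kernel_density_def exponential_density_def)
          define w where "w = tilt i y / q x y * ?\<rho> * exp ((1 - ?\<rho>) * r y * t)"
          have w: "0 \<le> w" "ratio x i (y, ennreal t) = ennreal w"
            using tilt_nonneg[OF i, of y] q_pos[of x y] \<rho>_pos[OF \<iota>_in, of y] False by (auto simp: w_def ratio_def)
          have "0 \<le> exponential_density (r y) t" using ry by (intro erlang_density_nonneg) simp
          then have "ennreal (q x y) * (ennreal (exponential_density (r y) t) * ratio x i (y, ennreal t)) = ennreal (kernel_density i (y, t))"
            unfolding w(2) *[folded w_def, symmetric] using w(1) q_pos[of x y] by (simp only: ennreal_mult mult_nonneg_nonneg less_imp_le)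
          then show ?thesis by (simp add: mult.assoc[symmetric])
        qed (simp add: kernel_density_def exponential_density_def)
      qed
      finally show ?thesis .
    next
      \<comment> \<open>Outside \<open>D\<close> both sides vanish, which disposes of the states of
        rate 0, whose holding time has no density.\<close>
      case False
      then have "ratio x i (y, t) = 0" for t by (simp add: ratio_def tilt_def)
      then show ?thesis using False by (simp add: kernel_density_def tilt_def)
    qed
  qed
  also have "\<dots> = (\<integral>\<^sup>+\<xi>. F (fst \<xi>, ennreal (snd \<xi>)) \<partial>kernel i)"
    by (subst nn_integral_kernel) auto
  finally show ?thesis .
qed

text \<open>The likelihood ratio of the tilted chain after \<open>n\<close> jumps, on the event that the first
  jump occurs before time one.\<close>

definition weight :: "nat \<Rightarrow> (nat \<Rightarrow> 'a \<times> ennreal) \<Rightarrow> ennreal" where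
  "weight n z = (if snd (z 0) \<le> 1 then 1 else 0) * (\<Prod>k<n. ratio (fst (z k)) (lab z k) (z (Suc k)))"

lemma measurable_weight[measurable]: "weight n \<in> borel_measurable (PiM UNIV (\<lambda>_. visit_space))"
  unfolding weight_def[abs_def] by measurable

lemma lab_upd: "k \<le> n \<Longrightarrow> lab (z(Suc n := \<zeta>)) k = lab z k"
  by (simp add: lab_def)

lemma weight_Suc_upd: "weight (Suc n) (z(Suc n := \<zeta>)) = weight n z * ratio (fst (z n)) (lab z n) \<zeta>"
proof -
  have "(\<Prod>k<n. ratio (fst ((z(Suc n := \<zeta>)) k)) (lab (z(Suc n := \<zeta>)) k) ((z(Suc n := \<zeta>)) (Suc k))) =
    (\<Prod>k<n. ratio (fst (z k)) (lab z k) (z (Suc k)))"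
    by (intro prod.cong refl) (simp add: lab_upd)
  then show ?thesis by (simp add: weight_def lab_upd mult.assoc)
qed

lemma weight_cong:
  assumes "\<And>k. k \<le> n \<Longrightarrow> z k = z' k" shows "weight n z = weight n z'"
proof -
  have "(\<Prod>k<n. ratio (fst (z k)) (lab z k) (z (Suc k))) = (\<Prod>k<n. ratio (fst (z' k)) (lab z' k) (z' (Suc k)))"
    using assms by (intro prod.cong refl) (simp add: lab_def)
  then show ?thesis using assms[of 0] by (simp add: weight_def)
qed

lemma measurable_upd_visit: "(\<lambda>\<zeta>. z(n := \<zeta>)) \<in> (visit_space :: ('a \<times> ennreal) measure) \<rightarrow>\<^sub>M PiM UNIV (\<lambda>_. visit_space)"
  using measurable_fun_upd[of UNIV UNIV n "\<lambda>_. z" visit_space "\<lambda>_. visit_space" "\<lambda>x. x"]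
  by (auto simp: space_PiM space_pair_measure)

text \<open>The law weighted by \<open>weight\<close> acts as the law of the tilted chain: the last
  visit is integrated out under \<open>kernel\<close>, whose parameter is the current label
  alone.\<close>

lemma nn_integral_weight_Suc:
  assumes F[measurable]: "F \<in> borel_measurable (PiM UNIV (\<lambda>_. visit_space))"
    and dep: "\<And>z z'. (\<And>k. k \<le> Suc n \<Longrightarrow> z k = z' k) \<Longrightarrow> F z = F z'"
  shows "(\<integral>\<^sup>+z. weight (Suc n) z * F z \<partial>law x) =
    (\<integral>\<^sup>+z. weight n z * (\<integral>\<^sup>+\<xi>. F (z(Suc n := (fst \<xi>, ennreal (snd \<xi>)))) \<partial>kernel (lab z n)) \<partial>law x)"
proof -
  have "(\<integral>\<^sup>+z. weight (Suc n) z * F z \<partial>law x) =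
    (\<integral>\<^sup>+z. (\<integral>\<^sup>+y. (\<integral>\<^sup>+t. weight (Suc n) (z(Suc n := (y, t))) * F (z(Suc n := (y, t))) \<partial>holding_time (r y)) \<partial>p (fst (z n))) \<partial>law x)"
  proof (rule nn_integral_law_Suc)
    show "weight (Suc n) z * F z = weight (Suc n) z' * F z'" if "\<And>k. k \<le> Suc n \<Longrightarrow> z k = z' k" for z z'
      using weight_cong[OF that] dep[OF that] by simp
  qed measurable
  also have "\<dots> = (\<integral>\<^sup>+z. weight n z * (\<integral>\<^sup>+\<xi>. F (z(Suc n := (fst \<xi>, ennreal (snd \<xi>)))) \<partial>kernel (lab z n)) \<partial>law x)"
  proof (intro nn_integral_cong)
    fix z
    have Fz[measurable]: "(\<lambda>\<zeta>. F (z(Suc n := \<zeta>))) \<in> borel_measurable visit_space"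
      by (rule measurable_compose[OF measurable_upd_visit F])
    have "(\<integral>\<^sup>+y. (\<integral>\<^sup>+t. weight (Suc n) (z(Suc n := (y, t))) * F (z(Suc n := (y, t))) \<partial>holding_time (r y)) \<partial>p (fst (z n))) =
      (\<integral>\<^sup>+y. (\<integral>\<^sup>+t. ratio (fst (z n)) (lab z n) (y, t) * (weight n z * F (z(Suc n := (y, t)))) \<partial>holding_time (r y)) \<partial>p (fst (z n)))"
      by (simp add: weight_Suc_upd mult_ac)
    also have "\<dots> = (\<integral>\<^sup>+\<xi>. weight n z * F (z(Suc n := (fst \<xi>, ennreal (snd \<xi>)))) \<partial>kernel (lab z n))"
      by (rule nn_integral_ratio[where F="\<lambda>\<zeta>. weight n z * F (z(Suc n := \<zeta>))"]) (auto simp: lab_in)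
    also have "\<dots> = weight n z * (\<integral>\<^sup>+\<xi>. F (z(Suc n := (fst \<xi>, ennreal (snd \<xi>)))) \<partial>kernel (lab z n))"
    proof (rule nn_integral_cmult)
      have "(\<lambda>\<xi>. (fst \<xi>, ennreal (snd \<xi>))) \<in> kernel (lab z n) \<rightarrow>\<^sub>M visit_space" by measurable
      from measurable_compose[OF this Fz]
      show "(\<lambda>\<xi>. F (z(Suc n := (fst \<xi>, ennreal (snd \<xi>))))) \<in> borel_measurable (kernel (lab z n))" .
    qed
    finally show "(\<integral>\<^sup>+y. (\<integral>\<^sup>+t. weight (Suc n) (z(Suc n := (y, t))) * F (z(Suc n := (y, t))) \<partial>holding_time (r y)) \<partial>p (fst (z n))) =
      weight n z * (\<integral>\<^sup>+\<xi>. F (z(Suc n := (fst \<xi>, ennreal (snd \<xi>)))) \<partial>kernel (lab z n))" .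
  qed
  finally show ?thesis .
qed

lemma nn_integral_weight: "(\<integral>\<^sup>+z. weight n z \<partial>law x) = (\<integral>\<^sup>+z. weight 0 z \<partial>law x)"
proof (induction n)
  case (Suc n)
  have "emeasure (kernel (lab z n)) (space (kernel (lab z n))) = 1" for z
    using prob_space_kernel[OF lab_in] by (rule prob_space.emeasure_space_1)
  then have "(\<integral>\<^sup>+z. weight (Suc n) z * 1 \<partial>law x) = (\<integral>\<^sup>+z. weight n z \<partial>law x)"
    by (subst nn_integral_weight_Suc) (auto simp del: space_kernel)
  with Suc show ?case by simp
qed simp

text \<open>The mass of the weighted law is the probability that the first holding time is at most
  one. The bound \<open>1 - exp (- r x)\<close> is where a starting point away from the zero set of
  \<open>r\<close> helps.\<close>

lemma nn_integral_weight_0: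
  "ennreal (1 - exp (- r x)) \<le> (\<integral>\<^sup>+z. weight 0 z \<partial>law x)" "(\<integral>\<^sup>+z. weight 0 z \<partial>law x) \<le> 1"
proof -
  have eq: "(\<integral>\<^sup>+z. weight 0 z \<partial>law x) = (\<integral>\<^sup>+t. (if t \<le> 1 then 1 else 0) \<partial>holding_time (r x))"
    using nn_integral_law_0[of "\<lambda>\<zeta>. if snd \<zeta> \<le> 1 then 1 else 0" x] by (simp add: weight_def)
  have "(\<integral>\<^sup>+z. weight 0 z \<partial>law x) \<le> (\<integral>\<^sup>+z. 1 \<partial>law x)"
    by (intro nn_integral_mono) (simp add: weight_def)
  then show "(\<integral>\<^sup>+z. weight 0 z \<partial>law x) \<le> 1"
    using prob_space.emeasure_space_1[OF prob_space_law, of x] by simp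
  show "ennreal (1 - exp (- r x)) \<le> (\<integral>\<^sup>+z. weight 0 z \<partial>law x)"
  proof (cases "r x = 0")
    case False
    then have rx: "0 < r x" using r_nonneg[of x] by simp
    have "(\<integral>\<^sup>+t. (if t \<le> 1 then 1 else 0) \<partial>holding_time (r x)) = (\<integral>\<^sup>+t. ennreal (exponential_density (r x) t) * indicator {..1} t \<partial>lborel)"
      by (subst nn_integral_holding_time[OF rx])
        (auto intro!: nn_integral_cong simp: indicator_def simp flip: ennreal_1)
    then have *: "(\<integral>\<^sup>+z. weight 0 z \<partial>law x) + ennreal (exp (- r x)) = 1"
      using nn_integral_exponential_split[OF rx, of 1] eq by simp
    then obtain w where w: "(\<integral>\<^sup>+z. weight 0 z \<partial>law x) = ennreal w" "0 \<le> w"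
      by (cases "\<integral>\<^sup>+z. weight 0 z \<partial>law x") auto
    with * have "ennreal (w + exp (- r x)) = ennreal 1" by simp
    then have "1 - exp (- r x) = w" using w(2) by (subst (asm) ennreal_inj) auto
    then show ?thesis using w(1) by simp
  qed simp
qed

definition martingale :: "('a \<Rightarrow> 'a \<times> real \<Rightarrow> real) \<Rightarrow> nat \<Rightarrow> (nat \<Rightarrow> 'a \<times> ennreal) \<Rightarrow> real" where
  "martingale \<Delta> n z = (\<Sum>k<n. \<Delta> (lab z k) (fst (z (Suc k)), enn2real (snd (z (Suc k)))))"

text \<open>Orthogonality of the increments: under the weighted law the cross term has conditional
  mean 0, so each jump adds at most \<open>C\<close>, the weighted law having mass at most
  1.\<close>

lemma martingale_second_moment:
  assumes m: "\<And>i. \<Delta> i \<in> borel_measurable (borel \<Otimes>\<^sub>M borel)"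
    and int: "\<And>i. i \<in> L \<Longrightarrow> integrable (kernel i) (\<Delta> i)" "\<And>i. i \<in> L \<Longrightarrow> integrable (kernel i) (\<lambda>\<xi>. (\<Delta> i \<xi>)\<^sup>2)"
    and mean: "\<And>i. i \<in> L \<Longrightarrow> (\<integral>\<xi>. \<Delta> i \<xi> \<partial>kernel i) = 0"
    and C: "\<And>i. i \<in> L \<Longrightarrow> (\<integral>\<xi>. (\<Delta> i \<xi>)\<^sup>2 \<partial>kernel i) \<le> C" "0 \<le> C"
  shows "(\<integral>\<^sup>+z. weight n z * ennreal ((martingale \<Delta> n z)\<^sup>2) \<partial>law x) \<le> ennreal (C * real n)"
    "martingale \<Delta> n \<in> borel_measurable (PiM UNIV (\<lambda>_. visit_space))"
proof -
  have [measurable]: "(\<lambda>z. \<Delta> (lab z k) (fst (z (Suc k)), enn2real (snd (z (Suc k))))) \<in> borel_measurable (PiM UNIV (\<lambda>_. visit_space))" for k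
  proof (rule measurable_compose_countable'[OF _ measurable_lab])
    fix i
    have "(\<lambda>z. (fst (z (Suc k)), enn2real (snd (z (Suc k))))) \<in> PiM UNIV (\<lambda>_. visit_space :: ('a \<times> ennreal) measure) \<rightarrow>\<^sub>M borel \<Otimes>\<^sub>M borel"
      by measurable
    from measurable_compose[OF this m]
    show "(\<lambda>z. \<Delta> i (fst (z (Suc k)), enn2real (snd (z (Suc k))))) \<in> borel_measurable (PiM UNIV (\<lambda>_. visit_space))" .
  qed (simp add: countable_finite)
  have [measurable]: "martingale \<Delta> n \<in> borel_measurable (PiM UNIV (\<lambda>_. visit_space))" for n
    unfolding martingale_def[abs_def] by measurable
  then show "martingale \<Delta> n \<in> borel_measurable (PiM UNIV (\<lambda>_. visit_space))" .
  show "(\<integral>\<^sup>+z. weight n z * ennreal ((martingale \<Delta> n z)\<^sup>2) \<partial>law x) \<le> ennreal (C * real n)"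
  proof (induction n)
    case 0 then show ?case by (simp add: martingale_def)
  next
    case (Suc n)
    have upd: "martingale \<Delta> (Suc n) (z(Suc n := \<zeta>)) = martingale \<Delta> n z + \<Delta> (lab z n) (fst \<zeta>, enn2real (snd \<zeta>))" for z \<zeta>
    proof -
      have "martingale \<Delta> n (z(Suc n := \<zeta>)) = martingale \<Delta> n z"
        unfolding martingale_def by (intro sum.cong refl) (simp add: lab_upd)
      then show ?thesis by (simp add: martingale_def lab_upd)
    qed
    have "(\<integral>\<^sup>+z. weight (Suc n) z * ennreal ((martingale \<Delta> (Suc n) z)\<^sup>2) \<partial>law x) =
      (\<integral>\<^sup>+z. weight n z * (\<integral>\<^sup>+\<xi>. ennreal ((martingale \<Delta> (Suc n) (z(Suc n := (fst \<xi>, ennreal (snd \<xi>)))))\<^sup>2) \<partial>kernel (lab z n)) \<partial>law x)"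
    proof (rule nn_integral_weight_Suc)
      show "ennreal ((martingale \<Delta> (Suc n) z)\<^sup>2) = ennreal ((martingale \<Delta> (Suc n) z')\<^sup>2)"
        if "\<And>k. k \<le> Suc n \<Longrightarrow> z k = z' k" for z z'
      proof -
        have "martingale \<Delta> (Suc n) z = martingale \<Delta> (Suc n) z'"
          unfolding martingale_def using that by (intro sum.cong refl) (simp add: lab_def)
        then show ?thesis by simp
      qed
    qed measurable
    also have "\<dots> \<le> (\<integral>\<^sup>+z. weight n z * ennreal ((martingale \<Delta> n z)\<^sup>2) + weight n z * ennreal C \<partial>law x)"
    proof (intro nn_integral_mono)
      fix z
      let ?i = "lab z n" and ?N = "martingale \<Delta> n z"
      have i: "?i \<in> L" by (rule lab_in)
      interpret K: prob_space "kernel ?i" by (rule prob_space_kernel[OF i])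
      have "(\<integral>\<^sup>+\<xi>. ennreal ((martingale \<Delta> (Suc n) (z(Suc n := (fst \<xi>, ennreal (snd \<xi>)))))\<^sup>2) \<partial>kernel ?i) =
        (\<integral>\<^sup>+\<xi>. ennreal ((?N + \<Delta> ?i \<xi>)\<^sup>2) \<partial>kernel ?i)"
        using AE_kernel_nonneg[of ?i] by (intro nn_integral_cong_AE) (auto simp: upd)
      also have "\<dots> = ennreal (\<integral>\<xi>. (?N + \<Delta> ?i \<xi>)\<^sup>2 \<partial>kernel ?i)"
      proof (rule nn_integral_eq_integral)
        show "integrable (kernel ?i) (\<lambda>\<xi>. (?N + \<Delta> ?i \<xi>)\<^sup>2)" using int[OF i] by (simp add: power2_sum)
      qed simp
      also have "(\<integral>\<xi>. (?N + \<Delta> ?i \<xi>)\<^sup>2 \<partial>kernel ?i) = ?N\<^sup>2 + (\<integral>\<xi>. (\<Delta> ?i \<xi>)\<^sup>2 \<partial>kernel ?i)"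
        using int[OF i] mean[OF i] K.prob_space by (simp add: power2_sum)
      also have "ennreal (?N\<^sup>2 + (\<integral>\<xi>. (\<Delta> ?i \<xi>)\<^sup>2 \<partial>kernel ?i)) \<le> ennreal (?N\<^sup>2 + C)"
        using C(1)[OF i] by (intro ennreal_leI) simp
      also have "\<dots> = ennreal (?N\<^sup>2) + ennreal C" using C(2) by simp
      finally show "weight n z * (\<integral>\<^sup>+\<xi>. ennreal ((martingale \<Delta> (Suc n) (z(Suc n := (fst \<xi>, ennreal (snd \<xi>)))))\<^sup>2) \<partial>kernel ?i) \<le>
        weight n z * ennreal (?N\<^sup>2) + weight n z * ennreal C"
        unfolding distrib_left[symmetric] by (rule mult_left_mono) simp
    qed
    also have "\<dots> = (\<integral>\<^sup>+z. weight n z * ennreal ((martingale \<Delta> n z)\<^sup>2) \<partial>law x) + (\<integral>\<^sup>+z. weight n z \<partial>law x) * ennreal C"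
      by (subst nn_integral_add) (auto simp: nn_integral_multc)
    also have "\<dots> \<le> ennreal (C * real n) + 1 * ennreal C"
      using Suc.IH nn_integral_weight_0(2) by (intro add_mono mult_right_mono) (auto simp: nn_integral_weight[where n=n])
    also have "\<dots> = ennreal (C * real (Suc n))" using C(2) by (simp add: ennreal_plus[symmetric] algebra_simps del: ennreal_plus)
    finally show ?case .
  qed
qed

text \<open>The time integral over visits 1 to \<open>n\<close>. Visit 0 is left out because its
  state and holding time are not drawn from the tilted kernel.\<close>

definition visit_sum :: "('a \<Rightarrow> real) \<Rightarrow> nat \<Rightarrow> (nat \<Rightarrow> 'a \<times> ennreal) \<Rightarrow> real" where
  "visit_sum \<psi> n z = (\<Sum>k<n. enn2real (snd (z (Suc k))) * \<psi> (fst (z (Suc k))))"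

definition mean_visit :: "('a \<Rightarrow> real) \<Rightarrow> real" where
  "mean_visit \<psi> = (\<Sum>j\<in>L. stat j * cell_mean \<psi> j)"

lemma measurable_visit_sum:
  "\<psi> \<in> borel_measurable borel \<Longrightarrow> visit_sum \<psi> n \<in> borel_measurable (PiM UNIV (\<lambda>_. visit_space))"
proof -
  assume [measurable]: "\<psi> \<in> borel_measurable borel"
  show "visit_sum \<psi> n \<in> borel_measurable (PiM UNIV (\<lambda>_. visit_space))"
    unfolding visit_sum_def[abs_def] by measurable
qed

text \<open>Chebyshev's inequality for the martingale obtained by adding a corrector to each visit.
  The deviation is this martingale plus a telescoping boundary term and an error of at most
  \<open>\<epsilon>\<close> per visit from the approximate Poisson equation.\<close>

lemma weak_law:
  assumes \<psi>[measurable]: "\<psi> \<in> borel_measurable borel" and B: "\<And>y. \<bar>\<psi> y\<bar> \<le> B" and \<epsilon>: "0 < \<epsilon>"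
  shows "\<exists>C. \<forall>n x. 0 < n \<longrightarrow> (\<integral>\<^sup>+z. weight n z * indicator {z. C + 2 * \<epsilon> * n < \<bar>visit_sum \<psi> n z - n * mean_visit \<psi>\<bar>} z \<partial>law x) \<le> ennreal (C / n)"
proof -
  obtain h where h: "\<And>i. i \<in> L \<Longrightarrow> \<bar>h i - labels.step h i - (cell_mean \<psi> i - mean_visit \<psi>)\<bar> \<le> \<epsilon>"
    using labels.approximate_Poisson[OF \<epsilon>, of "cell_mean \<psi>"] unfolding mean_visit_def by blast
  \<comment> \<open>The corrector is the image of \<open>h\<close> under the chain: on labels
    \<open>cell_mean \<psi> + h'\<close> is close to \<open>h + mean_visit \<psi>\<close>, and one
    more step turns the latter into \<open>h' + mean_visit \<psi>\<close>, the wanted conditional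
    mean.\<close>
  define h' where "h' = labels.step h"
  define c where "c i = (\<integral>\<xi>. snd \<xi> * \<psi> (fst \<xi>) + h' (\<iota> (fst \<xi>)) \<partial>kernel i)" for i
  define \<Delta> where "\<Delta> i \<xi> = snd \<xi> * \<psi> (fst \<xi>) + h' (\<iota> (fst \<xi>)) - c i" for i and \<xi> :: "'a \<times> real"
  have \<Delta>m: "\<Delta> i \<in> borel_measurable (borel \<Otimes>\<^sub>M borel)" for i
  proof -
    have [measurable]: "(\<lambda>\<xi>. h' (\<iota> (fst \<xi>))) \<in> borel_measurable (borel \<Otimes>\<^sub>M borel :: ('a \<times> real) measure)"
      by (rule measurable_label) simp
    show ?thesis unfolding \<Delta>_def[abs_def] by measurable
  qed
  have c: "\<bar>c i - (h' i + mean_visit \<psi>)\<bar> \<le> \<epsilon>" if i: "i \<in> L" for i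
  proof -
    have eq: "c i - (h' i + mean_visit \<psi>) = (\<Sum>j\<in>L. trans_prob i j * (cell_mean \<psi> j + h' j - h j - mean_visit \<psi>))"
      using labels.P_sum[OF i] kernel_mean[OF i \<psi> B, of h']
      by (simp add: c_def h'_def labels.step_def right_diff_distrib distrib_left sum_subtractf sum.distrib sum_distrib_right[symmetric])
    have "\<bar>c i - (h' i + mean_visit \<psi>)\<bar> \<le> (\<Sum>j\<in>L. trans_prob i j * \<epsilon>)"
      unfolding eq
    proof (rule order_trans[OF sum_abs], rule sum_mono)
      fix j assume j: "j \<in> L"
      have "\<bar>cell_mean \<psi> j + h' j - h j - mean_visit \<psi>\<bar> \<le> \<epsilon>" using h[OF j] unfolding h'_def by linarith
      then show "\<bar>trans_prob i j * (cell_mean \<psi> j + h' j - h j - mean_visit \<psi>)\<bar> \<le> trans_prob i j * \<epsilon>"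
        using labels.P_nonneg[OF i j] by (simp add: abs_mult mult_left_mono)
    qed
    also have "\<dots> = \<epsilon>" using labels.P_sum[OF i] by (simp add: sum_distrib_right[symmetric])
    finally show ?thesis .
  qed
  define C0 where "C0 = (\<Sum>i\<in>L. \<bar>\<integral>\<xi>. (\<Delta> i \<xi>)\<^sup>2 \<partial>kernel i\<bar>)"
  have C0: "(\<integral>\<xi>. (\<Delta> i \<xi>)\<^sup>2 \<partial>kernel i) \<le> C0" if "i \<in> L" for i
    using member_le_sum[of i L "\<lambda>i. \<bar>\<integral>\<xi>. (\<Delta> i \<xi>)\<^sup>2 \<partial>kernel i\<bar>"] that by (simp add: C0_def)
  have C00: "0 \<le> C0" by (simp add: C0_def sum_nonneg)
  have int: "integrable (kernel i) (\<Delta> i)" "integrable (kernel i) (\<lambda>\<xi>. (\<Delta> i \<xi>)\<^sup>2)" "(\<integral>\<xi>. \<Delta> i \<xi> \<partial>kernel i) = 0" if i: "i \<in> L" for i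
  proof -
    interpret K: prob_space "kernel i" by (rule prob_space_kernel[OF i])
    note k = kernel_affine_integrable[OF i \<psi> B, where h=h']
    show "integrable (kernel i) (\<Delta> i)" unfolding \<Delta>_def by (intro Bochner_Integration.integrable_diff k(1)) simp
    show "integrable (kernel i) (\<lambda>\<xi>. (\<Delta> i \<xi>)\<^sup>2)" unfolding \<Delta>_def by (rule k(2))
    show "(\<integral>\<xi>. \<Delta> i \<xi> \<partial>kernel i) = 0"
      unfolding \<Delta>_def using k(1) K.prob_space by (subst Bochner_Integration.integral_diff) (simp_all add: c_def[symmetric])
  qed
  note M = martingale_second_moment[of \<Delta>, OF \<Delta>m int(1) int(2) int(3) C0 C00]
  define H where "H = (\<Sum>i\<in>L. \<bar>h' i\<bar>)"
  have H: "\<bar>h' i\<bar> \<le> H" if "i \<in> L" for i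
    using member_le_sum[of i L "\<lambda>i. \<bar>h' i\<bar>"] that by (simp add: H_def)
  have close: "\<bar>visit_sum \<psi> n z - n * mean_visit \<psi> - martingale \<Delta> n z\<bar> \<le> 2 * H + \<epsilon> * n" for n z
  proof -
    let ?d = "visit_sum \<psi> n z - n * mean_visit \<psi> - martingale \<Delta> n z"
    have "?d = (\<Sum>k<n. c (lab z k) - h' (lab z (Suc k)) - mean_visit \<psi>)"
    proof -
      have "(\<Sum>k<n. mean_visit \<psi>) = n * mean_visit \<psi>" by simp
      moreover have "visit_sum \<psi> n z - (\<Sum>k<n. mean_visit \<psi>) - martingale \<Delta> n z = (\<Sum>k<n. c (lab z k) - h' (lab z (Suc k)) - mean_visit \<psi>)"
        unfolding visit_sum_def martingale_def \<Delta>_def sum_subtractf[symmetric]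
        by (intro sum.cong refl) (simp add: lab_def)
      ultimately show ?thesis by simp
    qed
    also have "\<dots> = (\<Sum>k<n. (c (lab z k) - (h' (lab z k) + mean_visit \<psi>)) + (h' (lab z k) - h' (lab z (Suc k))))"
      by (simp add: algebra_simps)
    also have "\<dots> = (\<Sum>k<n. c (lab z k) - (h' (lab z k) + mean_visit \<psi>)) + (h' (lab z 0) - h' (lab z n))"
      using sum_lessThan_telescope'[of "\<lambda>k. h' (lab z k)" n] by (simp only: sum.distrib)
    finally have "\<bar>?d\<bar> \<le> (\<Sum>k<n. \<bar>c (lab z k) - (h' (lab z k) + mean_visit \<psi>)\<bar>) + 2 * H"
      using sum_abs[of "\<lambda>k. c (lab z k) - (h' (lab z k) + mean_visit \<psi>)" "{..<n}"] H[OF lab_in, of z 0] H[OF lab_in, of z n]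
      by linarith
    moreover have "(\<Sum>k<n. \<bar>c (lab z k) - (h' (lab z k) + mean_visit \<psi>)\<bar>) \<le> (\<Sum>k<n. \<epsilon>)"
      by (intro sum_mono c lab_in)
    ultimately show ?thesis by (simp add: mult.commute)
  qed
  \<comment> \<open>The first entry absorbs the boundary term; the second is the Chebyshev constant,
    a second moment of at most \<open>C0 * n\<close> over \<open>(\<epsilon> * n)^2\<close>.\<close>
  define C where "C = max (2 * H) (C0 / \<epsilon>\<^sup>2)"
  have "(\<integral>\<^sup>+z. weight n z * indicator {z. C + 2 * \<epsilon> * n < \<bar>visit_sum \<psi> n z - n * mean_visit \<psi>\<bar>} z \<partial>law x) \<le> ennreal (C / n)" if n: "0 < n" for n x
  proof -
    have "(\<integral>\<^sup>+z. weight n z * indicator {z. C + 2 * \<epsilon> * n < \<bar>visit_sum \<psi> n z - n * mean_visit \<psi>\<bar>} z \<partial>law x) \<le>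
      (\<integral>\<^sup>+z. ennreal (1 / (\<epsilon> * n)\<^sup>2) * (weight n z * ennreal ((martingale \<Delta> n z)\<^sup>2)) \<partial>law x)"
    proof (intro nn_integral_mono)
      fix z
      show "weight n z * indicator {z. C + 2 * \<epsilon> * n < \<bar>visit_sum \<psi> n z - n * mean_visit \<psi>\<bar>} z \<le>
        ennreal (1 / (\<epsilon> * n)\<^sup>2) * (weight n z * ennreal ((martingale \<Delta> n z)\<^sup>2))"
      proof (cases "C + 2 * \<epsilon> * n < \<bar>visit_sum \<psi> n z - n * mean_visit \<psi>\<bar>")
        case True
        have "2 * H \<le> C" by (simp add: C_def)
        then have "\<epsilon> * n \<le> \<bar>martingale \<Delta> n z\<bar>" using True close[of n z] by linarith
        then have "(\<epsilon> * n)\<^sup>2 \<le> (martingale \<Delta> n z)\<^sup>2" using \<epsilon> power_mono[of "\<epsilon> * n" "\<bar>martingale \<Delta> n z\<bar>" 2] by simp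
        then have "1 \<le> 1 / (\<epsilon> * n)\<^sup>2 * (martingale \<Delta> n z)\<^sup>2" using \<epsilon> n by (simp add: pos_le_divide_eq)
        then have "1 \<le> ennreal (1 / (\<epsilon> * n)\<^sup>2) * ennreal ((martingale \<Delta> n z)\<^sup>2)"
          using ennreal_leI[of 1] by (simp add: ennreal_mult[symmetric])
        from mult_left_mono[OF this, of "weight n z"] show ?thesis using True by (simp add: mult_ac)
      qed simp
    qed
    also have "\<dots> = ennreal (1 / (\<epsilon> * n)\<^sup>2) * (\<integral>\<^sup>+z. weight n z * ennreal ((martingale \<Delta> n z)\<^sup>2) \<partial>law x)"
      using M(2) by (intro nn_integral_cmult) simp
    also have "\<dots> \<le> ennreal (1 / (\<epsilon> * n)\<^sup>2) * ennreal (C0 * n)"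
      by (intro mult_left_mono M(1)) auto
    also have "\<dots> = ennreal (C0 / \<epsilon>\<^sup>2 / n)"
      using C00 n \<epsilon> by (simp add: ennreal_mult[symmetric] power2_eq_square)
    also have "\<dots> \<le> ennreal (C / n)" by (intro ennreal_leI divide_right_mono) (auto simp: C_def)
    finally show ?thesis .
  qed
  then show ?thesis by blast
qed

end

section \<open>From a number of visits to a time horizon\<close>

lemma clipped_time_increment_le:
  assumes "snd (z k) \<noteq> \<infinity>" "0 \<le> T"
  shows "clipped_time z T (Suc k) - clipped_time z T k \<le> enn2real (snd (z k))"
proof -
  let ?J = "jump_time z k" and ?t = "snd (z k)"
  have fin: "min ?J (ennreal T) < \<infinity>" "?t < \<infinity>"
    using assms(1) by (auto simp: min_less_iff_disj top.not_eq_extremum)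
  have "min (?J + ?t) (ennreal T) \<le> min ?J (ennreal T) + ?t"
  proof (cases "?J \<le> ennreal T")
    case True then show ?thesis by (simp add: min_absorb1)
  next
    case False
    then have "min ?J (ennreal T) = ennreal T" by (simp add: min_absorb2)
    moreover have "min (?J + ?t) (ennreal T) \<le> ennreal T + ?t" by (rule order_trans[OF min.cobounded2]) simp
    ultimately show ?thesis by simp
  qed
  then have "enn2real (min (?J + ?t) (ennreal T)) \<le> enn2real (min ?J (ennreal T) + ?t)"
    using fin by (intro enn2real_mono) auto
  also have "\<dots> = enn2real (min ?J (ennreal T)) + enn2real ?t"
    using fin by (intro enn2real_plus) auto
  finally show ?thesis by (simp add: clipped_time_def jump_time_def)
qed

context tilted_chain begin

lemma jump_time_visit_sum:
  assumes fin: "\<And>k. k < n \<Longrightarrow> snd (z (Suc k)) \<noteq> \<infinity>"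
  shows "jump_time z (Suc n) = snd (z 0) + ennreal (visit_sum (\<lambda>_. 1) n z)"
proof -
  have "jump_time z (Suc n) = snd (z 0) + (\<Sum>k<n. snd (z (Suc k)))"
    unfolding jump_time_def by (rule sum.lessThan_Suc_shift)
  also have "(\<Sum>k<n. snd (z (Suc k))) = (\<Sum>k<n. ennreal (enn2real (snd (z (Suc k)))))"
    using fin by (intro sum.cong refl) (simp add: ennreal_enn2real top.not_eq_extremum)
  also have "\<dots> = ennreal (visit_sum (\<lambda>_. 1) n z)"
    unfolding visit_sum_def by (subst sum_ennreal) auto
  finally show ?thesis .
qed

text \<open>The integral up to \<open>T\<close> and the sum over visits 1 to \<open>n\<close> differ
  by the initial visit and by what the visits spend after \<open>T\<close>. The initial visit, of
  length at most one, counts twice: it carries its own integral and it delays the others, which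
  gives the 2.\<close>

lemma path_integral_visit_sum:
  assumes ex: "(SUP n. jump_time z n) = \<infinity>" and 0: "snd (z 0) \<le> 1" and fin: "\<And>k. k < n \<Longrightarrow> snd (z (Suc k)) \<noteq> \<infinity>"
    and T: "0 < T" "T \<le> visit_sum (\<lambda>_. 1) n z" and B: "\<And>y. \<bar>f y\<bar> \<le> B"
  shows "\<bar>(LINT t:{0..T}|lborel. f (jump_path z t)) - visit_sum f n z\<bar> \<le> B * (visit_sum (\<lambda>_. 1) n z - T + 2)"
proof -
  let ?s = "clipped_time z T" and ?V = "visit_sum (\<lambda>_. 1) n z"
  have B0: "0 \<le> B" using B[of undefined] by linarith
  have J: "ennreal T \<le> jump_time z (Suc n)"
  proof -
    have "ennreal T \<le> ennreal ?V" using T by (intro ennreal_leI)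
    also have "\<dots> \<le> snd (z 0) + ennreal ?V" by simp
    also have "\<dots> = jump_time z (Suc n)" by (rule jump_time_visit_sum[symmetric]) (rule fin)
    finally show ?thesis .
  qed
  have sT: "?s (Suc n) = T" using J T by (intro clipped_time_late) auto
  have s1: "?s (Suc 0) \<le> 1"
  proof -
    have "?s (Suc 0) \<le> enn2real 1"
      unfolding clipped_time_def using 0 by (intro enn2real_mono) (auto simp: jump_time_def min_le_iff_disj)
    then show ?thesis by simp
  qed
  have inc: "?s (Suc (Suc k)) - ?s (Suc k) \<le> enn2real (snd (z (Suc k)))" if "k < n" for k
    using clipped_time_increment_le[of z "Suc k" T] fin[OF that] T by simp
  have eq: "(LINT t:{0..T}|lborel. f (jump_path z t)) - visit_sum f n z = f (fst (z 0)) * ?s (Suc 0) +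
      (\<Sum>k<n. f (fst (z (Suc k))) * ((?s (Suc (Suc k)) - ?s (Suc k)) - enn2real (snd (z (Suc k)))))"
    using T(1) by (subst integral_jump_path[OF ex _ J])
      (simp_all add: sum.lessThan_Suc_shift visit_sum_def right_diff_distrib sum_subtractf mult.commute del: sum.lessThan_Suc)
  have "\<bar>f (fst (z 0)) * ?s (Suc 0)\<bar> \<le> B * 1"
    unfolding abs_mult using B B0 s1 clipped_time_nonneg[of z T "Suc 0"] by (intro mult_mono) auto
  moreover have "\<bar>\<Sum>k<n. f (fst (z (Suc k))) * ((?s (Suc (Suc k)) - ?s (Suc k)) - enn2real (snd (z (Suc k))))\<bar> \<le>
    (\<Sum>k<n. B * (enn2real (snd (z (Suc k))) - (?s (Suc (Suc k)) - ?s (Suc k))))"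
  proof (rule order_trans[OF sum_abs], rule sum_mono)
    fix k assume "k \<in> {..<n}"
    then have "\<bar>(?s (Suc (Suc k)) - ?s (Suc k)) - enn2real (snd (z (Suc k)))\<bar> = enn2real (snd (z (Suc k))) - (?s (Suc (Suc k)) - ?s (Suc k))"
      using inc[of k] by simp
    then show "\<bar>f (fst (z (Suc k))) * ((?s (Suc (Suc k)) - ?s (Suc k)) - enn2real (snd (z (Suc k))))\<bar> \<le>
      B * (enn2real (snd (z (Suc k))) - (?s (Suc (Suc k)) - ?s (Suc k)))"
      unfolding abs_mult using B[of "fst (z (Suc k))"] by (metis abs_ge_zero mult_right_mono)
  qed
  moreover have "(\<Sum>k<n. B * (enn2real (snd (z (Suc k))) - (?s (Suc (Suc k)) - ?s (Suc k)))) = B * (?V - (T - ?s (Suc 0)))"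
  proof -
    have "(\<Sum>k<n. ?s (Suc (Suc k)) - ?s (Suc k)) = T - ?s (Suc 0)"
      using sum_lessThan_telescope[of "\<lambda>k. ?s (Suc k)" n] sT by simp
    then show ?thesis by (simp add: sum_distrib_left[symmetric] sum_subtractf visit_sum_def)
  qed
  moreover have "B * (?V - (T - ?s (Suc 0))) \<le> B * (?V - T + 1)" using s1 B0 by (intro mult_left_mono) auto
  ultimately show ?thesis unfolding eq by (simp add: distrib_left right_diff_distrib)
qed

text \<open>The exponent of \<open>ratio\<close> per unit of time spent at \<open>y\<close>.\<close>

definition cost where "cost y = (1 - \<rho> (\<iota> y)) * r y"

lemma cost_measurable[measurable]: "cost \<in> borel_measurable borel"
proof -
  have [measurable]: "(\<lambda>y. \<rho> (\<iota> y)) \<in> borel_measurable borel" by (rule measurable_label) simp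
  show ?thesis unfolding cost_def[abs_def] by measurable
qed

lemma cost_bounded: "\<exists>B. \<forall>y. \<bar>cost y\<bar> \<le> B"
proof (intro exI allI)
  fix y
  have "\<bar>1 - \<rho> (\<iota> y)\<bar> \<le> (\<Sum>i\<in>L. \<bar>1 - \<rho> i\<bar>)"
    using \<iota>_in by (intro member_le_sum[where f="\<lambda>i. \<bar>1 - \<rho> i\<bar>"]) auto
  moreover have "\<bar>r y\<bar> \<le> R" using r_nonneg[of y] R(2)[of y] by simp
  ultimately show "\<bar>cost y\<bar> \<le> (\<Sum>i\<in>L. \<bar>1 - \<rho> i\<bar>) * R"
    unfolding cost_def abs_mult by (intro mult_mono) (auto intro: sum_nonneg)
qed

text \<open>Apart from the time exponent, a jump from label \<open>i\<close> to label
  \<open>j\<close> contributes \<open>Q i j / q\<close> times \<open>g j / g i\<close>, where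
  \<open>g i = exp (\<phi> i) * \<rho> i\<close>. The second factor telescopes and the first is at
  most 1, except at the first jump, where \<open>l0\<close> need not be the label of the state;
  \<open>K\<close> bounds that one.\<close>

lemma weight_le: "\<exists>W>0. \<forall>n z. weight n z \<le> ennreal (W * exp (visit_sum cost n z))"
proof -
  define g where "g i = exp (\<phi> i) * \<rho> i" for i
  have g: "0 < g i" if "i \<in> L" for i using \<rho>_pos[OF that] by (simp add: g_def)
  define K where "K = 1 + (\<Sum>i\<in>L. \<Sum>j\<in>L. Q i j / qmin)"
  have Qn: "0 \<le> Q i j / qmin" if "i \<in> L" "j \<in> L" for i j using Q_pos[OF that] qmin(1) by simp
  have K: "Q i j / qmin \<le> K" if "i \<in> L" "j \<in> L" for i j
  proof -
    have "Q i j / qmin \<le> (\<Sum>j\<in>L. Q i j / qmin)" using that Qn by (intro member_le_sum[where f="\<lambda>j. Q i j / qmin"]) auto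
    also have "\<dots> \<le> (\<Sum>i\<in>L. \<Sum>j\<in>L. Q i j / qmin)"
      using that Qn by (intro member_le_sum[where f="\<lambda>i. \<Sum>j\<in>L. Q i j / qmin"]) (auto intro!: sum_nonneg)
    finally show ?thesis by (simp add: K_def)
  qed
  have K1: "1 \<le> K" unfolding K_def using Qn by (simp add: sum_nonneg)
  have rat: "ratio (fst (z k)) (lab z k) (z (Suc k)) \<le>
      ennreal (c * (g (lab z (Suc k)) / g (lab z k)) * exp (enn2real (snd (z (Suc k))) * cost (fst (z (Suc k)))))"
    if c: "Q (lab z k) (lab z (Suc k)) / q (fst (z k)) (fst (z (Suc k))) \<le> c" for c k z
  proof (cases "snd (z (Suc k)) = \<infinity> \<or> fst (z (Suc k)) \<notin> D")
    case True then show ?thesis by (auto simp: ratio_def tilt_def)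
  next
    case False
    let ?y = "fst (z (Suc k))" and ?i = "lab z k" and ?j = "lab z (Suc k)"
    have j: "\<iota> ?y = ?j" by (simp add: lab_def)
    have "ratio (fst (z k)) ?i (z (Suc k)) = ennreal (Q ?i ?j / q (fst (z k)) ?y * (g ?j / g ?i) * exp (enn2real (snd (z (Suc k))) * cost ?y))"
      using False \<rho>_pos[OF lab_in, of z k] by (simp add: ratio_def tilt_def j cost_def g_def exp_diff mult_ac)
    also have "\<dots> \<le> ennreal (c * (g ?j / g ?i) * exp (enn2real (snd (z (Suc k))) * cost ?y))"
      using c g[OF lab_in, of z k] g[OF lab_in, of z "Suc k"] by (intro ennreal_leI mult_right_mono) (auto intro: less_imp_le)
    finally show ?thesis .
  qed
  have main: "weight n z \<le> ennreal (K * (g (lab z n) / g l0) * exp (visit_sum cost n z))" for n z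
  proof (induction n)
    case 0
    then show ?case using K1 g[OF l0] ennreal_leI[of 1 K] by (simp add: weight_def lab_def visit_sum_def)
  next
    case (Suc n)
    have w: "weight (Suc n) z = weight n z * ratio (fst (z n)) (lab z n) (z (Suc n))"
      by (simp add: weight_def mult.assoc)
    have v: "visit_sum cost (Suc n) z = visit_sum cost n z + enn2real (snd (z (Suc n))) * cost (fst (z (Suc n)))"
      by (simp add: visit_sum_def)
    let ?e = "exp (enn2real (snd (z (Suc n))) * cost (fst (z (Suc n))))"
    show ?case
    proof (cases "n = 0")
      case True
      have "Q (lab z 0) (lab z (Suc 0)) / q (fst (z 0)) (fst (z (Suc 0))) \<le> Q (lab z 0) (lab z (Suc 0)) / qmin"
        using Q_pos[OF lab_in lab_in, of z 0 z "Suc 0"] qmin by (intro divide_left_mono) (auto intro: less_imp_le mult_pos_pos q_pos)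
      also have "\<dots> \<le> K" by (rule K[OF lab_in lab_in])
      finally have "ratio (fst (z 0)) (lab z 0) (z (Suc 0)) \<le> ennreal (K * (g (lab z (Suc 0)) / g l0) * exp (visit_sum cost (Suc 0) z))"
        using rat[of z 0 K] by (simp add: lab_def visit_sum_def)
      moreover have "weight (Suc 0) z \<le> 1 * ratio (fst (z 0)) (lab z 0) (z (Suc 0))"
        using w True by (simp add: weight_def)
      ultimately show ?thesis using True by simp
    next
      case False
      have "Q (lab z n) (lab z (Suc n)) / q (fst (z n)) (fst (z (Suc n))) \<le> 1"
        using False Q_le[of "fst (z n)" "fst (z (Suc n))"] q_pos by (simp add: lab_def divide_le_eq)
      then have "ratio (fst (z n)) (lab z n) (z (Suc n)) \<le> ennreal (1 * (g (lab z (Suc n)) / g (lab z n)) * ?e)" by (rule rat)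
      then have "weight (Suc n) z \<le> ennreal (K * (g (lab z n) / g l0) * exp (visit_sum cost n z)) * ennreal (1 * (g (lab z (Suc n)) / g (lab z n)) * ?e)"
        unfolding w using Suc.IH by (intro mult_mono) auto
      also have "\<dots> = ennreal (K * (g (lab z (Suc n)) / g l0) * exp (visit_sum cost (Suc n) z))"
        using K1 g[OF l0] g[OF lab_in, of z n] g[OF lab_in, of z "Suc n"]
        by (subst ennreal_mult[symmetric]) (auto simp: v exp_add)
      finally show ?thesis .
    qed
  qed
  define W where "W = K * (\<Sum>i\<in>L. g i / g l0)"
  have "weight n z \<le> ennreal (W * exp (visit_sum cost n z))" for n z
  proof (rule order_trans[OF main], intro ennreal_leI mult_right_mono)
    have "g (lab z n) / g l0 \<le> (\<Sum>i\<in>L. g i / g l0)"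
      using lab_in g l0 by (intro member_le_sum[where f="\<lambda>i. g i / g l0"]) (auto intro: less_imp_le)
    then show "K * (g (lab z n) / g l0) \<le> W" unfolding W_def using K1 by (intro mult_left_mono) auto
  qed simp
  moreover have "0 < W" unfolding W_def using K1 g l0 by (intro mult_pos_pos sum_pos) auto
  ultimately show ?thesis by blast
qed

lemma weight_nonzero:
  assumes "weight n z \<noteq> 0"
  shows "snd (z 0) \<le> 1" "k < n \<Longrightarrow> snd (z (Suc k)) \<noteq> \<infinity>"
proof -
  show "snd (z 0) \<le> 1" using assms by (auto simp: weight_def split: if_splits)
  assume k: "k < n"
  have "ratio (fst (z k)) (lab z k) (z (Suc k)) \<noteq> 0"
    using assms k by (auto simp: weight_def prod_zero_iff)
  then show "snd (z (Suc k)) \<noteq> \<infinity>" by (auto simp: ratio_def)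
qed

definition good where
  "good \<Psi> \<epsilon> n = {z. \<forall>\<psi>\<in>\<Psi>. \<bar>visit_sum \<psi> n z - n * mean_visit \<psi>\<bar> \<le> 3 * \<epsilon> * real n}"

text \<open>The weighted mass is at least \<open>1 - exp (- \<delta>1)\<close>, and the weak law
  makes each of the finitely many bad events small, uniformly in \<open>x\<close>; half of the mass
  is left.\<close>

lemma good_mass:
  assumes \<Psi>: "finite \<Psi>" "\<And>\<psi>. \<psi> \<in> \<Psi> \<Longrightarrow> \<psi> \<in> borel_measurable borel" "\<And>\<psi>. \<psi> \<in> \<Psi> \<Longrightarrow> \<exists>B. \<forall>y. \<bar>\<psi> y\<bar> \<le> B"
    and \<epsilon>: "0 < \<epsilon>" and \<delta>1: "0 < \<delta>1"
  shows "\<exists>N. \<forall>n\<ge>N. \<forall>x. \<delta>1 \<le> r x \<longrightarrow> ennreal ((1 - exp (- \<delta>1)) / 2) \<le> (\<integral>\<^sup>+z. weight n z * indicator (good \<Psi> \<epsilon> n) z \<partial>law x)"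
proof -
  have "\<forall>\<psi>\<in>\<Psi>. \<exists>C. \<forall>n x. 0 < n \<longrightarrow> (\<integral>\<^sup>+z. weight n z * indicator {z. C + 2 * \<epsilon> * real n < \<bar>visit_sum \<psi> n z - real n * mean_visit \<psi>\<bar>} z \<partial>law x) \<le> ennreal (C / real n)"
    using weak_law[OF \<Psi>(2) _ \<epsilon>] \<Psi>(3) by meson
  from bchoice[OF this] obtain C where C: "\<forall>\<psi>\<in>\<Psi>. \<forall>n x. 0 < n \<longrightarrow> (\<integral>\<^sup>+z. weight n z * indicator {z. C \<psi> + 2 * \<epsilon> * real n < \<bar>visit_sum \<psi> n z - real n * mean_visit \<psi>\<bar>} z \<partial>law x) \<le> ennreal (C \<psi> / real n)"
    by (elim exE) (rule that)
  define C0 where "C0 = (\<Sum>\<psi>\<in>\<Psi>. \<bar>C \<psi>\<bar>)"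
  have C0: "C \<psi> \<le> C0" if "\<psi> \<in> \<Psi>" for \<psi>
    using member_le_sum[of \<psi> \<Psi> "\<lambda>\<psi>. \<bar>C \<psi>\<bar>"] that \<Psi>(1) by (simp add: C0_def)
  have C00: "0 \<le> C0" by (simp add: C0_def sum_nonneg)
  define p1 where "p1 = 1 - exp (- \<delta>1)"
  have p1: "0 < p1" using \<delta>1 by (simp add: p1_def)
  \<comment> \<open>Large enough for two purposes: \<open>C0 \<le> \<epsilon> * n\<close> brings the
    thresholds of the weak law below \<open>3 * \<epsilon> * n\<close>, and the bad events together
    weigh at most \<open>p1 / 2\<close>.\<close>
  obtain N :: nat where N: "C0 / \<epsilon> + real (card \<Psi>) * C0 * 2 / p1 + 1 \<le> real N" using real_arch_simple by blast
  show ?thesis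
  proof (intro exI[of _ N] allI impI)
    fix n x assume n: "N \<le> n" and x: "\<delta>1 \<le> r x"
    have nn: "C0 / \<epsilon> \<le> n" "card \<Psi> * C0 * 2 / p1 \<le> n" "0 < real n"
    proof -
      have "0 \<le> C0 / \<epsilon>" "0 \<le> card \<Psi> * C0 * 2 / p1" using C00 \<epsilon> p1 by auto
      then show "C0 / \<epsilon> \<le> n" "card \<Psi> * C0 * 2 / p1 \<le> n" "0 < real n" using N n by linarith+
    qed
    let ?bad = "\<lambda>\<psi>. {z. C \<psi> + 2 * \<epsilon> * real n < \<bar>visit_sum \<psi> n z - real n * mean_visit \<psi>\<bar>}"
    have bm: "(\<lambda>z. indicator (?bad \<psi>) z :: ennreal) \<in> borel_measurable (law x)" if "\<psi> \<in> \<Psi>" for \<psi>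
    proof -
      have [measurable]: "visit_sum \<psi> n \<in> borel_measurable (PiM UNIV (\<lambda>_. visit_space))" using measurable_visit_sum \<Psi>(2) that by blast
      have "{z \<in> space (law x). C \<psi> + 2 * \<epsilon> * real n < \<bar>visit_sum \<psi> n z - real n * mean_visit \<psi>\<bar>} \<in> sets (law x)" by measurable
      then show ?thesis by (intro borel_measurable_indicator) (simp add: space_law)
    qed
    have gm: "(\<lambda>z. indicator (good \<Psi> \<epsilon> n) z :: ennreal) \<in> borel_measurable (law x)"
    proof -
      have [measurable]: "visit_sum \<psi> n \<in> borel_measurable (PiM UNIV (\<lambda>_. visit_space))" if "\<psi> \<in> \<Psi>" for \<psi> using measurable_visit_sum \<Psi>(2) that by blast
      have "{z \<in> space (law x). \<forall>\<psi>\<in>\<Psi>. \<bar>visit_sum \<psi> n z - real n * mean_visit \<psi>\<bar> \<le> 3 * \<epsilon> * real n} \<in> sets (law x)"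
        using \<Psi>(1) by (intro sets.sets_Collect_finite_All) measurable
      then show ?thesis by (intro borel_measurable_indicator) (simp add: space_law good_def)
    qed
    have [measurable]: "weight n \<in> borel_measurable (law x)" by simp
    have "ennreal p1 \<le> ennreal (1 - exp (- r x))" unfolding p1_def using x by (intro ennreal_leI) simp
    also have "\<dots> \<le> (\<integral>\<^sup>+z. weight n z \<partial>law x)" using nn_integral_weight_0(1) by (simp add: nn_integral_weight[where n=n])
    also have "\<dots> \<le> (\<integral>\<^sup>+z. weight n z * indicator (good \<Psi> \<epsilon> n) z + (\<Sum>\<psi>\<in>\<Psi>. weight n z * indicator (?bad \<psi>) z) \<partial>law x)"
    proof (intro nn_integral_mono)
      fix z
      show "weight n z \<le> weight n z * indicator (good \<Psi> \<epsilon> n) z + (\<Sum>\<psi>\<in>\<Psi>. weight n z * indicator (?bad \<psi>) z)"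
      proof (cases "z \<in> good \<Psi> \<epsilon> n")
        case False
        then obtain \<psi> where \<psi>: "\<psi> \<in> \<Psi>" "3 * \<epsilon> * n < \<bar>visit_sum \<psi> n z - n * mean_visit \<psi>\<bar>" by (auto simp: good_def)
        have "C0 \<le> \<epsilon> * n" using nn(1) \<epsilon> by (simp add: divide_le_eq mult.commute)
        then have "z \<in> ?bad \<psi>" using C0[OF \<psi>(1)] \<psi>(2) by simp
        then have "weight n z = weight n z * indicator (?bad \<psi>) z" by simp
        also have "\<dots> \<le> (\<Sum>\<psi>\<in>\<Psi>. weight n z * indicator (?bad \<psi>) z)"
          using \<psi>(1) \<Psi>(1) by (intro member_le_sum[where f="\<lambda>\<psi>. weight n z * indicator (?bad \<psi>) z"]) auto
        finally show ?thesis by (simp add: add_increasing)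
      qed simp
    qed
    also have "\<dots> = (\<integral>\<^sup>+z. weight n z * indicator (good \<Psi> \<epsilon> n) z \<partial>law x) + (\<Sum>\<psi>\<in>\<Psi>. (\<integral>\<^sup>+z. weight n z * indicator (?bad \<psi>) z \<partial>law x))"
    proof -
      have wb: "(\<lambda>z. weight n z * indicator (?bad \<psi>) z) \<in> borel_measurable (law x)" if "\<psi> \<in> \<Psi>" for \<psi>
        by (rule borel_measurable_times_ennreal[OF _ bm[OF that]]) simp
      have wg: "(\<lambda>z. weight n z * indicator (good \<Psi> \<epsilon> n) z) \<in> borel_measurable (law x)"
        by (rule borel_measurable_times_ennreal[OF _ gm]) simp
      have ws: "(\<lambda>z. \<Sum>\<psi>\<in>\<Psi>. weight n z * indicator (?bad \<psi>) z) \<in> borel_measurable (law x)"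
        by (rule borel_measurable_sum) (rule wb)
      show ?thesis unfolding nn_integral_add[OF wg ws] using nn_integral_sum[of \<Psi> "\<lambda>\<psi> z. weight n z * indicator (?bad \<psi>) z" "law x", OF wb]
        by simp
    qed
    also have "\<dots> \<le> (\<integral>\<^sup>+z. weight n z * indicator (good \<Psi> \<epsilon> n) z \<partial>law x) + (\<Sum>\<psi>\<in>\<Psi>. ennreal (C0 / n))"
    proof (intro add_left_mono sum_mono)
      fix \<psi> assume "\<psi> \<in> \<Psi>"
      then have "(\<integral>\<^sup>+z. weight n z * indicator (?bad \<psi>) z \<partial>law x) \<le> ennreal (C \<psi> / n)" using C nn(3) by simp
      also have "\<dots> \<le> ennreal (C0 / n)" using C0[OF \<open>\<psi> \<in> \<Psi>\<close>] by (intro ennreal_leI divide_right_mono) auto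
      finally show "(\<integral>\<^sup>+z. weight n z * indicator (?bad \<psi>) z \<partial>law x) \<le> ennreal (C0 / n)" .
    qed
    also have "(\<Sum>\<psi>\<in>\<Psi>. ennreal (C0 / n)) = ennreal (card \<Psi> * (C0 / n))"
      using C00 by (simp add: ennreal_mult[symmetric] ennreal_of_nat_eq_real_of_nat)
    also have "\<dots> \<le> ennreal (p1 / 2)"
      using nn(2,3) p1 by (intro ennreal_leI) (simp add: field_simps)
    finally have *: "ennreal p1 \<le> (\<integral>\<^sup>+z. weight n z * indicator (good \<Psi> \<epsilon> n) z \<partial>law x) + ennreal (p1 / 2)"
      by (simp add: add_left_mono)
    show "ennreal ((1 - exp (- \<delta>1)) / 2) \<le> (\<integral>\<^sup>+z. weight n z * indicator (good \<Psi> \<epsilon> n) z \<partial>law x)"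
      using * p1 unfolding p1_def[symmetric]
      by (cases "\<integral>\<^sup>+z. weight n z * indicator (good \<Psi> \<epsilon> n) z \<partial>law x")
        (auto simp: ennreal_plus[symmetric] ennreal_le_iff simp del: ennreal_plus)
  qed
qed

lemma measure_path_event:
  fixes x :: 'a and v :: "('a \<Rightarrow> real) \<Rightarrow> real" and e T :: real
  assumes Fs: "finite Fs" "\<And>f. f \<in> Fs \<Longrightarrow> continuous_on UNIV f" and T: "0 < T"
  defines "E \<equiv> {z \<in> space (law x). \<forall>f\<in>Fs. \<bar>1 / T * (LINT t:{0..T}|lborel. f (jump_path z t)) - v f\<bar> < e}"
  shows "E \<in> sets (law x)"
    "measure (chain_law r p x) {\<omega> \<in> space (chain_law r p x). \<forall>f\<in>Fs. \<bar>(\<integral>y. f y \<partial>empirical_measure T \<omega>) - v f\<bar> < e} = measure (law x) E"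
proof -
  let ?S = "{\<omega> \<in> space skorokhod_space. \<forall>f\<in>Fs. \<bar>1 / T * (LINT t:{0..T}|lborel. f (\<omega> t)) - v f\<bar> < e}"
  have S: "?S \<in> sets skorokhod_space"
  proof (rule sets.sets_Collect_finite_All[OF _ Fs(1)])
    fix f assume "f \<in> Fs"
    then have [measurable]: "(\<lambda>\<omega>. LINT t:{0..T}|lborel. f (\<omega> t)) \<in> borel_measurable skorokhod_space"
      by (intro measurable_path_integral Fs(2))
    show "{\<omega> \<in> space skorokhod_space. \<bar>1 / T * (LINT t:{0..T}|lborel. f (\<omega> t)) - v f\<bar> < e} \<in> sets skorokhod_space"
      by measurable
  qed
  have E: "E = jump_path -` ?S \<inter> space (law x)"
    unfolding E_def by (auto simp: space_skorokhod cadlag_jump_path)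
  show "E \<in> sets (law x)" unfolding E by (rule measurable_sets[OF measurable_jump_path_law S])
  have sp: "space (chain_law r p x) = space skorokhod_space" by (rule sets_eq_imp_space_eq[OF sets_chain_law])
  have eq: "{\<omega> \<in> space (chain_law r p x). \<forall>f\<in>Fs. \<bar>(\<integral>y. f y \<partial>empirical_measure T \<omega>) - v f\<bar> < e} = ?S"
    using Fs(2) by (auto simp: sp space_skorokhod integral_empirical_measure[OF _ T])
  show "measure (chain_law r p x) {\<omega> \<in> space (chain_law r p x). \<forall>f\<in>Fs. \<bar>(\<integral>y. f y \<partial>empirical_measure T \<omega>) - v f\<bar> < e} = measure (law x) E"
    unfolding eq unfolding chain_law_def E by (rule measure_distr[OF measurable_jump_path_law S])
qed

text \<open>On the good event \<open>n\<close> visits last at least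
  \<open>n * (m1 - 3 * \<epsilon>)\<close>, and \<open>n\<close> is just large enough for this to
  reach \<open>T\<close>, so the overshoot is at most \<open>m1 + 6 * \<epsilon> * n\<close>. The
  error is split into a part free of \<open>T\<close> and a part proportional to
  \<open>\<epsilon> * T\<close>.\<close>

lemma good_path_close:
  assumes z: "z \<in> good \<Psi> \<epsilon> n" "weight n z \<noteq> 0" and ex: "(SUP n. jump_time z n) = \<infinity>"
    and \<Psi>: "(\<lambda>_. 1) \<in> \<Psi>" "f \<in> \<Psi>" and B: "\<And>y. \<bar>f y\<bar> \<le> B" and M: "\<bar>mean_visit f\<bar> \<le> M"
    and m1: "m1 = mean_visit (\<lambda>_. 1)" "0 < m1" and \<epsilon>: "0 < \<epsilon>" "\<epsilon> \<le> m1 / 6" and T: "0 < T"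
    and n: "T / (m1 - 3 * \<epsilon>) \<le> real n" "real n \<le> T / (m1 - 3 * \<epsilon>) + 1"
  shows "\<bar>(LINT t:{0..T}|lborel. f (jump_path z t)) - T * (mean_visit f / m1)\<bar> \<le>
    (B * (m1 + 2 + 6 * \<epsilon>) + 3 * \<epsilon> + M) + T * (\<epsilon> * ((6 * B + 3) * (2 / m1) + M * (6 / m1\<^sup>2)))"
    "\<bar>real n - T / m1\<bar> \<le> T * (\<epsilon> * (6 / m1\<^sup>2)) + 1" "real n \<le> 2 * T / m1 + 1"
proof -
  define a where "a = m1 - 3 * \<epsilon>"
  have a: "m1 / 2 \<le> a" "0 < a" "a \<le> m1" using m1(2) \<epsilon> by (auto simp: a_def)
  have B0: "0 \<le> B" using B[of undefined] by linarith
  have M0: "0 \<le> M" using M by linarith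
  have Ta: "T / a \<le> 2 * T / m1"
  proof -
    have "T / a \<le> T / (m1 / 2)" using a m1(2) T by (intro divide_left_mono) auto
    then show ?thesis by (simp add: mult.commute)
  qed
  show n2: "real n \<le> 2 * T / m1 + 1" using n(2) Ta by (simp add: a_def)
  have "1 / a - 1 / m1 = 3 * \<epsilon> / (a * m1)" using a m1(2) by (simp add: a_def field_simps)
  also have "\<dots> \<le> 3 * \<epsilon> / (m1 / 2 * m1)" using a m1(2) \<epsilon> by (intro divide_left_mono mult_right_mono mult_pos_pos) auto
  also have "\<dots> = \<epsilon> * (6 / m1\<^sup>2)" by (simp add: power2_eq_square)
  finally have "T * (1 / a - 1 / m1) \<le> T * (\<epsilon> * (6 / m1\<^sup>2))" using T by (intro mult_left_mono) auto
  moreover have "T / m1 \<le> T / a" using a m1(2) T by (intro divide_left_mono) auto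
  ultimately show n3: "\<bar>real n - T / m1\<bar> \<le> T * (\<epsilon> * (6 / m1\<^sup>2)) + 1"
    using n by (simp add: a_def[symmetric] right_diff_distrib)
  let ?V = "visit_sum (\<lambda>_. 1) n z"
  have g: "\<bar>visit_sum \<psi> n z - n * mean_visit \<psi>\<bar> \<le> 3 * \<epsilon> * n" if "\<psi> \<in> \<Psi>" for \<psi> using z(1) that by (simp add: good_def)
  have gV: "\<bar>?V - n * m1\<bar> \<le> 3 * \<epsilon> * n" using g[OF \<Psi>(1)] m1(1) by simp
  have na: "T \<le> n * a" using n(1)[folded a_def] a(2) by (simp add: pos_divide_le_eq)
  have "n * a \<le> (T / a + 1) * a" using n(2)[folded a_def] a(2) by (intro mult_right_mono) auto
  then have na2: "n * a \<le> T + a" using a(2) by (simp add: distrib_right)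
  have nae: "n * a = n * m1 - 3 * \<epsilon> * n" by (simp add: a_def algebra_simps)
  have TV: "T \<le> ?V" using gV na nae by linarith
  have "?V - T \<le> m1 + 6 * \<epsilon> * n" using gV na2 nae a(3) by linarith
  have "\<bar>(LINT t:{0..T}|lborel. f (jump_path z t)) - visit_sum f n z\<bar> \<le> B * (?V - T + 2)"
    using weight_nonzero[OF z(2)] by (intro path_integral_visit_sum ex T TV B) auto
  also have "\<dots> \<le> B * (m1 + 6 * \<epsilon> * n + 2)" using \<open>?V - T \<le> m1 + 6 * \<epsilon> * n\<close> B0 by (intro mult_left_mono) auto
  finally have 1: "\<bar>(LINT t:{0..T}|lborel. f (jump_path z t)) - visit_sum f n z\<bar> \<le> B * (m1 + 6 * \<epsilon> * n + 2)" .
  have "\<bar>n * mean_visit f - T * (mean_visit f / m1)\<bar> = \<bar>real n - T / m1\<bar> * \<bar>mean_visit f\<bar>"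
    by (simp add: abs_mult[symmetric] left_diff_distrib)
  also have "\<dots> \<le> (T * (\<epsilon> * (6 / m1\<^sup>2)) + 1) * M" using n3 M by (intro mult_mono) auto
  finally have 2: "\<bar>n * mean_visit f - T * (mean_visit f / m1)\<bar> \<le> (T * (\<epsilon> * (6 / m1\<^sup>2)) + 1) * M" .
  have "\<epsilon> * (6 * B + 3) * n \<le> \<epsilon> * (6 * B + 3) * (2 * T / m1 + 1)" using n2 \<epsilon> B0 by (intro mult_left_mono) auto
  then have 3: "B * (m1 + 6 * \<epsilon> * n + 2) + 3 * \<epsilon> * n \<le> B * (m1 + 2) + \<epsilon> * (6 * B + 3) * (2 * T / m1 + 1)"
    by (simp add: algebra_simps)
  have "\<bar>(LINT t:{0..T}|lborel. f (jump_path z t)) - T * (mean_visit f / m1)\<bar> \<le>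
      B * (m1 + 2) + \<epsilon> * (6 * B + 3) * (2 * T / m1 + 1) + (T * (\<epsilon> * (6 / m1\<^sup>2)) + 1) * M"
    using 1 2 3 g[OF \<Psi>(2)] by linarith
  also have "\<dots> = (B * (m1 + 2 + 6 * \<epsilon>) + 3 * \<epsilon> + M) + T * (\<epsilon> * ((6 * B + 3) * (2 / m1) + M * (6 / m1\<^sup>2)))"
    by (simp add: algebra_simps)
  finally show "\<bar>(LINT t:{0..T}|lborel. f (jump_path z t)) - T * (mean_visit f / m1)\<bar> \<le>
    (B * (m1 + 2 + 6 * \<epsilon>) + 3 * \<epsilon> + M) + T * (\<epsilon> * ((6 * B + 3) * (2 / m1) + M * (6 / m1\<^sup>2)))" .
qed

text \<open>On the good event the weight is at most
  \<open>W * exp (n * mean_visit cost + 3 * \<epsilon> * n)\<close> and the empirical integrals are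
  close to their limits. Dividing the weighted mass \<open>p0\<close> by this bound gives the
  probability, with \<open>n\<close> close to \<open>T / m1\<close>.\<close>

theorem tilted_lower_bound:
  assumes Fs: "finite Fs" "\<And>f. f \<in> Fs \<Longrightarrow> continuous_on UNIV f" and e: "0 < e" and \<kappa>: "0 < \<kappa>" and \<delta>1: "0 < \<delta>1"
    and m1: "m1 = mean_visit (\<lambda>_. 1)" "0 < m1"
  shows "\<forall>\<^sub>F T in at_top. \<forall>x. \<delta>1 \<le> r x \<longrightarrow> exp (- T * (mean_visit cost / m1 + \<kappa>)) \<le>
    measure (chain_law r p x) {\<omega> \<in> space (chain_law r p x). \<forall>f\<in>Fs. \<bar>(\<integral>y. f y \<partial>empirical_measure T \<omega>) - mean_visit f / m1\<bar> < e}"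
proof -
  define \<Psi> where "\<Psi> = insert (\<lambda>_. 1) (insert cost Fs)"
  have bd: "\<exists>B. \<forall>y. \<bar>\<psi> y\<bar> \<le> B" if "\<psi> \<in> \<Psi>" for \<psi>
  proof -
    have "\<exists>B. \<forall>y. \<bar>f y\<bar> \<le> B" if "f \<in> Fs" for f
      using bounded_continuous_compact[OF compact_space Fs(2)[OF that]] by blast
    then show ?thesis using that cost_bounded unfolding \<Psi>_def by force
  qed
  then have "\<forall>\<psi>\<in>\<Psi>. \<exists>B. \<forall>y. \<bar>\<psi> y\<bar> \<le> B" by blast
  from bchoice[OF this] obtain b where b: "\<forall>\<psi>\<in>\<Psi>. \<forall>y. \<bar>\<psi> y\<bar> \<le> b \<psi>" by (elim exE) (rule that)
  have fin: "finite \<Psi>" using Fs(1) by (simp add: \<Psi>_def)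
  define B where "B = (\<Sum>\<psi>\<in>\<Psi>. \<bar>b \<psi>\<bar>)"
  have B: "\<bar>\<psi> y\<bar> \<le> B" if "\<psi> \<in> \<Psi>" for \<psi> y
    using b that member_le_sum[of \<psi> \<Psi> "\<lambda>\<psi>. \<bar>b \<psi>\<bar>"] fin unfolding B_def by (smt (verit) abs_ge_zero)
  have B0: "0 \<le> B" by (simp add: B_def sum_nonneg)
  define M where "M = (\<Sum>\<psi>\<in>\<Psi>. \<bar>mean_visit \<psi>\<bar>)"
  have M: "\<bar>mean_visit \<psi>\<bar> \<le> M" if "\<psi> \<in> \<Psi>" for \<psi>
    using that member_le_sum[of \<psi> \<Psi> "\<lambda>\<psi>. \<bar>mean_visit \<psi>\<bar>"] fin by (simp add: M_def)
  have M0: "0 \<le> M" by (simp add: M_def sum_nonneg)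
  \<comment> \<open>The coefficient of \<open>\<epsilon> * T\<close> in
    \<open>good_path_close\<close>; \<open>\<epsilon>\<close> is taken so small that
    \<open>\<epsilon> * A\<close> is at most a quarter of both \<open>e\<close> and
    \<open>\<kappa>\<close>.\<close>
  define A where "A = (6 * B + 3) * (2 / m1) + M * (6 / m1\<^sup>2)"
  have A: "0 < A" unfolding A_def using B0 M0 m1(2) by (intro add_pos_nonneg mult_pos_pos add_nonneg_pos mult_nonneg_nonneg) auto
  define \<epsilon> where "\<epsilon> = min (m1 / 6) (min e \<kappa> / (4 * A))"
  have \<epsilon>: "0 < \<epsilon>" "\<epsilon> \<le> m1 / 6" using m1(2) A e \<kappa> by (auto simp: \<epsilon>_def)
  have "\<epsilon> * A \<le> min e \<kappa> / (4 * A) * A" using A by (intro mult_right_mono) (auto simp: \<epsilon>_def)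
  then have \<epsilon>A: "\<epsilon> * A \<le> e / 4" "\<epsilon> * A \<le> \<kappa> / 4" using A by (auto simp: min_def split: if_splits)
  define a where "a = m1 - 3 * \<epsilon>"
  have a: "0 < a" using m1(2) \<epsilon> by (simp add: a_def)
  define p0 where "p0 = (1 - exp (- \<delta>1)) / 2"
  have p0: "0 < p0" using \<delta>1 by (simp add: p0_def)
  obtain W where W: "0 < W" "\<forall>n z. weight n z \<le> ennreal (W * exp (visit_sum cost n z))" using weight_le by blast
  have meas: "\<psi> \<in> borel_measurable borel" if "\<psi> \<in> \<Psi>" for \<psi>
    using that Fs(2) borel_measurable_continuous_onI by (auto simp: \<Psi>_def)
  obtain N where N: "\<forall>n\<ge>N. \<forall>x. \<delta>1 \<le> r x \<longrightarrow> ennreal p0 \<le> (\<integral>\<^sup>+z. weight n z * indicator (good \<Psi> \<epsilon> n) z \<partial>law x)"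
    using good_mass[OF fin meas bd \<epsilon>(1) \<delta>1] unfolding p0_def by blast
  \<comment> \<open>The errors that do not grow with \<open>T\<close>: \<open>c1\<close> in the
    closeness of the integrals, \<open>c2\<close> in the exponent. Both are outweighed once
    \<open>T\<close> passes the thresholds in \<open>ev\<close>.\<close>
  define c1 where "c1 = B * (m1 + 2 + 6 * \<epsilon>) + 3 * \<epsilon> + M"
  define c2 where "c2 = ln (W / p0) + M + 3 * \<epsilon>"
  have ev: "\<forall>\<^sub>F T in at_top. (0::real) < T \<and> a * N \<le> T \<and> 4 * c1 / e \<le> T \<and> 2 * c2 / \<kappa> \<le> T"
    by (intro eventually_conj eventually_gt_at_top eventually_ge_at_top)
  then show ?thesis
  proof eventually_elim
    case (elim T)
    then have T: "0 < T" "a * N \<le> T" "4 * c1 / e \<le> T" "2 * c2 / \<kappa> \<le> T" by auto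
    show ?case
    proof (intro allI impI)
      fix x assume x: "\<delta>1 \<le> r x"
      interpret PL: prob_space "law x" by (rule prob_space_law)
      define n where "n = nat \<lceil>T / a\<rceil>"
      have n: "T / a \<le> real n" "real n \<le> T / a + 1"
      proof -
        have "0 < T / a" using T(1) a by simp
        then have "0 \<le> \<lceil>T / a\<rceil>" by linarith
        then have "real n = of_int \<lceil>T / a\<rceil>" by (simp add: n_def)
        then show "T / a \<le> real n" "real n \<le> T / a + 1" by linarith+
      qed
      have "real N \<le> T / a" using T(2) a by (simp add: field_simps)
      then have nN: "N \<le> n" using n(1) by linarith
      let ?E = "{z \<in> space (law x). \<forall>f\<in>Fs. \<bar>1 / T * (LINT t:{0..T}|lborel. f (jump_path z t)) - mean_visit f / m1\<bar> < e}"
      have E: "?E \<in> sets (law x)" by (rule measure_path_event(1)[OF Fs T(1)])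
      have E2: "measure (chain_law r p x) {\<omega> \<in> space (chain_law r p x). \<forall>f\<in>Fs. \<bar>(\<integral>y. f y \<partial>empirical_measure T \<omega>) - mean_visit f / m1\<bar> < e} = PL.prob ?E"
        by (rule measure_path_event(2)[OF Fs T(1)])
      let ?c = "W * exp (n * mean_visit cost + 3 * \<epsilon> * n)"
      have "ennreal p0 \<le> (\<integral>\<^sup>+z. weight n z * indicator (good \<Psi> \<epsilon> n) z \<partial>law x)" using N nN x by blast
      also have "\<dots> \<le> (\<integral>\<^sup>+z. ennreal ?c * indicator ?E z \<partial>law x)"
      proof (rule nn_integral_mono_AE)
        show "AE z in law x. weight n z * indicator (good \<Psi> \<epsilon> n) z \<le> ennreal ?c * indicator ?E z"
          using AE_nonexplosive[OF R(2), of x]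
        proof eventually_elim
          case (elim z)
          show ?case
          proof (cases "weight n z = 0 \<or> z \<notin> good \<Psi> \<epsilon> n")
            case False
            then have z: "z \<in> good \<Psi> \<epsilon> n" "weight n z \<noteq> 0" by auto
            have "z \<in> ?E"
            proof (intro CollectI conjI ballI)
              show "z \<in> space (law x)" by (simp add: space_law)
              fix f assume f: "f \<in> Fs"
              then have f\<Psi>: "f \<in> \<Psi>" by (simp add: \<Psi>_def)
              let ?I = "LINT t:{0..T}|lborel. f (jump_path z t)"
              have "\<bar>?I - T * (mean_visit f / m1)\<bar> \<le> c1 + T * (\<epsilon> * A)"
                unfolding c1_def A_def using n
                by (intro good_path_close(1)[OF z elim _ f\<Psi> B[OF f\<Psi>] M[OF f\<Psi>] m1 \<epsilon> T(1)]) (auto simp: \<Psi>_def a_def)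
              also have "\<dots> \<le> T * (e / 4) + T * (e / 4)"
                using T e \<epsilon>A(1) by (intro add_mono mult_left_mono) (auto simp: field_simps)
              also have "\<dots> < T * e" using T(1) e by simp
              finally have "\<bar>?I - T * (mean_visit f / m1)\<bar> < T * e" .
              moreover have "\<bar>?I - T * (mean_visit f / m1)\<bar> = T * \<bar>1 / T * ?I - mean_visit f / m1\<bar>"
              proof -
                have "?I - T * (mean_visit f / m1) = T * (1 / T * ?I - mean_visit f / m1)" using T(1) by (simp add: right_diff_distrib)
                then show ?thesis using T(1) by (simp only: abs_mult abs_of_pos)
              qed
              ultimately show "\<bar>1 / T * ?I - mean_visit f / m1\<bar> < e" using T(1) by simp
            qed
            moreover have "weight n z \<le> ennreal ?c"
            proof -
              have "\<bar>visit_sum cost n z - n * mean_visit cost\<bar> \<le> 3 * \<epsilon> * n" using z(1) by (simp add: good_def \<Psi>_def)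
              then have "W * exp (visit_sum cost n z) \<le> ?c" using W(1) by (intro mult_left_mono) auto
              then show ?thesis using W(2) ennreal_leI order_trans by blast
            qed
            ultimately show ?thesis using z by simp
          qed auto
        qed
      qed
      also have "\<dots> = ennreal ?c * emeasure (law x) ?E" by (rule nn_integral_cmult_indicator) (rule E)
      also have "\<dots> = ennreal (?c * PL.prob ?E)"
        using W(1) by (simp add: PL.emeasure_eq_measure ennreal_mult)
      finally have p: "p0 \<le> ?c * PL.prob ?E" using W(1) by (subst (asm) ennreal_le_iff) auto
      \<comment> \<open>These bounds concern only the number \<open>n\<close> but are drawn from a
        lemma about a good sequence; the positive weighted mass provides one.\<close>
      have nb: "\<bar>real n - T / m1\<bar> \<le> T * (\<epsilon> * (6 / m1\<^sup>2)) + 1" "real n \<le> 2 * T / m1 + 1"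
      proof -
        have "\<exists>z. z \<in> good \<Psi> \<epsilon> n \<and> weight n z \<noteq> 0 \<and> (SUP n. jump_time z n) = \<infinity>"
        proof (rule ccontr)
          assume none: "\<nexists>z. z \<in> good \<Psi> \<epsilon> n \<and> weight n z \<noteq> 0 \<and> (SUP n. jump_time z n) = \<infinity>"
          have "ennreal p0 \<le> (\<integral>\<^sup>+z. weight n z * indicator (good \<Psi> \<epsilon> n) z \<partial>law x)"
            using N nN x by blast
          also have "\<dots> = (\<integral>\<^sup>+z. 0 \<partial>law x)"
          proof (rule nn_integral_cong_AE)
            show "AE z in law x. weight n z * indicator (good \<Psi> \<epsilon> n) z = 0"
              using AE_nonexplosive[OF R(2), of x]
            proof eventually_elim
              case (elim z)
              then have "weight n z = 0 \<or> z \<notin> good \<Psi> \<epsilon> n" using none by blast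
              then show ?case by auto
            qed
          qed
          finally show False using p0 by simp
        qed
        then obtain z where z: "z \<in> good \<Psi> \<epsilon> n" "weight n z \<noteq> 0" "(SUP n. jump_time z n) = \<infinity>" by blast
        have 1: "(\<lambda>_. 1) \<in> \<Psi>" by (simp add: \<Psi>_def)
        show "\<bar>real n - T / m1\<bar> \<le> T * (\<epsilon> * (6 / m1\<^sup>2)) + 1" "real n \<le> 2 * T / m1 + 1"
          using good_path_close(2,3)[OF z 1 1 B[OF 1] M[OF 1] m1 \<epsilon> T(1)] n by (auto simp: a_def)
      qed
      have "n * mean_visit cost - T * (mean_visit cost / m1) = (real n - T / m1) * mean_visit cost"
        by (simp add: left_diff_distrib)
      also have "\<dots> \<le> \<bar>real n - T / m1\<bar> * \<bar>mean_visit cost\<bar>" by (simp add: abs_mult[symmetric])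
      also have "\<dots> \<le> (T * (\<epsilon> * (6 / m1\<^sup>2)) + 1) * M"
        using nb(1) M[of cost] by (intro mult_mono) (auto simp: \<Psi>_def)
      finally have c: "n * mean_visit cost \<le> T * (mean_visit cost / m1) + (T * (\<epsilon> * (6 / m1\<^sup>2)) + 1) * M" by simp
      have "3 * \<epsilon> * n \<le> 3 * \<epsilon> * (2 * T / m1 + 1)" using nb(2) \<epsilon>(1) by (intro mult_left_mono) auto
      with c have "n * mean_visit cost + 3 * \<epsilon> * n \<le> T * (mean_visit cost / m1) + T * (\<epsilon> * (3 * (2 / m1) + M * (6 / m1\<^sup>2))) + (M + 3 * \<epsilon>)"
        by (simp add: algebra_simps)
      also have "T * (\<epsilon> * (3 * (2 / m1) + M * (6 / m1\<^sup>2))) \<le> T * (\<epsilon> * A)"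
        unfolding A_def using T(1) \<epsilon>(1) B0 m1(2) by (intro mult_left_mono add_right_mono mult_right_mono) auto
      also have "T * (\<epsilon> * A) \<le> T * (\<kappa> / 4)" using T(1) \<epsilon>A(2) by (intro mult_left_mono) auto
      finally have ex: "n * mean_visit cost + 3 * \<epsilon> * n \<le> T * (mean_visit cost / m1) + T * (\<kappa> / 4) + (M + 3 * \<epsilon>)" by simp
      have "exp (- T * (mean_visit cost / m1 + \<kappa>)) \<le> exp (- (n * mean_visit cost + 3 * \<epsilon> * n) - ln (W / p0))"
      proof -
        have "c2 \<le> T * (\<kappa> / 2)" using T(4) \<kappa> by (simp add: field_simps)
        then show ?thesis using ex T(1) \<kappa> unfolding c2_def exp_le_cancel_iff
          by (simp add: algebra_simps) (use mult_pos_pos[OF T(1) \<kappa>] in linarith)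
      qed
      also have "\<dots> = exp (- (n * mean_visit cost + 3 * \<epsilon> * n)) * (p0 / W)"
        using W(1) p0 by (simp add: exp_diff)
      also have "\<dots> = p0 / ?c"
      proof -
        have "exp (- u) * (p0 / W) = p0 / (W * exp u)" for u by (simp add: exp_minus field_simps)
        then show ?thesis .
      qed
      also have "\<dots> \<le> PL.prob ?E" using p W(1) by (simp add: divide_le_eq mult.commute)
      finally show "exp (- T * (mean_visit cost / m1 + \<kappa>)) \<le> measure (chain_law r p x)
        {\<omega> \<in> space (chain_law r p x). \<forall>f\<in>Fs. \<bar>(\<integral>y. f y \<partial>empirical_measure T \<omega>) - mean_visit f / m1\<bar> < e}"
        unfolding E2 .
    qed
  qed
qed

end

section \<open>Discretisation\<close>

text \<open>The minimising \<open>\<phi>\<close> has no a priori bound. Truncating \<open>e\<^sup>\<phi>\<close> to \<open>[1/K, K]\<close> costs little, with an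
  error that does not depend on the partition.\<close>

lemma truncated_tilt:
  fixes Q :: "'l \<Rightarrow> 'l \<Rightarrow> real" and \<phi> b m :: "'l \<Rightarrow> real"
  assumes L: "finite L" "L \<noteq> {}" and b: "\<And>i. i \<in> L \<Longrightarrow> 0 \<le> b i"
    and Q: "\<And>i j. i \<in> L \<Longrightarrow> j \<in> L \<Longrightarrow> c \<le> Q i j" "\<And>i j. i \<in> L \<Longrightarrow> j \<in> L \<Longrightarrow> Q i j \<le> C" and c: "0 < c"
    and m: "\<And>j. j \<in> L \<Longrightarrow> 0 < m j" "(\<Sum>j\<in>L. m j) \<le> 1" and K: "1 \<le> K"
  shows "\<exists>v. (\<forall>i\<in>L. 1 / K \<le> v i \<and> v i \<le> K) \<and>
    (\<Sum>i\<in>L. \<Sum>j\<in>L. b i * Q i j * m j * (v j / v i)) \<le>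
      (1 + C / (K * c)) * (\<Sum>i\<in>L. \<Sum>j\<in>L. b i * Q i j * m j * exp (\<phi> j - \<phi> i)) + (\<Sum>i\<in>L. b i) * (2 * C / K)"
proof -
  \<comment> \<open>Normalises \<open>u\<close> to total mass 1 against \<open>m\<close>, so the
    values \<open>P i\<close> lie between \<open>c\<close> and \<open>C\<close> however wild
    \<open>\<phi>\<close> is; the quotients \<open>u j / u i\<close> are unaffected.\<close>
  define S where "S = (\<Sum>j\<in>L. m j * exp (\<phi> j))"
  have S: "0 < S" unfolding S_def using L m by (intro sum_pos) auto
  define u where "u j = exp (\<phi> j) / S" for j
  have u: "0 < u j" for j using S by (simp add: u_def)
  have uS: "(\<Sum>j\<in>L. m j * u j) = 1" using S by (simp add: u_def sum_divide_distrib[symmetric] S_def)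
  have cC: "0 < C" using L Q c by (meson all_not_in_conv less_le_trans order_trans)
  have K0: "0 < K" using K by simp
  \<comment> \<open>Adding \<open>1 / K\<close> costs at most \<open>C / K\<close> in the
    numerators; cutting at \<open>K\<close> adds at most \<open>1 / K\<close> to the inverse of
    \<open>v\<close>. The cross term \<open>C / K / u i\<close> is absorbed by
    \<open>P i / u i\<close>, because \<open>P i\<close> is at least \<open>c\<close>.\<close>
  define v where "v j = min K (u j + 1 / K)" for j
  have K1: "1 / K \<le> K" using K by (simp add: divide_le_eq) (metis K mult_mono mult_1 order_trans zero_le_one)
  have v: "1 / K \<le> v j" "v j \<le> K" for j using u[of j] K1 by (auto simp: v_def)
  have v0: "0 < v j" for j using v(1)[of j] K0 by (smt (verit) divide_pos_pos)
  have vinv: "1 / v i \<le> 1 / u i + 1 / K" for i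
  proof (cases "K \<le> u i + 1 / K")
    case True then show ?thesis using u[of i] by (simp add: v_def)
  next
    case False
    then have "v i = u i + 1 / K" by (simp add: v_def)
    moreover have "1 / (u i + 1 / K) \<le> 1 / u i" using u[of i] K0 by (intro divide_left_mono) (auto intro!: mult_pos_pos add_pos_pos)
    ultimately show ?thesis using K0 by (smt (verit) divide_pos_pos)
  qed
  define P where "P i = (\<Sum>j\<in>L. Q i j * m j * u j)" for i
  have P: "c \<le> P i" "P i \<le> C" if i: "i \<in> L" for i
  proof -
    have "(\<Sum>j\<in>L. c * (m j * u j)) \<le> P i"
      unfolding P_def mult.assoc using Q(1)[OF i] m u by (intro sum_mono mult_right_mono) (auto intro: less_imp_le)
    then show "c \<le> P i" using uS by (simp add: sum_distrib_left[symmetric])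
    have "P i \<le> (\<Sum>j\<in>L. C * (m j * u j))"
      unfolding P_def mult.assoc using Q(2)[OF i] m u by (intro sum_mono mult_right_mono) (auto intro: less_imp_le)
    then show "P i \<le> C" using uS by (simp add: sum_distrib_left[symmetric])
  qed
  have bound: "(\<Sum>j\<in>L. Q i j * m j * v j) / v i \<le> (1 + C / (K * c)) * (P i / u i) + 2 * C / K" if i: "i \<in> L" for i
  proof -
    have Qm: "0 \<le> Q i j * m j" if "j \<in> L" for j using Q(1)[OF i that] c m(1)[OF that] by (intro mult_nonneg_nonneg) auto
    have "(\<Sum>j\<in>L. Q i j * m j * v j) \<le> (\<Sum>j\<in>L. Q i j * m j * (u j + 1 / K))"
      using Qm by (intro sum_mono mult_left_mono) (auto simp: v_def)
    also have "\<dots> = P i + (\<Sum>j\<in>L. Q i j * m j) * (1 / K)"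
      by (simp add: P_def distrib_left sum.distrib sum_divide_distrib)
    also have "(\<Sum>j\<in>L. Q i j * m j) \<le> (\<Sum>j\<in>L. C * m j)"
      using Q(2)[OF i] m by (intro sum_mono mult_right_mono) (auto intro: less_imp_le)
    also have "\<dots> = C * (\<Sum>j\<in>L. m j)" by (simp add: sum_distrib_left)
    also have "\<dots> \<le> C" using m(2) cC by simp
    finally have 1: "(\<Sum>j\<in>L. Q i j * m j * v j) \<le> P i + C * (1 / K)" using K0 by (simp add: divide_right_mono)
    have "(\<Sum>j\<in>L. Q i j * m j * v j) * (1 / v i) \<le> (P i + C * (1 / K)) * (1 / u i + 1 / K)"
      using 1 vinv[of i] v0[of i] P[OF i] c cC K0 by (intro mult_mono) auto
    also have "\<dots> = P i / u i + C / K / u i + (P i + C / K) / K" by (simp add: distrib_left distrib_right add_divide_distrib)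
    also have "C / K / u i \<le> C / (K * c) * (P i / u i)"
    proof -
      have "C / K * 1 \<le> C / K * (P i / c)" using P(1)[OF i] c cC K0 by (intro mult_left_mono) auto
      then have "C / K * 1 / u i \<le> C / K * (P i / c) / u i" using u[of i] by (intro divide_right_mono) auto
      then show ?thesis by simp
    qed
    also have "(P i + C / K) / K \<le> 2 * C / K"
    proof (rule divide_right_mono)
      have "C / K \<le> C" using K cC by (simp add: divide_le_eq)
      then show "P i + C / K \<le> 2 * C" using P(2)[OF i] by linarith
    qed (use K0 in simp)
    finally show ?thesis by (simp add: algebra_simps)
  qed
  have eq: "(\<Sum>i\<in>L. \<Sum>j\<in>L. b i * Q i j * m j * exp (\<phi> j - \<phi> i)) = (\<Sum>i\<in>L. b i * (P i / u i))"
  proof (intro sum.cong refl)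
    fix i
    have "exp (\<phi> j - \<phi> i) = u j / u i" for j using S by (simp add: u_def exp_diff)
    then show "(\<Sum>j\<in>L. b i * Q i j * m j * exp (\<phi> j - \<phi> i)) = b i * (P i / u i)"
      by (simp add: P_def sum_distrib_left sum_divide_distrib mult.assoc)
  qed
  have "(\<Sum>i\<in>L. \<Sum>j\<in>L. b i * Q i j * m j * (v j / v i)) = (\<Sum>i\<in>L. b i * ((\<Sum>j\<in>L. Q i j * m j * v j) / v i))"
    by (intro sum.cong refl) (simp add: sum_distrib_left sum_divide_distrib mult.assoc)
  also have "\<dots> \<le> (\<Sum>i\<in>L. b i * ((1 + C / (K * c)) * (P i / u i) + 2 * C / K))"
    using bound b by (intro sum_mono mult_left_mono) auto
  also have "\<dots> = (1 + C / (K * c)) * (\<Sum>i\<in>L. b i * (P i / u i)) + (\<Sum>i\<in>L. b i) * (2 * C / K)"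
    by (simp only: distrib_left sum.distrib sum_distrib_left sum_distrib_right mult.left_commute)
  finally show ?thesis using v by (intro exI[of _ v]) (simp only: eq, simp)
qed

section \<open>Simple test functions in the rate functional\<close>

lemma regular_sandwich:
  fixes M :: "'a::polish_space measure"
  assumes M: "M \<in> prob_measures" and B: "B \<in> sets borel" and \<epsilon>: "0 < \<epsilon>"
  shows "\<exists>K U. compact K \<and> open U \<and> K \<subseteq> B \<and> B \<subseteq> U \<and> measure M (U - K) < \<epsilon>"
proof -
  interpret prob_space M using M by (simp add: prob_measures_iff)
  have s: "sets M = sets borel" using M by (simp add: prob_measures_iff)
  have f: "emeasure M (space M) \<noteq> \<infinity>" by simp
  have "\<exists>K\<in>{K. K \<subseteq> B \<and> compact K}. emeasure M B < emeasure M K + ennreal (\<epsilon>/2)"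
    using \<epsilon> by (intro SUP_approx_ennreal[OF _ _ inner_regular[OF s f B]]) auto
  then obtain K where K: "K \<subseteq> B" "compact K" "emeasure M B < emeasure M K + ennreal (\<epsilon>/2)" by blast
  have "\<exists>U\<in>{U. B \<subseteq> U \<and> open U}. emeasure M U < emeasure M B + ennreal (\<epsilon>/2)"
    using \<epsilon> by (intro INF_approx_ennreal[OF _ outer_regular[OF s f B]]) auto
  then obtain U where U: "B \<subseteq> U" "open U" "emeasure M U < emeasure M B + ennreal (\<epsilon>/2)" by blast
  have KU: "K \<in> sets M" "U \<in> sets M" using K U by (auto simp: s compact_imp_closed)
  have "prob B < prob K + \<epsilon>/2" "prob U < prob B + \<epsilon>/2"
    using K(3) U(3) \<epsilon> by (simp_all add: emeasure_eq_measure ennreal_plus[symmetric] ennreal_less_iff del: ennreal_plus)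
  moreover have "prob (U - K) = prob U - prob K" using K(1) U(1) KU by (intro finite_measure_Diff) auto
  ultimately show ?thesis using K U by (intro exI[of _ K] exI[of _ U]) auto
qed

text \<open>One continuous function serves both measures: take the union of the inner compact sets
  and the intersection of the outer open sets, and separate by Urysohn's lemma.\<close>

lemma indicator_L1_approx:
  fixes M N :: "'a::polish_space measure"
  assumes M: "M \<in> prob_measures" "N \<in> prob_measures" and B: "B \<in> sets borel" and \<epsilon>: "0 < \<epsilon>"
  shows "\<exists>f. continuous_on UNIV f \<and> (\<forall>x. 0 \<le> f x \<and> f x \<le> 1) \<and>
    (\<integral>x. \<bar>f x - indicator B x\<bar> \<partial>M) \<le> \<epsilon> \<and> (\<integral>x. \<bar>f x - indicator B x\<bar> \<partial>N) \<le> (\<epsilon>::real)"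
proof -
  obtain K1 U1 where 1: "compact K1" "open U1" "K1 \<subseteq> B" "B \<subseteq> U1" "measure M (U1 - K1) < \<epsilon>"
    using regular_sandwich[OF M(1) B \<epsilon>] by blast
  obtain K2 U2 where 2: "compact K2" "open U2" "K2 \<subseteq> B" "B \<subseteq> U2" "measure N (U2 - K2) < \<epsilon>"
    using regular_sandwich[OF M(2) B \<epsilon>] by blast
  define K U where "K = K1 \<union> K2" and "U = U1 \<inter> U2"
  have KU: "closed K" "open U" "K \<subseteq> B" "B \<subseteq> U" using 1 2 by (auto simp: K_def U_def compact_imp_closed)
  have "normal_space (euclidean :: 'a topology)" by (intro metrizable_imp_normal_space metrizable_space_euclidean)
  then obtain f :: "'a \<Rightarrow> real" where f: "continuous_map euclidean (top_of_set {0..1}) f" "f ` (- U) \<subseteq> {0}" "f ` K \<subseteq> {1}"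
    by (rule Urysohn_lemma[of _ "- U" K 0 1]) (use KU in \<open>auto simp: disjnt_def\<close>)
  have fc: "continuous_on UNIV f" "0 \<le> f x" "f x \<le> 1" for x
    using f(1) by (auto simp: continuous_map_in_subtopology image_subset_iff Pi_iff)
  have le: "\<bar>f x - indicator B x\<bar> \<le> indicator (U - K) x" for x :: 'a
    using f(2,3) KU(3,4) fc(2)[of x] fc(3)[of x] by (auto simp: indicator_def image_subset_iff)
  have "(\<integral>x. \<bar>f x - indicator B x\<bar> \<partial>P) \<le> \<epsilon>" if P: "P \<in> prob_measures" and small: "measure P (U - K) < \<epsilon>" for P
  proof -
    interpret P: prob_space P using P by (simp add: prob_measures_iff)
    have s: "sets P = sets borel" using P by (simp add: prob_measures_iff)
    have UK: "U - K \<in> sets P" using KU by (auto simp: s)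
    have fm: "f \<in> borel_measurable borel" using fc(1) by (rule borel_measurable_continuous_onI)
    have "(\<integral>x. \<bar>f x - indicator B x\<bar> \<partial>P) \<le> (\<integral>x. indicator (U - K) x \<partial>P)"
    proof (rule integral_mono)
      show "integrable P (\<lambda>x. \<bar>f x - indicator B x\<bar>)"
      proof (rule prob_measure_integrable[OF P, of _ 1])
        show "(\<lambda>x. \<bar>f x - indicator B x\<bar>) \<in> borel_measurable borel" using fm B by measurable
        show "\<bar>\<bar>f x - indicator B x\<bar>\<bar> \<le> 1" for x using fc(2)[of x] fc(3)[of x] by (auto simp: indicator_def)
      qed
      show "integrable P (indicator (U - K) :: 'a \<Rightarrow> real)" using UK by (intro integrable_real_indicator) (auto simp: P.emeasure_eq_measure)
    qed (rule le)
    also have "\<dots> = measure P (U - K)" using UK by simp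
    finally show ?thesis using small by simp
  qed
  moreover have "measure M (U - K) < \<epsilon>" "measure N (U - K) < \<epsilon>"
  proof -
    interpret M: prob_space M using M by (simp add: prob_measures_iff)
    interpret N: prob_space N using M by (simp add: prob_measures_iff)
    have "measure M (U - K) \<le> measure M (U1 - K1)" using M 1 by (intro M.finite_measure_mono) (auto simp: K_def U_def prob_measures_iff compact_imp_closed)
    then show "measure M (U - K) < \<epsilon>" using 1 by simp
    have "measure N (U - K) \<le> measure N (U2 - K2)" using M 2 by (intro N.finite_measure_mono) (auto simp: K_def U_def prob_measures_iff compact_imp_closed)
    then show "measure N (U - K) < \<epsilon>" using 2 by simp
  qed
  ultimately show ?thesis using fc M by (intro exI[of _ f]) auto
qed

lemma measurable_label_function:
  "\<iota> \<in> borel \<rightarrow>\<^sub>M count_space L \<Longrightarrow> (\<lambda>y. h (\<iota> y)) \<in> borel_measurable borel"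
  by (rule measurable_compose[where g=h and N="count_space L"]) simp_all

lemma sets_label:
  assumes "\<iota> \<in> borel \<rightarrow>\<^sub>M count_space L" shows "{y. \<iota> y = j} \<in> sets borel"
proof -
  have "(\<lambda>y. if \<iota> y = j then 1 else 0 :: real) \<in> borel_measurable borel"
    by (rule measurable_label_function[OF assms, where h="\<lambda>l. if l = j then 1 else 0"])
  from measurable_sets[OF this, of "{1}"] have "(\<lambda>y. if \<iota> y = j then 1 else 0 :: real) -` {1} \<in> sets borel" by simp
  moreover have "(\<lambda>y. if \<iota> y = j then 1 else 0 :: real) -` {1} = {y. \<iota> y = j}" by (auto split: if_splits)
  ultimately show ?thesis by simp
qed

lemma integral_label_function:
  fixes h :: "'l \<Rightarrow> real"
  assumes M: "M \<in> prob_measures" and L: "finite L" and \<iota>: "\<iota> \<in> borel \<rightarrow>\<^sub>M count_space L" and D: "D \<in> sets borel"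
  shows "(\<integral>y. indicator D y * h (\<iota> y) \<partial>M) = (\<Sum>j\<in>L. h j * measure M {y \<in> D. \<iota> y = j})"
proof -
  interpret prob_space M using M by (simp add: prob_measures_iff)
  have in_L: "\<iota> y \<in> L" for y using measurable_space[OF \<iota>, of y] by simp
  have s: "{y \<in> D. \<iota> y = j} \<in> sets M" for j
  proof -
    have "{y \<in> D. \<iota> y = j} = D \<inter> {y. \<iota> y = j}" by auto
    then show ?thesis using D sets_label[OF \<iota>, of j] M by (simp add: prob_measures_iff)
  qed
  have "indicator D y * h (\<iota> y) = (\<Sum>j\<in>L. h j * indicator {y \<in> D. \<iota> y = j} y)" for y
  proof -
    have "(\<Sum>j\<in>L. h j * indicator {y \<in> D. \<iota> y = j} y) = (\<Sum>j\<in>L. if j = \<iota> y then indicator D y * h j else 0)"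
      by (intro sum.cong) (auto simp: indicator_def)
    then show ?thesis using in_L[of y] L by simp
  qed
  then have "(\<integral>y. indicator D y * h (\<iota> y) \<partial>M) = (\<integral>y. (\<Sum>j\<in>L. h j * indicator {y \<in> D. \<iota> y = j} y) \<partial>M)" by simp
  also have "\<dots> = (\<Sum>j\<in>L. (\<integral>y. h j * indicator {y \<in> D. \<iota> y = j} y \<partial>M))"
    using s by (intro Bochner_Integration.integral_sum integrable_mult_right integrable_real_indicator) (auto simp: emeasure_eq_measure)
  also have "\<dots> = (\<Sum>j\<in>L. h j * measure M {y \<in> D. \<iota> y = j})" using s by simp
  finally show ?thesis .
qed

context density_chain begin

lemma lam_prob_measures: "lam \<in> prob_measures"
  by (simp add: prob_measures_iff prob_lam)

text \<open>The supremum over continuous functions also dominates the value at the logarithm of a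
  positive simple function. The approximation takes place in \<open>L1\<close> of
  \<open>\<mu>\<close>, for the outer integral, and in \<open>L1\<close> of \<open>lam\<close>, for
  the jump mean.\<close>

lemma rate_ge_simple:
  assumes \<mu>: "\<mu> \<in> prob_measures" and L: "finite L" and \<iota>: "\<iota> \<in> borel \<rightarrow>\<^sub>M count_space L"
    and v: "\<And>j. j \<in> L \<Longrightarrow> \<alpha> \<le> v j \<and> v j \<le> \<beta>" and \<alpha>: "0 < \<alpha>"
  shows "ereal (\<integral>x. r x - r x * (jump_mean (\<lambda>y. v (\<iota> y)) x / v (\<iota> x)) \<partial>\<mu>) \<le> rate \<mu>"
proof (rule ereal_le_epsilon2)
  fix \<tau> :: real assume \<tau>: "0 < \<tau>"
  have in_L: "\<iota> y \<in> L" for y using measurable_space[OF \<iota>, of y] by simp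
  have vb: "\<alpha> \<le> v (\<iota> y)" "v (\<iota> y) \<le> \<beta>" for y using v[OF in_L] by auto
  have \<beta>: "0 < \<beta>" using vb[of undefined] \<alpha> by linarith
  have [measurable]: "(\<lambda>y. v (\<iota> y)) \<in> borel_measurable borel" by (rule measurable_label_function[OF \<iota>])
  have [measurable]: "{y. \<iota> y = j} \<in> sets borel" for j by (rule sets_label[OF \<iota>])
  \<comment> \<open>The total error is at most \<open>c\<close> times the \<open>L1\<close>
    distance: the first summand comes from the jump mean in the numerator, the second from the
    denominator.\<close>
  define c where "c = R * (qmax / \<alpha> + \<beta> / \<alpha>\<^sup>2)"
  have c: "0 < c" unfolding c_def using R(1) qmax(1) \<alpha> \<beta> by (intro mult_pos_pos add_pos_pos divide_pos_pos) auto
  define \<epsilon> where "\<epsilon> = \<tau> / c / (real (card L) * \<beta> + 1)"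
  have \<epsilon>: "0 < \<epsilon>" unfolding \<epsilon>_def using \<tau> c \<beta> by (intro divide_pos_pos) (auto intro!: add_nonneg_pos)
  have "\<forall>j\<in>L. \<exists>f. continuous_on UNIV f \<and> (\<forall>x. 0 \<le> f x \<and> f x \<le> 1) \<and>
    (\<integral>x. \<bar>f x - indicator {y. \<iota> y = j} x\<bar> \<partial>\<mu>) \<le> \<epsilon> \<and> (\<integral>x. \<bar>f x - indicator {y. \<iota> y = j} x\<bar> \<partial>lam) \<le> \<epsilon>"
    by (intro ballI indicator_L1_approx \<mu> lam_prob_measures \<epsilon>) simp
  from bchoice[OF this] obtain f where f: "\<forall>j\<in>L. continuous_on UNIV (f j) \<and> (\<forall>x. 0 \<le> f j x \<and> f j x \<le> 1) \<and>
    (\<integral>x. \<bar>f j x - indicator {y. \<iota> y = j} x\<bar> \<partial>\<mu>) \<le> \<epsilon> \<and> (\<integral>x. \<bar>f j x - indicator {y. \<iota> y = j} x\<bar> \<partial>lam) \<le> \<epsilon>"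
    by (elim exE) (rule that)
  have fm: "f j \<in> borel_measurable borel" if "j \<in> L" for j using f that by (intro borel_measurable_continuous_onI) auto
  have fi: "\<bar>f j x - indicator {y. \<iota> y = j} x\<bar> \<le> 1" if "j \<in> L" for j x
  proof -
    have "0 \<le> f j x" "f j x \<le> 1" using f that by auto
    then show ?thesis by (auto simp: indicator_def)
  qed
  define w where "w x = (\<Sum>j\<in>L. v j * \<bar>f j x - indicator {y. \<iota> y = j} x\<bar>)" for x
  have wm[measurable]: "w \<in> borel_measurable borel" unfolding w_def[abs_def] using fm by measurable
  have w_bd: "0 \<le> w x" "w x \<le> real (card L) * \<beta>" for x
  proof -
    show "0 \<le> w x" unfolding w_def using v \<alpha> by (intro sum_nonneg mult_nonneg_nonneg) (auto intro: order_trans[OF less_imp_le])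
    have "w x \<le> (\<Sum>j\<in>L. \<beta> * 1)" unfolding w_def
    proof (intro sum_mono mult_mono)
      show "\<bar>f j x - indicator {y. \<iota> y = j} x\<bar> \<le> 1" if "j \<in> L" for j using fi[OF that] .
    qed (use v \<beta> in auto)
    then show "w x \<le> real (card L) * \<beta>" by simp
  qed
  have wint: "integrable M w" if "M \<in> prob_measures" for M
    using w_bd by (intro prob_measure_integrable[OF that wm]) (auto simp: abs_le_iff)
  have w_small: "(\<integral>x. w x \<partial>M) \<le> \<tau> / c"
    if M: "M \<in> prob_measures" and s: "\<And>j. j \<in> L \<Longrightarrow> (\<integral>x. \<bar>f j x - indicator {y. \<iota> y = j} x\<bar> \<partial>M) \<le> \<epsilon>" for M
  proof -
    have i: "integrable M (\<lambda>x. \<bar>f j x - indicator {y. \<iota> y = j} x\<bar>)" if "j \<in> L" for j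
    proof (rule prob_measure_integrable[OF M, of _ 1])
      show "(\<lambda>x. \<bar>f j x - indicator {y. \<iota> y = j} x\<bar>) \<in> borel_measurable borel" using fm[OF that] by measurable
    qed (use fi[OF that] in simp)
    have "(\<integral>x. w x \<partial>M) = (\<Sum>j\<in>L. v j * (\<integral>x. \<bar>f j x - indicator {y. \<iota> y = j} x\<bar> \<partial>M))"
      unfolding w_def using i by (subst Bochner_Integration.integral_sum) auto
    also have "\<dots> \<le> (\<Sum>j\<in>L. \<beta> * \<epsilon>)"
      using v s \<beta> by (intro sum_mono mult_mono) auto
    also have "\<dots> = real (card L) * \<beta> * \<epsilon>" by simp
    also have "\<dots> \<le> (real (card L) * \<beta> + 1) * \<epsilon>" using \<epsilon> by (intro mult_right_mono) auto
    also have "\<dots> = \<tau> / c"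
    proof -
      have "real (card L) * \<beta> + 1 \<noteq> 0" using \<beta> by (smt (verit) mult_nonneg_nonneg of_nat_0_le_iff)
      then show ?thesis by (simp add: \<epsilon>_def)
    qed
    finally show ?thesis .
  qed
  \<comment> \<open>Clamping to the interval from \<open>\<alpha>\<close> to \<open>\<beta>\<close>,
    which contains \<open>v (\<iota> x)\<close>, preserves the error bound \<open>w\<close> and
    keeps the logarithm continuous.\<close>
  define u where "u x = max \<alpha> (min \<beta> (\<Sum>j\<in>L. v j * f j x))" for x
  have u: "\<alpha> \<le> u x" "u x \<le> \<beta>" for x using vb[of x] by (auto simp: u_def)
  have uc: "continuous_on UNIV u" unfolding u_def[abs_def] using f by (intro continuous_intros) auto
  have um[measurable]: "u \<in> borel_measurable borel" using uc by (rule borel_measurable_continuous_onI)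
  have uv: "\<bar>u x - v (\<iota> x)\<bar> \<le> w x" for x
  proof -
    have "v (\<iota> x) = (\<Sum>j\<in>L. v j * indicator {y. \<iota> y = j} x)"
    proof -
      have "(\<Sum>j\<in>L. v j * indicator {y. \<iota> y = j} x) = (\<Sum>j\<in>L. if j = \<iota> x then v j else 0)"
        by (intro sum.cong) (auto simp: indicator_def)
      then show ?thesis using in_L[of x] L by simp
    qed
    then have "\<bar>(\<Sum>j\<in>L. v j * f j x) - v (\<iota> x)\<bar> = \<bar>\<Sum>j\<in>L. v j * (f j x - indicator {y. \<iota> y = j} x)\<bar>"
      by (simp add: right_diff_distrib sum_subtractf)
    also have "\<dots> \<le> w x" unfolding w_def
      using v \<alpha> by (intro order_trans[OF sum_abs] sum_mono) (force simp: abs_mult intro!: mult_right_mono)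
    finally have "\<bar>(\<Sum>j\<in>L. v j * f j x) - v (\<iota> x)\<bar> \<le> w x" .
    moreover have "\<bar>u x - v (\<iota> x)\<bar> \<le> \<bar>(\<Sum>j\<in>L. v j * f j x) - v (\<iota> x)\<bar>"
      using vb[of x] by (auto simp: u_def max_def min_def)
    ultimately show ?thesis by linarith
  qed
  define \<phi> where "\<phi> x = ln (u x)" for x
  have u0: "0 < u x" "0 < v (\<iota> x)" for x using u(1)[of x] vb(1)[of x] \<alpha> by linarith+
  have un: "u x \<noteq> 0" for x using u0(1)[of x] by simp
  have \<phi>c: "continuous_on UNIV \<phi>" unfolding \<phi>_def[abs_def] using uc un by (intro continuous_on_ln) auto
  have e\<phi>: "exp (\<phi> x) = u x" for x using u0(1)[of x] by (simp add: \<phi>_def)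
  let ?Pu = "jump_mean u" and ?Pv = "jump_mean (\<lambda>y. v (\<iota> y))"
  have ub: "\<bar>u y\<bar> \<le> \<beta>" "\<bar>v (\<iota> y)\<bar> \<le> \<beta>" for y using u[of y] vb[of y] \<alpha> by (auto simp: abs_le_iff)
  have Pdiff: "\<bar>?Pu x - ?Pv x\<bar> \<le> qmax * (\<tau> / c)" for x
  proof -
    have "\<bar>?Pu x - ?Pv x\<bar> = \<bar>\<integral>y. q x y * u y - q x y * v (\<iota> y) \<partial>lam\<bar>"
      unfolding jump_mean_def using integrable_q_mult[OF um ub(1)] integrable_q_mult[OF _ ub(2)]
      by (subst Bochner_Integration.integral_diff) auto
    also have "\<dots> \<le> (\<integral>y. \<bar>q x y * u y - q x y * v (\<iota> y)\<bar> \<partial>lam)" by (rule integral_abs_bound)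
    also have "\<dots> \<le> (\<integral>y. qmax * w y \<partial>lam)"
    proof (rule integral_mono)
      show "integrable lam (\<lambda>y. \<bar>q x y * u y - q x y * v (\<iota> y)\<bar>)"
        using integrable_q_mult[OF um ub(1)] integrable_q_mult[OF _ ub(2)] by (intro integrable_abs Bochner_Integration.integrable_diff) auto
      show "integrable lam (\<lambda>y. qmax * w y)" using wint[OF lam_prob_measures] by simp
      show "\<bar>q x y * u y - q x y * v (\<iota> y)\<bar> \<le> qmax * w y" for y
        unfolding right_diff_distrib[symmetric] abs_mult using qmax q_pos[of x y] uv[of y] by (intro mult_mono) auto
    qed
    also have "\<dots> \<le> qmax * (\<tau> / c)"
      using mult_left_mono[OF w_small[OF lam_prob_measures], of qmax] f qmax(1) by simp
    finally show ?thesis .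
  qed
  have Pv: "0 \<le> ?Pv x" "?Pv x \<le> \<beta>" for x
  proof -
    show "0 \<le> ?Pv x" unfolding jump_mean_def using q_pos u0(2) by (intro Bochner_Integration.integral_nonneg mult_nonneg_nonneg) (auto intro: less_imp_le)
    have "?Pv x \<le> jump_mean (\<lambda>_. \<beta>) x" using vb by (intro jump_mean_mono[where B=\<beta> and B'=\<beta>] ub) (use \<beta> in auto)
    then show "?Pv x \<le> \<beta>" by (simp add: jump_mean_const)
  qed
  have Pm[measurable]: "?Pu \<in> borel_measurable borel" "?Pv \<in> borel_measurable borel"
    using continuous_jump_mean[OF um ub(1)] continuous_jump_mean[OF _ ub(2)] by (auto intro: borel_measurable_continuous_onI)
  have pt: "r x - r x * (?Pv x / v (\<iota> x)) \<le> - potential \<phi> x + (R * (qmax * (\<tau> / c) / \<alpha>) + R * (\<beta> / \<alpha>\<^sup>2) * w x)" for x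
  proof -
    let ?v = "v (\<iota> x)"
    have "?Pu x / u x - ?Pv x / ?v = (?Pu x - ?Pv x) / u x + ?Pv x * (1 / u x - 1 / ?v)" by (simp add: diff_divide_distrib right_diff_distrib)
    also have "\<dots> \<le> qmax * (\<tau> / c) / \<alpha> + \<beta> * (w x / \<alpha>\<^sup>2)"
    proof (intro add_mono)
      have "(?Pu x - ?Pv x) / u x \<le> \<bar>?Pu x - ?Pv x\<bar> / u x" using u0(1)[of x] by (intro divide_right_mono) auto
      also have "\<dots> \<le> qmax * (\<tau> / c) / \<alpha>" using Pdiff[of x] u(1)[of x] \<alpha> by (intro frac_le) (auto intro: order_trans[OF abs_ge_zero])
      finally show "(?Pu x - ?Pv x) / u x \<le> qmax * (\<tau> / c) / \<alpha>" .
      have "1 / u x - 1 / ?v = (?v - u x) / (u x * ?v)" using u0[of x] by (simp add: field_simps)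
      also have "\<dots> \<le> w x / \<alpha>\<^sup>2"
        unfolding power2_eq_square using uv[of x] u(1)[of x] vb(1)[of x] \<alpha> w_bd(1)[of x] by (intro frac_le mult_mono mult_pos_pos) auto
      finally have 1: "1 / u x - 1 / ?v \<le> w x / \<alpha>\<^sup>2" .
      have "?Pv x * (1 / u x - 1 / ?v) \<le> ?Pv x * (w x / \<alpha>\<^sup>2)" using 1 Pv(1) by (rule mult_left_mono)
      also have "\<dots> \<le> \<beta> * (w x / \<alpha>\<^sup>2)" using Pv(2)[of x] w_bd(1)[of x] by (intro mult_right_mono) auto
      finally show "?Pv x * (1 / u x - 1 / ?v) \<le> \<beta> * (w x / \<alpha>\<^sup>2)" .
    qed
    finally have d: "?Pu x / u x - ?Pv x / ?v \<le> qmax * (\<tau> / c) / \<alpha> + \<beta> * (w x / \<alpha>\<^sup>2)" .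
    have "r x * (?Pu x / u x - ?Pv x / ?v) \<le> r x * (qmax * (\<tau> / c) / \<alpha> + \<beta> * (w x / \<alpha>\<^sup>2))" using d r_nonneg by (rule mult_left_mono)
    also have "\<dots> \<le> R * (qmax * (\<tau> / c) / \<alpha> + \<beta> * (w x / \<alpha>\<^sup>2))"
      using R(2) qmax(1) \<tau> c \<alpha> \<beta> w_bd(1)[of x] by (intro mult_right_mono add_nonneg_nonneg) auto
    finally have "r x * (?Pu x / u x) - r x * (?Pv x / ?v) \<le> R * (qmax * (\<tau> / c) / \<alpha>) + R * (\<beta> / \<alpha>\<^sup>2) * w x"
      by (simp add: right_diff_distrib distrib_left)
    moreover have "potential \<phi> x = r x * (?Pu x / u x) - r x"
      by (simp add: potential_def e\<phi> right_diff_distrib)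
    ultimately show ?thesis by linarith
  qed
  have ip: "integrable \<mu> (\<lambda>x. - potential \<phi> x)" using integrable_potential[OF \<mu> \<phi>c] by simp
  interpret \<mu>: prob_space \<mu> using \<mu> by (simp add: prob_measures_iff)
  have "(\<integral>x. r x - r x * (?Pv x / v (\<iota> x)) \<partial>\<mu>) \<le> (\<integral>x. - potential \<phi> x + (R * (qmax * (\<tau> / c) / \<alpha>) + R * (\<beta> / \<alpha>\<^sup>2) * w x) \<partial>\<mu>)"
  proof (rule integral_mono[OF _ _ pt])
    have Pb: "0 \<le> ?Pv x / v (\<iota> x)" "?Pv x / v (\<iota> x) \<le> \<beta> / \<alpha>" for x
      using Pv[of x] vb[of x] u0[of x] \<alpha> \<beta> by (auto intro!: frac_le divide_nonneg_pos)
    have "\<bar>r x - r x * (?Pv x / v (\<iota> x))\<bar> \<le> R + R * (\<beta> / \<alpha>)" for x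
    proof -
      have "\<bar>r x * (?Pv x / v (\<iota> x))\<bar> \<le> R * (\<beta> / \<alpha>)"
        unfolding abs_mult using Pb[of x] r_nonneg[of x] R by (intro mult_mono) auto
      then show ?thesis using r_nonneg[of x] R(2)[of x] by linarith
    qed
    then show "integrable \<mu> (\<lambda>x. r x - r x * (?Pv x / v (\<iota> x)))" by (intro prob_measure_integrable[OF \<mu>]) measurable
    show "integrable \<mu> (\<lambda>x. - potential \<phi> x + (R * (qmax * (\<tau> / c) / \<alpha>) + R * (\<beta> / \<alpha>\<^sup>2) * w x))"
      using ip wint[OF \<mu>] by (intro Bochner_Integration.integrable_add integrable_mult_right) auto
  qed
  also have "\<dots> = (\<integral>x. - potential \<phi> x \<partial>\<mu>) + (R * (qmax * (\<tau> / c) / \<alpha>) + R * (\<beta> / \<alpha>\<^sup>2) * (\<integral>x. w x \<partial>\<mu>))"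
    using ip wint[OF \<mu>] by (subst Bochner_Integration.integral_add) (auto simp: \<mu>.prob_space)
  also have "\<dots> \<le> - (\<integral>x. potential \<phi> x \<partial>\<mu>) + (R * (qmax * (\<tau> / c) / \<alpha>) + R * (\<beta> / \<alpha>\<^sup>2) * (\<tau> / c))"
    using w_small[OF \<mu>] f R(1) \<beta> \<alpha> by (intro add_mono mult_left_mono) auto
  also have "R * (qmax * (\<tau> / c) / \<alpha>) + R * (\<beta> / \<alpha>\<^sup>2) * (\<tau> / c) = c * (\<tau> / c)" by (simp add: c_def algebra_simps add_divide_distrib)
  also have "\<dots> = \<tau>" using c by simp
  finally have "ereal (\<integral>x. r x - r x * (?Pv x / v (\<iota> x)) \<partial>\<mu>) \<le> ereal (- (\<integral>x. potential \<phi> x \<partial>\<mu>)) + ereal \<tau>" by simp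
  also have "\<dots> \<le> rate \<mu> + ereal \<tau>" using rate_ge[OF \<phi>c] by (intro add_right_mono)
  finally show "ereal (\<integral>x. r x - r x * (?Pv x / v (\<iota> x)) \<partial>\<mu>) \<le> rate \<mu> + ereal \<tau>" .
qed

end

section \<open>Partitions with cells of positive mass\<close>

text \<open>A separated set of largest cardinality is a net. Cardinalities are bounded because each
  ball of a finite cover by balls of radius \<open>d / 2\<close> contains at most one point of a
  separated set.\<close>

lemma finite_separated_net:
  assumes "compact (UNIV :: 'a::metric_space set)" and d: "0 < d"
  shows "\<exists>S :: 'a set. finite S \<and> (\<forall>a\<in>S. \<forall>b\<in>S. a \<noteq> b \<longrightarrow> d \<le> dist a b) \<and> (\<forall>x. \<exists>c\<in>S. dist x c < d)"
proof -
  obtain k :: "'a set" where k: "finite k" "UNIV \<subseteq> (\<Union>x\<in>k. ball x (d/2))"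
    using assms unfolding compact_eq_totally_bounded by (meson half_gt_zero)
  define P where "P S \<longleftrightarrow> finite S \<and> (\<forall>a\<in>S. \<forall>b\<in>S. a \<noteq> b \<longrightarrow> d \<le> dist a b)" for S :: "'a set"
  have card: "card S < Suc (card k)" if S: "P S" for S
  proof -
    have "\<forall>x. \<exists>y\<in>k. dist y x < d/2" using k(2) by (auto simp: subset_iff)
    then obtain g where g: "\<And>x. g x \<in> k" "\<And>x. dist (g x) x < d/2" by metis
    have "inj_on g S"
    proof (rule inj_onI, rule ccontr)
      fix a b assume ab: "a \<in> S" "b \<in> S" "g a = g b" "a \<noteq> b"
      have "dist a b \<le> dist (g a) a + dist (g a) b" by (rule dist_triangle3)
      also have "\<dots> < d" using g(2)[of a] g(2)[of b] ab(3) by simp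
      finally show False using S ab by (auto simp: P_def not_le[symmetric])
    qed
    then have "card S \<le> card k" using g(1) k(1) by (intro card_inj_on_le) auto
    then show ?thesis by simp
  qed
  have "P {}" by (simp add: P_def)
  with card have "\<exists>S. P S \<and> (\<forall>S'. P S' \<longrightarrow> card S' \<le> card S)" by (intro ex_has_greatest_nat) auto
  then obtain S where S: "P S" "\<And>S'. P S' \<Longrightarrow> card S' \<le> card S" by blast
  have "\<exists>c\<in>S. dist x c < d" for x
  proof (rule ccontr)
    assume n: "\<not> (\<exists>c\<in>S. dist x c < d)"
    then have "x \<notin> S" using d by force
    moreover have "P (insert x S)" using S(1) n by (auto simp: P_def not_less dist_commute)
    ultimately show False using S(2)[of "insert x S"] S(1) by (simp add: P_def)
  qed
  then show ?thesis using S(1) by (auto simp: P_def)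
qed

text \<open>The points within \<open>d / 2\<close> of a centre must get that centre as label, so
  that its cell contains a ball; separation makes these balls disjoint and the demands consistent.
  \<open>c0\<close> is the default label for points far from all centres.\<close>

lemma measurable_nearest_label:
  fixes S :: "'a::polish_space set"
  assumes "finite S" "\<And>a b. a \<in> S \<Longrightarrow> b \<in> S \<Longrightarrow> a \<noteq> b \<Longrightarrow> d \<le> dist a b" and d: "0 < d"
  shows "\<exists>f. f \<in> borel_measurable borel \<and> (\<forall>x. f x \<in> insert c0 S) \<and> (\<forall>x. \<forall>c\<in>S. dist x c < d/2 \<longrightarrow> f x = c) \<and>
    (\<forall>x. (\<exists>c\<in>S. dist x c < d) \<longrightarrow> dist x (f x) < d)"
  using assms(1,2)
proof (induction S)
  case empty
  show ?case by (intro exI[of _ "\<lambda>_. c0"]) auto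
next
  case (insert c S)
  have "\<exists>f. f \<in> borel_measurable borel \<and> (\<forall>x. f x \<in> insert c0 S) \<and> (\<forall>x. \<forall>c\<in>S. dist x c < d/2 \<longrightarrow> f x = c) \<and>
    (\<forall>x. (\<exists>c\<in>S. dist x c < d) \<longrightarrow> dist x (f x) < d)"
    by (rule insert.IH) (use insert.prems in auto)
  then obtain f where f: "f \<in> borel_measurable borel" "\<forall>x. f x \<in> insert c0 S" "\<forall>x. \<forall>c\<in>S. dist x c < d/2 \<longrightarrow> f x = c"
    "\<forall>x. (\<exists>c\<in>S. dist x c < d) \<longrightarrow> dist x (f x) < d" by (elim exE conjE)
  note [measurable] = f(1)
  \<comment> \<open>The new centre takes its own half ball and those points within \<open>d\<close>
    of it whose present label is too far away.\<close>
  let ?P = "\<lambda>x. dist x c < d/2 \<or> (dist x c < d \<and> \<not> dist x (f x) < d)"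
  let ?g = "\<lambda>x. if ?P x then c else f x"
  have far: "\<not> dist x c < d/2" if "c' \<in> S" "dist x c' < d/2" for x c'
  proof
    assume "dist x c < d/2"
    moreover have "d \<le> dist c' c" using insert that by (metis insertCI)
    ultimately show False using dist_triangle3[of c' c x] that by linarith
  qed
  show ?case
  proof (intro exI[of _ ?g] conjI allI ballI impI)
    show "?g \<in> borel_measurable borel" by measurable
    show "?g x \<in> insert c0 (insert c S)" for x using f(2) by auto
    show "?g x = c'" if "c' \<in> insert c S" "dist x c' < d/2" for x c'
      using that far[of c' x] f(3) d by auto
    show "dist x (?g x) < d" if "\<exists>c'\<in>insert c S. dist x c' < d" for x
      using that f(4) d by auto
  qed
qed

context density_chain begin

text \<open>Each cell contains the ball of radius \<open>d / 2\<close> about its label, which has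
  positive mass as a nonempty open set.\<close>

lemma positive_cells:
  assumes d: "0 < d"
  shows "\<exists>L \<iota>. finite L \<and> L \<noteq> {} \<and> \<iota> \<in> borel \<rightarrow>\<^sub>M count_space L \<and> (\<forall>x. dist x (\<iota> x) < d) \<and>
    (\<forall>j\<in>L. 0 < measure lam {y. \<iota> y = j})"
proof -
  obtain S :: "'a set" where S: "finite S" "\<forall>a\<in>S. \<forall>b\<in>S. a \<noteq> b \<longrightarrow> d \<le> dist a b" "\<forall>x. \<exists>c\<in>S. dist x c < d"
    using finite_separated_net[OF compact_space d] by (elim exE conjE)
  obtain c0 where c0: "c0 \<in> S" using S(3) by blast
  have "\<exists>f. f \<in> borel_measurable borel \<and> (\<forall>x. f x \<in> insert c0 S) \<and> (\<forall>x. \<forall>c\<in>S. dist x c < d/2 \<longrightarrow> f x = c) \<and>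
    (\<forall>x. (\<exists>c\<in>S. dist x c < d) \<longrightarrow> dist x (f x) < d)"
    by (rule measurable_nearest_label[OF S(1) _ d]) (use S(2) in auto)
  then obtain f where f: "f \<in> borel_measurable borel" "\<forall>x. f x \<in> insert c0 S" "\<forall>x. \<forall>c\<in>S. dist x c < d/2 \<longrightarrow> f x = c"
    "\<forall>x. (\<exists>c\<in>S. dist x c < d) \<longrightarrow> dist x (f x) < d" by (elim exE conjE)
  have m: "f \<in> borel \<rightarrow>\<^sub>M count_space S"
    unfolding measurable_count_space_eq2[OF S(1)]
  proof (intro conjI ballI)
    show "f \<in> space borel \<rightarrow> S" using f(2) c0 by (auto simp: insert_absorb)
    show "f -` {a} \<inter> space borel \<in> sets borel" for a using f(1) by (intro measurable_sets[OF f(1)]) simp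
  qed
  have "0 < measure lam {y. f y = j}" if j: "j \<in> S" for j
  proof -
    have "0 < emeasure lam (ball j (d/2))" using d by (intro lam_open) auto
    then have "0 < measure lam (ball j (d/2))" by (simp add: lam.emeasure_eq_measure)
    also have "\<dots> \<le> measure lam {y. f y = j}"
      using f(3) j sets_label[OF m, of j] by (intro lam.finite_measure_mono) (auto simp: sets_lam dist_commute)
    finally show ?thesis .
  qed
  then show ?thesis using S f m c0 by (intro exI[of _ S] exI[of _ f]) auto
qed

text \<open>Continuity from above: the sets decrease to the zero set of \<open>r\<close>, which is
  null for \<open>lam\<close>.\<close>

lemma small_rate_set:
  assumes \<epsilon>: "0 < \<epsilon>" shows "\<exists>\<delta>>0. measure lam {x. r x < \<delta>} < \<epsilon>"
proof -
  have s: "{x. r x < a} \<in> sets lam" for a using r_measurable by (simp add: sets_lam)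
  have "(\<lambda>n. measure lam {x. r x < 1 / real (Suc n)}) \<longlonglongrightarrow> measure lam (\<Inter>n. {x. r x < 1 / real (Suc n)})"
  proof (rule lam.finite_Lim_measure_decseq)
    show "decseq (\<lambda>n. {x. r x < 1 / real (Suc n)})"
      unfolding decseq_def by (auto elim!: less_le_trans intro!: frac_le)
  qed (use s in auto)
  also have "(\<Inter>n. {x. r x < 1 / real (Suc n)}) = {x. r x \<le> 0}"
  proof (intro equalityI subsetI)
    fix x assume x: "x \<in> (\<Inter>n. {x. r x < 1 / real (Suc n)})"
    show "x \<in> {x. r x \<le> 0}"
    proof (rule ccontr)
      assume "x \<notin> {x. r x \<le> 0}"
      then obtain n where "1 / real (Suc n) < r x" using nat_approx_posE by (metis mem_Collect_eq not_le)
      moreover have "r x < 1 / real (Suc n)" using x by blast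
      ultimately show False by simp
    qed
  qed (auto intro: le_less_trans)
  also have "measure lam {x. r x \<le> 0} = 0"
  proof -
    have "AE x in lam. x \<notin> {x. r x \<le> 0}" using r_AE_pos by eventually_elim auto
    moreover have "{x. r x \<le> 0} \<in> sets lam" using r_measurable by (simp add: sets_lam)
    ultimately show ?thesis by (simp add: lam.prob_eq_0)
  qed
  finally have "\<forall>\<^sub>F n in sequentially. measure lam {x. r x < 1 / real (Suc n)} < \<epsilon>" using \<epsilon> by (rule order_tendstoD)
  then obtain n where "measure lam {x. r x < 1 / real (Suc n)} < \<epsilon>" by (auto simp: eventually_sequentially)
  then show ?thesis by (intro exI[of _ "1 / real (Suc n)"]) simp
qed

lemma uniformly_small_oscillation:
  assumes "finite Fs" "\<And>f. f \<in> Fs \<Longrightarrow> continuous_on (UNIV :: 'a set) (f :: 'a \<Rightarrow> real)" and e: "0 < e"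
  shows "\<exists>d>0. \<forall>f\<in>Fs. \<forall>x y. dist x y < d \<longrightarrow> \<bar>f x - f y\<bar> < e"
  using assms(1,2)
proof (induction Fs)
  case empty then show ?case by (intro exI[of _ 1]) auto
next
  case (insert f Fs)
  then obtain d where d: "0 < d" "\<forall>f\<in>Fs. \<forall>x y. dist x y < d \<longrightarrow> \<bar>f x - f y\<bar> < e" by auto
  have "uniformly_continuous_on UNIV f" using insert by (intro compact_uniformly_continuous compact_space) auto
  then obtain d' where d': "0 < d'" "\<And>x y. dist x y < d' \<Longrightarrow> \<bar>f x - f y\<bar> < e"
    unfolding uniformly_continuous_on_def dist_real_def using e by (metis UNIV_I)
  show ?case using d d' by (intro exI[of _ "min d d'"]) auto
qed

end

section \<open>Stationary averages of the tilted chain\<close>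

context tilted_chain begin

text \<open>The factor \<open>\<rho> j\<close> cancels: a cell is visited in proportion to
  \<open>\<beta> j * \<rho> j\<close>, and its visits last in proportion to
  \<open>1 / \<rho> j\<close>. Up to the common \<open>Z\<close>, the time spent in a cell depends
  on \<open>\<beta> j\<close> and the cell alone.\<close>

lemma stat_cell_mean:
  assumes j: "j \<in> L"
  shows "stat j * cell_mean \<psi> j = \<beta> j * (\<integral>y. indicator (cell j) y * (\<psi> y / r y) \<partial>lam) / mass j / Z"
  using \<rho>_pos[OF j] cell_pos[OF j] Z_pos by (simp add: stat_def cell_mean_def field_simps)

lemma integrable_cell:
  assumes [measurable]: "\<psi> \<in> borel_measurable borel" and B: "\<And>y. \<bar>\<psi> y\<bar> \<le> B"
  shows "integrable lam (\<lambda>y. indicator (cell j) y * (\<psi> y / r y))"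
proof (rule prob_measure_integrable[OF lam_prob_measures])
  show "(\<lambda>y. indicator (cell j) y * (\<psi> y / r y)) \<in> borel_measurable borel" using r_measurable by measurable
  show "\<bar>indicator (cell j) y * (\<psi> y / r y)\<bar> \<le> B / \<delta>" for y
  proof (cases "y \<in> D")
    case True
    have "\<bar>\<psi> y\<bar> / r y \<le> B / \<delta>" using B[of y] r_ge[OF True] \<delta> by (intro frac_le) auto
    then show ?thesis using B[of y] \<delta> r_nonneg[of y] by (auto simp: indicator_def intro!: divide_nonneg_pos)
  next
    case False
    then show ?thesis using B[of y] \<delta> by (auto intro!: divide_nonneg_pos)
  qed
qed

text \<open>On cell \<open>j\<close> the quotient \<open>cost / r\<close> is the constant
  \<open>1 - \<rho> j\<close>. Dividing by the mean duration of a visit later cancels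
  \<open>Z\<close> and leaves the sum of \<open>\<beta>\<close> minus the energy.\<close>

lemma mean_visit_cost: "mean_visit cost = ((\<Sum>j\<in>L. \<beta> j) - (\<Sum>j\<in>L. \<beta> j * \<rho> j)) / Z"
proof -
  have "stat j * cell_mean cost j = \<beta> j * (1 - \<rho> j) / Z" if j: "j \<in> L" for j
  proof -
    have "indicator (cell j) y * (cost y / r y) = (1 - \<rho> j) * indicator (cell j) y" for y
      using r_ge[of y] \<delta> by (auto simp: indicator_def cost_def)
    then have "(\<integral>y. indicator (cell j) y * (cost y / r y) \<partial>lam) = (1 - \<rho> j) * mass j" by (simp add: sets_lam)
    then show ?thesis using cell_pos[OF j] by (simp add: stat_cell_mean[OF j])
  qed
  then show ?thesis
    by (simp add: mean_visit_def right_diff_distrib sum_subtractf sum_divide_distrib diff_divide_distrib)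
qed

context
  fixes w :: "'a \<Rightarrow> real"
  assumes w: "\<And>j. j \<in> L \<Longrightarrow> \<beta> j * (\<integral>y. indicator (cell j) y * (1 / r y) \<partial>lam) = w j * mass j"
begin

text \<open>By the assumption on \<open>w\<close>, which prescribes \<open>\<beta>\<close>, the mean
  time per jump spent in cell \<open>j\<close> is \<open>w j / Z\<close>; so \<open>w\<close> gives
  the long-run time fractions when it sums to 1.\<close>

lemma mean_visit_1: "mean_visit (\<lambda>_. 1) = (\<Sum>j\<in>L. w j) / Z"
  unfolding mean_visit_def sum_divide_distrib
proof (intro sum.cong refl)
  show "stat j * cell_mean (\<lambda>_. 1) j = w j / Z" if j: "j \<in> L" for j
    unfolding stat_cell_mean[OF j] w[OF j] using cell_pos[OF j] by simp
qed

lemma mean_visit_close: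
  assumes [measurable]: "\<psi> \<in> borel_measurable borel" and B: "\<And>y. \<bar>\<psi> y\<bar> \<le> B"
    and a: "\<And>y. y \<in> D \<Longrightarrow> \<bar>\<psi> y - a (\<iota> y)\<bar> \<le> e"
  shows "\<bar>mean_visit \<psi> - (\<Sum>j\<in>L. w j * a j) / Z\<bar> \<le> e * (\<Sum>j\<in>L. w j) / Z"
proof -
  let ?J = "\<lambda>\<psi> j. \<integral>y. indicator (cell j) y * (\<psi> y / r y) \<partial>lam"
  have J: "\<bar>?J \<psi> j - a j * ?J (\<lambda>_. 1) j\<bar> \<le> e * ?J (\<lambda>_. 1) j" for j
  proof -
    define g where "g y = indicator (cell j) y * (1 / r y)" for y
    define h where "h y = indicator (cell j) y * (\<psi> y / r y)" for y
    have i: "integrable lam g" unfolding g_def by (rule integrable_cell[where B=1]) auto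
    have i2: "integrable lam h" unfolding h_def by (rule integrable_cell[OF assms(1) B])
    have "(\<integral>y. h y \<partial>lam) - a j * (\<integral>y. g y \<partial>lam) = (\<integral>y. h y - a j * g y \<partial>lam)"
      using i i2 by simp
    moreover have "\<bar>\<dots>\<bar> \<le> (\<integral>y. \<bar>h y - a j * g y\<bar> \<partial>lam)"
      by (rule integral_abs_bound)
    moreover have "\<dots> \<le> (\<integral>y. e * g y \<partial>lam)"
    proof (rule integral_mono)
      show "\<bar>h y - a j * g y\<bar> \<le> e * g y" for y
      proof (cases "y \<in> cell j")
        case True
        then have "0 < r y" using r_ge[of y] \<delta> by auto
        moreover have "\<bar>\<psi> y - a j\<bar> \<le> e" using a[of y] True by auto
        ultimately show ?thesis using True by (simp add: g_def h_def diff_divide_distrib[symmetric] divide_right_mono)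
      qed (simp add: g_def h_def)
    qed (use i i2 in auto)
    moreover have "\<dots> = e * (\<integral>y. g y \<partial>lam)" by simp
    ultimately have "\<bar>(\<integral>y. h y \<partial>lam) - a j * (\<integral>y. g y \<partial>lam)\<bar> \<le> e * (\<integral>y. g y \<partial>lam)" by linarith
    then show ?thesis by (simp only: g_def h_def)
  qed
  have "\<bar>mean_visit \<psi> - (\<Sum>j\<in>L. w j * a j) / Z\<bar> = \<bar>\<Sum>j\<in>L. \<beta> j * ?J \<psi> j / mass j / Z - w j * a j / Z\<bar>"
    by (simp add: mean_visit_def stat_cell_mean sum_subtractf sum_divide_distrib)
  also have "\<dots> \<le> (\<Sum>j\<in>L. e * w j / Z)"
  proof (intro order_trans[OF sum_abs] sum_mono)
    fix j assume j: "j \<in> L"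
    have wj: "w j = \<beta> j * ?J (\<lambda>_. 1) j / mass j" using w[OF j] cell_pos[OF j] by (simp add: field_simps)
    have k: "0 \<le> \<beta> j / mass j / Z" using \<beta>_pos[OF j] cell_pos[OF j] Z_pos by simp
    have "\<beta> j * ?J \<psi> j / mass j / Z - w j * a j / Z = (?J \<psi> j - a j * ?J (\<lambda>_. 1) j) * (\<beta> j / mass j / Z)"
    proof -
      have "b * X / m / z - b * J / m * a' / z = (X - a' * J) * (b / m / z)" for b X m z J a' :: real
        by (simp add: algebra_simps diff_divide_distrib)
      then show ?thesis unfolding wj .
    qed
    then have "\<bar>\<beta> j * ?J \<psi> j / mass j / Z - w j * a j / Z\<bar> = \<bar>?J \<psi> j - a j * ?J (\<lambda>_. 1) j\<bar> * (\<beta> j / mass j / Z)"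
      using k by (simp only: abs_mult abs_of_nonneg)
    moreover have "\<dots> \<le> e * ?J (\<lambda>_. 1) j * (\<beta> j / mass j / Z)" using J[of j] k by (rule mult_right_mono)
    moreover have "\<dots> = e * w j / Z" unfolding wj by (simp add: mult_ac)
    ultimately show "\<bar>\<beta> j * ?J \<psi> j / mass j / Z - w j * a j / Z\<bar> \<le> e * w j / Z" by linarith
  qed
  also have "\<dots> = e * (\<Sum>j\<in>L. w j) / Z" by (simp add: sum_distrib_left sum_divide_distrib)
  finally show ?thesis .
qed

end

end

text \<open>A partition fine at scale \<open>\<eta>\<close> for \<open>q\<close> and
  \<open>r\<close>, and a set \<open>D\<close> of rates at least \<open>\<delta>\<close> that misses
  at most \<open>\<eta>\<close> of \<open>lam\<close> yet meets every cell. The bound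
  \<open>\<eta> \<le> qmin / 2\<close> keeps the lowered kernel positive. The weights under
  \<open>\<mu>\<close> are not cut down to \<open>D\<close>, so mass of \<open>\<mu>\<close> at
  small rates is counted in full.\<close>

locale discretized_chain = density_chain r p lam q for r :: "'a::polish_space \<Rightarrow> real" and p lam q +
  fixes L :: "'a set" and \<iota> :: "'a \<Rightarrow> 'a" and D :: "'a set" and \<delta> \<eta> :: real and \<mu> :: "'a measure"
  assumes L: "finite L" "L \<noteq> {}" and \<iota>[measurable]: "\<iota> \<in> borel \<rightarrow>\<^sub>M count_space L"
    and D[measurable]: "D \<in> sets borel" and \<delta>: "0 < \<delta>" and r_ge: "\<And>y. y \<in> D \<Longrightarrow> \<delta> \<le> r y"
    and \<eta>: "0 < \<eta>" "\<eta> \<le> qmin / 2"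
    and q_close: "\<And>x y. \<bar>q x y - q (\<iota> x) (\<iota> y)\<bar> \<le> \<eta>"
    and r_close: "\<And>x y. \<iota> x = \<iota> y \<Longrightarrow> \<bar>r x - r y\<bar> \<le> \<eta>"
    and D_small: "measure lam (- D) \<le> \<eta>"
    and cell_pos: "\<And>j. j \<in> L \<Longrightarrow> 0 < measure lam {y \<in> D. \<iota> y = j}"
    and \<mu>: "\<mu> \<in> prob_measures"
    and weight_pos: "\<And>j. j \<in> L \<Longrightarrow> 0 < measure \<mu> {y. \<iota> y = j}"
begin

definition "label_weight j = measure \<mu> {y. \<iota> y = j}"
definition "cell_mass j = measure lam {y \<in> D. \<iota> y = j}"
definition "inv_rate j = (\<integral>y. indicator {y \<in> D. \<iota> y = j} y * (1 / r y) \<partial>lam)"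
text \<open>The harmonic mean of \<open>r\<close> over the cell. With the weights \<open>label_rate\<close> in the minimisation the tilted chain
  spends the fraction \<open>\<mu> {y. \<iota> y = j}\<close> of its time in cell \<open>j\<close>.\<close>

definition "cell_rate j = cell_mass j / inv_rate j"
definition "label_rate j = label_weight j * cell_rate j"
text \<open>Lowered by \<open>\<eta>\<close> so that it lies below \<open>q\<close> on the whole
  product of two cells, as the likelihood ratio requires; at most \<open>2 * \<eta>\<close> is
  lost.\<close>

definition "label_kernel i j = q i j - \<eta>"
definition "energy \<phi> = (\<Sum>i\<in>L. \<Sum>j\<in>L. label_rate i * label_kernel i j * cell_mass j * exp (\<phi> j - \<phi> i))"

lemma \<iota>_in: "\<iota> x \<in> L"
  using measurable_space[OF \<iota>, of x] by simp

lemma cell_sets[measurable]: "{y \<in> D. \<iota> y = j} \<in> sets borel"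
proof -
  have "{y \<in> D. \<iota> y = j} = D \<inter> {y. \<iota> y = j}" by auto
  then show ?thesis using D sets_label[OF \<iota>, of j] by simp
qed

lemma inv_rate_integrable: "integrable lam (\<lambda>y. indicator {y \<in> D. \<iota> y = j} y * (1 / r y))"
proof (rule prob_measure_integrable[OF lam_prob_measures])
  show "(\<lambda>y. indicator {y \<in> D. \<iota> y = j} y * (1 / r y)) \<in> borel_measurable borel" using r_measurable by measurable
  show "\<bar>indicator {y \<in> D. \<iota> y = j} y * (1 / r y)\<bar> \<le> 1 / \<delta>" for y
    using r_ge[of y] \<delta> by (auto simp: indicator_def intro!: frac_le)
qed

lemma cell_integrable: "integrable lam (indicator {y \<in> D. \<iota> y = j} :: 'a \<Rightarrow> real)"
  by (intro integrable_real_indicator) (auto simp: sets_lam lam.emeasure_eq_measure)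

lemma cell_mass_pos: "j \<in> L \<Longrightarrow> 0 < cell_mass j"
  using cell_pos by (simp add: cell_mass_def)

lemma cell_mass_integral: "cell_mass j = (\<integral>y. indicator {y \<in> D. \<iota> y = j} y \<partial>lam)"
  by (simp add: cell_mass_def sets_lam)

lemma cell_mass_le_inv_rate: "cell_mass j \<le> R * inv_rate j"
proof -
  have "(\<integral>y. indicator {y \<in> D. \<iota> y = j} y \<partial>lam) \<le> (\<integral>y. R * (indicator {y \<in> D. \<iota> y = j} y * (1 / r y)) \<partial>lam)"
  proof (rule integral_mono[OF cell_integrable])
    show "integrable lam (\<lambda>y. R * (indicator {y \<in> D. \<iota> y = j} y * (1 / r y)))" by (intro integrable_mult_right inv_rate_integrable)
    show "indicator {y \<in> D. \<iota> y = j} y \<le> R * (indicator {y \<in> D. \<iota> y = j} y * (1 / r y))" for y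
      using r_ge[of y] \<delta> R(2)[of y] by (auto simp: indicator_def le_divide_eq)
  qed
  also have "\<dots> = R * inv_rate j" unfolding inv_rate_def by (rule integral_mult_right_zero)
  finally show ?thesis by (simp only: cell_mass_integral)
qed

lemma inv_rate_pos: assumes "j \<in> L" shows "0 < inv_rate j"
proof -
  have "0 < R * inv_rate j" using cell_mass_le_inv_rate[of j] cell_mass_pos[OF assms] by linarith
  then show ?thesis using R(1) by (rule zero_less_mult_pos)
qed

lemma cell_rate_bounds: "j \<in> L \<Longrightarrow> 0 < cell_rate j" "j \<in> L \<Longrightarrow> cell_rate j \<le> R"
  using cell_mass_le_inv_rate[of j] cell_mass_pos[of j] inv_rate_pos[of j] by (auto simp: cell_rate_def divide_le_eq)

text \<open>A harmonic mean of values that all lie within \<open>\<eta>\<close> of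
  \<open>r x\<close>. The point \<open>x\<close> may lie outside \<open>D\<close>, even where
  \<open>r\<close> vanishes, so the bound covers all the mass of \<open>\<mu>\<close>.\<close>

lemma cell_rate_close: "\<bar>cell_rate (\<iota> x) - r x\<bar> \<le> \<eta>"
proof -
  define g where "g y = indicator {y \<in> D. \<iota> y = \<iota> x} y * (1 / r y)" for y
  define h :: "'a \<Rightarrow> real" where "h = indicator {y \<in> D. \<iota> y = \<iota> x}"
  have i: "integrable lam g" "integrable lam h"
    using inv_rate_integrable cell_integrable by (auto simp: g_def[abs_def] h_def)
  have inv: "inv_rate (\<iota> x) = (\<integral>y. g y \<partial>lam)" by (simp only: inv_rate_def g_def)
  have "cell_mass (\<iota> x) - r x * inv_rate (\<iota> x) = (\<integral>y. h y - r x * g y \<partial>lam)"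
    using i unfolding inv h_def[symmetric] cell_mass_integral by simp
  moreover have "\<bar>\<dots>\<bar> \<le> (\<integral>y. \<bar>h y - r x * g y\<bar> \<partial>lam)" by (rule integral_abs_bound)
  moreover have "\<dots> \<le> (\<integral>y. \<eta> * g y \<partial>lam)"
  proof (rule integral_mono)
    show "\<bar>h y - r x * g y\<bar> \<le> \<eta> * g y" for y
    proof (cases "y \<in> D \<and> \<iota> y = \<iota> x")
      case True
      then have y: "0 < r y" "\<bar>r y - r x\<bar> \<le> \<eta>" using r_ge[of y] \<delta> r_close[of y x] by auto
      have "h y - r x * g y = (r y - r x) / r y" using True y by (simp add: h_def g_def diff_divide_distrib)
      then show ?thesis using True y by (simp add: g_def divide_right_mono)
    qed (auto simp: g_def h_def)
  qed (use i in auto)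
  moreover have "\<dots> = \<eta> * inv_rate (\<iota> x)" by (simp add: inv)
  ultimately have d: "\<bar>cell_mass (\<iota> x) - r x * inv_rate (\<iota> x)\<bar> \<le> \<eta> * inv_rate (\<iota> x)" by linarith
  have "cell_rate (\<iota> x) - r x = (cell_mass (\<iota> x) - r x * inv_rate (\<iota> x)) / inv_rate (\<iota> x)"
    using inv_rate_pos[OF \<iota>_in, of x] by (simp add: cell_rate_def field_simps)
  then show ?thesis using d inv_rate_pos[OF \<iota>_in, of x] by (simp add: divide_le_eq)
qed

lemma sum_label_weight: "(\<Sum>j\<in>L. label_weight j) = 1"
proof -
  interpret \<mu>: prob_space \<mu> using \<mu> by (simp add: prob_measures_iff)
  have "space \<mu> = UNIV" using \<mu> by (auto simp: prob_measures_iff dest: sets_eq_imp_space_eq)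
  then show ?thesis
    using integral_label_function[OF \<mu> L(1) \<iota>, of UNIV "\<lambda>_. 1"] \<mu>.prob_space by (simp add: label_weight_def)
qed

lemma label_weight_pos: "j \<in> L \<Longrightarrow> 0 < label_weight j"
  using weight_pos by (simp add: label_weight_def)

lemma label_rate_pos: "j \<in> L \<Longrightarrow> 0 < label_rate j"
  using label_weight_pos cell_rate_bounds by (simp add: label_rate_def)

lemma sum_label_rate: "(\<Sum>j\<in>L. label_rate j) \<le> R"
proof -
  have "(\<Sum>j\<in>L. label_rate j) \<le> (\<Sum>j\<in>L. label_weight j * R)"
    unfolding label_rate_def using cell_rate_bounds label_weight_pos by (intro sum_mono mult_left_mono) (auto intro: less_imp_le)
  then show ?thesis by (simp add: sum_label_weight flip: sum_distrib_right)
qed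

lemma sum_cell_mass: "(\<Sum>j\<in>L. cell_mass j) \<le> 1"
  using integral_label_function[OF lam_prob_measures L(1) \<iota> D, of "\<lambda>_. 1"] D lam.prob_le_1[of D]
  by (simp add: cell_mass_def sets_lam)

lemma label_kernel_bounds: "qmin / 2 \<le> label_kernel i j" "label_kernel i j \<le> qmax" "label_kernel (\<iota> x) (\<iota> y) \<le> q x y"
  "q x y \<le> label_kernel (\<iota> x) (\<iota> y) + 2 * \<eta>"
  using qmin(2)[of i j] qmax(2)[of i j] \<eta> q_close[of x y] by (auto simp: label_kernel_def)

text \<open>Two losses of order \<open>\<eta>\<close>: at most \<open>2 * \<eta>\<close> in the
  kernel on \<open>D\<close>, and the jumps into the complement of \<open>D\<close>, whose mass is
  at most \<open>\<eta>\<close>.\<close>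

lemma jump_mean_label_le:
  assumes v: "\<And>j. j \<in> L \<Longrightarrow> 0 \<le> v j" "\<And>j. j \<in> L \<Longrightarrow> v j \<le> K"
  shows "jump_mean (\<lambda>y. v (\<iota> y)) x \<le> (\<Sum>j\<in>L. label_kernel (\<iota> x) j * cell_mass j * v j) + \<eta> * K * (2 + qmax)"
proof -
  let ?h = "\<lambda>j. (label_kernel (\<iota> x) j + 2 * \<eta>) * v j"
  have vb: "0 \<le> v (\<iota> y)" "v (\<iota> y) \<le> K" for y using v \<iota>_in[of y] by auto
  have vm[measurable]: "(\<lambda>y. v (\<iota> y)) \<in> borel_measurable borel" by (rule measurable_label_function[OF \<iota>])
  have hm[measurable]: "(\<lambda>y. ?h (\<iota> y)) \<in> borel_measurable borel" by (rule measurable_label_function[OF \<iota>])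
  have hb: "\<bar>?h (\<iota> y)\<bar> \<le> (qmax + 2 * \<eta>) * K" for y
    unfolding abs_mult using vb[of y] label_kernel_bounds(1,2)[of "\<iota> x" "\<iota> y"] qmin(1) \<eta>(1) qmax(1)
    by (intro mult_mono) auto
  have i1: "integrable lam (\<lambda>y. indicator D y * ?h (\<iota> y))"
    by (rule prob_measure_integrable[OF lam_prob_measures, where B="(qmax + 2 * \<eta>) * K"])
      (use hb order_trans[OF abs_ge_zero hb[of undefined]] in \<open>auto simp: indicator_def simp del: abs_mult\<close>)
  have i2: "integrable lam (\<lambda>y. qmax * K * indicator (- D) y)"
    by (intro integrable_mult_right integrable_real_indicator) (auto simp: sets_lam lam.emeasure_eq_measure)
  have "jump_mean (\<lambda>y. v (\<iota> y)) x \<le> (\<integral>y. indicator D y * ?h (\<iota> y) + qmax * K * indicator (- D) y \<partial>lam)"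
    unfolding jump_mean_def
  proof (rule integral_mono)
    show "integrable lam (\<lambda>y. q x y * v (\<iota> y))" by (rule integrable_q_mult[where B=K]) (use vb in auto)
    show "integrable lam (\<lambda>y. indicator D y * ?h (\<iota> y) + qmax * K * indicator (- D) y)" using i1 i2 by simp
    show "q x y * v (\<iota> y) \<le> indicator D y * ?h (\<iota> y) + qmax * K * indicator (- D) y" for y
    proof (cases "y \<in> D")
      case True
      then show ?thesis using label_kernel_bounds(4)[of x y] vb[of y] by (simp add: mult_right_mono)
    next
      case False
      then show ?thesis using qmax vb[of y] q_pos[of x y] by (auto intro!: mult_mono)
    qed
  qed
  also have "\<dots> = (\<integral>y. indicator D y * ?h (\<iota> y) \<partial>lam) + qmax * K * measure lam (- D)"
    using i1 i2 D by (simp add: sets_lam)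
  also have "(\<integral>y. indicator D y * ?h (\<iota> y) \<partial>lam) = (\<Sum>j\<in>L. ?h j * cell_mass j)"
    unfolding cell_mass_def by (rule integral_label_function[OF lam_prob_measures L(1) \<iota> D])
  also have "\<dots> = (\<Sum>j\<in>L. label_kernel (\<iota> x) j * cell_mass j * v j) + 2 * \<eta> * (\<Sum>j\<in>L. v j * cell_mass j)"
    by (simp add: algebra_simps sum.distrib sum_distrib_left)
  finally have 1: "jump_mean (\<lambda>y. v (\<iota> y)) x \<le> (\<Sum>j\<in>L. label_kernel (\<iota> x) j * cell_mass j * v j) +
    2 * \<eta> * (\<Sum>j\<in>L. v j * cell_mass j) + qmax * K * measure lam (- D)" .
  have K: "0 \<le> K" using vb[of undefined] by linarith
  have "(\<Sum>j\<in>L. v j * cell_mass j) \<le> (\<Sum>j\<in>L. K * cell_mass j)"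
    using v cell_mass_pos by (intro sum_mono mult_right_mono) (auto intro: less_imp_le)
  also have "\<dots> \<le> K" using sum_cell_mass K by (simp add: mult_left_le flip: sum_distrib_left)
  finally have "2 * \<eta> * (\<Sum>j\<in>L. v j * cell_mass j) \<le> 2 * \<eta> * K" using \<eta>(1) by (intro mult_left_mono) auto
  moreover have "qmax * K * measure lam (- D) \<le> qmax * K * \<eta>" using D_small K qmax(1) by (intro mult_left_mono) auto
  ultimately show ?thesis using 1 by (simp add: algebra_simps)
qed

text \<open>The truncation of \<open>exp \<phi>\<close> gives a simple function that is admissible
  by \<open>rate_ge_simple\<close>. The first two error terms come from the truncation, the last
  from the discretisation; none depends on \<open>\<phi>\<close> or on the number of cells.\<close>

lemma discretized_cost_le:
  assumes K: "1 \<le> K"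
  shows "ereal ((\<Sum>j\<in>L. label_rate j) - energy \<phi>) \<le> rate \<mu> +
    ereal (R * (qmax / (K * (qmin / 2))) + R * (2 * qmax / K) + \<eta> * (1 + K\<^sup>2 * (qmax + R * (2 + qmax))))"
    (is "_ \<le> _ + ereal ?err")
\<comment> \<open>Truncation enlarges the energy by a relative error. In the nontrivial case the
  energy is below the sum of the label rates, hence below \<open>R\<close>, and the error becomes an
  absolute one.\<close>
proof (cases "(\<Sum>j\<in>L. label_rate j) \<le> energy \<phi>")
  case True
  have "0 \<le> ?err" using R(1) qmax(1) qmin(1) \<eta>(1) K by (intro add_nonneg_nonneg mult_nonneg_nonneg divide_nonneg_nonneg) auto
  then have "0 \<le> rate \<mu> + ereal ?err" using rate_functional_nonneg by (intro add_nonneg_nonneg) auto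
  moreover have "ereal ((\<Sum>j\<in>L. label_rate j) - energy \<phi>) \<le> 0" using True by simp
  ultimately show ?thesis by (rule order_trans[rotated])
next
  case False
  let ?\<beta> = "\<Sum>j\<in>L. label_rate j"
  have K0: "0 < K" using K by simp
  have "\<exists>v. (\<forall>i\<in>L. 1 / K \<le> v i \<and> v i \<le> K) \<and>
    (\<Sum>i\<in>L. \<Sum>j\<in>L. label_rate i * label_kernel i j * cell_mass j * (v j / v i)) \<le>
      (1 + qmax / (K * (qmin / 2))) * energy \<phi> + ?\<beta> * (2 * qmax / K)"
    unfolding energy_def
  proof (rule truncated_tilt[OF L])
    show "0 \<le> label_rate i" if "i \<in> L" for i using label_rate_pos[OF that] by simp
    show "0 < qmin / 2" using qmin(1) by simp
  qed (use label_kernel_bounds cell_mass_pos sum_cell_mass K in auto)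
  then obtain v where v: "\<forall>i\<in>L. 1 / K \<le> v i \<and> v i \<le> K" and
    V: "(\<Sum>i\<in>L. \<Sum>j\<in>L. label_rate i * label_kernel i j * cell_mass j * (v j / v i)) \<le>
      (1 + qmax / (K * (qmin / 2))) * energy \<phi> + ?\<beta> * (2 * qmax / K)" by (elim exE conjE)
  define V where "V = (\<Sum>i\<in>L. \<Sum>j\<in>L. label_rate i * label_kernel i j * cell_mass j * (v j / v i))"
  have V_le: "V \<le> energy \<phi> + R * (qmax / (K * (qmin / 2))) + R * (2 * qmax / K)"
  proof -
    have "qmax / (K * (qmin / 2)) * energy \<phi> \<le> qmax / (K * (qmin / 2)) * R"
      using False sum_label_rate qmax(1) qmin(1) K0 by (intro mult_left_mono) auto
    moreover have "?\<beta> * (2 * qmax / K) \<le> R * (2 * qmax / K)"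
      using sum_label_rate qmax(1) K0 by (intro mult_right_mono) auto
    ultimately show ?thesis using V unfolding V_def[symmetric] by (simp only: distrib_right mult_1 mult.commute[of R])
  qed
  have v0: "0 < v i" if "i \<in> L" for i using v that K0 by (metis less_le_trans zero_less_divide_1_iff)
  define S where "S i = (\<Sum>j\<in>L. label_kernel i j * cell_mass j * v j)" for i
  have S: "0 \<le> S i" "S i \<le> qmax * K" if "i \<in> L" for i
  proof -
    have m: "0 \<le> cell_mass j" "0 \<le> v j" "v j \<le> K" "0 \<le> label_kernel i j" "label_kernel i j \<le> qmax" if "j \<in> L" for j
      using cell_mass_pos[OF that] v0[OF that] v that label_kernel_bounds(1,2)[of i j] qmin(1) by auto
    show "0 \<le> S i" unfolding S_def using m by (intro sum_nonneg mult_nonneg_nonneg) auto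
    have "S i \<le> (\<Sum>j\<in>L. qmax * cell_mass j * K)" unfolding S_def using m qmax(1) by (intro sum_mono mult_mono) auto
    also have "\<dots> = qmax * (\<Sum>j\<in>L. cell_mass j) * K" by (simp add: sum_distrib_left sum_distrib_right)
    also have "\<dots> \<le> qmax * 1 * K" using sum_cell_mass qmax(1) K0 by (intro mult_right_mono mult_left_mono) auto
    finally show "S i \<le> qmax * K" by simp
  qed
  let ?P = "jump_mean (\<lambda>y. v (\<iota> y))"
  let ?c = "\<eta> * (1 + K\<^sup>2 * (qmax + R * (2 + qmax)))"
  let ?h = "\<lambda>i. cell_rate i - cell_rate i * (S i / v i) - ?c"
  have vinv: "1 / v (\<iota> x) \<le> K" "0 \<le> 1 / v (\<iota> x)" for x
    using v \<iota>_in[of x] v0[OF \<iota>_in, of x] K0 by (auto simp: divide_le_eq mult.commute pos_divide_le_eq)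
  have pt: "?h (\<iota> x) \<le> r x - r x * (?P x / v (\<iota> x))" for x
  proof -
    let ?i = "\<iota> x"
    have "?P x \<le> S ?i + \<eta> * K * (2 + qmax)"
      unfolding S_def using v v0 by (intro jump_mean_label_le) (auto intro: less_imp_le)
    then have "r x * (?P x * (1 / v ?i)) \<le> r x * ((S ?i + \<eta> * K * (2 + qmax)) * (1 / v ?i))"
      using vinv[of x] r_nonneg[of x] by (intro mult_left_mono mult_right_mono) auto
    also have "\<dots> = r x * (S ?i * (1 / v ?i)) + r x * (\<eta> * K * (2 + qmax) * (1 / v ?i))" by (simp only: distrib_right distrib_left)
    also have "\<dots> \<le> (cell_rate ?i + \<eta>) * (S ?i * (1 / v ?i)) + R * (\<eta> * K * (2 + qmax) * K)"
      using vinv[of x] S[OF \<iota>_in, of x] R cell_rate_close[of x] cell_rate_bounds(1)[OF \<iota>_in, of x] \<eta>(1) K0 qmax(1)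
      by (intro add_mono mult_mono mult_nonneg_nonneg) auto
    also have "\<dots> = cell_rate ?i * (S ?i * (1 / v ?i)) + \<eta> * (S ?i * (1 / v ?i)) + R * (\<eta> * K * (2 + qmax) * K)"
      by (simp only: distrib_right)
    finally have 1: "r x * (?P x / v ?i) \<le> cell_rate ?i * (S ?i / v ?i) + \<eta> * (S ?i / v ?i) + R * (\<eta> * K * (2 + qmax) * K)" by simp
    have "S ?i * (1 / v ?i) \<le> qmax * K * K"
      using vinv[of x] S[OF \<iota>_in, of x] qmax(1) K0 by (intro mult_mono) auto
    then have "\<eta> * (S ?i / v ?i) \<le> \<eta> * (qmax * K * K)" using \<eta>(1) by (intro mult_left_mono) auto
    moreover have "cell_rate ?i - \<eta> \<le> r x" using cell_rate_close[of x] by linarith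
    moreover have "?c = \<eta> + \<eta> * (qmax * K * K) + R * (\<eta> * K * (2 + qmax) * K)" by (simp add: power2_eq_square algebra_simps)
    ultimately show ?thesis using 1 by linarith
  qed
  have eq: "(\<integral>x. ?h (\<iota> x) \<partial>\<mu>) = ?\<beta> - V - ?c"
  proof -
    have "(\<integral>x. ?h (\<iota> x) \<partial>\<mu>) = (\<Sum>j\<in>L. ?h j * label_weight j)"
      using integral_label_function[OF \<mu> L(1) \<iota>, of UNIV ?h] by (simp add: label_weight_def)
    also have "\<dots> = (\<Sum>j\<in>L. label_rate j - label_rate j * (S j / v j) - ?c * label_weight j)"
      by (intro sum.cong refl) (simp add: label_rate_def algebra_simps)
    also have "\<dots> = ?\<beta> - (\<Sum>j\<in>L. label_rate j * (S j / v j)) - ?c"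
      by (simp only: sum_subtractf sum_distrib_left[symmetric] sum_label_weight mult_1_right)
    also have "(\<Sum>j\<in>L. label_rate j * (S j / v j)) = V"
      unfolding V_def S_def by (simp add: sum_distrib_left sum_divide_distrib mult_ac)
    finally show ?thesis .
  qed
  have hm: "(\<lambda>x. ?h (\<iota> x)) \<in> borel_measurable borel" by (rule measurable_label_function[OF \<iota>])
  have "(\<integral>x. ?h (\<iota> x) \<partial>\<mu>) \<le> (\<integral>x. r x - r x * (?P x / v (\<iota> x)) \<partial>\<mu>)"
  proof (rule integral_mono[OF _ _ pt])
    have "\<bar>?h (\<iota> x)\<bar> \<le> Max ((\<lambda>j. \<bar>?h j\<bar>) ` L)" for x using \<iota>_in L by (intro Max_ge) auto
    then show "integrable \<mu> (\<lambda>x. ?h (\<iota> x))" by (intro prob_measure_integrable[OF \<mu> hm])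
    have vm[measurable]: "(\<lambda>y. v (\<iota> y)) \<in> borel_measurable borel" by (rule measurable_label_function[OF \<iota>])
    have vb: "\<bar>v (\<iota> y)\<bar> \<le> K" for y using v v0[OF \<iota>_in, of y] \<iota>_in[of y] by simp
    have [measurable]: "?P \<in> borel_measurable borel" "r \<in> borel_measurable borel"
      using continuous_jump_mean[OF vm vb] r_measurable by (auto intro: borel_measurable_continuous_onI)
    have P: "0 \<le> ?P x" "?P x \<le> K" for x
    proof -
      show "0 \<le> ?P x" unfolding jump_mean_def using q_pos v0[OF \<iota>_in]
        by (intro Bochner_Integration.integral_nonneg mult_nonneg_nonneg) (auto intro: less_imp_le)
      have "?P x \<le> jump_mean (\<lambda>_. K) x"
        by (rule jump_mean_mono[where B=K and B'=K]) (use vb K0 in \<open>auto intro: order_trans[OF abs_ge_self]\<close>)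
      then show "?P x \<le> K" by (simp add: jump_mean_const)
    qed
    have "\<bar>r x - r x * (?P x / v (\<iota> x))\<bar> \<le> R + R * (K * K)" for x
    proof -
      have "\<bar>r x * (?P x * (1 / v (\<iota> x)))\<bar> \<le> R * (K * K)"
        unfolding abs_mult using P[of x] vinv[of x] r_nonneg[of x] R K0 by (intro mult_mono) auto
      then have "\<bar>r x * (?P x / v (\<iota> x))\<bar> \<le> R * (K * K)" by (simp only: times_divide_eq_right mult_1_right)
      then show ?thesis using r_nonneg[of x] R(2)[of x] by linarith
    qed
    then show "integrable \<mu> (\<lambda>x. r x - r x * (?P x / v (\<iota> x)))" by (intro prob_measure_integrable[OF \<mu>]) measurable
  qed
  then have "?\<beta> - energy \<phi> \<le> (\<integral>x. r x - r x * (?P x / v (\<iota> x)) \<partial>\<mu>) + ?err" unfolding eq using V_le by linarith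
  then have "ereal (?\<beta> - energy \<phi>) \<le> ereal (\<integral>x. r x - r x * (?P x / v (\<iota> x)) \<partial>\<mu>) + ereal ?err" by simp
  also have "\<dots> \<le> rate \<mu> + ereal ?err"
    by (intro add_right_mono rate_ge_simple[OF \<mu> L(1) \<iota>, where \<alpha>="1/K" and \<beta>=K]) (use v K0 in auto)
  finally show ?thesis .
qed

section \<open>The lower bound\<close>

text \<open>For the stationary \<open>\<phi>\<close> the time fractions of the tilted chain are the
  weights \<open>label_weight j\<close>. Its averages of \<open>f\<close> are within
  \<open>2 * (e / 3)\<close> of the integrals under \<open>\<mu>\<close>: one third for replacing
  \<open>f\<close> by its label values along the chain, one for doing so under \<open>\<mu>\<close>.
  The last third is left for fluctuations.\<close>

lemma discretized_lower_bound:
  fixes Fs :: "('a \<Rightarrow> real) set"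
  assumes Fs: "finite Fs" "\<And>f. f \<in> Fs \<Longrightarrow> continuous_on UNIV f" and e: "0 < e"
    and close: "\<And>f x. f \<in> Fs \<Longrightarrow> \<bar>f x - f (\<iota> x)\<bar> \<le> e / 3"
    and A: "openin weak_topology A"
      "\<And>\<nu>. \<nu> \<in> prob_measures \<Longrightarrow> (\<And>f. f \<in> Fs \<Longrightarrow> \<bar>(\<integral>x. f x \<partial>\<nu>) - (\<integral>x. f x \<partial>\<mu>)\<bar> < e) \<Longrightarrow> \<nu> \<in> A"
    and \<delta>1: "0 < \<delta>1"
  shows "\<exists>\<phi>. \<forall>\<kappa>>0. \<forall>\<^sub>F T in at_top. \<forall>x. \<delta>1 \<le> r x \<longrightarrow> exp (- T * ((\<Sum>j\<in>L. label_rate j) - energy \<phi> + \<kappa>)) \<le>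
    measure (chain_law r p x) {\<omega> \<in> space (chain_law r p x). empirical_measure T \<omega> \<in> A}"
proof -
  have kernel_pos: "0 < label_kernel i j" for i j using label_kernel_bounds(1)[of i j] qmin(1) by linarith
  have pos: "0 < label_rate i * label_kernel i j * cell_mass j" if "i \<in> L" "j \<in> L" for i j
    using label_rate_pos[OF that(1)] kernel_pos cell_mass_pos[OF that(2)] by simp
  obtain \<phi> where \<phi>: "\<And>l. l \<in> L \<Longrightarrow> (\<Sum>i\<in>L. label_rate i * label_kernel i l * cell_mass l * exp (\<phi> l - \<phi> i)) =
      (\<Sum>j\<in>L. label_rate l * label_kernel l j * cell_mass j * exp (\<phi> j - \<phi> l))"
    using exponential_tilt_balanced[where w="\<lambda>i j. label_rate i * label_kernel i j * cell_mass j", OF L pos] by blast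
  obtain l0 where l0: "l0 \<in> L" using L(2) by blast
  interpret tilt: tilted_chain r p lam q L \<iota> D \<delta> label_kernel \<phi> label_rate l0
  proof
    show "label_kernel (\<iota> x) (\<iota> y) \<le> q x y" for x y by (rule label_kernel_bounds(3))
    show "0 < measure lam {y \<in> D. \<iota> y = j}" if "j \<in> L" for j using cell_pos[OF that] .
  qed (use L \<iota> D \<delta> r_ge l0 kernel_pos label_rate_pos \<phi>[unfolded cell_mass_def] in auto)
  have w: "label_rate j * (\<integral>y. indicator {y \<in> D. \<iota> y = j} y * (1 / r y) \<partial>lam) = label_weight j * measure lam {y \<in> D. \<iota> y = j}"
    if "j \<in> L" for j
    using inv_rate_pos[OF that] unfolding label_rate_def cell_rate_def cell_mass_def[symmetric] inv_rate_def[symmetric] by simp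
  define m1 where "m1 = tilt.mean_visit (\<lambda>_. 1)"
  have "m1 = (\<Sum>j\<in>L. label_weight j) / tilt.Z" unfolding m1_def by (rule tilt.mean_visit_1) (rule w)
  then have m1: "m1 = 1 / tilt.Z" by (simp add: sum_label_weight)
  have m1_pos: "0 < m1" using tilt.Z_pos by (simp add: m1)
  have \<rho>: "(\<Sum>j\<in>L. label_rate j * tilt.\<rho> j) = energy \<phi>"
    unfolding energy_def tilt.\<rho>_def cell_mass_def by (simp add: sum_distrib_left mult.assoc)
  have cost: "tilt.mean_visit tilt.cost / m1 = (\<Sum>j\<in>L. label_rate j) - energy \<phi>"
    using tilt.Z_pos unfolding tilt.mean_visit_cost m1 \<rho> by simp
  have near: "\<bar>tilt.mean_visit f / m1 - (\<integral>x. f x \<partial>\<mu>)\<bar> \<le> 2 * (e / 3)" if f: "f \<in> Fs" for f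
  proof -
    obtain B where B: "\<And>x. \<bar>f x\<bar> \<le> B" using bounded_continuous_compact[OF compact_space Fs(2)[OF f]] by blast
    have fm: "f \<in> borel_measurable borel" by (rule borel_measurable_continuous_onI[OF Fs(2)[OF f]])
    have fi: "(\<lambda>x. f (\<iota> x)) \<in> borel_measurable borel" by (rule measurable_label_function[OF \<iota>])
    have "\<bar>tilt.mean_visit f - (\<Sum>j\<in>L. label_weight j * f j) / tilt.Z\<bar> \<le> e / 3 * (\<Sum>j\<in>L. label_weight j) / tilt.Z"
      by (rule tilt.mean_visit_close[OF w fm B]) (use close[OF f] in auto)
    then have "\<bar>tilt.mean_visit f - (\<Sum>j\<in>L. label_weight j * f j) / tilt.Z\<bar> * tilt.Z \<le> e / 3"
      using tilt.Z_pos by (simp add: sum_label_weight le_divide_eq)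
    moreover have "\<bar>tilt.mean_visit f - (\<Sum>j\<in>L. label_weight j * f j) / tilt.Z\<bar> * tilt.Z =
      \<bar>(tilt.mean_visit f - (\<Sum>j\<in>L. label_weight j * f j) / tilt.Z) * tilt.Z\<bar>"
      using tilt.Z_pos by (simp add: abs_mult)
    moreover have "(tilt.mean_visit f - (\<Sum>j\<in>L. label_weight j * f j) / tilt.Z) * tilt.Z =
      tilt.mean_visit f / m1 - (\<Sum>j\<in>L. label_weight j * f j)"
      using tilt.Z_pos by (simp add: m1 left_diff_distrib)
    ultimately have 1: "\<bar>tilt.mean_visit f / m1 - (\<Sum>j\<in>L. label_weight j * f j)\<bar> \<le> e / 3" by simp
    have "(\<integral>x. f (\<iota> x) \<partial>\<mu>) = (\<Sum>j\<in>L. label_weight j * f j)"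
      using integral_label_function[OF \<mu> L(1) \<iota>, of UNIV f] by (simp add: label_weight_def mult.commute)
    moreover have "\<bar>(\<integral>x. f x \<partial>\<mu>) - (\<integral>x. f (\<iota> x) \<partial>\<mu>)\<bar> \<le> e / 3"
      by (rule prob_measure_integral_close[OF \<mu>])
        (use prob_measure_integrable[OF \<mu> fm B] prob_measure_integrable[OF \<mu> fi B] close[OF f] in auto)
    ultimately show ?thesis using 1 by linarith
  qed
  show ?thesis
  proof (intro exI[of _ \<phi>] allI impI)
    fix \<kappa> :: real assume \<kappa>: "0 < \<kappa>"
    have e3: "0 < e / 3" using e by simp
    have "\<forall>\<^sub>F T in at_top. \<forall>x. \<delta>1 \<le> r x \<longrightarrow> exp (- T * ((\<Sum>j\<in>L. label_rate j) - energy \<phi> + \<kappa>)) \<le>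
      measure (chain_law r p x) {\<omega> \<in> space (chain_law r p x). \<forall>f\<in>Fs. \<bar>(\<integral>y. f y \<partial>empirical_measure T \<omega>) - tilt.mean_visit f / m1\<bar> < e / 3}"
      using tilt.tilted_lower_bound[OF Fs e3 \<kappa> \<delta>1 m1_def m1_pos] unfolding cost .
    then show "\<forall>\<^sub>F T in at_top. \<forall>x. \<delta>1 \<le> r x \<longrightarrow> exp (- T * ((\<Sum>j\<in>L. label_rate j) - energy \<phi> + \<kappa>)) \<le>
      measure (chain_law r p x) {\<omega> \<in> space (chain_law r p x). empirical_measure T \<omega> \<in> A}"
      using eventually_gt_at_top[of 0]
    proof eventually_elim
      case (elim T)
      show ?case
      proof (intro allI impI)
        fix x assume "\<delta>1 \<le> r x"
        then have "exp (- T * ((\<Sum>j\<in>L. label_rate j) - energy \<phi> + \<kappa>)) \<le>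
          measure (chain_law r p x) {\<omega> \<in> space (chain_law r p x). \<forall>f\<in>Fs. \<bar>(\<integral>y. f y \<partial>empirical_measure T \<omega>) - tilt.mean_visit f / m1\<bar> < e / 3}"
          using elim(1) by blast
        also have "\<dots> \<le> measure (chain_law r p x) {\<omega> \<in> space (chain_law r p x). empirical_measure T \<omega> \<in> A}"
        proof (rule finite_measure.finite_measure_mono)
          show "finite_measure (chain_law r p x)" using prob_space_chain by (rule prob_space.finite_measure)
          show "{\<omega> \<in> space (chain_law r p x). empirical_measure T \<omega> \<in> A} \<in> sets (chain_law r p x)"
            using sets_empirical_measure_open[OF compact_space A(1) elim(2)]
            by (simp add: sets_chain_law sets_eq_imp_space_eq[OF sets_chain_law])
          show "{\<omega> \<in> space (chain_law r p x). \<forall>f\<in>Fs. \<bar>(\<integral>y. f y \<partial>empirical_measure T \<omega>) - tilt.mean_visit f / m1\<bar> < e / 3}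
            \<subseteq> {\<omega> \<in> space (chain_law r p x). empirical_measure T \<omega> \<in> A}"
          proof (clarify, rule A(2))
            fix \<omega> assume \<omega>: "\<omega> \<in> space (chain_law r p x)"
              "\<forall>f\<in>Fs. \<bar>(\<integral>y. f y \<partial>empirical_measure T \<omega>) - tilt.mean_visit f / m1\<bar> < e / 3"
            have "cadlag \<omega>" using \<omega>(1) by (simp add: sets_eq_imp_space_eq[OF sets_chain_law] skorokhod_space_def space_restrict_space)
            then show "empirical_measure T \<omega> \<in> prob_measures" using elim(2) by (rule empirical_measure_in_prob_measures)
            show "\<bar>(\<integral>y. f y \<partial>empirical_measure T \<omega>) - (\<integral>y. f y \<partial>\<mu>)\<bar> < e" if "f \<in> Fs" for f
            proof -
              have "\<bar>(\<integral>y. f y \<partial>empirical_measure T \<omega>) - tilt.mean_visit f / m1\<bar> < e / 3" using \<omega>(2) that by blast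
              then show ?thesis using near[OF that] by linarith
            qed
          qed
        qed
        finally show "exp (- T * ((\<Sum>j\<in>L. label_rate j) - energy \<phi> + \<kappa>)) \<le>
          measure (chain_law r p x) {\<omega> \<in> space (chain_law r p x). empirical_measure T \<omega> \<in> A}" .
      qed
    qed
  qed
qed

end

section \<open>Choice of the partition and mixing with the reference measure\<close>

context density_chain begin

text \<open>Domination of \<open>lam\<close> gives every cell positive mass under
  \<open>\<mu>\<close>, as the balance argument requires. The slack \<open>\<kappa>\<close> is spent
  as a quarter each on truncation and discretisation and a half on fluctuations.\<close>

lemma lower_bound_dominating:
  assumes \<mu>: "\<mu> \<in> prob_measures" and dom: "0 < s" "\<And>B. B \<in> sets borel \<Longrightarrow> s * measure lam B \<le> measure \<mu> B"
    and I: "rate \<mu> \<le> ereal I" and A: "openin weak_topology A" "\<mu> \<in> A" and \<kappa>: "0 < \<kappa>" and \<delta>1: "0 < \<delta>1"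
  shows "\<forall>\<^sub>F T in at_top. \<forall>x. \<delta>1 \<le> r x \<longrightarrow> exp (- T * (I + \<kappa>)) \<le>
    measure (chain_law r p x) {\<omega> \<in> space (chain_law r p x). empirical_measure T \<omega> \<in> A}"
proof -
  obtain Fs :: "('a \<Rightarrow> real) set" and e :: real where Fs: "finite Fs" and e: "0 < e"
    and Fc: "\<forall>f\<in>Fs. continuous_on UNIV f \<and> bounded (range f)"
    and nbhd: "\<forall>\<nu>\<in>prob_measures. (\<forall>f\<in>Fs. \<bar>(\<integral>x. f x \<partial>\<nu>) - (\<integral>x. f x \<partial>\<mu>)\<bar> < e) \<longrightarrow> \<nu> \<in> A"
    using weak_topology_nbhd[OF A] by (elim exE conjE)
  define c0 where "c0 = R * (qmax / (qmin / 2)) + R * (2 * qmax)"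
  have c0: "0 < c0" unfolding c0_def using R(1) qmax(1) qmin(1) by (intro add_pos_pos mult_pos_pos divide_pos_pos) auto
  \<comment> \<open>\<open>K\<close> depends on \<open>\<kappa>\<close> and the global bounds only,
    so it is fixed before the partition; \<open>\<eta>\<close> is then chosen against
    \<open>c1\<close>, which grows like the square of \<open>K\<close>.\<close>
  define K where "K = max 1 (c0 / (\<kappa> / 4))"
  have K: "1 \<le> K" by (simp add: K_def)
  have K_err: "R * (qmax / (K * (qmin / 2))) + R * (2 * qmax / K) \<le> \<kappa> / 4"
  proof -
    have "R * (qmax / (K * (qmin / 2))) + R * (2 * qmax / K) = c0 / K" by (simp add: c0_def add_divide_distrib)
    also have "\<dots> \<le> \<kappa> / 4"
    proof -
      have "c0 / (\<kappa> / 4) \<le> K" by (simp add: K_def)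
      then have "c0 \<le> K * (\<kappa> / 4)" using \<kappa> by (simp add: pos_divide_le_eq)
      then show ?thesis using K by (simp add: pos_divide_le_eq mult.commute)
    qed
    finally show ?thesis .
  qed
  define c1 where "c1 = 1 + K\<^sup>2 * (qmax + R * (2 + qmax))"
  have c1: "0 < c1" unfolding c1_def using qmax(1) R(1) by (intro add_pos_nonneg) auto
  define \<eta> where "\<eta> = min (qmin / 2) (\<kappa> / 4 / c1)"
  have \<eta>: "0 < \<eta>" "\<eta> \<le> qmin / 2" using qmin(1) \<kappa> c1 by (auto simp: \<eta>_def)
  have \<eta>_err: "\<eta> * c1 \<le> \<kappa> / 4"
  proof -
    have "\<eta> \<le> \<kappa> / 4 / c1" by (simp add: \<eta>_def)
    then show ?thesis using c1 by (simp add: pos_le_divide_eq)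
  qed
  obtain d1 where d1: "0 < d1" "\<forall>x y x' y'. dist x x' < d1 \<longrightarrow> dist y y' < d1 \<longrightarrow> \<bar>q x y - q x' y'\<bar> < \<eta>"
    using q_uniform[OF \<eta>(1)] by (elim exE conjE)
  have "0 < min (e / 3) (\<eta> / 2)" using e \<eta> by simp
  then have "\<exists>d>0. \<forall>f\<in>insert r Fs. \<forall>x y. dist x y < d \<longrightarrow> \<bar>f x - f y\<bar> < min (e / 3) (\<eta> / 2)"
    by (intro uniformly_small_oscillation) (use Fs Fc r_continuous in auto)
  then obtain d2 where d2: "0 < d2" "\<forall>f\<in>insert r Fs. \<forall>x y. dist x y < d2 \<longrightarrow> \<bar>f x - f y\<bar> < min (e / 3) (\<eta> / 2)"
    by (elim exE conjE)
  have "0 < min d1 d2" using d1 d2 by simp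
  from positive_cells[OF this] obtain L \<iota> where L: "finite L" "L \<noteq> {}" and \<iota>: "\<iota> \<in> borel \<rightarrow>\<^sub>M count_space L"
    and near: "\<forall>x. dist x (\<iota> x) < min d1 d2" and cells: "\<forall>j\<in>L. 0 < measure lam {y. \<iota> y = j}"
    by (elim exE conjE)
  define m0 where "m0 = Min ((\<lambda>j. measure lam {y. \<iota> y = j}) ` L)"
  have m0: "0 < m0" unfolding m0_def using L cells by (subst Min_gr_iff) auto
  have m0_le: "m0 \<le> measure lam {y. \<iota> y = j}" if "j \<in> L" for j unfolding m0_def using L that by (intro Min_le) auto
  \<comment> \<open>Chosen after the partition: the states of rate under \<open>\<delta>\<close>
    weigh less than the lightest cell, so removing them leaves every cell with positive
    mass.\<close>
  obtain \<delta> where \<delta>: "0 < \<delta>" "measure lam {x. r x < \<delta>} < min \<eta> m0"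
    using small_rate_set[of "min \<eta> m0"] \<eta>(1) m0 by auto
  define D where "D = {x. \<delta> \<le> r x}"
  have D: "D \<in> sets borel" using r_measurable by (simp add: D_def)
  have Dc: "- D = {x. r x < \<delta>}" by (auto simp: D_def)
  have s: "{y. \<iota> y = j} \<in> sets lam" for j using sets_label[OF \<iota>] by (simp add: sets_lam)
  interpret disc: discretized_chain r p lam q L \<iota> D \<delta> \<eta> \<mu>
  proof
    show "\<bar>q x y - q (\<iota> x) (\<iota> y)\<bar> \<le> \<eta>" for x y
      using d1(2)[rule_format, of x "\<iota> x" y "\<iota> y"] near[rule_format, of x] near[rule_format, of y] by simp
    show "\<bar>r x - r y\<bar> \<le> \<eta>" if "\<iota> x = \<iota> y" for x y
    proof -
      have "\<bar>r z - r (\<iota> z)\<bar> < \<eta> / 2" for z using d2(2) near[rule_format, of z] by auto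
      from this[of x] this[of y] show ?thesis unfolding that by linarith
    qed
    show "measure lam (- D) \<le> \<eta>" using \<delta> by (simp add: Dc)
    show "0 < measure lam {y \<in> D. \<iota> y = j}" if j: "j \<in> L" for j
    proof -
      have 1: "{y \<in> D. \<iota> y = j} = {y. \<iota> y = j} \<inter> D" by auto
      have "measure lam {y. \<iota> y = j} \<le> measure lam ({y \<in> D. \<iota> y = j} \<union> (- D))"
        using s D by (intro lam.finite_measure_mono) (auto simp: 1 sets_lam)
      also have "\<dots> \<le> measure lam {y \<in> D. \<iota> y = j} + measure lam (- D)"
        using s D by (intro measure_Un_le) (auto simp: 1 sets_lam)
      finally show ?thesis using m0_le[OF j] \<delta>(2) by (simp add: Dc)
    qed
    show "0 < measure \<mu> {y. \<iota> y = j}" if j: "j \<in> L" for j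
    proof -
      have "0 < s * measure lam {y. \<iota> y = j}" using dom(1) cells j by simp
      also have "\<dots> \<le> measure \<mu> {y. \<iota> y = j}" using sets_label[OF \<iota>] by (rule dom(2))
      finally show ?thesis .
    qed
  qed (use L \<iota> D \<delta> \<eta> \<mu> in \<open>auto simp: D_def\<close>)
  have "\<exists>\<phi>. \<forall>\<kappa>>0. \<forall>\<^sub>F T in at_top. \<forall>x. \<delta>1 \<le> r x \<longrightarrow> exp (- T * ((\<Sum>j\<in>L. disc.label_rate j) - disc.energy \<phi> + \<kappa>)) \<le>
    measure (chain_law r p x) {\<omega> \<in> space (chain_law r p x). empirical_measure T \<omega> \<in> A}"
  proof (rule disc.discretized_lower_bound[OF Fs _ e _ A(1) _ \<delta>1])
    show "\<bar>f x - f (\<iota> x)\<bar> \<le> e / 3" if "f \<in> Fs" for f x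
    proof -
      have "dist x (\<iota> x) < d2" using near[rule_format, of x] by simp
      then have "\<bar>f x - f (\<iota> x)\<bar> < min (e / 3) (\<eta> / 2)" using d2(2) that by blast
      then show ?thesis by simp
    qed
  qed (use Fc nbhd in blast)+
  then obtain \<phi> where \<phi>: "\<forall>\<kappa>>0. \<forall>\<^sub>F T in at_top. \<forall>x. \<delta>1 \<le> r x \<longrightarrow> exp (- T * ((\<Sum>j\<in>L. disc.label_rate j) - disc.energy \<phi> + \<kappa>)) \<le>
    measure (chain_law r p x) {\<omega> \<in> space (chain_law r p x). empirical_measure T \<omega> \<in> A}" by (elim exE)
  let ?err = "R * (qmax / (K * (qmin / 2))) + R * (2 * qmax / K) + \<eta> * (1 + K\<^sup>2 * (qmax + R * (2 + qmax)))"
  have "ereal ((\<Sum>j\<in>L. disc.label_rate j) - disc.energy \<phi>) \<le> rate \<mu> + ereal ?err" by (rule disc.discretized_cost_le[OF K])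
  also have "\<dots> \<le> ereal I + ereal ?err" using I by (rule add_right_mono)
  finally have cost: "(\<Sum>j\<in>L. disc.label_rate j) - disc.energy \<phi> \<le> I + \<kappa> / 2" using K_err \<eta>_err by (simp add: c1_def)
  have "0 < \<kappa> / 2" using \<kappa> by simp
  from \<phi>[rule_format, OF this] eventually_gt_at_top[of 0] show ?thesis
  proof eventually_elim
    case (elim T)
    show ?case
    proof (intro allI impI)
      fix x assume x: "\<delta>1 \<le> r x"
      have "T * ((\<Sum>j\<in>L. disc.label_rate j) - disc.energy \<phi> + \<kappa> / 2) \<le> T * (I + \<kappa>)"
        using cost elim(2) by (intro mult_left_mono) auto
      then have "exp (- T * (I + \<kappa>)) \<le> exp (- T * ((\<Sum>j\<in>L. disc.label_rate j) - disc.energy \<phi> + \<kappa> / 2))" by simp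
      also have "\<dots> \<le> measure (chain_law r p x) {\<omega> \<in> space (chain_law r p x). empirical_measure T \<omega> \<in> A}"
        using elim(1) x by blast
      finally show "exp (- T * (I + \<kappa>)) \<le> measure (chain_law r p x) {\<omega> \<in> space (chain_law r p x). empirical_measure T \<omega> \<in> A}" .
    qed
  qed
qed

text \<open>Minus the potential is at most \<open>r\<close>. The bound is used for
  \<open>lam\<close>: by convexity an admixture of \<open>lam\<close> with weight \<open>s\<close>
  adds at most \<open>s * R\<close> to the rate.\<close>

lemma rate_le_R: assumes \<mu>: "\<mu> \<in> prob_measures" shows "rate \<mu> \<le> ereal R"
  unfolding rate_eq
proof (rule SUP_least)
  fix \<phi> :: "'a \<Rightarrow> real" assume "\<phi> \<in> {\<phi>. continuous_on UNIV \<phi>}"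
  then have \<phi>: "continuous_on UNIV \<phi>" by simp
  interpret \<mu>: prob_space \<mu> using \<mu> by (simp add: prob_measures_iff)
  have pt: "- potential \<phi> x \<le> R" for x
  proof -
    have "0 \<le> jump_mean (\<lambda>y. exp (\<phi> y)) x / exp (\<phi> x)"
      unfolding jump_mean_def using q_pos by (intro divide_nonneg_pos Bochner_Integration.integral_nonneg mult_nonneg_nonneg) (auto intro: less_imp_le)
    then have "0 \<le> r x * (jump_mean (\<lambda>y. exp (\<phi> y)) x / exp (\<phi> x))" by (rule mult_nonneg_nonneg[OF r_nonneg])
    then show ?thesis using R(2)[of x] by (simp add: potential_def right_diff_distrib)
  qed
  have "(\<integral>x. - potential \<phi> x \<partial>\<mu>) \<le> R"
    by (rule \<mu>.integral_le_const) (use integrable_potential[OF \<mu> \<phi>] pt in auto)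
  then show "ereal (- (\<integral>x. potential \<phi> x \<partial>\<mu>)) \<le> ereal R" by simp
qed

lemma lower_bound_open:
  assumes A: "openin weak_topology A" "\<mu> \<in> A" and I: "rate \<mu> \<le> ereal I" and \<kappa>: "0 < \<kappa>" and \<delta>1: "0 < \<delta>1"
  shows "\<forall>\<^sub>F T in at_top. \<forall>x. \<delta>1 \<le> r x \<longrightarrow> exp (- T * (I + \<kappa>)) \<le>
    measure (chain_law r p x) {\<omega> \<in> space (chain_law r p x). empirical_measure T \<omega> \<in> A}"
proof -
  have \<mu>: "\<mu> \<in> prob_measures" using openin_subset[OF A(1)] A(2) by auto
  obtain Fs :: "('a \<Rightarrow> real) set" and e :: real where Fs: "finite Fs" and e: "0 < e"
    and Fc: "\<forall>f\<in>Fs. continuous_on UNIV f \<and> bounded (range f)"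
    and nbhd: "\<forall>\<nu>\<in>prob_measures. (\<forall>f\<in>Fs. \<bar>(\<integral>x. f x \<partial>\<nu>) - (\<integral>x. f x \<partial>\<mu>)\<bar> < e) \<longrightarrow> \<nu> \<in> A"
    using weak_topology_nbhd[OF A] by (elim exE conjE)
  define b where "b f = \<bar>(\<integral>x. f x \<partial>lam) - (\<integral>x. f x \<partial>\<mu>)\<bar>" for f :: "'a \<Rightarrow> real"
  define b0 where "b0 = (\<Sum>f\<in>Fs. b f) + 1"
  have b: "b f < b0" if "f \<in> Fs" for f
    unfolding b0_def using member_le_sum[of f Fs b] Fs that by (simp add: b_def add_strict_increasing2)
  have b0: "0 < b0" unfolding b0_def b_def by (intro add_nonneg_pos sum_nonneg) auto
  have I0: "0 \<le> I" using order_trans[OF rate_functional_nonneg I] by simp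
  \<comment> \<open>The bound \<open>e / b0\<close> keeps the mixture in \<open>A\<close>,
    \<open>\<kappa> / 2 / R\<close> keeps the added rate below \<open>\<kappa> / 2\<close>, and
    \<open>1 / 2\<close> makes it a proper mixture.\<close>
  define s where "s = min (1 / 2) (min (e / b0) (\<kappa> / 2 / R))"
  have s: "0 < s" "s \<le> 1 / 2" "s \<le> e / b0" "s \<le> \<kappa> / 2 / R"
  proof -
    have "0 < e / b0" "0 < \<kappa> / 2 / R" using e b0 \<kappa> R(1) by simp_all
    then show "0 < s" "s \<le> 1 / 2" "s \<le> e / b0" "s \<le> \<kappa> / 2 / R" unfolding s_def by linarith+
  qed
  define \<nu> where "\<nu> = mixture (1 - s) \<mu> lam"
  have \<nu>: "\<nu> \<in> prob_measures" unfolding \<nu>_def using s by (intro mixture_in_prob_measures \<mu> lam_prob_measures) auto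
  have "\<nu> \<in> A"
  proof (rule nbhd[rule_format, OF \<nu>])
    fix f assume f: "f \<in> Fs"
    then have fc: "continuous_on UNIV f" using Fc by blast
    obtain B where B: "\<And>x. \<bar>f x\<bar> \<le> B" using bounded_continuous_compact[OF compact_space fc] by blast
    have "(\<integral>x. f x \<partial>\<nu>) = (1 - s) * (\<integral>x. f x \<partial>\<mu>) + (1 - (1 - s)) * (\<integral>x. f x \<partial>lam)"
      unfolding \<nu>_def using s by (intro integral_mixture[OF \<mu> lam_prob_measures _ _ borel_measurable_continuous_onI[OF fc] B]) auto
    then have "(\<integral>x. f x \<partial>\<nu>) - (\<integral>x. f x \<partial>\<mu>) = s * ((\<integral>x. f x \<partial>lam) - (\<integral>x. f x \<partial>\<mu>))" by (simp add: algebra_simps)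
    then have "\<bar>(\<integral>x. f x \<partial>\<nu>) - (\<integral>x. f x \<partial>\<mu>)\<bar> = s * b f" using s(1) by (simp add: abs_mult b_def)
    also have "\<dots> < s * b0" using b[OF f] s(1) by simp
    also have "\<dots> \<le> e" using s(3) b0 by (simp add: pos_le_divide_eq)
    finally show "\<bar>(\<integral>x. f x \<partial>\<nu>) - (\<integral>x. f x \<partial>\<mu>)\<bar> < e" .
  qed
  have dom: "s * measure lam B \<le> measure \<nu> B" if B: "B \<in> sets borel" for B
  proof -
    interpret \<nu>: prob_space \<nu> using \<nu> by (simp add: prob_measures_iff)
    have "ennreal (s * measure lam B) \<le> emeasure \<nu> B"
      unfolding \<nu>_def using s B \<mu>
      by (subst emeasure_mixture) (auto simp: prob_measures_iff sets_lam ennreal_mult lam.emeasure_eq_measure)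
    then show ?thesis by (simp add: \<nu>.emeasure_eq_measure)
  qed
  have rate_\<nu>: "rate \<nu> \<le> ereal (I + \<kappa> / 2)"
  proof -
    have "rate \<nu> \<le> ereal (1 - s) * rate \<mu> + ereal (1 - (1 - s)) * rate lam"
      unfolding \<nu>_def by (rule convex_rate[unfolded convex_functional_def, rule_format]) (use \<mu> lam_prob_measures s in auto)
    also have "\<dots> = ereal (1 - s) * rate \<mu> + ereal s * rate lam" by simp
    also have "\<dots> \<le> ereal (1 - s) * ereal I + ereal s * ereal R"
      using ereal_mult_left_mono[OF I, of "ereal (1 - s)"] ereal_mult_left_mono[OF rate_le_R[OF lam_prob_measures], of "ereal s"] s
      by (intro add_mono) (simp_all del: times_ereal.simps)
    also have "\<dots> \<le> ereal (I + \<kappa> / 2)"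
    proof -
      have "s * R \<le> \<kappa> / 2" using s(4) R(1) by (simp add: pos_le_divide_eq)
      moreover have "(1 - s) * I \<le> I" using s(1) I0 by (intro mult_left_le_one_le) (use s(2) in auto)
      ultimately show ?thesis by simp
    qed
    finally show ?thesis .
  qed
  have "0 < \<kappa> / 2" using \<kappa> by simp
  from lower_bound_dominating[OF \<nu> s(1) dom rate_\<nu> A(1) \<open>\<nu> \<in> A\<close> this \<delta>1] show ?thesis by (simp add: add.assoc)
qed

theorem large_deviations_lower:
  assumes E1: "compact E1" "E1 \<subseteq> UNIV - {x. r x = 0}" and A: "openin weak_topology A"
  shows "- (INF \<mu>\<in>A. rate \<mu>) \<le> Liminf at_top (\<lambda>T::real. INF x\<in>E1. ereal (1 / T) *
      log_ereal (measure (chain_law r p x) {\<omega> \<in> space (chain_law r p x). empirical_measure T \<omega> \<in> A}))"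
    (is "_ \<le> Liminf at_top ?f")
proof -
  \<comment> \<open>Compactness of \<open>E1\<close> enters here: the continuous \<open>r\<close>
    attains a positive minimum on it.\<close>
  have "\<exists>\<delta>1>0. \<forall>x\<in>E1. \<delta>1 \<le> r x"
  proof (cases "E1 = {}")
    case True then show ?thesis by (intro exI[of _ 1]) auto
  next
    case False
    have "continuous_on E1 r" by (rule continuous_on_subset[OF r_continuous]) simp
    from continuous_attains_inf[OF E1(1) False this] obtain z where z: "z \<in> E1" "\<forall>x\<in>E1. r z \<le> r x" by blast
    have "0 < r z" using z(1) E1(2) r_nonneg[of z] by (force simp: less_le)
    then show ?thesis using z(2) by blast
  qed
  then obtain \<delta>1 where \<delta>1: "0 < \<delta>1" "\<forall>x\<in>E1. \<delta>1 \<le> r x" by (elim exE conjE)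
  have *: "- Liminf at_top ?f \<le> rate \<mu>" if \<mu>: "\<mu> \<in> A" for \<mu>
  proof (rule ereal_le_epsilon2)
    fix \<kappa> :: real assume \<kappa>: "0 < \<kappa>"
    show "- Liminf at_top ?f \<le> rate \<mu> + ereal \<kappa>"
    proof (cases "rate \<mu>")
      case (real I)
      have I: "rate \<mu> \<le> ereal I" by (simp only: real order_refl)
      have "\<forall>\<^sub>F T in at_top. ereal (- (I + \<kappa>)) \<le> ?f T"
        using lower_bound_open[OF A \<mu> I \<kappa> \<delta>1(1)] eventually_gt_at_top[of 0]
      proof eventually_elim
        case (elim T)
        show ?case
        proof (rule INF_greatest)
          fix x assume x: "x \<in> E1"
          let ?m = "measure (chain_law r p x) {\<omega> \<in> space (chain_law r p x). empirical_measure T \<omega> \<in> A}"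
          have m: "exp (- T * (I + \<kappa>)) \<le> ?m" using elim(1) \<delta>1(2) x by blast
          then have m0: "0 < ?m" by (rule less_le_trans[OF exp_gt_zero])
          have "- T * (I + \<kappa>) \<le> ln ?m" using m m0 by (simp add: ln_ge_iff)
          then have "1 / T * (- T * (I + \<kappa>)) \<le> 1 / T * ln ?m" using elim(2) by (intro mult_left_mono) auto
          moreover have "1 / T * (- T * (I + \<kappa>)) = - (I + \<kappa>)" using elim(2) by simp
          ultimately have "- (I + \<kappa>) \<le> 1 / T * ln ?m" by linarith
          then show "ereal (- (I + \<kappa>)) \<le> ereal (1 / T) * log_ereal ?m" using m0 by (simp add: log_ereal_def)
        qed
      qed
      then have "ereal (- (I + \<kappa>)) \<le> Liminf at_top ?f" by (rule Liminf_bounded)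
      then have "- Liminf at_top ?f \<le> - ereal (- (I + \<kappa>))" by (simp only: ereal_minus_le_minus)
      also have "- ereal (- (I + \<kappa>)) = rate \<mu> + ereal \<kappa>" unfolding real by simp
      finally show ?thesis .
    qed (use rate_functional_nonneg[of "jump_rates r p" \<mu>] in auto)
  qed
  have "- Liminf at_top ?f \<le> (INF \<mu>\<in>A. rate \<mu>)" by (rule INF_greatest) (rule *)
  then show ?thesis by (simp add: ereal_uminus_le_reorder)
qed

end

theorem corollary2p4:
  fixes r :: "'a::polish_space \<Rightarrow> real"
    and p :: "'a \<Rightarrow> 'a measure"
    and lam :: "'a measure"
    and q :: "'a \<Rightarrow> 'a \<Rightarrow> real"
  assumes compact: "compact (UNIV :: 'a set)"
    and kernel: "p \<in> borel \<rightarrow>\<^sub>M prob_algebra borel"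
    and r_nonneg: "\<And>x. 0 \<le> r x"
    and r_continuous: "continuous_on UNIV r"
    and lam_prob: "prob_space lam" "sets lam = sets borel"
    and lam_pos: "\<And>U. open U \<Longrightarrow> U \<noteq> {} \<Longrightarrow> 0 < emeasure lam U"
    and q_continuous: "continuous_on UNIV (\<lambda>(x, y). q x y)"
    and q_pos: "\<And>x y. 0 < q x y"
    and p_density: "\<And>x. p x = density lam (\<lambda>y. ennreal (q x y))"
    and r_inverse_integrable: "(\<integral>\<^sup>+x. 1 / ennreal (r x) \<partial>lam) < \<infinity>"
    and level_sets: "\<exists>\<delta> :: nat \<Rightarrow> real. (\<forall>n. 0 < \<delta> n) \<and> \<delta> \<longlonglongrightarrow> 0 \<and>
      (SUP n. emeasure lam {x. r x < 2 * \<delta> n} /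
              emeasure lam ({x. r x < 2 * \<delta> n} - {x. r x < \<delta> n})) < \<infinity>"
  shows "convex_functional (rate_functional (jump_rates r p)) \<and>
    lower_semicontinuous_map weak_topology (rate_functional (jump_rates r p)) \<and>
    (\<forall>E1 C A. compact E1 \<longrightarrow> E1 \<subseteq> UNIV - {x. r x = 0} \<longrightarrow>
       closedin weak_topology C \<longrightarrow> openin weak_topology A \<longrightarrow>
       Limsup at_top (\<lambda>T::real. SUP x\<in>E1. ereal (1 / T) *
           log_ereal (measure (chain_law r p x)
             {\<omega> \<in> space (chain_law r p x). empirical_measure T \<omega> \<in> C}))
         \<le> - (INF \<mu>\<in>C. rate_functional (jump_rates r p) \<mu>) \<and>
       Liminf at_top (\<lambda>T::real. INF x\<in>E1. ereal (1 / T) *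
           log_ereal (measure (chain_law r p x)
             {\<omega> \<in> space (chain_law r p x). empirical_measure T \<omega> \<in> A}))
         \<ge> - (INF \<mu>\<in>A. rate_functional (jump_rates r p) \<mu>))"
proof -
  have r_borel: "r \<in> borel_measurable borel" by (rule borel_measurable_continuous_onI[OF r_continuous])
  \<comment> \<open>In \<open>ennreal\<close> the quotient of 1 by 0 is infinite, so a finite
    integral forces \<open>r\<close> to be positive almost everywhere.\<close>
  have "AE x in lam. 1 / ennreal (r x) \<noteq> \<infinity>"
  proof (rule nn_integral_noteq_infinite)
    show "(\<lambda>x. 1 / ennreal (r x)) \<in> borel_measurable lam"
      unfolding measurable_cong_sets[OF lam_prob(2) refl] using r_borel by measurable
  qed (use r_inverse_integrable in auto)
  then have r_AE_pos: "AE x in lam. 0 < r x"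
  proof eventually_elim
    case (elim x)
    show "0 < r x"
    proof (rule ccontr)
      assume "\<not> 0 < r x"
      then have "r x = 0" using r_nonneg[of x] by linarith
      with elim show False by (simp add: ennreal_divide_zero)
    qed
  qed
  interpret density_chain r p lam q
    by (intro density_chain.intro jump_chain.intro density_chain_axioms.intro r_borel r_nonneg kernel compact
      r_continuous lam_prob lam_pos q_continuous q_pos p_density r_AE_pos)
  show ?thesis
    by (intro conjI allI impI convex_rate lower_semicontinuous_rate large_deviations_upper large_deviations_lower)
qed

end
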